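(* Let $0<s<1$, $n\ge1$, $T>0$, let $\Omega\subset\mathbb{R}^n$ be a bounded open set and let $\widetilde\Omega\subset\mathbb{R}^n$ be an open set with $\Omega\Subset\widetilde\Omega$. If $Q\in L^\infty(\Omega_T)$ satisfies the eigenvalue condition (stated in the context), then for any $g\in L^2(\Omega_T)$ and any $\epsilon>0$ there exists $u_\epsilon\in\mathcal H^s(\mathbb{R}^{n+1})$ which solves $$(\mathcal L^s+Q)u_\epsilon=0\ \text{ in }\Omega_T,\qquad \operatorname{supp}(u_\epsilon)\subset\overline{\widetilde\Omega_T},\quad \widetilde\Omega_T:=(-T,T)\times\widetilde\Omega,$$ and satisfies $\|u_\epsilon-g\|_{L^2(\Omega_T)}<\epsilon$.
   Context: Points of $\mathbb{R}^{n+1}$ are written $(t,x)$ with $t\in\mathbb{R}$, $x\in\mathbb{R}^n$. The Fourier transform is $\widehat u(\rho,\xi)=\int_{\mathbb{R}^{n+1}}e^{-i(t\rho+x\cdot\xi)}u(t,x)\,dt\,dx$. The operator $\mathcal L^s=(\partial_t-\Delta_x)^s$ and its adjoint $\mathcal L^s_*$ are defined by $\widehat{\mathcal L^su}=(i\rho+|\xi|^2)^s\widehat u$ and $\widehat{\mathcal L^s_*u}=(-i\rho+|\xi|^2)^s\widehat u$ (principal branch); $\mathcal L^{s/2},\mathcal L^{s/2}_*$ are defined analogously. $\mathcal H^s(\mathbb{R}^{n+1})$ is the space of $u\in L^2(\mathbb{R}^{n+1})$ with $\|u\|^2_{\mathcal H^s}=\int(1+|i\rho+|\xi|^2|)^s|\widehat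 u|^2\,d\rho\,d\xi<\infty$. For closed $E$, $\mathcal H^s_E=\{u\in\mathcal H^s(\mathbb{R}^{n+1}):\operatorname{supp}u\subset E\}$. Notation: $\Omega_T=(-T,T)\times\Omega$, $\Omega_e=\mathbb{R}^n\setminus\overline\Omega$, $(\Omega_e)_T=(-T,T)\times\Omega_e$, $(f,g)_O=\int_Of\overline g\,dx\,dt$. $\Omega\Subset\widetilde\Omega$ means that $\overline\Omega$ is a compact subset of $\widetilde\Omega$. $B_Q(u,w)=(\mathcal L^{s/2}u,\mathcal L^{s/2}_*w)_{\mathbb{R}^{n+1}}+(Qu,w)_{\Omega_T}$ for $u,w\in\mathcal H^s(\mathbb{R}^{n+1})$. A function $u\in\mathcal H^s(\mathbb{R}^{n+1})$ solves $(\mathcal L^s+Q)u=0$ in $\Omega_T$ if $B_Q(u,w)=0$ for all $w\in\mathcal H^s_{\overline{\Omega_T}}$. Eigenvalue condition for $Q$: if $u\in\mathcal H^s(\mathbb{R}^{n+1})$ solves $(\mathcal L^s+Q)u=0$ in $\Omega_T$ with $u=0$ in $(\Omega_e)_T$ and $u=0$ in $(-\infty,-T]\times\mathbb{R}^n$, then $u\equiv0$ in $(-\infty,T)\times\mathbb{R}^n$. Potentials are real-valued. *)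

theory Defs
  imports "HOL-Analysis.Analysis"
begin

text \<open>
  Space-time \<open>\<real> \<times> \<real>\<^sup>n\<close> is the type \<open>real \<times> (real ^ 'n)\<close>; its points are \<open>(t, x)\<close>, and on the
  Fourier side \<open>(\<rho>, \<xi>)\<close>. Elements of \<open>L\<^sup>2\<close> and \<open>L\<^sup>\<infinity>\<close> are represented by Lebesgue measurable
  functions; everything below is insensitive to changes on null sets.
\<close>

type_synonym 'n spacetime = "real \<times> (real ^ 'n)"

definition L2 :: "'a measure \<Rightarrow> ('a \<Rightarrow> complex) set" where
  "L2 M = {f \<in> borel_measurable M. integrable M (\<lambda>z. (cmod (f z))\<^sup>2)}"

definition L2_inner :: "'a measure \<Rightarrow> ('a \<Rightarrow> complex) \<Rightarrow> ('a \<Rightarrow> complex) \<Rightarrow> complex" where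
  "L2_inner M f g = (LINT z|M. f z * cnj (g z))"

definition L2_norm :: "'a measure \<Rightarrow> ('a \<Rightarrow> complex) \<Rightarrow> real" where
  "L2_norm M f = sqrt (LINT z|M. (cmod (f z))\<^sup>2)"

definition Linf :: "'a measure \<Rightarrow> ('a \<Rightarrow> real) set" where
  "Linf M = {f \<in> borel_measurable M. \<exists>C. AE z in M. \<bar>f z\<bar> \<le> C}"

definition vanishes_on :: "('a::euclidean_space \<Rightarrow> complex) \<Rightarrow> 'a set \<Rightarrow> bool" where
  "vanishes_on u A \<longleftrightarrow> (AE z in lebesgue. z \<in> A \<longrightarrow> u z = 0)"

text \<open>The support of an \<open>L\<^sup>2\<close> class: the complement of the largest open set on which it vanishes.\<close>

definition supp :: "('a::euclidean_space \<Rightarrow> complex) \<Rightarrow> 'a set" where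
  "supp u = - \<Union>{U. open U \<and> vanishes_on u U}"

definition fourier_L1 ::
    "('n::finite spacetime \<Rightarrow> complex) \<Rightarrow> 'n spacetime \<Rightarrow> complex" where
  "fourier_L1 u = (\<lambda>(\<rho>, \<xi>).
     LINT (t, x)|lebesgue. exp (- \<i> * complex_of_real (t * \<rho> + x \<bullet> \<xi>)) * u (t, x))"

text \<open>
  On \<open>L\<^sup>2\<close> the Fourier transform is the continuous extension of the integral transform from
  \<open>L\<^sup>1 \<inter> L\<^sup>2\<close>. By Plancherel \<open>v\<close> below exists and is unique almost everywhere, so the choice made in
  \<open>fourier\<close> is one of a representative.
\<close>

definition has_fourier ::
    "('n::finite spacetime \<Rightarrow> complex) \<Rightarrow> ('n spacetime \<Rightarrow> complex) \<Rightarrow> bool" where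
  "has_fourier u v \<longleftrightarrow>
     u \<in> L2 lebesgue \<and> v \<in> L2 lebesgue \<and>
     (\<exists>f :: nat \<Rightarrow> 'n spacetime \<Rightarrow> complex.
        (\<forall>k. integrable lebesgue (f k) \<and> f k \<in> L2 lebesgue \<and> fourier_L1 (f k) \<in> L2 lebesgue) \<and>
        (\<lambda>k. L2_norm lebesgue (\<lambda>z. f k z - u z)) \<longlonglongrightarrow> 0 \<and>
        (\<lambda>k. L2_norm lebesgue (\<lambda>\<zeta>. fourier_L1 (f k) \<zeta> - v \<zeta>)) \<longlonglongrightarrow> 0)"

definition fourier :: "('n::finite spacetime \<Rightarrow> complex) \<Rightarrow> 'n spacetime \<Rightarrow> complex" where
  "fourier u = (SOME v. has_fourier u v)"

text \<open>
  The operator with Fourier symbol \<open>m\<close>, meaningful for those \<open>u\<close> in \<open>L\<^sup>2\<close> with \<open>m \<cdot> fourier u\<close> in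
  \<open>L\<^sup>2\<close>; the chosen \<open>v\<close> is then unique almost everywhere.
\<close>

definition fourier_multiplier ::
    "('n::finite spacetime \<Rightarrow> complex) \<Rightarrow> ('n spacetime \<Rightarrow> complex) \<Rightarrow> 'n spacetime \<Rightarrow> complex" where
  "fourier_multiplier m u =
     (SOME v. v \<in> L2 lebesgue \<and> (AE \<zeta> in lebesgue. fourier v \<zeta> = m \<zeta> * fourier u \<zeta>))"

text \<open>
  \<open>frac_heat a\<close> is \<open>(\<partial>\<^sub>t - \<Delta>\<^sub>x)\<^sup>a\<close> and \<open>frac_heat_adj a\<close> its adjoint. The complex \<open>powr\<close> is the
  principal branch.
\<close>

definition frac_heat ::
    "real \<Rightarrow> ('n::finite spacetime \<Rightarrow> complex) \<Rightarrow> 'n spacetime \<Rightarrow> complex" where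
  "frac_heat a = fourier_multiplier
     (\<lambda>(\<rho>, \<xi>). (\<i> * complex_of_real \<rho> + complex_of_real ((norm \<xi>)\<^sup>2)) powr complex_of_real a)"

definition frac_heat_adj ::
    "real \<Rightarrow> ('n::finite spacetime \<Rightarrow> complex) \<Rightarrow> 'n spacetime \<Rightarrow> complex" where
  "frac_heat_adj a = fourier_multiplier
     (\<lambda>(\<rho>, \<xi>). (- \<i> * complex_of_real \<rho> + complex_of_real ((norm \<xi>)\<^sup>2)) powr complex_of_real a)"

definition Hs :: "real \<Rightarrow> ('n::finite spacetime \<Rightarrow> complex) set" where
  "Hs s = {u \<in> L2 lebesgue. integrable lebesgue (\<lambda>(\<rho>, \<xi>).
     (1 + cmod (\<i> * complex_of_real \<rho> + complex_of_real ((norm \<xi>)\<^sup>2))) powr s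
       * (cmod (fourier u (\<rho>, \<xi>)))\<^sup>2)}"

definition Hs_supp :: "real \<Rightarrow> 'n::finite spacetime set \<Rightarrow> ('n spacetime \<Rightarrow> complex) set" where
  "Hs_supp s E = {u \<in> Hs s. supp u \<subseteq> E}"

definition cyl :: "real \<Rightarrow> (real ^ 'n) set \<Rightarrow> 'n::finite spacetime set" where
  "cyl T A = {-T<..<T} \<times> A"

definition B_form ::
    "real \<Rightarrow> real \<Rightarrow> (real ^ 'n) set \<Rightarrow> ('n::finite spacetime \<Rightarrow> real) \<Rightarrow>
     ('n spacetime \<Rightarrow> complex) \<Rightarrow> ('n spacetime \<Rightarrow> complex) \<Rightarrow> complex" where
  "B_form s T \<Omega> Q u w =
     L2_inner lebesgue (frac_heat (s / 2) u) (frac_heat_adj (s / 2) w)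
     + L2_inner (lebesgue_on (cyl T \<Omega>)) (\<lambda>z. complex_of_real (Q z) * u z) w"

definition solves ::
    "real \<Rightarrow> real \<Rightarrow> (real ^ 'n) set \<Rightarrow> ('n::finite spacetime \<Rightarrow> real) \<Rightarrow>
     ('n spacetime \<Rightarrow> complex) \<Rightarrow> bool" where
  "solves s T \<Omega> Q u \<longleftrightarrow>
     u \<in> Hs s \<and> (\<forall>w \<in> Hs_supp s (closure (cyl T \<Omega>)). B_form s T \<Omega> Q u w = 0)"

definition eigenvalue_condition ::
    "real \<Rightarrow> real \<Rightarrow> (real ^ 'n) set \<Rightarrow> ('n::finite spacetime \<Rightarrow> real) \<Rightarrow> bool" where
  "eigenvalue_condition s T \<Omega> Q \<longleftrightarrow>
     (\<forall>u. solves s T \<Omega> Q u \<and> vanishes_on u (cyl T (- closure \<Omega>))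
          \<and> vanishes_on u ({..-T} \<times> UNIV)
        \<longrightarrow> vanishes_on u ({..<T} \<times> UNIV))"

end

(* The realified form of the problem is coercive up to a compact term, and under the eigenvalue
   condition the Fredholm alternative solves the direct and the adjoint Dirichlet problem. If h is
   orthogonal to all restrictions of admissible solutions, let phi solve the adjoint problem with right
   hand side h. Inserting the solutions with exterior data f, supported in a cylinder over a ball W off
   the closure of Omega, shows that phi is orthogonal to L^s f for all such f. As f and phi have
   separated supports, the semigroup formula for L^s turns this into
     \<integral> \<tau>^(-\<beta>) exp(-|y - x|^2 / (4 \<tau>)) phi(t + \<tau>, y) dy d\<tau> = 0  for x in W and |t| < T,  \<beta> = 1 + s + n/2.
   Applying \<partial>_t + \<Delta>_x raises \<beta> by one, so all moments in 1/\<tau> vanish; this disintegrates the identity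
   over \<tau>, and differentiating in x then yields all moments in y. Hence phi = 0 and h = 0 on Omega_T. *)

theory Submission
  imports Defs "HOL-Probability.Characteristic_Functions"
begin

section \<open>The Fredholm alternative for bilinear forms\<close>

text \<open>The eigenvalue condition gives uniqueness for the direct problem only. The defect of
  coercivity is dominated by finitely many functionals, so uniqueness yields solvability, and
  solvability yields uniqueness for the adjoint. No new Hilbert space is built:
  \<open>Hs_lift\<close> identifies the Sobolev space with all of L^2, where the test space becomes
  a closed subspace \<open>V\<close> and the form is bounded. The pairing with L^s f is accessible
  because z^s is a multiple of the integral of t^(-1-s) (1 - e^(-t z)) over t > 0. Separation of the
  supports removes the term 1 and keeps the heat kernel away from its singularity at the origin;
  this is why W has positive distance from the closure of \<Omega>. Unique continuation then
  concerns an explicit kernel that is flat at \<tau> = 0 for y \<noteq> x, and moments together with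
  Weierstrass approximation settle it. The factor produced by \<partial>_t + \<Delta>_x is \<beta> -
  n/2, which is positive for this \<beta>. The kernel at time t sees only times after t, so t has to
  approach -T before all of phi is reached.\<close>

lemma orthogonal_projection_exists:
  fixes S :: "'a::{real_inner,complete_space} set"
  assumes "closed S" "subspace S"
  shows "\<exists>p\<in>S. \<forall>s\<in>S. (x - p) \<bullet> s = 0"
proof -
  define D where "D = (\<lambda>s. (norm (x - s))\<^sup>2) ` S"
  define d where "d = Inf D"
  have ne: "D \<noteq> {}" using subspace_0[OF assms(2)] by (auto simp: D_def)
  have bdd: "bdd_below D" by (auto simp: D_def intro!: bdd_belowI[of _ 0])
  have dle: "d \<le> (norm (x - s))\<^sup>2" if "s \<in> S" for s
    unfolding d_def using that bdd by (auto simp: D_def intro!: cInf_lower)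
  have "\<exists>s\<in>S. (norm (x - s))\<^sup>2 < d + inverse (real (Suc n))" for n
    using cInf_lessD[OF ne, of "d + inverse (real (Suc n))"] by (auto simp: d_def D_def)
  then obtain p where pS: "\<And>n. p n \<in> S" and pd: "\<And>n. (norm (x - p n))\<^sup>2 < d + inverse (real (Suc n))"
    by metis
  \<comment> \<open>By the parallelogram identity: the midpoint lies in \<open>S\<close>, so its
    distance to \<open>x\<close> is at least the infimum, which forces two near minimisers to be
    close to each other.\<close>
  have est: "(norm (p m - p n))\<^sup>2 \<le> 2 * inverse (real (Suc m)) + 2 * inverse (real (Suc n))" for m n
  proof -
    let ?q = "(1/2) *\<^sub>R (p m + p n)"
    have "?q \<in> S" using pS assms(2) by (simp add: subspace_add subspace_scale)
    then have "d \<le> (norm (x - ?q))\<^sup>2" by (rule dle)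
    moreover have "(norm (p m - p n))\<^sup>2 = 2 * (norm (x - p m))\<^sup>2 + 2 * (norm (x - p n))\<^sup>2 - 4 * (norm (x - ?q))\<^sup>2"
      by (simp add: power2_norm_eq_inner algebra_simps inner_commute)
    ultimately show ?thesis using pd[of m] pd[of n] by linarith
  qed
  have "Cauchy p"
  proof (rule CauchyI)
    fix e :: real assume e: "0 < e"
    then obtain N where N: "inverse (real (Suc N)) < e\<^sup>2 / 4"
      using reals_Archimedean[of "e\<^sup>2 / 4"] by auto
    show "\<exists>M. \<forall>m\<ge>M. \<forall>n\<ge>M. norm (p m - p n) < e"
    proof (intro exI[of _ N] allI impI)
      fix m n assume mn: "N \<le> m" "N \<le> n"
      have "inverse (real (Suc m)) \<le> inverse (real (Suc N))" "inverse (real (Suc n)) \<le> inverse (real (Suc N))"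
        using mn by (auto intro!: le_imp_inverse_le)
      then have "(norm (p m - p n))\<^sup>2 < e\<^sup>2" using est[of m n] N by linarith
      then show "norm (p m - p n) < e" using e by (simp add: power_less_imp_less_base)
    qed
  qed
  then obtain q where q: "p \<longlonglongrightarrow> q" using Cauchy_convergent convergent_def by blast
  have qS: "q \<in> S" using closed_sequentially[OF assms(1)] pS q by blast
  have "(\<lambda>n. (norm (x - p n))\<^sup>2) \<longlonglongrightarrow> (norm (x - q))\<^sup>2" by (intro tendsto_intros q)
  moreover have "(\<lambda>n. d + inverse (real (Suc n))) \<longlonglongrightarrow> d + 0"
    by (intro tendsto_intros LIMSEQ_inverse_real_of_nat)
  ultimately have qd: "(norm (x - q))\<^sup>2 \<le> d"
    using LIMSEQ_le pd by (metis (no_types, lifting) add.right_neutral less_imp_le)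
  have "(x - q) \<bullet> s = 0" if s: "s \<in> S" for s
  proof (rule ccontr)
    assume c: "(x - q) \<bullet> s \<noteq> 0"
    then have s0: "s \<bullet> s > 0" by (metis inner_gt_zero_iff inner_zero_right)
    \<comment> \<open>This \<open>t\<close> minimises the squared distance along the line q + t s; a
      nonzero inner product would push it below the infimum.\<close>
    define t where "t = ((x - q) \<bullet> s) / (s \<bullet> s)"
    have "q + t *\<^sub>R s \<in> S" using qS s assms(2) by (simp add: subspace_add subspace_scale)
    then have "d \<le> (norm (x - (q + t *\<^sub>R s)))\<^sup>2" by (rule dle)
    also have "\<dots> = (norm (x - q))\<^sup>2 - 2 * t * ((x - q) \<bullet> s) + t * t * (s \<bullet> s)"
      by (simp add: power2_norm_eq_inner algebra_simps inner_commute)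
    also have "\<dots> = (norm (x - q))\<^sup>2 - ((x - q) \<bullet> s)\<^sup>2 / (s \<bullet> s)"
      using s0 by (simp add: t_def power2_eq_square field_simps)
    also have "\<dots> < (norm (x - q))\<^sup>2" using c s0 by simp
    finally show False using qd by simp
  qed
  then show ?thesis using qS by blast
qed

text \<open>The version relative to a closed subspace \<open>S\<close> is chosen because the test
  space of the problem depends on term parameters and so is no type. The representing vector spans
  the orthogonal complement, inside \<open>S\<close>, of the kernel of \<open>f\<close>.\<close>

lemma riesz_representation_on:
  fixes f :: "'a::{real_inner,complete_space} \<Rightarrow> real"
  assumes S: "closed S" "subspace S" and f: "bounded_linear f"
  shows "\<exists>r\<in>S. \<forall>x\<in>S. f x = x \<bullet> r"
proof (cases "\<forall>x\<in>S. f x = 0")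
  case True
  then show ?thesis using subspace_0[OF S(2)] by (intro bexI[of _ 0]) auto
next
  case False
  then obtain x where x: "x \<in> S" "f x \<noteq> 0" by auto
  interpret f: bounded_linear f by fact
  let ?K = "S \<inter> f -` {0}"
  have "closed ?K"
    using S(1) f.continuous_on[OF continuous_on_id] by (intro closed_Int closed_vimage) auto
  moreover have "subspace ?K" using S(2)
    by (auto simp: subspace_def f.add f.scaleR f.zero)
  ultimately obtain p where p: "p \<in> ?K" "\<And>s. s \<in> ?K \<Longrightarrow> (x - p) \<bullet> s = 0"
    using orthogonal_projection_exists[of ?K x] by blast
  define z where "z = x - p"
  have zS: "z \<in> S" using x p S by (auto simp: z_def subspace_diff)
  have fz: "f z = f x" using p by (simp add: z_def f.diff)
  then have z0: "z \<noteq> 0" using x f.zero by metis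
  show ?thesis
  proof (intro bexI[of _ "(f z / (z \<bullet> z)) *\<^sub>R z"] ballI)
    fix y assume y: "y \<in> S"
    have "y - (f y / f z) *\<^sub>R z \<in> ?K"
      using y zS S(2) x fz by (simp add: f.diff f.scaleR subspace_diff subspace_scale)
    then have "z \<bullet> (y - (f y / f z) *\<^sub>R z) = 0" using p(2) z_def by blast
    then have "z \<bullet> y = f y / f z * (z \<bullet> z)" by (simp add: inner_diff_right)
    then show "f y = y \<bullet> ((f z / (z \<bullet> z)) *\<^sub>R z)"
      using x fz z0 by (simp add: inner_commute)
  qed (use zS S in \<open>simp add: subspace_scale\<close>)
qed

text \<open>The form need not be symmetric, so Riesz alone does not solve the equation. With
  \<open>A\<close> the operator that represents \<open>b\<close> on \<open>S\<close>, the map v |->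
  v - \<rho> (A v - l) is a contraction for small \<rho>, and its fixed point solves A v =
  l.\<close>

lemma lax_milgram_on:
  fixes b :: "'a::{real_inner,complete_space} \<Rightarrow> 'a \<Rightarrow> real"
  assumes S: "closed S" "subspace S" and b: "bounded_bilinear b" and c: "0 < c"
    and coer: "\<And>v. v \<in> S \<Longrightarrow> c * (norm v)\<^sup>2 \<le> b v v" and f: "bounded_linear f"
  shows "\<exists>v\<in>S. \<forall>w\<in>S. b v w = f w"
proof -
  interpret b: bounded_bilinear b by fact
  obtain l where l: "l \<in> S" "\<And>w. w \<in> S \<Longrightarrow> f w = w \<bullet> l"
    using riesz_representation_on[OF S f] by blast
  have "\<exists>r\<in>S. \<forall>w\<in>S. b v w = w \<bullet> r" for v
    by (rule riesz_representation_on[OF S b.bounded_linear_right])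
  then obtain A where AS: "\<And>v. A v \<in> S" and A: "\<And>v w. w \<in> S \<Longrightarrow> b v w = w \<bullet> A v" by metis
  obtain M where M: "M > 0" "\<And>v w. norm (b v w) \<le> norm v * norm w * M" using b.pos_bounded by blast
  have Adiff: "A u - A v = A (u - v)" for u v
  proof -
    have "w \<bullet> (A u - A v - A (u - v)) = 0" if "w \<in> S" for w
      using A[OF that, of u] A[OF that, of v] A[OF that, of "u - v"] by (simp add: inner_diff_right b.diff_left)
    moreover have "A u - A v - A (u - v) \<in> S" using AS S(2) by (simp add: subspace_diff)
    ultimately have "A u - A v - A (u - v) = 0" using inner_eq_zero_iff by blast
    then show ?thesis by simp
  qed
  have Abd: "norm (A v) \<le> M * norm v" for v
  proof -
    have "norm (A v) * norm (A v) = b v (A v)" using A[OF AS, of v v] by (simp add: dot_square_norm power2_eq_square)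
    also have "\<dots> \<le> norm v * norm (A v) * M" using M(2)[of v "A v"] by simp
    finally have "norm (A v) * norm (A v) \<le> (M * norm v) * norm (A v)" by (simp add: mult_ac)
    then show ?thesis using M(1) by (cases "A v = 0") (auto simp: mult_le_cancel_right)
  qed
  \<comment> \<open>Every \<rho> with 0 < \<rho> < 2 c / M^2 gives q < 1; this choice satisfies
    \<rho> M^2 < c.\<close>
  define \<rho> where "\<rho> = c / (M\<^sup>2 + c\<^sup>2)"
  have den: "M\<^sup>2 + c\<^sup>2 > 0" using M(1) c by (simp add: add_pos_pos)
  have \<rho>0: "\<rho> > 0" using c den by (simp add: \<rho>_def)
  define q where "q = 1 - 2 * \<rho> * c + \<rho>\<^sup>2 * M\<^sup>2"
  have q1: "q < 1"
  proof -
    have "\<rho> * M\<^sup>2 < 2 * c" unfolding \<rho>_def using c den M by (simp add: field_simps power2_eq_square add_pos_pos)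
    then have "\<rho> * (\<rho> * M\<^sup>2) < \<rho> * (2 * c)" using \<rho>0 by simp
    then show ?thesis by (simp add: q_def power2_eq_square algebra_simps)
  qed
  \<comment> \<open>\<open>max q 0\<close>, because for \<open>S = {0}\<close> nothing prevents c >
    M, and then q may be negative.\<close>
  have con: "(norm (v - \<rho> *\<^sub>R A v))\<^sup>2 \<le> max q 0 * (norm v)\<^sup>2" if "v \<in> S" for v
  proof -
    have "(norm (v - \<rho> *\<^sub>R A v))\<^sup>2 = (norm v)\<^sup>2 - 2 * \<rho> * b v v + \<rho>\<^sup>2 * (norm (A v))\<^sup>2"
      using A[OF that, of v] by (simp only: power2_norm_eq_inner) (simp add: algebra_simps inner_commute power2_eq_square)
    also have "\<dots> \<le> (norm v)\<^sup>2 - 2 * \<rho> * (c * (norm v)\<^sup>2) + \<rho>\<^sup>2 * (M * norm v)\<^sup>2"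
      using coer[OF that] \<rho>0 Abd[of v] by (intro add_mono diff_mono mult_left_mono power_mono) auto
    also have "\<dots> = q * (norm v)\<^sup>2" by (simp add: q_def algebra_simps power2_eq_square)
    also have "\<dots> \<le> max q 0 * (norm v)\<^sup>2" by (intro mult_right_mono) auto
    finally show ?thesis .
  qed
  define T where "T v = v - \<rho> *\<^sub>R (A v - l)" for v
  have TS: "T ` S \<subseteq> S" using AS l(1) S(2) by (auto simp: T_def subspace_diff subspace_scale)
  have "dist (T u) (T v) \<le> sqrt (max q 0) * dist u v" if "u \<in> S" "v \<in> S" for u v
  proof -
    have "T u - T v = (u - v) - \<rho> *\<^sub>R A (u - v)" by (simp add: T_def Adiff[symmetric] algebra_simps)
    then have "(norm (T u - T v))\<^sup>2 \<le> max q 0 * (norm (u - v))\<^sup>2"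
      using con[of "u - v"] that S(2) by (simp add: subspace_diff)
    then have "norm (T u - T v) \<le> sqrt (max q 0 * (norm (u - v))\<^sup>2)" by (rule real_le_rsqrt)
    then show ?thesis by (simp add: dist_norm real_sqrt_mult)
  qed
  moreover have "complete S" "S \<noteq> {}" using S subspace_0 by (auto simp: complete_eq_closed)
  ultimately obtain v where v: "v \<in> S" "T v = v"
    using Banach_fix[of S "sqrt (max q 0)" T] TS q1 by auto
  then have "A v = l" using \<rho>0 by (simp add: T_def)
  then show ?thesis using v(1) A l(2) by auto
qed

text \<open>A dimension count inside a possibly infinite-dimensional space: the image of a basis is
  independent and has as many elements as the basis, and a basis vector outside its span would
  enlarge it beyond the dimension.\<close>

lemma linear_inj_on_span_imp_surj_on:
  fixes T :: "'a::real_vector \<Rightarrow> 'a"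
  assumes "linear T" "finite E" "T ` span E \<subseteq> span E" "inj_on T (span E)"
  shows "T ` span E = span E"
proof -
  obtain B where B: "B \<subseteq> E" "independent B" "span B = span E"
    using maximal_independent_subset[of E] by (metis subset_antisym span_mono span_minimal subspace_span)
  have fB: "finite B" using B(1) assms(2) by (rule finite_subset)
  have iB: "independent (T ` B)"
    using linear_independent_injective_image[OF assms(1) B(2)] assms(4) B(3) by simp
  have sub: "T ` B \<subseteq> span B" using assms(3) B span_superset by blast
  have "inj_on T B" using assms(4) B span_superset by (metis inj_on_subset)
  then have cB: "card (T ` B) = card B" by (rule card_image)
  have "x \<in> span (T ` B)" if "x \<in> B" for x
  proof (rule ccontr)
    assume x: "x \<notin> span (T ` B)"
    then have "independent (insert x (T ` B))" using iB by (simp add: independent_insertI)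
    moreover have "insert x (T ` B) \<subseteq> span B" using sub that span_superset by blast
    ultimately have "card (insert x (T ` B)) \<le> card B" using independent_span_bound[OF fB] by blast
    moreover have "x \<notin> T ` B" using x span_base[of x "T ` B"] by blast
    ultimately show False using fB cB by simp
  qed
  then have "B \<subseteq> span (T ` B)" by blast
  then have "span B \<subseteq> span (T ` B)" by (rule span_minimal) (rule subspace_span)
  then have "span E \<subseteq> span (T ` B)" using B(3) by simp
  also have "\<dots> = T ` span E" using linear_span_image[OF assms(1), of B] B by simp
  finally show ?thesis using assms(3) by blast
qed

lemma bounded_bilinear_add:
  assumes "bounded_bilinear f" "bounded_bilinear g"
  shows "bounded_bilinear (\<lambda>x y. f x y + g x y)"
proof -
  interpret f: bounded_bilinear f by fact
  interpret g: bounded_bilinear g by fact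
  obtain K where K: "\<And>x y. norm (f x y) \<le> norm x * norm y * K" using f.bounded by blast
  obtain L where L: "\<And>x y. norm (g x y) \<le> norm x * norm y * L" using g.bounded by blast
  show ?thesis
  proof
    show "\<exists>K. \<forall>a b. norm (f a b + g a b) \<le> norm a * norm b * K"
    proof (intro exI[of _ "K + L"] allI)
      fix a b
      show "norm (f a b + g a b) \<le> norm a * norm b * (K + L)"
        using norm_triangle_ineq[of "f a b" "g a b"] K[of a b] L[of a b] by (simp add: distrib_left)
    qed
  qed (simp_all only: f.add_left f.add_right g.add_left g.add_right f.scaleR_left g.scaleR_left
      f.scaleR_right g.scaleR_right scaleR_add_right ac_simps)
qed

lemma bounded_bilinear_zero: "bounded_bilinear (\<lambda>x y. 0)"
  by standard (simp_all, rule exI[of _ 0], simp)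

text \<open>A form which is coercive up to finitely many functionals differs from a coercive one by an
  operator of finite rank, for which injectivity and surjectivity agree.\<close>

lemma fredholm_alternative_on:
  fixes b :: "'a::{real_inner,complete_space} \<Rightarrow> 'a \<Rightarrow> real"
  assumes S: "closed S" "subspace S" and b: "bounded_bilinear b" and c: "0 < c"
    and I: "finite I" and l: "\<And>i. i \<in> I \<Longrightarrow> bounded_linear (l i)"
    and coer: "\<And>v. v \<in> S \<Longrightarrow> c * (norm v)\<^sup>2 \<le> b v v + (\<Sum>i\<in>I. (l i v)\<^sup>2)"
    and inj: "\<And>v. v \<in> S \<Longrightarrow> (\<And>w. w \<in> S \<Longrightarrow> b v w = 0) \<Longrightarrow> v = 0"
    and f: "bounded_linear f"
  shows "\<exists>v\<in>S. \<forall>w\<in>S. b v w = f w"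
proof -
  interpret b: bounded_bilinear b by fact
  \<comment> \<open>Extended by zero outside \<open>I\<close>, so that representing vectors can be
    chosen for all indices at once.\<close>
  define k where "k i v = (if i \<in> I then l i v else 0)" for i v
  have k: "bounded_linear (k i)" for i
    using l by (cases "i \<in> I") (auto simp: k_def[abs_def])
  have ksum: "(\<Sum>i\<in>I. k i v * k i w) = (\<Sum>i\<in>I. l i v * l i w)" for v w
    by (rule sum.cong) (auto simp: k_def)
  define b' where "b' v w = b v w + (\<Sum>i\<in>I. k i v * k i w)" for v w
  have "bounded_bilinear (\<lambda>v w. k i v * k i w)" for i
    by (rule bounded_bilinear.comp[OF bounded_bilinear_mult k k])
  note bk = this
  have bs: "bounded_bilinear (\<lambda>v w. \<Sum>i\<in>J. k i v * k i w)" if "finite J" for J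
    using that
  proof (induction J rule: finite_induct)
    case empty
    then show ?case by (simp add: bounded_bilinear_zero)
  next
    case (insert x F)
    show ?case using bounded_bilinear_add[OF bk[of x] insert.IH] insert.hyps by simp
  qed
  have b': "bounded_bilinear b'"
    using bounded_bilinear_add[OF b bs[OF I]] by (simp add: b'_def[abs_def])
  interpret b': bounded_bilinear b' by fact
  have coer': "c * (norm v)\<^sup>2 \<le> b' v v" if "v \<in> S" for v
    using coer[OF that] ksum[of v v] by (simp add: b'_def power2_eq_square)
  have uniq: "v = 0" if "v \<in> S" "\<And>w. w \<in> S \<Longrightarrow> b' v w = 0" for v
    using coer'[OF that(1)] that c by (simp add: mult_le_0_iff)
  have solv: "\<exists>v\<in>S. \<forall>w\<in>S. b' v w = g w" if "bounded_linear g" for g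
    by (rule lax_milgram_on[OF S b' c coer' that])
  obtain y where y: "y \<in> S" "\<And>w. w \<in> S \<Longrightarrow> b' y w = f w" using solv[OF f] by blast
  have "\<exists>e. \<forall>i. e i \<in> S \<and> (\<forall>w\<in>S. b' (e i) w = k i w)" using solv[OF k] by metis
  then obtain e where e: "\<And>i. e i \<in> S" "\<And>i w. w \<in> S \<Longrightarrow> b' (e i) w = k i w" by blast
  \<comment> \<open>The finite-rank operator that represents the added term through
    \<open>b'\<close>. Hence b v w = b' (v - F v) w on \<open>S\<close>, and the task is to invert 1
    - F.\<close>
  define F where "F v = (\<Sum>i\<in>I. k i v *\<^sub>R e i)" for v
  have klin: "linear (k i)" for i using k bounded_linear.linear by blast
  have linF: "linear F"
    by (rule linearI) (auto simp: F_def linear_add[OF klin] linear_cmul[OF klin] scaleR_add_left sum.distrib scaleR_sum_right)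
  define T where "T v = v - F v" for v
  have linT: "linear T" unfolding T_def using linF by (intro linear_compose_sub linear_id[unfolded id_def])
  define E where "E = e ` I"
  have FE: "F v \<in> span E" for v
    unfolding F_def by (intro span_sum span_scale span_base) (auto simp: E_def)
  have ES: "span E \<subseteq> S" using e S(2) by (intro span_minimal) (auto simp: E_def)
  have b'F: "b' (F v) w = (\<Sum>i\<in>I. k i v * k i w)" if "w \<in> S" for v w
    using that by (simp add: F_def b'.sum_left b'.scaleR_left e)
  have T0: "v = 0" if "v \<in> S" "T v = 0" for v
  proof (rule inj[OF that(1)])
    fix w assume w: "w \<in> S"
    have "b' v w = b' (F v) w" using that by (simp add: T_def)
    then show "b v w = 0" unfolding b'F[OF w] by (simp add: b'_def)
  qed
  have "inj_on T (span E)"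
  proof (rule inj_onI)
    fix u v assume "u \<in> span E" "v \<in> span E" "T u = T v"
    then have "u - v \<in> S" "T (u - v) = 0" using ES linear_diff[OF linT] span_diff by (blast, simp)
    then show "u = v" using T0 by fastforce
  qed
  moreover have "T ` span E \<subseteq> span E" by (auto simp: T_def intro!: span_diff FE)
  ultimately have "T ` span E = span E"
    using linear_inj_on_span_imp_surj_on[OF linT] I E_def by blast
  \<comment> \<open>Solving v - F v = y with v = y + u reduces to u - F u = F y, an equation inside
    the finite-dimensional \<open>span E\<close>.\<close>
  then obtain u where u: "u \<in> span E" "T u = F y" using FE by (metis imageE)
  define v where "v = y + u"
  have vS: "v \<in> S" using y u ES S(2) by (auto simp: v_def subspace_add)
  have Tv: "v - F v = y" using u(2) by (simp add: v_def linear_add[OF linF] T_def algebra_simps)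
  have "b v w = f w" if w: "w \<in> S" for w
  proof -
    have "f w = b' (v - F v) w" unfolding Tv y(2)[OF w] ..
    also have "\<dots> = b v w" unfolding b'.diff_left b'F[OF w] by (simp add: b'_def)
    finally show ?thesis by simp
  qed
  then show ?thesis using vS by blast
qed

text \<open>Injectivity of the adjoint comes from solvability of the direct problem: if b w v = 0
  for all w, take u with b u w = w \<bullet> v for all w; testing with w = v gives v \<bullet> v =
  0.\<close>

lemma fredholm_alternative_adjoint_on:
  fixes b :: "'a::{real_inner,complete_space} \<Rightarrow> 'a \<Rightarrow> real"
  assumes S: "closed S" "subspace S" and b: "bounded_bilinear b" and c: "0 < c"
    and I: "finite I" and l: "\<And>i. i \<in> I \<Longrightarrow> bounded_linear (l i)"
    and coer: "\<And>v. v \<in> S \<Longrightarrow> c * (norm v)\<^sup>2 \<le> b v v + (\<Sum>i\<in>I. (l i v)\<^sup>2)"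
    and inj: "\<And>v. v \<in> S \<Longrightarrow> (\<And>w. w \<in> S \<Longrightarrow> b v w = 0) \<Longrightarrow> v = 0"
    and f: "bounded_linear f"
  shows "\<exists>v\<in>S. \<forall>w\<in>S. b w v = f w"
proof (rule fredholm_alternative_on[where b = "\<lambda>v w. b w v", OF S _ c I l coer _ f])
  show "bounded_bilinear (\<lambda>v w. b w v)" by (rule bounded_bilinear.flip[OF b])
next
  fix v assume v: "v \<in> S" "\<And>w. w \<in> S \<Longrightarrow> b w v = 0"
  obtain u where "u \<in> S" "\<forall>w\<in>S. b u w = w \<bullet> v"
    using fredholm_alternative_on[OF S b c I l coer inj bounded_linear_inner_left] by blast
  then show "v = 0" using v by (metis inner_eq_zero_iff)
qed

section \<open>The Hilbert space of square integrable functions\<close>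

lemma borel_measurable_cnj [measurable (raw)]:
  assumes "f \<in> borel_measurable M"
  shows "(\<lambda>z. cnj (f z)) \<in> borel_measurable M"
  using measurable_compose[OF assms borel_measurable_continuous_onI[OF continuous_on_cnj[OF continuous_on_id]]] .

lemma L2_measurable [measurable_dest]: "f \<in> L2 M \<Longrightarrow> f \<in> borel_measurable M"
  by (simp add: L2_def)

lemma L2_integrable: "f \<in> L2 M \<Longrightarrow> integrable M (\<lambda>z. (cmod (f z))\<^sup>2)"
  by (simp add: L2_def)

lemma L2_bound:
  assumes "g \<in> borel_measurable M" "integrable M h" "AE z in M. (cmod (g z))\<^sup>2 \<le> h z"
  shows "g \<in> L2 M"
proof -
  have "integrable M (\<lambda>z. (cmod (g z))\<^sup>2)"
    by (rule Bochner_Integration.integrable_bound[OF assms(2)]) (use assms in \<open>auto elim!: eventually_mono\<close>)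
  then show ?thesis using assms by (simp add: L2_def)
qed

lemma L2_integrable_mult:
  assumes "f \<in> L2 M" "g \<in> L2 M"
  shows "integrable M (\<lambda>z. f z * cnj (g z))"
proof (rule Bochner_Integration.integrable_bound)
  show "integrable M (\<lambda>z. (cmod (f z))\<^sup>2 + (cmod (g z))\<^sup>2)" using assms by (simp add: L2_def)
  have "a * b \<le> a\<^sup>2 + b\<^sup>2" if "0 \<le> a" "0 \<le> b" for a b :: real
  proof -
    have "0 \<le> (a - b)\<^sup>2" "0 \<le> a * b" using that by auto
    then show ?thesis by (simp add: power2_diff)
  qed
  then show "AE z in M. norm (f z * cnj (g z)) \<le> norm ((cmod (f z))\<^sup>2 + (cmod (g z))\<^sup>2)"
    by (auto simp: norm_mult)
qed (use assms in \<open>auto simp: L2_def\<close>)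

lemma L2_add: "f \<in> L2 M \<Longrightarrow> g \<in> L2 M \<Longrightarrow> (\<lambda>z. f z + g z) \<in> L2 M"
proof (rule L2_bound[where h = "\<lambda>z. 2 * (cmod (f z))\<^sup>2 + 2 * (cmod (g z))\<^sup>2"])
  have "(cmod (a + b))\<^sup>2 \<le> 2 * (cmod a)\<^sup>2 + 2 * (cmod b)\<^sup>2" for a b
  proof -
    have "(cmod (a + b))\<^sup>2 \<le> (cmod a + cmod b)\<^sup>2" by (intro power_mono norm_triangle_ineq) auto
    also have "\<dots> \<le> 2 * (cmod a)\<^sup>2 + 2 * (cmod b)\<^sup>2"
      using zero_le_power2[of "cmod a - cmod b"] by (simp add: power2_eq_square algebra_simps)
    finally show ?thesis .
  qed
  then show "AE z in M. (cmod (f z + g z))\<^sup>2 \<le> 2 * (cmod (f z))\<^sup>2 + 2 * (cmod (g z))\<^sup>2" by simp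
qed (auto simp: L2_def)

lemma L2_bounded_mult:
  assumes "f \<in> L2 M" "b \<in> borel_measurable M" "AE z in M. cmod (b z) \<le> C"
  shows "(\<lambda>z. b z * f z) \<in> L2 M"
proof (rule L2_bound[where h = "\<lambda>z. C\<^sup>2 * (cmod (f z))\<^sup>2"])
  show "AE z in M. (cmod (b z * f z))\<^sup>2 \<le> C\<^sup>2 * (cmod (f z))\<^sup>2"
    using assms(3)
  proof eventually_elim
    case (elim z)
    have "cmod (b z * f z) \<le> C * cmod (f z)" using elim by (auto simp: norm_mult intro: mult_right_mono)
    then have "(cmod (b z * f z))\<^sup>2 \<le> (C * cmod (f z))\<^sup>2" by (rule power_mono) auto
    then show ?case by (simp add: power_mult_distrib)
  qed
qed (use assms in \<open>auto simp: L2_def\<close>)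

lemma L2_cmult: "f \<in> L2 M \<Longrightarrow> (\<lambda>z. c * f z) \<in> L2 M"
  by (rule L2_bounded_mult[where C = "cmod c"]) auto

lemma L2_minus: "f \<in> L2 M \<Longrightarrow> (\<lambda>z. - f z) \<in> L2 M"
  by (simp add: L2_def)

lemma L2_diff: "f \<in> L2 M \<Longrightarrow> g \<in> L2 M \<Longrightarrow> (\<lambda>z. f z - g z) \<in> L2 M"
  using L2_add[of f M "\<lambda>z. - g z"] L2_minus by auto

lemma L2_zero [simp]: "(\<lambda>z. 0) \<in> L2 M"
  by (simp add: L2_def)

lemma L2_cnj: "f \<in> L2 M \<Longrightarrow> (\<lambda>z. cnj (f z)) \<in> L2 M"
  unfolding L2_def by auto

lemma L2_cong_AE:
  assumes "f \<in> L2 M" "g \<in> borel_measurable M" "AE z in M. f z = g z"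
  shows "g \<in> L2 M"
proof (rule L2_bound[OF assms(2) L2_integrable[OF assms(1)]])
  show "AE z in M. (cmod (g z))\<^sup>2 \<le> (cmod (f z))\<^sup>2" using assms(3) by eventually_elim simp
qed

section \<open>Classes of square integrable functions as a Hilbert space type\<close>

definition l2_rel :: "('a::euclidean_space \<Rightarrow> complex) \<Rightarrow> ('a \<Rightarrow> complex) \<Rightarrow> bool" where
  "l2_rel f g \<longleftrightarrow> f \<in> L2 lebesgue \<and> g \<in> L2 lebesgue \<and> (AE z in lebesgue. f z = g z)"

\<comment> \<open>The relation is partial: a function that is not square integrable is related to
  nothing, not even to itself, so every class comes from \<open>L2 lebesgue\<close>. Having a type
  makes the results for \<open>complete_space\<close> applicable.\<close>
quotient_type (overloaded) 'a l2 = "'a::euclidean_space \<Rightarrow> complex" / partial: l2_rel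
  morphisms of_l2 to_l2
proof (rule part_equivpI)
  show "\<exists>f :: 'a \<Rightarrow> complex. l2_rel f f" by (rule exI[of _ "\<lambda>_. 0"]) (simp add: l2_rel_def)
  show "symp l2_rel" by (auto simp: symp_def l2_rel_def elim: eventually_mono)
  show "transp l2_rel"
    by (auto simp: transp_def l2_rel_def)
qed

lemma to_l2_eq_iff:
  "f \<in> L2 lebesgue \<Longrightarrow> g \<in> L2 lebesgue \<Longrightarrow> to_l2 f = to_l2 g \<longleftrightarrow> (AE z in lebesgue. f z = g z)"
  using Quotient3_rel[OF Quotient3_l2, of f g] by (simp add: l2_rel_def)

lemma to_l2_cong:
  "f \<in> L2 lebesgue \<Longrightarrow> g \<in> L2 lebesgue \<Longrightarrow> (AE z in lebesgue. f z = g z) \<Longrightarrow> to_l2 f = to_l2 g"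
  by (simp add: to_l2_eq_iff)

lemma of_l2_L2 [simp, measurable_dest]: "of_l2 x \<in> L2 lebesgue"
  using Quotient3_rep_reflp[OF Quotient3_l2, of x] by (simp add: l2_rel_def)

lemma of_l2_measurable [measurable]: "of_l2 x \<in> borel_measurable lebesgue"
  using of_l2_L2 L2_measurable by blast

lemma to_of_l2 [simp]: "to_l2 (of_l2 x) = x"
  by (rule Quotient3_abs_rep[OF Quotient3_l2])

lemma of_to_l2: "f \<in> L2 lebesgue \<Longrightarrow> AE z in lebesgue. of_l2 (to_l2 f) z = f z"
  using to_l2_eq_iff[of "of_l2 (to_l2 f)" f] by simp

lemma l2_cases:
  obtains f where "f \<in> L2 lebesgue" "x = to_l2 f"
  using of_l2_L2[of x] to_of_l2[of x] by metis

text \<open>The type carries a real inner product, which is the real part of this pairing. The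
  imaginary part is recovered as the real inner product with \<i> times the second argument, see
  \<open>Im_l2_cinner\<close>; complex identities thus reduce to real ones.\<close>

definition l2_cinner :: "'a::euclidean_space l2 \<Rightarrow> 'a l2 \<Rightarrow> complex" where
  "l2_cinner x y = L2_inner lebesgue (of_l2 x) (of_l2 y)"

instantiation l2 :: (euclidean_space) real_inner
begin

definition zero_l2 :: "'a l2" where "0 = to_l2 (\<lambda>_. 0)"
definition plus_l2 :: "'a l2 \<Rightarrow> 'a l2 \<Rightarrow> 'a l2"
  where "x + y = to_l2 (\<lambda>z. of_l2 x z + of_l2 y z)"
definition minus_l2 :: "'a l2 \<Rightarrow> 'a l2 \<Rightarrow> 'a l2"
  where "x - y = to_l2 (\<lambda>z. of_l2 x z - of_l2 y z)"
definition uminus_l2 :: "'a l2 \<Rightarrow> 'a l2" where "- x = to_l2 (\<lambda>z. - of_l2 x z)"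
definition scaleR_l2 :: "real \<Rightarrow> 'a l2 \<Rightarrow> 'a l2"
  where "scaleR r x = to_l2 (\<lambda>z. complex_of_real r * of_l2 x z)"
definition inner_l2 :: "'a l2 \<Rightarrow> 'a l2 \<Rightarrow> real" where "inner x y = Re (l2_cinner x y)"
definition norm_l2 :: "'a l2 \<Rightarrow> real" where "norm_l2 x = sqrt (inner x x)"
definition dist_l2 :: "'a l2 \<Rightarrow> 'a l2 \<Rightarrow> real" where "dist_l2 x y = norm (x - y)"
definition sgn_l2 :: "'a l2 \<Rightarrow> 'a l2" where "sgn_l2 x = scaleR (inverse (norm x)) x"
definition uniformity_l2 :: "('a l2 \<times> 'a l2) filter"
  where "uniformity_l2 = (INF e\<in>{0 <..}. principal {(x, y). dist x y < e})"
definition open_l2 :: "'a l2 set \<Rightarrow> bool"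
  where "open_l2 U = (\<forall>x\<in>U. eventually (\<lambda>(x', y). x' = x \<longrightarrow> y \<in> U) uniformity)"

lemma to_l2_add:
  assumes "f \<in> L2 lebesgue" "g \<in> L2 lebesgue"
  shows "to_l2 f + to_l2 g = to_l2 (\<lambda>z. f z + g z)"
  unfolding plus_l2_def
  by (rule to_l2_cong) (use of_to_l2[OF assms(1)] of_to_l2[OF assms(2)] assms in \<open>auto intro: L2_add\<close>)

lemma to_l2_diff:
  assumes "f \<in> L2 lebesgue" "g \<in> L2 lebesgue"
  shows "to_l2 f - to_l2 g = to_l2 (\<lambda>z. f z - g z)"
  unfolding minus_l2_def
  by (rule to_l2_cong) (use of_to_l2[OF assms(1)] of_to_l2[OF assms(2)] assms in \<open>auto intro: L2_diff\<close>)

lemma to_l2_minus: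
  assumes "f \<in> L2 lebesgue"
  shows "- to_l2 f = to_l2 (\<lambda>z. - f z)"
  unfolding uminus_l2_def
  by (rule to_l2_cong) (use of_to_l2[OF assms(1)] assms in \<open>auto intro: L2_minus\<close>)

lemma to_l2_scaleR:
  assumes "f \<in> L2 lebesgue"
  shows "r *\<^sub>R to_l2 f = to_l2 (\<lambda>z. complex_of_real r * f z)"
  unfolding scaleR_l2_def
  by (rule to_l2_cong) (use of_to_l2[OF assms(1)] assms in \<open>auto intro: L2_cmult\<close>)

lemma l2_cinner_to_l2:
  assumes "f \<in> L2 lebesgue" "g \<in> L2 lebesgue"
  shows "l2_cinner (to_l2 f) (to_l2 g) = L2_inner lebesgue f g"
  unfolding l2_cinner_def L2_inner_def
  by (rule integral_cong_AE) (use of_to_l2[OF assms(1)] of_to_l2[OF assms(2)] assms in auto)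

lemma inner_to_l2:
  assumes "f \<in> L2 lebesgue" "g \<in> L2 lebesgue"
  shows "to_l2 f \<bullet> to_l2 g = Re (LINT z|lebesgue. f z * cnj (g z))"
  using l2_cinner_to_l2[OF assms] by (simp add: inner_l2_def L2_inner_def)

lemma inner_to_l2_self:
  assumes "f \<in> L2 lebesgue"
  shows "to_l2 f \<bullet> to_l2 f = (LINT z|lebesgue. (cmod (f z))\<^sup>2)"
proof -
  have "(LINT z|lebesgue. f z * cnj (f z)) = complex_of_real (LINT z|lebesgue. (cmod (f z))\<^sup>2)"
    unfolding integral_complex_of_real[symmetric] by (simp add: complex_norm_square del: of_real_power)
  then show ?thesis by (simp add: inner_to_l2[OF assms assms])
qed

instance
proof
  fix x y w :: "'a l2" and r q :: real
  obtain f where f: "f \<in> L2 lebesgue" "x = to_l2 f" by (rule l2_cases)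
  obtain g where g: "g \<in> L2 lebesgue" "y = to_l2 g" by (rule l2_cases)
  obtain h where h: "h \<in> L2 lebesgue" "w = to_l2 h" by (rule l2_cases)
  note [simp] = to_l2_add to_l2_diff to_l2_minus to_l2_scaleR L2_add L2_diff L2_minus L2_cmult
    inner_to_l2 L2_integrable_mult f g h zero_l2_def
  show "x + y + w = x + (y + w)" "x + y = y + x" "0 + x = x" "- x + x = 0" "x - y = x + - y"
    "r *\<^sub>R (x + y) = r *\<^sub>R x + r *\<^sub>R y" "(r + q) *\<^sub>R x = r *\<^sub>R x + q *\<^sub>R x"
    "r *\<^sub>R q *\<^sub>R x = (r * q) *\<^sub>R x" "1 *\<^sub>R x = x"
    by (simp_all add: algebra_simps)
  show "dist x y = norm (x - y)" by (simp add: dist_l2_def)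
  show "sgn x = inverse (norm x) *\<^sub>R x" by (simp add: sgn_l2_def)
  show "uniformity = (INF e\<in>{0 <..}. principal {(x :: 'a l2, y). dist x y < e})" by (simp add: uniformity_l2_def)
  show "open U = (\<forall>x\<in>U. eventually (\<lambda>(x', y). x' = x \<longrightarrow> y \<in> U) uniformity)" for U :: "'a l2 set"
    by (simp add: open_l2_def)
  show "x \<bullet> y = y \<bullet> x"
  proof -
    have "(LINT z|lebesgue. g z * cnj (f z)) = cnj (LINT z|lebesgue. f z * cnj (g z))"
      by (subst Bochner_Integration.integral_cnj[symmetric], rule Bochner_Integration.integral_cong) (simp_all add: mult.commute)
    then show ?thesis by simp
  qed
  show "(x + y) \<bullet> w = x \<bullet> w + y \<bullet> w" by (simp add: distrib_right)
  show "r *\<^sub>R x \<bullet> y = r * (x \<bullet> y)" by (simp add: mult.assoc)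
  have xx: "x \<bullet> x = (LINT z|lebesgue. (cmod (f z))\<^sup>2)" by (simp add: inner_to_l2_self del: inner_to_l2)
  show "0 \<le> x \<bullet> x" unfolding xx by simp
  show "norm x = sqrt (x \<bullet> x)" by (simp add: norm_l2_def)
  have "x \<bullet> x = 0 \<longleftrightarrow> (AE z in lebesgue. (cmod (f z))\<^sup>2 = 0)"
    unfolding xx by (rule integral_nonneg_eq_0_iff_AE) (use L2_integrable[OF f(1)] in auto)
  also have "\<dots> \<longleftrightarrow> x = 0" by (simp add: to_l2_eq_iff)
  finally show "x \<bullet> x = 0 \<longleftrightarrow> x = 0" .
qed

end

lemma norm_to_l2: "f \<in> L2 lebesgue \<Longrightarrow> norm (to_l2 f) = L2_norm lebesgue f"
  by (simp add: norm_l2_def inner_to_l2_self L2_norm_def)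

lemma norm_to_l2_sq: "f \<in> L2 lebesgue \<Longrightarrow> (norm (to_l2 f))\<^sup>2 = (LINT z|lebesgue. (cmod (f z))\<^sup>2)"
  by (simp add: power2_norm_eq_inner inner_to_l2_self)

lemma norm_to_l2_nn:
  assumes "f \<in> L2 lebesgue"
  shows "ennreal ((norm (to_l2 f))\<^sup>2) = (\<integral>\<^sup>+z. ennreal ((cmod (f z))\<^sup>2) \<partial>lebesgue)"
  unfolding norm_to_l2_sq[OF assms]
  by (rule nn_integral_eq_integral[symmetric]) (use L2_integrable[OF assms] in auto)

text \<open>A weighted form of the Riesz--Fischer argument: if \<open>\<Sum>2\<^sup>k \<parallel>d\<^sub>k\<parallel>\<^sup>2\<close> is finite then
  \<open>d\<^sub>k\<close> decays geometrically almost everywhere.\<close>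

lemma AE_summable_of_L2_decay:
  fixes d :: "nat \<Rightarrow> 'a::euclidean_space \<Rightarrow> complex"
  assumes d: "\<And>k. d k \<in> L2 lebesgue" and small: "\<And>k. norm (to_l2 (d k)) \<le> (1/2)^k"
  shows "AE z in lebesgue. summable (\<lambda>k. d k z)"
proof -
  have [measurable]: "d k \<in> borel_measurable lebesgue" for k using d L2_measurable by blast
  have "(\<integral>\<^sup>+z. (\<Sum>k. ennreal (2^k * (cmod (d k z))\<^sup>2)) \<partial>lebesgue)
      = (\<Sum>k. \<integral>\<^sup>+z. ennreal (2^k * (cmod (d k z))\<^sup>2) \<partial>lebesgue)"
    by (rule nn_integral_suminf) measurable
  also have "\<dots> = (\<Sum>k. ennreal (2^k * (norm (to_l2 (d k)))\<^sup>2))"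
    using d by (simp add: ennreal_mult nn_integral_cmult norm_to_l2_nn)
  also have "\<dots> \<le> (\<Sum>k. ennreal ((1/2)^k))"
  proof (intro suminf_le ennreal_leI)
    fix k
    have "(norm (to_l2 (d k)))\<^sup>2 \<le> ((1/2)^k)\<^sup>2" by (intro power_mono small) auto
    then have "2^k * (norm (to_l2 (d k)))\<^sup>2 \<le> 2^k * ((1/2)^k)\<^sup>2" by (intro mult_left_mono) auto
    also have "\<dots> = (1/2)^k" by (simp add: power2_eq_square power_one_over)
    finally show "2^k * (norm (to_l2 (d k)))\<^sup>2 \<le> (1/2)^k" .
  qed auto
  also have "\<dots> = ennreal (\<Sum>k. (1/2)^k)"
    by (rule suminf_ennreal2) auto
  also have "\<dots> < \<infinity>" by simp
  finally have "AE z in lebesgue. (\<Sum>k. ennreal (2^k * (cmod (d k z))\<^sup>2)) \<noteq> \<infinity>"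
    by (intro nn_integral_PInf_AE) auto
  then show ?thesis
  proof eventually_elim
    case (elim z)
    then have "summable (\<lambda>k. 2^k * (cmod (d k z))\<^sup>2)"
      by (intro summable_suminf_not_top) auto
    then have "(\<lambda>k. 2^k * (cmod (d k z))\<^sup>2) \<longlonglongrightarrow> 0" by (rule summable_LIMSEQ_zero)
    then have "eventually (\<lambda>k. 2^k * (cmod (d k z))\<^sup>2 < 1) sequentially" by (rule order_tendstoD) simp
    then have "eventually (\<lambda>k. norm (d k z) \<le> (sqrt (1/2))^k) sequentially"
    proof eventually_elim
      case (elim k)
      have "(cmod (d k z))\<^sup>2 \<le> (1/2)^k" using elim by (simp add: field_simps power_one_over)
      also have "\<dots> = ((sqrt (1/2))^k)\<^sup>2" by (subst power_mult[symmetric], subst mult.commute, subst power_mult) simp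
      finally show ?case by (rule power2_le_imp_le) simp
    qed
    then show ?case
      by (rule summable_comparison_test_ev) (auto intro!: summable_geometric simp: real_sqrt_divide)
  qed
qed

text \<open>Along a subsequence with geometrically small gaps the functions converge almost
  everywhere, and Fatou's lemma turns the pointwise limit into a limit in norm.\<close>

instance l2 :: (euclidean_space) complete_space
proof
  fix X :: "nat \<Rightarrow> 'a l2"
  assume X: "Cauchy X"
  have "\<exists>N. \<forall>m\<ge>N. \<forall>n\<ge>N. norm (X m - X n) < (1/2)^k" for k
    using CauchyD[OF X, of "(1/2)^k"] by simp
  then obtain N where N: "\<And>k m n. N k \<le> m \<Longrightarrow> N k \<le> n \<Longrightarrow> norm (X m - X n) < (1/2)^k" by metis
  \<comment> \<open>The partial sums of \<open>N\<close> dominate \<open>N k\<close> and are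
    monotone in \<open>k\<close>, so they can serve as the indices of the subsequence.\<close>
  define r where "r k = (\<Sum>i\<le>k. N i)" for k
  have rN: "N k \<le> r k" for k unfolding r_def by (rule member_le_sum) auto
  have rmono: "r k \<le> r j" if "k \<le> j" for k j unfolding r_def using that by (intro sum_mono2) auto
  define f where "f k = of_l2 (X (r k))" for k
  have fL2 [simp]: "f k \<in> L2 lebesgue" for k by (simp add: f_def)
  have [measurable]: "f k \<in> borel_measurable lebesgue" for k by (simp add: f_def)
  have fX: "to_l2 (f k) = X (r k)" for k by (simp add: f_def)
  have close: "norm (to_l2 (\<lambda>z. f j z - f k z)) \<le> (1/2)^k" if "k \<le> j" for k j
  proof -
    have "to_l2 (\<lambda>z. f j z - f k z) = X (r j) - X (r k)" by (simp add: to_l2_diff[symmetric] fX)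
    then show ?thesis using N[of k "r j" "r k"] rN[of k] rmono[OF that] by simp
  qed
  have "AE z in lebesgue. summable (\<lambda>k. f (Suc k) z - f k z)"
    by (rule AE_summable_of_L2_decay) (auto intro: L2_diff close)
  then have conv: "AE z in lebesgue. (\<lambda>k. f k z) \<longlonglongrightarrow> lim (\<lambda>k. f k z)"
  proof eventually_elim
    case (elim z)
    then have "convergent (\<lambda>n. \<Sum>k<n. f (Suc k) z - f k z)" by (simp add: summable_iff_convergent)
    then have cv: "convergent (\<lambda>n. f n z - f 0 z)" by (simp only: sum_lessThan_telescope[of "\<lambda>k. f k z"])
    have "convergent (\<lambda>n. (f n z - f 0 z) + f 0 z)" by (rule convergent_add[OF cv convergent_const])
    then show ?case by (simp add: convergent_LIMSEQ_iff)
  qed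
  define g where "g z = lim (\<lambda>k. f k z)" for z
  have [measurable]: "g \<in> borel_measurable lebesgue" unfolding g_def[abs_def] by measurable
  have bnd: "(\<integral>\<^sup>+z. ennreal ((cmod (g z - f k z))\<^sup>2) \<partial>lebesgue) \<le> ennreal (((1/2)^k)\<^sup>2)" for k
  proof -
    have "(\<integral>\<^sup>+z. ennreal ((cmod (g z - f k z))\<^sup>2) \<partial>lebesgue)
        = (\<integral>\<^sup>+z. liminf (\<lambda>j. ennreal ((cmod (f j z - f k z))\<^sup>2)) \<partial>lebesgue)"
    proof (rule nn_integral_cong_AE)
      show "AE z in lebesgue. ennreal ((cmod (g z - f k z))\<^sup>2) = liminf (\<lambda>j. ennreal ((cmod (f j z - f k z))\<^sup>2))"
        using conv
      proof eventually_elim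
        case (elim z)
        have "(\<lambda>j. ennreal ((cmod (f j z - f k z))\<^sup>2)) \<longlonglongrightarrow> ennreal ((cmod (g z - f k z))\<^sup>2)"
          unfolding g_def by (intro tendsto_intros elim)
        then show ?case by (intro lim_imp_Liminf[symmetric] trivial_limit_sequentially)
      qed
    qed
    also have "\<dots> \<le> liminf (\<lambda>j. \<integral>\<^sup>+z. ennreal ((cmod (f j z - f k z))\<^sup>2) \<partial>lebesgue)"
      by (rule nn_integral_liminf) measurable
    also have "\<dots> \<le> limsup (\<lambda>j. \<integral>\<^sup>+z. ennreal ((cmod (f j z - f k z))\<^sup>2) \<partial>lebesgue)"
      by (rule Liminf_le_Limsup) simp
    also have "\<dots> \<le> ennreal (((1/2)^k)\<^sup>2)"
    proof (rule Limsup_bounded)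
      show "\<forall>\<^sub>F j in sequentially. (\<integral>\<^sup>+z. ennreal ((cmod (f j z - f k z))\<^sup>2) \<partial>lebesgue) \<le> ennreal (((1/2)^k)\<^sup>2)"
        using eventually_ge_at_top[of k]
      proof eventually_elim
        case (elim j)
        show ?case
          by (subst norm_to_l2_nn[symmetric]) (auto intro!: L2_diff ennreal_leI power_mono close elim)
      qed
    qed
    finally show ?thesis .
  qed
  have gf: "(\<lambda>z. g z - f k z) \<in> L2 lebesgue" for k
    unfolding L2_def using le_less_trans[OF bnd[of k]] by (auto intro!: integrableI_nonneg)
  have gL2 [simp]: "g \<in> L2 lebesgue" using L2_add[OF gf[of 0] fL2[of 0]] by simp
  have gX: "norm (to_l2 g - X (r k)) \<le> (1/2)^k" for k
  proof -
    have "to_l2 g - X (r k) = to_l2 (\<lambda>z. g z - f k z)" by (simp add: fX[symmetric] to_l2_diff)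
    then have "ennreal ((norm (to_l2 g - X (r k)))\<^sup>2) \<le> ennreal (((1/2)^k)\<^sup>2)"
      using bnd[of k] norm_to_l2_nn[OF gf[of k]] by simp
    then have "(norm (to_l2 g - X (r k)))\<^sup>2 \<le> ((1/2)^k)\<^sup>2" by (simp add: ennreal_le_iff)
    then show ?thesis by (rule power2_le_imp_le) simp
  qed
  have "X \<longlonglongrightarrow> to_l2 g"
  proof (rule LIMSEQ_I)
    fix e :: real assume e: "0 < e"
    obtain k where k: "(1/2::real)^k < e / 2" using real_arch_pow_inv[of "e/2" "1/2"] e by auto
    show "\<exists>no. \<forall>n\<ge>no. norm (X n - to_l2 g) < e"
    proof (intro exI[of _ "N k"] allI impI)
      fix n assume n: "N k \<le> n"
      have "norm (X n - to_l2 g) \<le> norm (X n - X (r k)) + norm (X (r k) - to_l2 g)"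
        using norm_triangle_ineq[of "X n - X (r k)" "X (r k) - to_l2 g"] by simp
      then show "norm (X n - to_l2 g) < e"
        using N[OF n rN[of k]] gX[of k] k by (simp add: norm_minus_commute)
    qed
  qed
  then show "convergent X" by (rule convergentI)
qed

lemma Re_l2_cinner: "Re (l2_cinner x y) = x \<bullet> y"
  by (simp add: inner_l2_def)

section \<open>Multiplication operators on classes\<close>

definition l2_mult :: "('a::euclidean_space \<Rightarrow> complex) \<Rightarrow> 'a l2 \<Rightarrow> 'a l2" where
  "l2_mult b x = to_l2 (\<lambda>z. b z * of_l2 x z)"

definition bounded_multiplier :: "('a::euclidean_space \<Rightarrow> complex) \<Rightarrow> bool" where
  "bounded_multiplier b \<longleftrightarrow> b \<in> borel_measurable lebesgue \<and> (\<exists>C. AE z in lebesgue. cmod (b z) \<le> C)"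

lemma bounded_multiplierI:
  "b \<in> borel_measurable lebesgue \<Longrightarrow> (\<And>z. cmod (b z) \<le> C) \<Longrightarrow> bounded_multiplier b"
  by (auto simp: bounded_multiplier_def)

lemma bounded_multiplier_const [simp]: "bounded_multiplier (\<lambda>_. c)"
  by (rule bounded_multiplierI) auto

lemma L2_multiplier: "bounded_multiplier b \<Longrightarrow> f \<in> L2 lebesgue \<Longrightarrow> (\<lambda>z. b z * f z) \<in> L2 lebesgue"
  unfolding bounded_multiplier_def using L2_bounded_mult by blast

lemma l2_mult_to_l2:
  assumes "bounded_multiplier b" "f \<in> L2 lebesgue"
  shows "l2_mult b (to_l2 f) = to_l2 (\<lambda>z. b z * f z)"
  unfolding l2_mult_def
  by (rule to_l2_cong) (use of_to_l2[OF assms(2)] assms in \<open>auto intro: L2_multiplier\<close>)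

lemma norm_to_l2_mult_le:
  assumes f: "f \<in> L2 lebesgue" and g: "g \<in> L2 lebesgue" and le: "AE z in lebesgue. cmod (g z) \<le> C * cmod (f z)"
    and C: "0 \<le> C"
  shows "norm (to_l2 g) \<le> C * norm (to_l2 f)"
proof -
  have "(norm (to_l2 g))\<^sup>2 \<le> (LINT z|lebesgue. C\<^sup>2 * (cmod (f z))\<^sup>2)"
    unfolding norm_to_l2_sq[OF g]
  proof (rule integral_mono_AE)
    show "AE z in lebesgue. (cmod (g z))\<^sup>2 \<le> C\<^sup>2 * (cmod (f z))\<^sup>2"
      using le
    proof eventually_elim
      case (elim z)
      then have "(cmod (g z))\<^sup>2 \<le> (C * cmod (f z))\<^sup>2" by (intro power_mono) auto
      then show ?case by (simp add: power_mult_distrib)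
    qed
  qed (use L2_integrable[OF f] L2_integrable[OF g] in auto)
  also have "\<dots> = (C * norm (to_l2 f))\<^sup>2" by (simp add: power_mult_distrib norm_to_l2_sq[OF f])
  finally show ?thesis by (rule power2_le_imp_le) (use C in simp)
qed

lemma bounded_linear_l2_mult:
  assumes b: "bounded_multiplier b"
  shows "bounded_linear (l2_mult b)"
proof -
  obtain C where C: "AE z in lebesgue. cmod (b z) \<le> C" using b by (auto simp: bounded_multiplier_def)
  show ?thesis
  proof (rule bounded_linear_intro)
    fix x y :: "'a l2" and r :: real
    obtain f where f: "f \<in> L2 lebesgue" "x = to_l2 f" by (rule l2_cases)
    obtain g where g: "g \<in> L2 lebesgue" "y = to_l2 g" by (rule l2_cases)
    note [simp] = f g l2_mult_to_l2[OF b] L2_multiplier[OF b] to_l2_add to_l2_scaleR L2_add L2_cmult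
    show "l2_mult b (x + y) = l2_mult b x + l2_mult b y" by (simp add: distrib_left)
    show "l2_mult b (r *\<^sub>R x) = r *\<^sub>R l2_mult b x" by (simp add: mult_ac)
    have "norm (to_l2 (\<lambda>z. b z * f z)) \<le> max C 0 * norm (to_l2 f)"
    proof (rule norm_to_l2_mult_le)
      show "AE z in lebesgue. cmod (b z * f z) \<le> max C 0 * cmod (f z)"
        using C by eventually_elim (auto simp: norm_mult intro!: mult_right_mono)
    qed auto
    then show "norm (l2_mult b x) \<le> norm x * max C 0" by (simp add: mult.commute)
  qed
qed

lemma Im_l2_cinner: "Im (l2_cinner x y) = x \<bullet> l2_mult (\<lambda>_. \<i>) y"
proof -
  obtain f g where fg: "f \<in> L2 lebesgue" "x = to_l2 f" "g \<in> L2 lebesgue" "y = to_l2 g" by (metis l2_cases)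
  have "(LINT z|lebesgue. f z * cnj (\<i> * g z)) = (LINT z|lebesgue. - \<i> * (f z * cnj (g z)))"
    by (rule Bochner_Integration.integral_cong) (simp_all add: mult_ac)
  also have "\<dots> = - \<i> * (LINT z|lebesgue. f z * cnj (g z))" by (rule integral_mult_right_zero)
  finally show ?thesis using fg
    by (simp add: l2_cinner_to_l2 l2_mult_to_l2 L2_cmult inner_to_l2 L2_inner_def)
qed

text \<open>Lipschitz functions with compact support in \<open>A\<close> take the place of smooth
  test functions: cutoffs of the distance to a compact set are available at once, and since s < 1 a
  single derivative in L^2 is enough to lie in \<open>Hs s\<close>.\<close>

definition lip_test :: "'a::euclidean_space set \<Rightarrow> ('a \<Rightarrow> real) set" where
  "lip_test A = {p. (\<exists>L. L-lipschitz_on UNIV p) \<and> (\<exists>K. compact K \<and> K \<subseteq> A \<and> (\<forall>x. x \<notin> K \<longrightarrow> p x = 0))}"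

lemma lip_test_continuous: "p \<in> lip_test A \<Longrightarrow> continuous_on UNIV p"
  by (auto simp: lip_test_def intro: lipschitz_on_continuous_on)

lemma lip_test_borel [measurable_dest]: "p \<in> lip_test A \<Longrightarrow> p \<in> borel_measurable borel"
  by (intro borel_measurable_continuous_onI lip_test_continuous)

lemma lip_test_bounded:
  assumes "p \<in> lip_test A"
  obtains C where "\<And>x. \<bar>p x\<bar> \<le> C"
proof -
  obtain K where K: "compact K" "\<And>x. x \<notin> K \<Longrightarrow> p x = 0" using assms by (auto simp: lip_test_def)
  have "compact (p ` K)"
    using K lip_test_continuous[OF assms] by (intro compact_continuous_image) (auto intro: continuous_on_subset)
  then obtain C where C: "\<And>x. x \<in> K \<Longrightarrow> \<bar>p x\<bar> \<le> C"
    using compact_imp_bounded by (fastforce simp: bounded_iff)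
  have "\<bar>p x\<bar> \<le> max C 0" for x using C[of x] K(2)[of x] by (cases "x \<in> K") auto
  then show ?thesis by (rule that)
qed

lemma integrable_indicator_compact: "compact K \<Longrightarrow> integrable lborel (indicator K :: 'a::euclidean_space \<Rightarrow> real)"
  by (intro integrable_real_indicator) (auto intro: borel_compact emeasure_bounded_finite[OF compact_imp_bounded, simplified])

lemma lip_test_L2:
  assumes "p \<in> lip_test A"
  shows "(\<lambda>z. complex_of_real (p z)) \<in> L2 lborel" "integrable lborel (\<lambda>z. complex_of_real (p z))"
    "(\<lambda>z. complex_of_real (p z)) \<in> L2 lebesgue" "integrable lebesgue (\<lambda>z. complex_of_real (p z))"
proof -
  note [measurable] = lip_test_borel[OF assms]
  obtain K where K: "compact K" "\<And>x. x \<notin> K \<Longrightarrow> p x = 0" using assms by (auto simp: lip_test_def)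
  obtain C where C: "\<And>x. \<bar>p x\<bar> \<le> C" using lip_test_bounded[OF assms] by blast
  have iK: "integrable lborel (\<lambda>z. D * indicator K z :: real)" for D
    using integrable_indicator_compact[OF K(1)] by simp
  show 1: "(\<lambda>z. complex_of_real (p z)) \<in> L2 lborel"
  proof (rule L2_bound[OF _ iK[of "C\<^sup>2"]])
    have "(cmod (complex_of_real (p z)))\<^sup>2 \<le> C\<^sup>2 * indicator K z" for z
      using K(2)[of z] C[of z] by (cases "z \<in> K") (auto intro: abs_le_square_iff[THEN iffD1] power2_le_iff_abs_le[THEN iffD2, OF order_trans[OF abs_ge_zero C]])
    then show "AE z in lborel. (cmod (complex_of_real (p z)))\<^sup>2 \<le> C\<^sup>2 * indicator K z" by simp
  qed measurable
  show 2: "integrable lborel (\<lambda>z. complex_of_real (p z))"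
  proof (rule Bochner_Integration.integrable_bound[OF iK[of C]])
    have "cmod (complex_of_real (p z)) \<le> norm (C * indicator K z :: real)" for z
      using K(2)[of z] C[of z] by (cases "z \<in> K") auto
    then show "AE z in lborel. norm (complex_of_real (p z)) \<le> norm (C * indicator K z)" by simp
  qed measurable
  show "(\<lambda>z. complex_of_real (p z)) \<in> L2 lebesgue"
    using 1 unfolding L2_def by (auto simp: integrable_completion intro: measurable_completion)
  show "integrable lebesgue (\<lambda>z. complex_of_real (p z))"
    using 2 by (subst integrable_completion) measurable
qed

text \<open>If h were positive on a subset of \<open>U\<close> of positive measure, inner regularity
  would give a compact subset of positive measure; a vanishing integral over it forces h = 0 almost
  everywhere there.\<close>

lemma AE_zero_of_compact_integrals:
  fixes h :: "'a::euclidean_space \<Rightarrow> real"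
  assumes [measurable]: "h \<in> borel_measurable lebesgue" and U: "open U"
    and int: "\<And>K. compact K \<Longrightarrow> K \<subseteq> U \<Longrightarrow> integrable lebesgue (\<lambda>z. indicator K z * h z)"
    and zero: "\<And>K. compact K \<Longrightarrow> K \<subseteq> U \<Longrightarrow> (LINT z|lebesgue. indicator K z * h z) = 0"
  shows "AE z in lebesgue. z \<in> U \<longrightarrow> h z \<le> 0"
proof -
  have [measurable]: "U \<in> sets lebesgue" using U by auto
  define A where "A n = {z \<in> space lebesgue. 0 < h z} \<inter> (U \<inter> cball 0 (real n))" for n :: nat
  have A [measurable]: "A n \<in> sets lebesgue" for n unfolding A_def by measurable auto
  have "emeasure lebesgue (A n) = 0" for n
  proof (rule ccontr)
    assume "emeasure lebesgue (A n) \<noteq> 0"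
    then obtain e :: real where e: "e > 0" "ennreal e < emeasure lebesgue (A n)"
      by (metis ennreal_less_zero_iff zero_less_iff_neq_zero dense ennreal_cases top.extremum_strict less_le_trans)
    obtain K where K: "closed K" "K \<subseteq> A n" "emeasure lebesgue (A n - K) < ennreal e"
      using sets_lebesgue_inner_closed[OF A e(1)] by metis
    have "compact K"
      using K(1,2) by (intro compact_eq_bounded_closed[THEN iffD2] conjI) (auto simp: A_def intro: bounded_subset[OF bounded_cball])
    moreover have KO: "K \<subseteq> U" using K by (auto simp: A_def)
    moreover have "0 \<le> indicator K z * h z" for z using K(2) by (auto simp: A_def indicator_def)
    ultimately have "AE z in lebesgue. indicator K z * h z = 0"
      using integral_nonneg_eq_0_iff_AE[OF int, of K] zero[of K] by simp
    then have "AE z in lebesgue. z \<notin> K"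
      by eventually_elim (use K(2) in \<open>auto simp: A_def indicator_def split: if_splits\<close>)
    then have "emeasure lebesgue K = 0"
      using K(1) AE_iff_measurable[of K lebesgue "\<lambda>z. z \<notin> K"] by auto
    then have "emeasure lebesgue (A n) = emeasure lebesgue (A n - K)"
      using K by (subst emeasure_Diff_null_set) (auto simp: null_sets_def)
    then show False using K(3) e(2) by simp
  qed
  then have "(\<Union>n. A n) \<in> null_sets lebesgue" by (intro null_sets_UN) (auto simp: null_sets_def)
  then have "AE z in lebesgue. z \<notin> (\<Union>n. A n)" by (rule AE_not_in)
  then show ?thesis
  proof eventually_elim
    case (elim z)
    obtain n :: nat where "norm z \<le> real n" using real_arch_simple by blast
    then show ?case using elim by (auto simp: A_def not_less dist_norm)
  qed
qed

text \<open>Cutoffs of the distance to a compact set decrease to its indicator. Hence integrals over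
  compact sets vanish, and the one-sided statement applies to h and to -h.\<close>

lemma AE_zero_of_lip_test:
  fixes h :: "'a::euclidean_space \<Rightarrow> real"
  assumes [measurable]: "h \<in> borel_measurable lebesgue" and U: "open U"
    and int: "\<And>K. compact K \<Longrightarrow> K \<subseteq> U \<Longrightarrow> integrable lebesgue (\<lambda>z. indicator K z * h z)"
    and zero: "\<And>p. p \<in> lip_test U \<Longrightarrow> (LINT z|lebesgue. p z * h z) = 0"
  shows "AE z in lebesgue. z \<in> U \<longrightarrow> h z = 0"
proof -
  have Kzero: "(LINT z|lebesgue. indicator K z * h z) = 0" if K: "compact K" "K \<subseteq> U" for K
  proof (cases "K = {}")
    case False
    obtain \<delta> where \<delta>: "\<delta> > 0" "{x. infdist x K \<le> \<delta>} \<subseteq> U"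
      using compact_in_open_separated[OF False K(1) U K(2)] by blast
    define K' where "K' = {x. infdist x K \<le> \<delta>}"
    have K': "compact K'" unfolding K'_def by (rule compact_infdist_le[OF False K(1) \<delta>(1)])
    \<comment> \<open>Supported in the \<delta>-neighbourhood of \<open>K\<close>, inside
      \<open>U\<close>, for every k, and Lipschitz with constant (k + 1) / \<delta>.\<close>
    define p where "p k z = max 0 (1 - (real (Suc k) / \<delta>) * infdist z K)" for k z
    have supp: "p k z = 0" if "z \<notin> K'" for k z
    proof -
      have "1 \<le> infdist z K / \<delta>" using that \<delta>(1) by (simp add: K'_def field_simps)
      also have "\<dots> \<le> real (Suc k) * (infdist z K / \<delta>)"
        using mult_right_mono[of 1 "real (Suc k)" "infdist z K / \<delta>"] \<delta>(1) infdist_nonneg[of z K] by simp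
      finally show ?thesis by (simp add: p_def)
    qed
    have "(real (Suc k) / \<delta>)-lipschitz_on UNIV (p k)" for k
    proof (rule lipschitz_onI)
      fix x y
      have "\<bar>infdist x K - infdist y K\<bar> \<le> dist x y" by (rule infdist_triangle_abs)
      then have 1: "(real (Suc k) / \<delta>) * \<bar>infdist x K - infdist y K\<bar> \<le> (real (Suc k) / \<delta>) * dist x y"
        using \<delta>(1) by (intro mult_left_mono) auto
      have 2: "dist (p k x) (p k y) \<le> \<bar>(real (Suc k) / \<delta>) * infdist x K - (real (Suc k) / \<delta>) * infdist y K\<bar>"
      proof -
        have "\<bar>max 0 (1 - a) - max 0 (1 - b)\<bar> \<le> \<bar>a - b\<bar>" for a b :: real by (auto simp: max_def)
        then show ?thesis unfolding p_def dist_real_def .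
      qed
      show "dist (p k x) (p k y) \<le> (real (Suc k) / \<delta>) * dist x y"
      proof -
        have "\<bar>m * a - m * b\<bar> = m * \<bar>a - b\<bar>" if "0 \<le> m" for m a b :: real
          using that by (metis abs_mult abs_of_nonneg right_diff_distrib)
        from this[of "real (Suc k) / \<delta>"] show ?thesis
          using \<delta>(1) 1 2 by (metis (no_types, lifting) divide_nonneg_pos of_nat_0_le_iff order_trans)
      qed
    qed (use \<delta> in auto)
    then have pO: "p k \<in> lip_test U" for k
      using K' \<delta>(2) supp by (auto simp: lip_test_def K'_def)
    have lim: "(\<lambda>k. LINT z|lebesgue. p k z * h z) \<longlonglongrightarrow> (LINT z|lebesgue. indicator K z * h z)"
    proof (rule integral_dominated_convergence)
      show "integrable lebesgue (\<lambda>z. \<bar>indicator K' z * h z\<bar>)"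
        using int[OF K'] \<delta>(2) by (intro integrable_abs) (auto simp: K'_def)
      show "AE z in lebesgue. (\<lambda>k. p k z * h z) \<longlonglongrightarrow> indicator K z * h z"
      proof (rule AE_I2)
        fix z
        have "(\<lambda>k. p k z) \<longlonglongrightarrow> indicator K z"
        proof (cases "z \<in> K")
          case True
          then show ?thesis by (simp add: p_def)
        next
          case nK: False
          then have pos: "infdist z K > 0"
            using K(1) False by (simp add: infdist_pos_not_in_closed compact_imp_closed)
          obtain N :: nat where N: "\<delta> / infdist z K < real N" using reals_Archimedean2 by blast
          have "eventually (\<lambda>k. p k z = 0) sequentially"
            using eventually_ge_at_top[of N]
          proof eventually_elim
            case (elim k)
            then have "\<delta> / infdist z K \<le> real (Suc k)" using N by linarith
            then have "1 \<le> real (Suc k) / \<delta> * infdist z K" using pos \<delta>(1) by (simp add: field_simps)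
            then show ?case by (simp add: p_def)
          qed
          then show ?thesis using nK by (simp add: tendsto_eventually)
        qed
        then show "(\<lambda>k. p k z * h z) \<longlonglongrightarrow> indicator K z * h z" by (intro tendsto_mult tendsto_const)
      qed
      have p1: "\<bar>p k z\<bar> \<le> indicator K' z" for k z
        using supp[of z k] \<delta>(1) infdist_nonneg[of z K] by (cases "z \<in> K'") (auto simp: p_def)
      show "AE z in lebesgue. norm (p k z * h z) \<le> \<bar>indicator K' z * h z\<bar>" for k
        using p1[of k] by (auto simp: abs_mult intro!: mult_right_mono)
      have "p k \<in> borel_measurable lebesgue" for k
        using lip_test_borel[OF pO[of k]] by (intro measurable_completion) simp
      then show "(\<lambda>z. p k z * h z) \<in> borel_measurable lebesgue" for k
        by (intro borel_measurable_times assms(1))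
      show "(\<lambda>z. indicator K z * h z) \<in> borel_measurable lebesgue"
        using K(1) by (intro borel_measurable_times borel_measurable_indicator assms(1)) (rule fmeasurableD[OF lmeasurable_compact[OF K(1)]])
    qed
    then show ?thesis using zero[OF pO] by (simp add: LIMSEQ_const_iff)
  qed auto
  have "AE z in lebesgue. z \<in> U \<longrightarrow> h z \<le> 0"
    by (rule AE_zero_of_compact_integrals[OF assms(1) U int Kzero])
  moreover have "AE z in lebesgue. z \<in> U \<longrightarrow> - h z \<le> 0"
  proof (rule AE_zero_of_compact_integrals[OF borel_measurable_uminus[OF assms(1)] U])
    fix K assume K: "compact K" "K \<subseteq> U"
    show "integrable lebesgue (\<lambda>z. indicator K z * - h z)" using int[OF K] by simp
    show "(LINT z|lebesgue. indicator K z * - h z) = 0" using Kzero[OF K] by simp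
  qed
  ultimately show ?thesis by eventually_elim auto
qed

section \<open>The Plancherel theorem\<close>

lemma borel_measurable_cis [measurable (raw)]:
  assumes "f \<in> borel_measurable M"
  shows "(\<lambda>x. cis (f x)) \<in> borel_measurable M"
  using measurable_compose[OF assms borel_measurable_continuous_onI[OF continuous_on_cis[OF continuous_on_id]]] .

text \<open>A constant multiple of f(x) g(y) dominates the double integrand. This covers both the
  characters \<open>cis\<close> and the bounded heat kernel.\<close>

lemma fubini_bounded_kernel:
  fixes f :: "'a \<Rightarrow> complex" and g :: "'b \<Rightarrow> complex" and k :: "'a \<Rightarrow> 'b \<Rightarrow> complex"
  assumes "sigma_finite_measure M" "sigma_finite_measure N"
    and f: "integrable M f" and g: "integrable N g"
    and k [measurable]: "(\<lambda>(x, y). k x y) \<in> borel_measurable (M \<Otimes>\<^sub>M N)"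
    and kb: "\<And>x y. cmod (k x y) \<le> C"
  shows "(LINT x|M. f x * (LINT y|N. k x y * g y)) = (LINT y|N. g y * (LINT x|M. k x y * f x))"
    and "integrable M (\<lambda>x. f x * (LINT y|N. k x y * g y))"
proof -
  interpret pair_sigma_finite M N
    using assms(1,2) by (simp add: pair_sigma_finite_def)
  note [measurable] = borel_measurable_integrable[OF f] borel_measurable_integrable[OF g]
  have "integrable (M \<Otimes>\<^sub>M N) (\<lambda>(x, y). f x * g y)"
    using Fubini_integrable[of "\<lambda>(x, y). f x * g y"] f g by (simp add: norm_mult)
  then have "integrable (M \<Otimes>\<^sub>M N) (\<lambda>p. of_real C * (case p of (x, y) \<Rightarrow> f x * g y))"
    by (rule integrable_mult_right)
  then have int: "integrable (M \<Otimes>\<^sub>M N) (\<lambda>(x, y). f x * (k x y * g y))"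
  proof (rule Bochner_Integration.integrable_bound)
    have "cmod (f x * (k x y * g y)) \<le> cmod (of_real C * (f x * g y))" for x y
      using mult_mono[OF kb[of x y] order_refl, of "cmod (f x) * cmod (g y)"] order_trans[OF norm_ge_zero kb[of x y]]
      by (simp add: norm_mult mult_ac)
    then show "AE p in M \<Otimes>\<^sub>M N. norm (case p of (x, y) \<Rightarrow> f x * (k x y * g y))
        \<le> norm (of_real C * (case p of (x, y) \<Rightarrow> f x * g y))"
      by (intro AE_I2) (auto split: prod.split)
  qed measurable
  have "(LINT x|M. LINT y|N. f x * (k x y * g y)) = (LINT y|N. LINT x|M. f x * (k x y * g y))"
    using integral_fst[OF int] integral_snd[OF int] by simp
  also have "(LINT y|N. LINT x|M. f x * (k x y * g y)) = (LINT y|N. g y * (LINT x|M. k x y * f x))"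
    by (intro Bochner_Integration.integral_cong refl) (simp add: mult_ac flip: integral_mult_right_zero)
  finally show "(LINT x|M. f x * (LINT y|N. k x y * g y)) = (LINT y|N. g y * (LINT x|M. k x y * f x))"
    by simp
  show "integrable M (\<lambda>x. f x * (LINT y|N. k x y * g y))"
    using integrable_fst[OF int] by simp
qed

text \<open>The characteristic function of the standard normal law is known; the substitution x |->
  \<sigma> x with 2 c \<sigma>^2 = 1 transfers it to exp(- c x^2).\<close>

lemma gauss_ft_1:
  fixes c s :: real
  assumes c: "0 < c"
  shows "integrable lborel (\<lambda>x::real. cis (- (x * s)) * complex_of_real (exp (- c * x\<^sup>2)))"
    and "(LINT x|lborel. cis (- (x * s)) * complex_of_real (exp (- c * x\<^sup>2)))
      = complex_of_real (sqrt (pi / c) * exp (- s\<^sup>2 / (4 * c)))"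
proof -
  define \<sigma> where "\<sigma> = 1 / sqrt (2 * c)"
  have \<sigma>: "\<sigma> > 0" using c by (simp add: \<sigma>_def)
  have \<sigma>2: "2 * c * \<sigma>\<^sup>2 = 1" using c by (simp add: \<sigma>_def power_divide)
  let ?h = "\<lambda>x::real. cis (- (x * s)) * complex_of_real (exp (- c * x\<^sup>2))"
  have h: "?h (0 + \<sigma> * x) = complex_of_real (sqrt (2 * pi)) * (std_normal_density x *\<^sub>R iexp (- (\<sigma> * s) * x))" for x
  proof -
    have "c * (\<sigma> * x)\<^sup>2 = (2 * c * \<sigma>\<^sup>2) * x\<^sup>2 / 2" by (simp add: power_mult_distrib)
    then show ?thesis
      unfolding std_normal_density_def \<sigma>2 by (simp add: cis_conv_exp scaleR_conv_of_real mult_ac)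
  qed
  have "integrable std_normal_distribution (\<lambda>x. iexp (- (\<sigma> * s) * x))"
    using real_dist_normal_dist by (intro prob_space.integrable_iexp) (auto simp: real_distribution_def)
  then have int: "integrable lborel (\<lambda>x. std_normal_density x *\<^sub>R iexp (- (\<sigma> * s) * x))"
    by (subst (asm) integrable_density) auto
  have "(LINT x|lborel. std_normal_density x *\<^sub>R iexp (- (\<sigma> * s) * x)) = char std_normal_distribution (- (\<sigma> * s))"
    unfolding char_def by (subst integral_density) auto
  also have "\<dots> = complex_of_real (exp (- ((\<sigma> * s)\<^sup>2) / 2))" by (simp add: char_std_normal_distribution)
  finally have val: "(LINT x|lborel. std_normal_density x *\<^sub>R iexp (- (\<sigma> * s) * x)) = complex_of_real (exp (- ((\<sigma> * s)\<^sup>2) / 2))" .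
  have "integrable lborel (\<lambda>x. ?h (0 + \<sigma> * x))" unfolding h by (rule integrable_mult_right[OF int])
  then show "integrable lborel ?h"
    using lborel_integrable_real_affine_iff[of \<sigma> ?h 0] \<sigma> by simp
  have "(LINT x|lborel. ?h x) = \<bar>\<sigma>\<bar> *\<^sub>R (LINT x|lborel. ?h (0 + \<sigma> * x))"
    using \<sigma> by (intro lborel_integral_real_affine) auto
  also have "\<dots> = complex_of_real (\<sigma> * sqrt (2 * pi) * exp (- ((\<sigma> * s)\<^sup>2) / 2))"
    unfolding h using \<sigma> by (simp only: integral_mult_right_zero val) (simp add: scaleR_conv_of_real)
  also have "\<sigma> * sqrt (2 * pi) = sqrt (pi / c)"
    using c by (simp add: \<sigma>_def real_sqrt_divide real_sqrt_mult)
  also have "- ((\<sigma> * s)\<^sup>2) / 2 = - s\<^sup>2 / (4 * c)" using c by (simp add: \<sigma>_def power_mult_distrib power_divide)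
  finally show "(LINT x|lborel. ?h x) = complex_of_real (sqrt (pi / c) * exp (- s\<^sup>2 / (4 * c)))" by simp
qed

lemma lborel_prod_basis:
  fixes f :: "'a::euclidean_space \<Rightarrow> real \<Rightarrow> complex"
  assumes f: "\<And>b. b \<in> Basis \<Longrightarrow> integrable lborel (f b)"
  shows "integrable lborel (\<lambda>x::'a. \<Prod>b\<in>Basis. f b (x \<bullet> b))"
    and "(LINT x|lborel. (\<Prod>b\<in>Basis. f b (x \<bullet> b))) = (\<Prod>b\<in>Basis. LINT t|lborel. f b t)"
proof -
  interpret product_sigma_finite "\<lambda>_::'a. lborel :: real measure" by standard
  have [measurable]: "f b \<in> borel_measurable borel" if "b \<in> Basis" for b
    using borel_measurable_integrable[OF f[OF that]] by simp
  have [measurable]: "(\<lambda>x::'a. \<Prod>b\<in>Basis. f b (x \<bullet> b)) \<in> borel_measurable borel"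
    by (rule borel_measurable_prod) measurable
  have eq: "(\<Prod>b\<in>Basis. f b ((\<Sum>i\<in>Basis. x i *\<^sub>R i) \<bullet> b)) = (\<Prod>b\<in>Basis. f b (x b))" for x :: "'a \<Rightarrow> real"
    by (rule prod.cong) (auto simp: inner_sum_left inner_Basis if_distrib sum.delta cong: if_cong)
  show "integrable lborel (\<lambda>x::'a. \<Prod>b\<in>Basis. f b (x \<bullet> b))"
    by (subst lborel_eq, subst integrable_distr_eq) (auto simp: eq intro!: product_integrable_prod f)
  have "(LINT x|lborel. (\<Prod>b\<in>Basis. f b (x \<bullet> b)))
      = (LINT x|Pi\<^sub>M Basis (\<lambda>_::'a. lborel). (\<Prod>b\<in>Basis. f b (x b)))"
    by (subst lborel_eq, subst integral_distr) (auto simp: eq)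
  also have "\<dots> = (\<Prod>b\<in>Basis. LINT t|lborel. f b t)" by (rule product_integral_prod) (auto intro: f)
  finally show "(LINT x|lborel. (\<Prod>b\<in>Basis. f b (x \<bullet> b))) = (\<Prod>b\<in>Basis. LINT t|lborel. f b t)" .
qed

lemma norm_sq_basis: "(norm (x::'a::euclidean_space))\<^sup>2 = (\<Sum>b\<in>Basis. (x \<bullet> b)\<^sup>2)"
  by (simp add: norm_eq_sqrt_inner euclidean_inner[of x x] power2_eq_square sum_nonneg)

lemma cis_sum: "cis (\<Sum>b\<in>A. f b) = (\<Prod>b\<in>A. cis (f b))"
  by (induction A rule: infinite_finite_induct) (auto simp: cis_mult[symmetric])

lemma gauss_ft:
  fixes \<zeta> :: "'a::euclidean_space" and c :: real
  assumes c: "0 < c"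
  shows "integrable lborel (\<lambda>x::'a. cis (- (x \<bullet> \<zeta>)) * complex_of_real (exp (- c * (norm x)\<^sup>2)))"
    and "(LINT x|lborel. cis (- (x \<bullet> \<zeta>)) * complex_of_real (exp (- c * (norm x)\<^sup>2)))
      = complex_of_real (sqrt (pi / c) ^ DIM('a) * exp (- (norm \<zeta>)\<^sup>2 / (4 * c)))"
proof -
  let ?f = "\<lambda>b t. cis (- (t * (\<zeta> \<bullet> b))) * complex_of_real (exp (- c * t\<^sup>2))"
  have split: "(\<Prod>b\<in>Basis. ?f b (x \<bullet> b)) = cis (- (x \<bullet> \<zeta>)) * complex_of_real (exp (- c * (norm x)\<^sup>2))" for x :: 'a
    by (simp add: prod.distrib cis_sum[symmetric] exp_sum[symmetric] euclidean_inner[of x \<zeta>] norm_sq_basis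
        sum_negf sum_distrib_left flip: of_real_prod)
  show "integrable lborel (\<lambda>x::'a. cis (- (x \<bullet> \<zeta>)) * complex_of_real (exp (- c * (norm x)\<^sup>2)))"
    using lborel_prod_basis(1)[of ?f] gauss_ft_1(1)[OF c] unfolding split by blast
  have "(LINT x|lborel. cis (- (x \<bullet> \<zeta>)) * complex_of_real (exp (- c * (norm x)\<^sup>2)))
      = (\<Prod>b\<in>(Basis::'a set). complex_of_real (sqrt (pi / c) * exp (- (\<zeta> \<bullet> b)\<^sup>2 / (4 * c))))"
    using lborel_prod_basis(2)[of ?f] gauss_ft_1[OF c] unfolding split by simp
  also have "\<dots> = complex_of_real (sqrt (pi / c) ^ DIM('a) * exp (- (norm \<zeta>)\<^sup>2 / (4 * c)))"
    by (simp add: prod.distrib exp_sum[symmetric] norm_sq_basis sum_negf sum_divide_distrib flip: of_real_prod)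
  finally show "(LINT x|lborel. cis (- (x \<bullet> \<zeta>)) * complex_of_real (exp (- c * (norm x)\<^sup>2)))
      = complex_of_real (sqrt (pi / c) ^ DIM('a) * exp (- (norm \<zeta>)\<^sup>2 / (4 * c)))" .
qed

lemma gauss_integral:
  fixes c :: real
  assumes c: "0 < c"
  shows "integrable lborel (\<lambda>x::'a::euclidean_space. exp (- c * (norm x)\<^sup>2))"
    and "(LINT x|lborel. exp (- c * (norm (x::'a))\<^sup>2)) = sqrt (pi / c) ^ DIM('a)"
proof -
  have 1: "integrable lborel (\<lambda>x::'a. complex_of_real (exp (- c * (norm x)\<^sup>2)))"
    using gauss_ft(1)[OF c, of 0] by simp
  then show "integrable lborel (\<lambda>x::'a. exp (- c * (norm x)\<^sup>2))"
    by (simp add: complex_of_real_integrable_eq)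
  have "complex_of_real (LINT x|lborel. exp (- c * (norm (x::'a))\<^sup>2)) = complex_of_real (sqrt (pi / c) ^ DIM('a))"
    unfolding integral_complex_of_real[symmetric] using gauss_ft(2)[OF c, of "0::'a"] by simp
  then show "(LINT x|lborel. exp (- c * (norm (x::'a))\<^sup>2)) = sqrt (pi / c) ^ DIM('a)"
    by (simp only: of_real_eq_iff)
qed

text \<open>Taken over \<open>lborel\<close>, whose products are again of this kind, so that Fubini
  applies directly; \<open>fourier_L1_borel\<close> makes the connection with the completed
  measure.\<close>

definition ft :: "('a::euclidean_space \<Rightarrow> complex) \<Rightarrow> 'a \<Rightarrow> complex" where
  "ft f \<zeta> = (LINT z|lborel. cis (- (z \<bullet> \<zeta>)) * f z)"

lemma integrable_cis_mult:
  assumes "integrable lborel f" "h \<in> borel_measurable borel"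
  shows "integrable lborel (\<lambda>z. cis (h z) * f z)"
  by (rule Bochner_Integration.integrable_bound[OF assms(1)])
    (use assms borel_measurable_integrable[OF assms(1)] in \<open>auto simp: norm_mult\<close>)

lemma ft_measurable [measurable (raw)]:
  assumes [measurable]: "f \<in> borel_measurable borel"
  shows "ft f \<in> borel_measurable borel"
  unfolding ft_def[abs_def] by measurable

lemma norm_ft_le:
  assumes "integrable lborel f"
  shows "cmod (ft f \<zeta>) \<le> (LINT z|lborel. cmod (f z))"
proof -
  have "cmod (ft f \<zeta>) \<le> (LINT z|lborel. cmod (cis (- (z \<bullet> \<zeta>)) * f z))"
    unfolding ft_def by (rule integral_norm_bound)
  then show ?thesis by (simp add: norm_mult)
qed

lemma ft_mult_formula:
  fixes f g :: "'a::euclidean_space \<Rightarrow> complex"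
  assumes "integrable lborel f" "integrable lborel g"
  shows "(LINT \<zeta>|lborel. g \<zeta> * ft f \<zeta>) = (LINT z|lborel. f z * ft g z)"
  unfolding ft_def
  by (subst fubini_bounded_kernel(1)[OF _ _ assms(2,1), where C = 1])
    (auto simp: lborel.sigma_finite_measure_axioms inner_commute)

text \<open>The Fourier transform of exp(- c |\<zeta>|^2). Its integral is (2 pi)^n for every c and
  its mass concentrates at 0 as c tends to 0, so up to this constant it is an approximate
  identity.\<close>

definition gauss_kernel :: "real \<Rightarrow> 'a::euclidean_space \<Rightarrow> real" where
  "gauss_kernel c x = sqrt (pi / c) ^ DIM('a) * exp (- (norm x)\<^sup>2 / (4 * c))"

lemma gauss_kernel_nonneg [simp]: "0 < c \<Longrightarrow> 0 \<le> gauss_kernel c x"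
  by (simp add: gauss_kernel_def)

lemma gauss_kernel_measurable [measurable]: "gauss_kernel c \<in> borel_measurable borel"
  unfolding gauss_kernel_def[abs_def] by measurable

lemma gauss_kernel_integral:
  assumes c: "0 < c"
  shows "integrable lborel (gauss_kernel c :: 'a::euclidean_space \<Rightarrow> real)"
    and "(LINT x|lborel. gauss_kernel c (x::'a)) = (2 * pi) ^ DIM('a)"
proof -
  have eq: "gauss_kernel c x = sqrt (pi / c) ^ DIM('a) * exp (- (1 / (4 * c)) * (norm x)\<^sup>2)" for x :: 'a
    by (simp add: gauss_kernel_def)
  have c': "0 < 1 / (4 * c)" using c by simp
  show "integrable lborel (gauss_kernel c :: 'a \<Rightarrow> real)"
    unfolding eq[abs_def] using gauss_integral(1)[OF c', where 'a='a] by simp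
  have "sqrt (pi / c) * sqrt (pi / (1 / (4 * c))) = 2 * pi"
  proof -
    have "(pi / c) * (pi / (1 / (4 * c))) = (2 * pi)\<^sup>2" using c by (simp add: power2_eq_square)
    then have "sqrt (pi / c) * sqrt (pi / (1 / (4 * c))) = sqrt ((2 * pi)\<^sup>2)"
      by (simp only: real_sqrt_mult[symmetric])
    also have "\<dots> = 2 * pi" unfolding real_sqrt_abs by simp
    finally show ?thesis .
  qed
  then show "(LINT x|lborel. gauss_kernel c (x::'a)) = (2 * pi) ^ DIM('a)"
    unfolding eq by (simp only: integral_mult_right_zero gauss_integral(2)[OF c'] power_mult_distrib[symmetric])
qed

text \<open>The Gaussian factor makes Fubini applicable to the product of \<open>ft f\<close> with
  its conjugate. The integral over frequencies becomes a smoothing of \<open>f\<close> by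
  \<open>gauss_kernel c\<close>, and the limit as c tends to 0 is Plancherel's identity.\<close>

lemma ft_sq_gauss:
  fixes f :: "'a::euclidean_space \<Rightarrow> complex"
  assumes f: "integrable lborel f" and c: "0 < c"
  shows "(LINT \<zeta>|lborel. complex_of_real (exp (- c * (norm \<zeta>)\<^sup>2) * (cmod (ft f \<zeta>))\<^sup>2))
      = (LINT w|lborel. cnj (f w) * (LINT z|lborel. complex_of_real (gauss_kernel c (z - w)) * f z))"
proof -
  have [measurable]: "f \<in> borel_measurable borel" using borel_measurable_integrable[OF f] by simp
  define g where "g \<zeta> = complex_of_real (exp (- c * (norm \<zeta>)\<^sup>2))" for \<zeta> :: 'a
  have [measurable]: "g \<in> borel_measurable borel" unfolding g_def[abs_def] by measurable
  have gi: "integrable lborel g" unfolding g_def[abs_def] by (rule integrable_of_real[OF gauss_integral(1)[OF c]])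
  have gfi: "integrable lborel (\<lambda>\<zeta>. g \<zeta> * ft f \<zeta>)"
  proof (rule Bochner_Integration.integrable_bound)
    show "integrable lborel (\<lambda>\<zeta>. complex_of_real (LINT z|lborel. cmod (f z)) * g \<zeta>)" using gi by simp
    have "cmod (g \<zeta> * ft f \<zeta>) \<le> cmod (complex_of_real (LINT z|lborel. cmod (f z)) * g \<zeta>)" for \<zeta>
      using mult_right_mono[OF norm_ft_le[OF f, of \<zeta>] norm_ge_zero[of "g \<zeta>"]]
      by (simp add: norm_mult mult.commute)
    then show "AE \<zeta> in lborel. norm (g \<zeta> * ft f \<zeta>) \<le> norm (complex_of_real (LINT z|lborel. cmod (f z)) * g \<zeta>)" by simp
  qed measurable
  have cnj_ft: "cnj (ft f \<zeta>) = (LINT w|lborel. cis (w \<bullet> \<zeta>) * cnj (f w))" for \<zeta>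
    unfolding ft_def by (subst Bochner_Integration.integral_cnj[symmetric]) (simp add: cis_cnj)
  have "(LINT \<zeta>|lborel. complex_of_real (exp (- c * (norm \<zeta>)\<^sup>2) * (cmod (ft f \<zeta>))\<^sup>2))
      = (LINT \<zeta>|lborel. (g \<zeta> * ft f \<zeta>) * (LINT w|lborel. cis (w \<bullet> \<zeta>) * cnj (f w)))"
    by (rule Bochner_Integration.integral_cong) (simp_all add: g_def cnj_ft[symmetric] mult.assoc flip: complex_norm_square)
  also have "\<dots> = (LINT w|lborel. cnj (f w) * (LINT \<zeta>|lborel. cis (w \<bullet> \<zeta>) * (g \<zeta> * ft f \<zeta>)))"
    by (rule fubini_bounded_kernel(1)[where C = 1 and k = "\<lambda>\<zeta> w. cis (w \<bullet> \<zeta>)" and g = "\<lambda>w. cnj (f w)", OF _ _ gfi])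
      (use f in \<open>auto simp: lborel.sigma_finite_measure_axioms\<close>)
  also have "\<dots> = (LINT w|lborel. cnj (f w) * (LINT z|lborel. complex_of_real (gauss_kernel c (z - w)) * f z))"
  proof (rule Bochner_Integration.integral_cong)
    fix w :: 'a
    have gw: "integrable lborel (\<lambda>\<zeta>. cis (w \<bullet> \<zeta>) * g \<zeta>)" by (rule integrable_cis_mult[OF gi]) measurable
    have "(LINT \<zeta>|lborel. cis (w \<bullet> \<zeta>) * (g \<zeta> * ft f \<zeta>)) = (LINT \<zeta>|lborel. (cis (w \<bullet> \<zeta>) * g \<zeta>) * ft f \<zeta>)"
      by (simp add: mult.assoc)
    also have "\<dots> = (LINT z|lborel. f z * ft (\<lambda>\<zeta>. cis (w \<bullet> \<zeta>) * g \<zeta>) z)"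
      by (rule ft_mult_formula[OF f gw])
    also have "\<dots> = (LINT z|lborel. complex_of_real (gauss_kernel c (z - w)) * f z)"
    proof (rule Bochner_Integration.integral_cong)
      fix z :: 'a
      have "ft (\<lambda>\<zeta>. cis (w \<bullet> \<zeta>) * g \<zeta>) z = (LINT \<zeta>|lborel. cis (- (\<zeta> \<bullet> (z - w))) * g \<zeta>)"
        unfolding ft_def
        by (rule Bochner_Integration.integral_cong)
          (simp_all add: cis_mult mult.assoc[symmetric] inner_diff_right inner_commute)
      also have "\<dots> = complex_of_real (gauss_kernel c (z - w))"
        unfolding g_def gauss_ft(2)[OF c] gauss_kernel_def ..
      finally show "f z * ft (\<lambda>\<zeta>. cis (w \<bullet> \<zeta>) * g \<zeta>) z = complex_of_real (gauss_kernel c (z - w)) * f z" by simp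
    qed simp
    finally show "cnj (f w) * (LINT \<zeta>|lborel. cis (w \<bullet> \<zeta>) * (g \<zeta> * ft f \<zeta>))
        = cnj (f w) * (LINT z|lborel. complex_of_real (gauss_kernel c (z - w)) * f z)" by simp
  qed simp
  finally show ?thesis .
qed

lemma nn_integral_lborel_shift:
  fixes f :: "'a::euclidean_space \<Rightarrow> ennreal"
  assumes [measurable]: "f \<in> borel_measurable borel"
  shows "(\<integral>\<^sup>+z. f (z - w) \<partial>lborel) = (\<integral>\<^sup>+z. f z \<partial>lborel)"
proof -
  have "(\<integral>\<^sup>+z. f z \<partial>lborel) = (\<integral>\<^sup>+z. f z \<partial>distr lborel borel ((+) (- w)))" by (simp add: lborel_distr_plus)
  then show ?thesis by (subst (asm) nn_integral_distr) (auto simp: algebra_simps)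
qed

lemma norm_integral_le_nn_integral:
  fixes f :: "'a \<Rightarrow> 'b::{banach, second_countable_topology}"
  shows "ennreal (norm (integral\<^sup>L M f)) \<le> (\<integral>\<^sup>+x. ennreal (norm (f x)) \<partial>M)"
  using integral_norm_bound_ennreal[of M f] not_integrable_integral_eq[of M f] by (cases "integrable M f") auto

text \<open>The factor 2 stems from the crude a b \<le> a^2 + b^2. The bound serves for continuity
  of the transform; the exact constant is found afterwards on a dense subspace.\<close>

lemma nn_integral_ft_gauss_le:
  fixes f :: "'a::euclidean_space \<Rightarrow> complex"
  assumes f: "integrable lborel f" and c: "0 < c"
  shows "(\<integral>\<^sup>+\<zeta>. ennreal (exp (- c * (norm \<zeta>)\<^sup>2) * (cmod (ft f \<zeta>))\<^sup>2) \<partial>lborel)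
      \<le> 2 * (ennreal ((2 * pi) ^ DIM('a)) * (\<integral>\<^sup>+z. ennreal ((cmod (f z))\<^sup>2) \<partial>lborel))"
proof -
  have [measurable]: "f \<in> borel_measurable borel" using borel_measurable_integrable[OF f] by simp
  let ?G = "\<lambda>x::'a. ennreal (gauss_kernel c x)" and ?K = "ennreal ((2 * pi) ^ DIM('a))"
    and ?F = "\<lambda>z. ennreal ((cmod (f z))\<^sup>2)"
  have Gint: "(\<integral>\<^sup>+x. ?G x \<partial>lborel) = ?K"
    using gauss_kernel_integral[OF c, where 'a='a] c by (subst nn_integral_eq_integral) auto
  have Gshift: "(\<integral>\<^sup>+x. ?G (x - w) \<partial>lborel) = ?K" for w by (subst nn_integral_lborel_shift) (auto simp: Gint)
  have Gsym: "?G (x - w) = ?G (w - x)" for x w by (simp add: gauss_kernel_def norm_minus_commute)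
  have int: "integrable lborel (\<lambda>\<zeta>. exp (- c * (norm \<zeta>)\<^sup>2) * (cmod (ft f \<zeta>))\<^sup>2)"
  proof (rule Bochner_Integration.integrable_bound)
    show "integrable lborel (\<lambda>\<zeta>::'a. (LINT z|lborel. cmod (f z))\<^sup>2 * exp (- c * (norm \<zeta>)\<^sup>2))"
      by (rule integrable_mult_right[OF gauss_integral(1)[OF c]])
    have "(cmod (ft f \<zeta>))\<^sup>2 \<le> (LINT z|lborel. cmod (f z))\<^sup>2" for \<zeta> by (intro power_mono norm_ft_le f) auto
    then show "AE \<zeta> in lborel. norm (exp (- c * (norm \<zeta>)\<^sup>2) * (cmod (ft f \<zeta>))\<^sup>2)
        \<le> norm ((LINT z|lborel. cmod (f z))\<^sup>2 * exp (- c * (norm \<zeta>)\<^sup>2))"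
      by (intro AE_I2) (auto simp: abs_mult mult.commute intro!: mult_left_mono)
  qed measurable
  have "(\<integral>\<^sup>+\<zeta>. ennreal (exp (- c * (norm \<zeta>)\<^sup>2) * (cmod (ft f \<zeta>))\<^sup>2) \<partial>lborel)
      = ennreal (LINT \<zeta>|lborel. exp (- c * (norm \<zeta>)\<^sup>2) * (cmod (ft f \<zeta>))\<^sup>2)"
    by (rule nn_integral_eq_integral[OF int]) simp
  also have "\<dots> = ennreal (cmod (LINT w|lborel. cnj (f w) * (LINT z|lborel. complex_of_real (gauss_kernel c (z - w)) * f z)))"
  proof -
    have "(LINT \<zeta>|lborel. exp (- c * (norm \<zeta>)\<^sup>2) * (cmod (ft f \<zeta>))\<^sup>2) \<ge> 0"
      by (intro Bochner_Integration.integral_nonneg) simp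
    then show ?thesis
      unfolding ft_sq_gauss[OF f c, symmetric] integral_complex_of_real by simp
  qed
  also have "\<dots> \<le> (\<integral>\<^sup>+w. ennreal (cmod (cnj (f w) * (LINT z|lborel. complex_of_real (gauss_kernel c (z - w)) * f z))) \<partial>lborel)"
    by (rule norm_integral_le_nn_integral)
  also have "\<dots> \<le> (\<integral>\<^sup>+w. \<integral>\<^sup>+z. ?F w * ?G (z - w) + ?F z * ?G (z - w) \<partial>lborel \<partial>lborel)"
  proof (rule nn_integral_mono)
    fix w :: 'a
    have "ennreal (cmod (LINT z|lborel. complex_of_real (gauss_kernel c (z - w)) * f z))
        \<le> (\<integral>\<^sup>+z. ennreal (gauss_kernel c (z - w) * cmod (f z)) \<partial>lborel)"
      using norm_integral_le_nn_integral[of lborel "\<lambda>z. complex_of_real (gauss_kernel c (z - w)) * f z"] c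
      by (simp add: norm_mult)
    then have "ennreal (cmod (cnj (f w) * (LINT z|lborel. complex_of_real (gauss_kernel c (z - w)) * f z)))
        \<le> ennreal (cmod (f w)) * (\<integral>\<^sup>+z. ennreal (gauss_kernel c (z - w) * cmod (f z)) \<partial>lborel)"
      by (simp add: norm_mult ennreal_mult mult_left_mono)
    also have "\<dots> = (\<integral>\<^sup>+z. ennreal (cmod (f w) * (gauss_kernel c (z - w) * cmod (f z))) \<partial>lborel)"
      using c by (simp add: ennreal_mult nn_integral_cmult)
    also have "\<dots> \<le> (\<integral>\<^sup>+z. ?F w * ?G (z - w) + ?F z * ?G (z - w) \<partial>lborel)"
    proof (rule nn_integral_mono)
      fix z :: 'a
      have "0 \<le> gauss_kernel c (z - w) * (cmod (f w) - cmod (f z))\<^sup>2" using c by simp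
      then have "cmod (f w) * (gauss_kernel c (z - w) * cmod (f z))
          \<le> (cmod (f w))\<^sup>2 * gauss_kernel c (z - w) + (cmod (f z))\<^sup>2 * gauss_kernel c (z - w)"
      proof -
        have "0 \<le> cmod (f w) * (gauss_kernel c (z - w) * cmod (f z))" using c by simp
        moreover have "gauss_kernel c (z - w) * (cmod (f w) - cmod (f z))\<^sup>2
            = (cmod (f w))\<^sup>2 * gauss_kernel c (z - w) + (cmod (f z))\<^sup>2 * gauss_kernel c (z - w)
              - 2 * (cmod (f w) * (gauss_kernel c (z - w) * cmod (f z)))"
          by (simp add: power2_eq_square algebra_simps)
        ultimately show ?thesis using \<open>0 \<le> gauss_kernel c (z - w) * (cmod (f w) - cmod (f z))\<^sup>2\<close> by linarith
      qed
      then have "ennreal (cmod (f w) * (gauss_kernel c (z - w) * cmod (f z)))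
          \<le> ennreal ((cmod (f w))\<^sup>2 * gauss_kernel c (z - w) + (cmod (f z))\<^sup>2 * gauss_kernel c (z - w))"
        by (rule ennreal_leI)
      also have "\<dots> = ?F w * ?G (z - w) + ?F z * ?G (z - w)"
        using c by (simp add: ennreal_mult)
      finally show "ennreal (cmod (f w) * (gauss_kernel c (z - w) * cmod (f z)))
          \<le> ?F w * ?G (z - w) + ?F z * ?G (z - w)" .
    qed
    finally show "ennreal (cmod (cnj (f w) * (LINT z|lborel. complex_of_real (gauss_kernel c (z - w)) * f z)))
        \<le> (\<integral>\<^sup>+z. ?F w * ?G (z - w) + ?F z * ?G (z - w) \<partial>lborel)" .
  qed
  also have "\<dots> = ((\<integral>\<^sup>+w. \<integral>\<^sup>+z. ?F w * ?G (z - w) \<partial>lborel \<partial>lborel) + (\<integral>\<^sup>+w. \<integral>\<^sup>+z. ?F z * ?G (z - w) \<partial>lborel \<partial>lborel))"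
    by (simp add: nn_integral_add)
  also have "(\<integral>\<^sup>+w. \<integral>\<^sup>+z. ?F w * ?G (z - w) \<partial>lborel \<partial>lborel) = ?K * (\<integral>\<^sup>+z. ?F z \<partial>lborel)"
    by (simp add: nn_integral_cmult Gshift nn_integral_multc) (rule mult.commute)
  also have "(\<integral>\<^sup>+w. \<integral>\<^sup>+z. ?F z * ?G (z - w) \<partial>lborel \<partial>lborel) = (\<integral>\<^sup>+z. \<integral>\<^sup>+w. ?F z * ?G (z - w) \<partial>lborel \<partial>lborel)"
    by (rule lborel_pair.Fubini') measurable
  also have "\<dots> = ?K * (\<integral>\<^sup>+z. ?F z \<partial>lborel)"
  proof -
    have "(\<integral>\<^sup>+w. ?F z * ?G (z - w) \<partial>lborel) = ?F z * ?K" for z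
      by (subst Gsym) (simp add: nn_integral_cmult Gshift)
    then show ?thesis by (simp add: nn_integral_multc) (rule mult.commute)
  qed
  finally show ?thesis by (simp only: mult_2)
qed

text \<open>Monotone convergence in the Gaussian parameter. The parameter is the square of 1 / (k +
  1), so that the rescaling in \<open>ft_isometry\<close> has the scale 1 / (k + 1).\<close>

lemma nn_integral_ft_eq_SUP:
  fixes f :: "'a::euclidean_space \<Rightarrow> complex"
  assumes f: "integrable lborel f"
  shows "(\<integral>\<^sup>+\<zeta>. ennreal ((cmod (ft f \<zeta>))\<^sup>2) \<partial>lborel)
      = (SUP k. \<integral>\<^sup>+\<zeta>. ennreal (exp (- (1 / (real (Suc k))\<^sup>2) * (norm \<zeta>)\<^sup>2) * (cmod (ft f \<zeta>))\<^sup>2) \<partial>lborel)"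
proof -
  have [measurable]: "f \<in> borel_measurable borel" using borel_measurable_integrable[OF f] by simp
  let ?u = "\<lambda>k \<zeta>. ennreal (exp (- (1 / (real (Suc k))\<^sup>2) * (norm \<zeta>)\<^sup>2) * (cmod (ft f \<zeta>))\<^sup>2)"
  have inc: "incseq (\<lambda>k. ?u k \<zeta>)" for \<zeta> :: 'a
  proof (rule incseq_SucI)
    fix k
    have "1 / (real (Suc (Suc k)))\<^sup>2 \<le> 1 / (real (Suc k))\<^sup>2" by (intro divide_left_mono power_mono) auto
    then have "1 / (real (Suc (Suc k)))\<^sup>2 * (norm \<zeta>)\<^sup>2 \<le> 1 / (real (Suc k))\<^sup>2 * (norm \<zeta>)\<^sup>2"
      by (rule mult_right_mono) simp
    then show "?u k \<zeta> \<le> ?u (Suc k) \<zeta>" by (intro ennreal_leI mult_right_mono) auto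
  qed
  have "(SUP k. ?u k \<zeta>) = ennreal ((cmod (ft f \<zeta>))\<^sup>2)" for \<zeta> :: 'a
  proof -
    have "(\<lambda>k. inverse (real (Suc k))) \<longlonglongrightarrow> 0" by (rule LIMSEQ_inverse_real_of_nat)
    then have "(\<lambda>k. exp (- ((inverse (real (Suc k)))\<^sup>2) * (norm \<zeta>)\<^sup>2) * (cmod (ft f \<zeta>))\<^sup>2)
        \<longlonglongrightarrow> exp (- (0\<^sup>2) * (norm \<zeta>)\<^sup>2) * (cmod (ft f \<zeta>))\<^sup>2"
      by (intro tendsto_intros)
    then have "(\<lambda>k. ?u k \<zeta>) \<longlonglongrightarrow> ennreal ((cmod (ft f \<zeta>))\<^sup>2)"
      by (intro tendsto_ennrealI) (simp add: power_one_over inverse_eq_divide)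
    then show ?thesis using LIMSEQ_SUP[OF inc] LIMSEQ_unique by blast
  qed
  then have "(\<integral>\<^sup>+\<zeta>. ennreal ((cmod (ft f \<zeta>))\<^sup>2) \<partial>lborel) = (\<integral>\<^sup>+\<zeta>. (SUP k. ?u k \<zeta>) \<partial>lborel)" by simp
  also have "\<dots> = (SUP k. \<integral>\<^sup>+\<zeta>. ?u k \<zeta> \<partial>lborel)"
    using inc by (intro nn_integral_monotone_convergence_SUP) (auto simp: incseq_def le_fun_def)
  finally show ?thesis .
qed

lemma nn_integral_ft_le:
  fixes f :: "'a::euclidean_space \<Rightarrow> complex"
  assumes f: "integrable lborel f"
  shows "(\<integral>\<^sup>+\<zeta>. ennreal ((cmod (ft f \<zeta>))\<^sup>2) \<partial>lborel)
      \<le> 2 * (ennreal ((2 * pi) ^ DIM('a)) * (\<integral>\<^sup>+z. ennreal ((cmod (f z))\<^sup>2) \<partial>lborel))"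
  unfolding nn_integral_ft_eq_SUP[OF f] by (intro SUP_least nn_integral_ft_gauss_le f) simp

lemma lborel_integral_affine:
  fixes h :: "'a::euclidean_space \<Rightarrow> complex"
  assumes [measurable]: "h \<in> borel_measurable borel" and a: "0 < a"
  shows "(LINT z|lborel. h z) = complex_of_real (a ^ DIM('a)) * (LINT u|lborel. h (w + a *\<^sub>R u))"
proof -
  have "(LINT z|lborel. h z) = (LINT z|density (distr lborel borel (\<lambda>u. w + a *\<^sub>R u)) (\<lambda>_. ennreal (\<bar>a\<bar> ^ DIM('a))). h z)"
    using a lborel_affine[of a w] by simp
  also have "\<dots> = (LINT u|lborel. (\<bar>a\<bar> ^ DIM('a)) *\<^sub>R h (w + a *\<^sub>R u))"
    by (subst integral_density) (auto simp: integral_distr)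
  finally show ?thesis using a by (simp add: scaleR_conv_of_real)
qed

text \<open>Continuity of \<open>f\<close> gives pointwise convergence of the Gaussian means, here
  written with a fixed kernel and shrinking displacement as \<open>H k\<close>. Boundedness of
  \<open>f\<close> gives the dominating functions for this limit and for the outer integral.\<close>

lemma ft_isometry:
  fixes f :: "'a::euclidean_space \<Rightarrow> complex"
  assumes f: "integrable lborel f" "continuous_on UNIV f" and M: "\<And>z. cmod (f z) \<le> M"
  shows "(\<integral>\<^sup>+\<zeta>. ennreal ((cmod (ft f \<zeta>))\<^sup>2) \<partial>lborel) = ennreal ((2 * pi) ^ DIM('a) * (LINT z|lborel. (cmod (f z))\<^sup>2))"
proof -
  have [measurable]: "f \<in> borel_measurable borel" using borel_measurable_integrable[OF f(1)] by simp
  let ?K = "(2 * pi) ^ DIM('a)"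
  let ?G = "gauss_kernel 1 :: 'a \<Rightarrow> real"
  define c where "c k = 1 / (real (Suc k))\<^sup>2" for k
  have c: "c k > 0" for k by (simp add: c_def)
  define a where "a k = 1 / real (Suc k)" for k
  have a: "a k > 0" "c k = (a k)\<^sup>2" for k by (simp_all add: a_def c_def power_divide)
  have a0: "a \<longlonglongrightarrow> 0" unfolding a_def[abs_def] using LIMSEQ_inverse_real_of_nat by (simp add: inverse_eq_divide)
  define H where "H k w = (LINT u|lborel. complex_of_real (?G u) * f (w + a k *\<^sub>R u))" for k w
  have [measurable]: "H k \<in> borel_measurable borel" for k unfolding H_def[abs_def] by measurable
  have Gi: "integrable lborel ?G" and GK: "(LINT u|lborel. ?G u) = ?K"
    using gauss_kernel_integral[of 1, where 'a='a] by auto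
  have M0: "0 \<le> M" using order_trans[OF norm_ge_zero M] .
  have HG: "(LINT z|lborel. complex_of_real (gauss_kernel (c k) (z - w)) * f z) = H k w" for k w
  proof -
    have G: "(a k) ^ DIM('a) * gauss_kernel (c k) (a k *\<^sub>R u) = ?G u" for u :: 'a
    proof -
      have "a k * sqrt (pi / c k) = sqrt pi" using a(1)[of k] by (simp add: a(2) real_sqrt_divide)
      then have "(a k) ^ DIM('a) * sqrt (pi / c k) ^ DIM('a) = sqrt pi ^ DIM('a)"
        by (simp only: power_mult_distrib[symmetric])
      then show ?thesis using a(1)[of k]
        by (simp add: gauss_kernel_def a(2) power_mult_distrib mult.assoc[symmetric])
    qed
    have "(LINT z|lborel. complex_of_real (gauss_kernel (c k) (z - w)) * f z)
        = complex_of_real (a k ^ DIM('a)) * (LINT u|lborel. complex_of_real (gauss_kernel (c k) ((w + a k *\<^sub>R u) - w)) * f (w + a k *\<^sub>R u))"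
      by (rule lborel_integral_affine) (auto simp: a)
    also have "\<dots> = H k w"
      unfolding H_def integral_mult_right_zero[symmetric]
      by (rule Bochner_Integration.integral_cong) (simp_all add: G[symmetric] mult.assoc)
    finally show ?thesis .
  qed
  have Hb: "cmod (H k w) \<le> M * ?K" for k w
  proof -
    have "cmod (H k w) \<le> (LINT u|lborel. cmod (complex_of_real (?G u) * f (w + a k *\<^sub>R u)))"
      unfolding H_def by (rule integral_norm_bound)
    also have "\<dots> \<le> (LINT u|lborel. M * ?G u)"
    proof (rule Bochner_Integration.integral_mono')
      show "cmod (complex_of_real (?G u) * f (w + a k *\<^sub>R u)) \<le> M * ?G u" for u
        using mult_left_mono[OF M gauss_kernel_nonneg[of 1 u]] by (simp add: norm_mult mult.commute[of M])
    qed (use Gi M0 in auto)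
    finally show ?thesis using GK by simp
  qed
  have Hlim: "(\<lambda>k. H k w) \<longlonglongrightarrow> complex_of_real ?K * f w" for w
  proof -
    have "(\<lambda>k. H k w) \<longlonglongrightarrow> (LINT u|lborel. complex_of_real (?G u) * f w)"
      unfolding H_def
    proof (rule integral_dominated_convergence)
      show "integrable lborel (\<lambda>u. M * ?G u)" using Gi by simp
      show "AE u in lborel. (\<lambda>k. complex_of_real (?G u) * f (w + a k *\<^sub>R u)) \<longlonglongrightarrow> complex_of_real (?G u) * f w"
      proof (rule AE_I2)
        fix u
        have "(\<lambda>k. w + a k *\<^sub>R u) \<longlonglongrightarrow> w + 0 *\<^sub>R u" by (intro tendsto_intros a0)
        then have "(\<lambda>k. f (w + a k *\<^sub>R u)) \<longlonglongrightarrow> f w"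
          using f(2) by (intro isCont_tendsto_compose[of _ f]) (auto simp: continuous_on_eq_continuous_at)
        then show "(\<lambda>k. complex_of_real (?G u) * f (w + a k *\<^sub>R u)) \<longlonglongrightarrow> complex_of_real (?G u) * f w"
          by (intro tendsto_intros)
      qed
      show "AE u in lborel. norm (complex_of_real (?G u) * f (w + a k *\<^sub>R u)) \<le> M * ?G u" for k
        using mult_left_mono[OF M gauss_kernel_nonneg[of 1]] by (auto simp: norm_mult mult.commute[of M])
    qed measurable
    also have "(LINT u|lborel. complex_of_real (?G u) * f w) = complex_of_real ?K * f w"
      by (simp only: integral_mult_left_zero integral_complex_of_real GK)
    finally show ?thesis .
  qed
  have Jlim: "(\<lambda>k. LINT w|lborel. cnj (f w) * H k w) \<longlonglongrightarrow> (LINT w|lborel. cnj (f w) * (complex_of_real ?K * f w))"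
  proof (rule integral_dominated_convergence)
    show "integrable lborel (\<lambda>w. (M * ?K) * cmod (f w))" using f by simp
    show "AE w in lborel. (\<lambda>k. cnj (f w) * H k w) \<longlonglongrightarrow> cnj (f w) * (complex_of_real ?K * f w)"
      by (intro AE_I2 tendsto_mult tendsto_const Hlim)
    show "AE w in lborel. norm (cnj (f w) * H k w) \<le> (M * ?K) * cmod (f w)" for k
      using mult_right_mono[OF Hb norm_ge_zero] by (auto simp: norm_mult mult.commute)
  qed measurable
  have fcnj: "(LINT w|lborel. cnj (f w) * (complex_of_real ?K * f w)) = complex_of_real (?K * (LINT z|lborel. (cmod (f z))\<^sup>2))"
  proof -
    have "(LINT w|lborel. cnj (f w) * (complex_of_real ?K * f w)) = (LINT w|lborel. complex_of_real (?K * (cmod (f w))\<^sup>2))"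
      by (rule Bochner_Integration.integral_cong) (simp_all add: complex_norm_square mult_ac del: of_real_power)
    then show ?thesis unfolding integral_complex_of_real by simp
  qed
  let ?I = "\<lambda>k. LINT \<zeta>|lborel. exp (- c k * (norm \<zeta>)\<^sup>2) * (cmod (ft f \<zeta>))\<^sup>2"
  have Ilim: "?I \<longlonglongrightarrow> ?K * (LINT z|lborel. (cmod (f z))\<^sup>2)"
  proof -
    have "(\<lambda>k. complex_of_real (?I k)) \<longlonglongrightarrow> complex_of_real (?K * (LINT z|lborel. (cmod (f z))\<^sup>2))"
      using Jlim unfolding fcnj integral_complex_of_real[symmetric] ft_sq_gauss[OF f(1) c] HG .
    then show ?thesis by (simp only: tendsto_of_real_iff)
  qed
  let ?N = "\<lambda>k. \<integral>\<^sup>+\<zeta>. ennreal (exp (- c k * (norm \<zeta>)\<^sup>2) * (cmod (ft f \<zeta>))\<^sup>2) \<partial>lborel"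
  have int: "integrable lborel (\<lambda>\<zeta>. exp (- c k * (norm \<zeta>)\<^sup>2) * (cmod (ft f \<zeta>))\<^sup>2)" for k
  proof (rule Bochner_Integration.integrable_bound)
    show "integrable lborel (\<lambda>\<zeta>::'a. (LINT z|lborel. cmod (f z))\<^sup>2 * exp (- c k * (norm \<zeta>)\<^sup>2))"
      by (rule integrable_mult_right[OF gauss_integral(1)[OF c]])
    have "(cmod (ft f \<zeta>))\<^sup>2 \<le> (LINT z|lborel. cmod (f z))\<^sup>2" for \<zeta> by (intro power_mono norm_ft_le f) auto
    then show "AE \<zeta> in lborel. norm (exp (- c k * (norm \<zeta>)\<^sup>2) * (cmod (ft f \<zeta>))\<^sup>2)
        \<le> norm ((LINT z|lborel. cmod (f z))\<^sup>2 * exp (- c k * (norm \<zeta>)\<^sup>2))"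
      by (intro AE_I2) (auto simp: abs_mult mult.commute intro!: mult_left_mono)
  qed measurable
  have NI: "?N k = ennreal (?I k)" for k
    by (rule nn_integral_eq_integral[OF int]) simp
  have "incseq ?N"
  proof (rule incseq_SucI, rule nn_integral_mono)
    fix k and \<zeta> :: 'a
    have "c (Suc k) \<le> c k" unfolding c_def by (intro divide_left_mono power_mono) auto
    then have "c (Suc k) * (norm \<zeta>)\<^sup>2 \<le> c k * (norm \<zeta>)\<^sup>2" by (rule mult_right_mono) simp
    then show "ennreal (exp (- c k * (norm \<zeta>)\<^sup>2) * (cmod (ft f \<zeta>))\<^sup>2)
        \<le> ennreal (exp (- c (Suc k) * (norm \<zeta>)\<^sup>2) * (cmod (ft f \<zeta>))\<^sup>2)"
      by (intro ennreal_leI mult_right_mono) auto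
  qed
  then have "?N \<longlonglongrightarrow> (SUP k. ?N k)" by (rule LIMSEQ_SUP)
  moreover have "?N \<longlonglongrightarrow> ennreal (?K * (LINT z|lborel. (cmod (f z))\<^sup>2))"
    unfolding NI by (intro tendsto_ennrealI Ilim)
  ultimately have "(SUP k. ?N k) = ennreal (?K * (LINT z|lborel. (cmod (f z))\<^sup>2))" by (rule LIMSEQ_unique)
  then show ?thesis unfolding nn_integral_ft_eq_SUP[OF f(1)] c_def .
qed

section \<open>Extension of the transform to square integrable classes\<close>

lemma lebesgue_borel_representative:
  fixes f :: "'a::euclidean_space \<Rightarrow> complex"
  assumes [measurable]: "f \<in> borel_measurable lebesgue"
  obtains g where "g \<in> borel_measurable borel" "AE z in lebesgue. f z = g z"
proof -
  have "(\<lambda>z. Re (f z)) \<in> borel_measurable lebesgue" "(\<lambda>z. Im (f z)) \<in> borel_measurable lebesgue" by measurable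
  then obtain u v where [measurable]: "u \<in> borel_measurable lborel" "v \<in> borel_measurable lborel"
    and uv: "AE z in lborel. Re (f z) = u z" "AE z in lborel. Im (f z) = v z"
    using completion_ex_borel_measurable_real by metis
  show ?thesis
  proof
    show "(\<lambda>z. Complex (u z) (v z)) \<in> borel_measurable borel"
      by (subst borel_measurable_complex_iff) simp
    have "AE z in lborel. f z = Complex (u z) (v z)" using uv by eventually_elim (simp add: complex_eq_iff)
    then show "AE z in lebesgue. f z = Complex (u z) (v z)" by (rule AE_completion)
  qed
qed

lemma borel_imp_lebesgue: "f \<in> borel_measurable borel \<Longrightarrow> f \<in> borel_measurable lebesgue"
  by (intro measurable_completion) simp

lemma L2_lborel_iff: "f \<in> borel_measurable borel \<Longrightarrow> f \<in> L2 lborel \<longleftrightarrow> f \<in> L2 lebesgue"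
  unfolding L2_def by (auto simp: integrable_completion intro: borel_imp_lebesgue)

lemma L2_lborel_imp_lebesgue: "f \<in> L2 lborel \<Longrightarrow> f \<in> L2 lebesgue"
  using L2_measurable[of f lborel] by (subst L2_lborel_iff[symmetric]) auto

lemma l2_borel_cases:
  fixes x :: "'a::euclidean_space l2"
  obtains f where "f \<in> L2 lborel" "x = to_l2 f"
proof -
  obtain h where h: "h \<in> L2 lebesgue" "x = to_l2 h" by (rule l2_cases)
  obtain g where g: "g \<in> borel_measurable borel" "AE z in lebesgue. h z = g z"
    using lebesgue_borel_representative[OF L2_measurable[OF h(1)]] .
  have gL: "g \<in> L2 lebesgue" using L2_cong_AE[OF h(1) borel_imp_lebesgue[OF g(1)] g(2)] .
  show ?thesis
  proof (rule that)
    show "g \<in> L2 lborel" using gL L2_lborel_iff[OF g(1)] by simp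
    show "x = to_l2 g" unfolding h(2) by (rule to_l2_cong[OF h(1) gL g(2)])
  qed
qed

lemma norm_to_l2_nn_lborel:
  "f \<in> L2 lborel \<Longrightarrow> ennreal ((norm (to_l2 f))\<^sup>2) = (\<integral>\<^sup>+z. ennreal ((cmod (f z))\<^sup>2) \<partial>lborel)"
  by (simp add: norm_to_l2_nn L2_lborel_imp_lebesgue nn_integral_completion)

definition L12 :: "('a::euclidean_space \<Rightarrow> complex) set" where
  "L12 = {f \<in> L2 lborel. integrable lborel f}"

lemma L12_measurable [measurable_dest]: "f \<in> L12 \<Longrightarrow> f \<in> borel_measurable borel"
  using L2_measurable[of f lborel] by (simp add: L12_def)

lemma L12_L2: "f \<in> L12 \<Longrightarrow> f \<in> L2 lborel" "f \<in> L12 \<Longrightarrow> f \<in> L2 lebesgue"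
  by (simp_all add: L12_def L2_lborel_imp_lebesgue)

lemma L12_integrable: "f \<in> L12 \<Longrightarrow> integrable lborel f"
  by (simp add: L12_def)

lemma L12_add: "f \<in> L12 \<Longrightarrow> g \<in> L12 \<Longrightarrow> (\<lambda>z. f z + g z) \<in> L12"
  and L12_diff: "f \<in> L12 \<Longrightarrow> g \<in> L12 \<Longrightarrow> (\<lambda>z. f z - g z) \<in> L12"
  and L12_cmult: "f \<in> L12 \<Longrightarrow> (\<lambda>z. a * f z) \<in> L12"
  by (simp_all add: L12_def L2_add L2_diff L2_cmult)

lemma ft_add: "f \<in> L12 \<Longrightarrow> g \<in> L12 \<Longrightarrow> ft (\<lambda>z. f z + g z) = (\<lambda>\<zeta>. ft f \<zeta> + ft g \<zeta>)"
  unfolding ft_def[abs_def]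
  by (simp add: distrib_left Bochner_Integration.integral_add[OF integrable_cis_mult integrable_cis_mult] L12_integrable)

lemma ft_diff: "f \<in> L12 \<Longrightarrow> g \<in> L12 \<Longrightarrow> ft (\<lambda>z. f z - g z) = (\<lambda>\<zeta>. ft f \<zeta> - ft g \<zeta>)"
  unfolding ft_def[abs_def]
  by (simp add: right_diff_distrib Bochner_Integration.integral_diff[OF integrable_cis_mult integrable_cis_mult] L12_integrable)

lemma ft_cmult: "ft (\<lambda>z. a * f z) = (\<lambda>\<zeta>. a * ft f \<zeta>)"
  unfolding ft_def[abs_def] by (simp add: mult.left_commute)

lemma ft_L2:
  fixes f :: "'a::euclidean_space \<Rightarrow> complex"
  assumes "f \<in> L12"
  shows "ft f \<in> L2 lborel" "norm (to_l2 (ft f)) \<le> sqrt (2 * (2 * pi) ^ DIM('a)) * norm (to_l2 f)"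
proof -
  have f: "integrable lborel f" "f \<in> L2 lborel" and [measurable]: "f \<in> borel_measurable borel"
    using assms L12_measurable by (auto simp: L12_def)
  have le: "(\<integral>\<^sup>+\<zeta>. ennreal ((cmod (ft f \<zeta>))\<^sup>2) \<partial>lborel) \<le> ennreal (2 * (2 * pi) ^ DIM('a) * (norm (to_l2 f))\<^sup>2)"
    using nn_integral_ft_le[OF f(1)] unfolding norm_to_l2_nn_lborel[OF f(2), symmetric]
    by (simp add: ennreal_mult mult.assoc)
  then show 1: "ft f \<in> L2 lborel"
    unfolding L2_def using le_less_trans[OF le] by (auto intro!: integrableI_nonneg)
  have "(norm (to_l2 (ft f)))\<^sup>2 \<le> 2 * (2 * pi) ^ DIM('a) * (norm (to_l2 f))\<^sup>2"
    using le unfolding norm_to_l2_nn_lborel[OF 1, symmetric] by (subst (asm) ennreal_le_iff) auto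
  also have "\<dots> = (sqrt (2 * (2 * pi) ^ DIM('a)) * norm (to_l2 f))\<^sup>2" by (simp add: power_mult_distrib)
  finally show "norm (to_l2 (ft f)) \<le> sqrt (2 * (2 * pi) ^ DIM('a)) * norm (to_l2 f)"
    by (rule power2_le_imp_le) simp
qed

definition l2_truncate :: "('a::euclidean_space \<Rightarrow> complex) \<Rightarrow> nat \<Rightarrow> 'a \<Rightarrow> complex" where
  "l2_truncate f k z = indicator (cball 0 (real k)) z * f z"

lemma l2_truncate_L12:
  assumes f: "f \<in> L2 lborel"
  shows "l2_truncate f k \<in> L12"
proof -
  have [measurable]: "f \<in> borel_measurable borel" using L2_measurable[OF f] by simp
  have [measurable]: "l2_truncate f k \<in> borel_measurable borel"
    unfolding l2_truncate_def[abs_def] by (intro borel_measurable_times borel_measurable_indicator) auto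
  have 1: "l2_truncate f k \<in> L2 lborel"
    unfolding l2_truncate_def[abs_def]
    by (rule L2_bounded_mult[OF f, where C = 1]) (auto simp: indicator_def)
  have "integrable lborel (l2_truncate f k)"
  proof (rule Bochner_Integration.integrable_bound)
    show "integrable lborel (\<lambda>z. indicator (cball 0 (real k)) z + (cmod (f z))\<^sup>2)"
      using L2_integrable[OF f] integrable_indicator_compact[OF compact_cball] by (intro Bochner_Integration.integrable_add)
    have "t \<le> 1 + t\<^sup>2" for t :: real using zero_le_power2[of "t - 1/2"]
      by (simp add: power2_eq_square algebra_simps)
    then show "AE z in lborel. norm (l2_truncate f k z) \<le> norm (indicator (cball 0 (real k)) z + (cmod (f z))\<^sup>2)"
      by (intro AE_I2) (auto simp: l2_truncate_def indicator_def)
  qed measurable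
  with 1 show ?thesis by (simp add: L12_def)
qed

lemma l2_truncate_tendsto:
  assumes f: "f \<in> L2 lborel"
  shows "(\<lambda>k. to_l2 (l2_truncate f k)) \<longlonglongrightarrow> to_l2 f"
proof -
  have [measurable]: "f \<in> borel_measurable borel" using L2_measurable[OF f] by simp
  have tr: "l2_truncate f k \<in> L2 lebesgue" for k using l2_truncate_L12[OF f] by (rule L12_L2)
  have [measurable]: "l2_truncate f k \<in> borel_measurable borel" for k using L12_measurable[OF l2_truncate_L12[OF f]] .
  have fL: "f \<in> L2 lebesgue" by (rule L2_lborel_imp_lebesgue[OF f])
  have "(\<lambda>k. LINT z|lborel. (cmod (l2_truncate f k z - f z))\<^sup>2) \<longlonglongrightarrow> (LINT (z::'a)|lborel. 0 :: real)"
  proof (rule integral_dominated_convergence)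
    show "integrable lborel (\<lambda>z. (cmod (f z))\<^sup>2)" by (rule L2_integrable[OF f])
    show "AE z in lborel. (\<lambda>k. (cmod (l2_truncate f k z - f z))\<^sup>2) \<longlonglongrightarrow> 0"
    proof (rule AE_I2)
      fix z :: 'a
      obtain N :: nat where N: "norm z \<le> real N" using real_arch_simple by blast
      have "eventually (\<lambda>k. (cmod (l2_truncate f k z - f z))\<^sup>2 = 0) sequentially"
        using eventually_ge_at_top[of N]
        by eventually_elim (use N in \<open>auto simp: l2_truncate_def indicator_def\<close>)
      then show "(\<lambda>k. (cmod (l2_truncate f k z - f z))\<^sup>2) \<longlonglongrightarrow> 0" by (rule tendsto_eventually)
    qed
    show "AE z in lborel. norm ((cmod (l2_truncate f k z - f z))\<^sup>2) \<le> (cmod (f z))\<^sup>2" for k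
      by (intro AE_I2) (auto simp: l2_truncate_def indicator_def)
  qed measurable
  moreover have "(norm (to_l2 (l2_truncate f k) - to_l2 f))\<^sup>2 = (LINT z|lborel. (cmod (l2_truncate f k z - f z))\<^sup>2)" for k
    by (simp add: to_l2_diff[OF tr fL] norm_to_l2_sq[OF L2_diff[OF tr fL]] integral_completion)
  ultimately have "(\<lambda>k. (norm (to_l2 (l2_truncate f k) - to_l2 f))\<^sup>2) \<longlonglongrightarrow> 0" by simp
  then have "(\<lambda>k. sqrt ((norm (to_l2 (l2_truncate f k) - to_l2 f))\<^sup>2)) \<longlonglongrightarrow> sqrt 0" by (rule tendsto_real_sqrt)
  then show ?thesis by (subst LIM_zero_iff[symmetric], subst tendsto_norm_zero_iff[symmetric]) simp
qed

text \<open>A limit along truncations of an arbitrarily chosen Borel representative;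
  \<open>l2_ft_tendsto\<close> shows that every approximating sequence from \<open>L12\<close> has
  the same limit.\<close>

definition l2_ft :: "'a::euclidean_space l2 \<Rightarrow> 'a l2" where
  "l2_ft x = lim (\<lambda>k. to_l2 (ft (l2_truncate (SOME f. f \<in> L2 lborel \<and> x = to_l2 f) k)))"

lemma to_l2_ft_diff:
  "f \<in> L12 \<Longrightarrow> g \<in> L12 \<Longrightarrow> to_l2 (ft f) - to_l2 (ft g) = to_l2 (ft (\<lambda>z. f z - g z))"
  by (simp add: to_l2_diff ft_L2(1) L2_lborel_imp_lebesgue ft_diff)

lemma l2_ft_tendsto:
  fixes f :: "nat \<Rightarrow> 'a::euclidean_space \<Rightarrow> complex"
  assumes f: "\<And>k. f k \<in> L12" and lim: "(\<lambda>k. to_l2 (f k)) \<longlonglongrightarrow> x"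
  shows "(\<lambda>k. to_l2 (ft (f k))) \<longlonglongrightarrow> l2_ft x"
proof -
  let ?C = "sqrt (2 * (2 * pi) ^ DIM('a))"
  define h where "h = (SOME f. f \<in> L2 lborel \<and> x = to_l2 f)"
  have ex: "\<exists>f. f \<in> L2 lborel \<and> x = to_l2 f" by (rule l2_borel_cases[of x]) blast
  have h: "h \<in> L2 lborel \<and> x = to_l2 h" using someI_ex[OF ex] unfolding h_def .
  define t where "t k = l2_truncate h k" for k
  have t: "t k \<in> L12" for k unfolding t_def using h by (simp add: l2_truncate_L12)
  have tlim: "(\<lambda>k. to_l2 (t k)) \<longlonglongrightarrow> x" unfolding t_def using h l2_truncate_tendsto by auto
  have est: "norm (to_l2 (ft u) - to_l2 (ft v)) \<le> ?C * norm (to_l2 u - to_l2 v)" if "u \<in> L12" "v \<in> L12" for u v :: "'a \<Rightarrow> complex"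
    unfolding to_l2_ft_diff[OF that] to_l2_diff[OF L12_L2(2)[OF that(1)] L12_L2(2)[OF that(2)]]
    by (rule ft_L2(2)[OF L12_diff[OF that]])
  have "Cauchy (\<lambda>k. to_l2 (ft (t k)))"
  proof (rule CauchyI)
    fix e :: real assume e: "0 < e"
    have C: "0 < ?C" by simp
    obtain M where M: "\<And>m n. m \<ge> M \<Longrightarrow> n \<ge> M \<Longrightarrow> norm (to_l2 (t m) - to_l2 (t n)) < e / ?C"
      using CauchyD[OF LIMSEQ_imp_Cauchy[OF tlim], of "e / ?C"] e C by auto
    show "\<exists>M. \<forall>m\<ge>M. \<forall>n\<ge>M. norm (to_l2 (ft (t m)) - to_l2 (ft (t n))) < e"
    proof (intro exI[of _ M] allI impI)
      fix m n assume "M \<le> m" "M \<le> n"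
      then have "norm (to_l2 (t m) - to_l2 (t n)) * ?C < e" using M C by (simp only: pos_less_divide_eq[symmetric])
      then show "norm (to_l2 (ft (t m)) - to_l2 (ft (t n))) < e"
        using est[OF t t, of m n] by (simp add: mult.commute)
    qed
  qed
  then have "convergent (\<lambda>k. to_l2 (ft (t k)))" by (rule Cauchy_convergent)
  then have tl: "(\<lambda>k. to_l2 (ft (t k))) \<longlonglongrightarrow> l2_ft x"
    by (simp add: convergent_LIMSEQ_iff l2_ft_def h_def[symmetric] t_def[symmetric])
  have "(\<lambda>k. to_l2 (f k) - to_l2 (t k)) \<longlonglongrightarrow> x - x" by (intro tendsto_diff lim tlim)
  then have "(\<lambda>k. ?C * norm (to_l2 (f k) - to_l2 (t k))) \<longlonglongrightarrow> 0"
    by (intro tendsto_mult_right_zero tendsto_norm_zero) simp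
  then have "(\<lambda>k. to_l2 (ft (f k)) - to_l2 (ft (t k))) \<longlonglongrightarrow> 0"
    by (rule Lim_null_comparison[rotated]) (intro always_eventually allI est f t)
  from tendsto_add[OF this tl] show ?thesis by simp
qed

lemma l2_ft_L12: "f \<in> L12 \<Longrightarrow> l2_ft (to_l2 f) = to_l2 (ft f)"
  using l2_ft_tendsto[of "\<lambda>_. f" "to_l2 f"] by (simp add: LIMSEQ_const_iff)

lemma l2_L12_sequence:
  fixes x :: "'a::euclidean_space l2"
  obtains f where "\<And>k. f k \<in> L12" "(\<lambda>k. to_l2 (f k)) \<longlonglongrightarrow> x"
proof -
  obtain h where h: "h \<in> L2 lborel" "x = to_l2 h" by (rule l2_borel_cases)
  show ?thesis by (rule that[of "l2_truncate h"]) (use h in \<open>auto intro: l2_truncate_L12 l2_truncate_tendsto\<close>)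
qed

lemma bounded_linear_l2_ft: "bounded_linear (l2_ft :: 'a::euclidean_space l2 \<Rightarrow> 'a l2)"
proof (rule bounded_linear_intro)
  fix x y :: "'a l2" and r :: real
  obtain f where f: "\<And>k. f k \<in> L12" "(\<lambda>k. to_l2 (f k)) \<longlonglongrightarrow> x" by (rule l2_L12_sequence[of x]) blast
  obtain g where g: "\<And>k. g k \<in> L12" "(\<lambda>k. to_l2 (g k)) \<longlonglongrightarrow> y" by (rule l2_L12_sequence[of y]) blast
  note fl = l2_ft_tendsto[OF f] and gl = l2_ft_tendsto[OF g]
  note L = L12_L2(2)[OF f(1)] L12_L2(2)[OF g(1)] ft_L2(1)[OF f(1), THEN L2_lborel_imp_lebesgue]
    ft_L2(1)[OF g(1), THEN L2_lborel_imp_lebesgue]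
  have "(\<lambda>k. to_l2 (ft (\<lambda>z. f k z + g k z))) \<longlonglongrightarrow> l2_ft (x + y)"
    by (rule l2_ft_tendsto) (use tendsto_add[OF f(2) g(2)] f g in \<open>auto simp: to_l2_add L intro: L12_add\<close>)
  moreover have "(\<lambda>k. to_l2 (ft (\<lambda>z. f k z + g k z))) \<longlonglongrightarrow> l2_ft x + l2_ft y"
    using tendsto_add[OF fl gl] by (simp add: to_l2_add L ft_add f g)
  ultimately show "l2_ft (x + y) = l2_ft x + l2_ft y" by (rule LIMSEQ_unique)
  have "(\<lambda>k. to_l2 (ft (\<lambda>z. complex_of_real r * f k z))) \<longlonglongrightarrow> l2_ft (r *\<^sub>R x)"
    by (rule l2_ft_tendsto) (use tendsto_scaleR[OF tendsto_const f(2), of r] f in \<open>auto simp: to_l2_scaleR L intro: L12_cmult\<close>)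
  moreover have "(\<lambda>k. to_l2 (ft (\<lambda>z. complex_of_real r * f k z))) \<longlonglongrightarrow> r *\<^sub>R l2_ft x"
    using tendsto_scaleR[OF tendsto_const fl, of r] by (simp add: to_l2_scaleR L ft_cmult)
  ultimately show "l2_ft (r *\<^sub>R x) = r *\<^sub>R l2_ft x" by (rule LIMSEQ_unique)
  show "norm (l2_ft x) \<le> norm x * sqrt (2 * (2 * pi) ^ DIM('a))"
  proof (rule LIMSEQ_le)
    show "(\<lambda>k. norm (to_l2 (ft (f k)))) \<longlonglongrightarrow> norm (l2_ft x)" by (intro tendsto_norm fl)
    show "(\<lambda>k. norm (to_l2 (f k)) * sqrt (2 * (2 * pi) ^ DIM('a))) \<longlonglongrightarrow> norm x * sqrt (2 * (2 * pi) ^ DIM('a))"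
      by (intro tendsto_intros f(2))
    show "\<exists>N. \<forall>k\<ge>N. norm (to_l2 (ft (f k))) \<le> norm (to_l2 (f k)) * sqrt (2 * (2 * pi) ^ DIM('a))"
      using ft_L2(2)[OF f(1)] by (auto simp: mult.commute)
  qed
qed

section \<open>Density arguments, Parseval's identity and inversion\<close>

lemma subspace_closure:
  fixes S :: "'a::real_normed_vector set"
  assumes S: "subspace S"
  shows "subspace (closure S)"
  unfolding subspace_def
proof (intro conjI ballI allI)
  show "0 \<in> closure S" using subspace_0[OF S] closure_subset by blast
next
  fix x y assume "x \<in> closure S" "y \<in> closure S"
  then obtain f g where "\<And>n. f n \<in> S" "f \<longlonglongrightarrow> x" "\<And>n. g n \<in> S" "g \<longlonglongrightarrow> y"
    by (auto simp: closure_sequential)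
  then show "x + y \<in> closure S"
    unfolding closure_sequential
    by (intro exI[of _ "\<lambda>n. f n + g n"]) (auto intro: tendsto_add subspace_add[OF S])
next
  fix c x assume "x \<in> closure S"
  then obtain f where "\<And>n. f n \<in> S" "f \<longlonglongrightarrow> x" by (auto simp: closure_sequential)
  then show "c *\<^sub>R x \<in> closure S"
    unfolding closure_sequential
    by (intro exI[of _ "\<lambda>n. c *\<^sub>R f n"]) (auto intro!: tendsto_intros subspace_scale[OF S])
qed

text \<open>Density by duality: the projection onto the closure leaves a remainder orthogonal to
  \<open>S\<close>. It is applied to a dense class of nice functions, to the range of the transform
  and, in the end, to the approximating solutions.\<close>

lemma closure_eq_UNIV_of_orthogonal:
  fixes S :: "'a::{real_inner,complete_space} set"
  assumes S: "subspace S" and orth: "\<And>x. (\<And>s. s \<in> S \<Longrightarrow> x \<bullet> s = 0) \<Longrightarrow> x = 0"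
  shows "closure S = UNIV"
proof -
  have "x \<in> closure S" for x
  proof -
    obtain p where p: "p \<in> closure S" "\<And>s. s \<in> closure S \<Longrightarrow> (x - p) \<bullet> s = 0"
      using orthogonal_projection_exists[OF closed_closure subspace_closure[OF S], of x] by blast
    then have "x - p = 0" using orth closure_subset by (metis subsetD)
    then show ?thesis using p by simp
  qed
  then show ?thesis by blast
qed

lemma lip_test_L12: "p \<in> lip_test A \<Longrightarrow> (\<lambda>z. complex_of_real (p z)) \<in> L12"
  by (simp add: L12_def lip_test_L2)

text \<open>Real inner products with p and with \<i> p isolate the real and the imaginary part of
  the function.\<close>

lemma l2_vanishes_of_lip_test:
  fixes x :: "'a::euclidean_space l2"
  assumes U: "open U"
    and "\<And>p. p \<in> lip_test U \<Longrightarrow> x \<bullet> to_l2 (\<lambda>z. complex_of_real (p z)) = 0"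
    and "\<And>p. p \<in> lip_test U \<Longrightarrow> x \<bullet> to_l2 (\<lambda>z. \<i> * complex_of_real (p z)) = 0"
  shows "AE z in lebesgue. z \<in> U \<longrightarrow> of_l2 x z = 0"
proof -
  let ?f = "of_l2 x"
  have bound: "integrable lebesgue (\<lambda>z. indicator K z * h z)"
    if K: "compact K" and h: "h \<in> borel_measurable lebesgue" "\<And>z. \<bar>h z\<bar> \<le> cmod (?f z)" for K :: "'a set" and h
  proof (rule Bochner_Integration.integrable_bound)
    have "integrable lebesgue (indicator K :: 'a \<Rightarrow> real)"
      using integrable_indicator_compact[OF K] K
      by (subst integrable_completion) (auto intro: borel_compact)
    then show "integrable lebesgue (\<lambda>z. indicator K z + (cmod (?f z))\<^sup>2)"
      using L2_integrable[OF of_l2_L2[of x]] by (rule Bochner_Integration.integrable_add)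
    have t: "t \<le> 1 + t\<^sup>2" for t :: real using zero_le_power2[of "t - 1/2"]
      by (simp add: power2_eq_square algebra_simps)
    have "norm (indicator K z * h z) \<le> norm (indicator K z + (cmod (?f z))\<^sup>2)" for z
      using order_trans[OF h(2) t, of z] by (auto simp: indicator_def)
    then show "AE z in lebesgue. norm (indicator K z * h z) \<le> norm (indicator K z + (cmod (?f z))\<^sup>2)" by simp
    show "(\<lambda>z. indicator K z * h z) \<in> borel_measurable lebesgue"
      using fmeasurableD[OF lmeasurable_compact[OF K]] by (intro borel_measurable_times borel_measurable_indicator h)
  qed
  have "AE z in lebesgue. z \<in> U \<longrightarrow> Re (?f z) = 0"
  proof (rule AE_zero_of_lip_test[OF _ U])
    fix p assume p: "p \<in> lip_test U"
    have "0 = Re (LINT z|lebesgue. ?f z * cnj (complex_of_real (p z)))"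
      using assms(2)[OF p] inner_to_l2[OF of_l2_L2[of x] lip_test_L2(3)[OF p]] by simp
    also have "\<dots> = (LINT z|lebesgue. Re (?f z * cnj (complex_of_real (p z))))"
      by (rule integral_Re[symmetric]) (rule L2_integrable_mult[OF of_l2_L2 lip_test_L2(3)[OF p]])
    finally show "(LINT z|lebesgue. p z * Re (?f z)) = 0" by (simp add: mult.commute)
  qed (auto intro!: bound abs_Re_le_cmod)
  moreover have "AE z in lebesgue. z \<in> U \<longrightarrow> Im (?f z) = 0"
  proof (rule AE_zero_of_lip_test[OF _ U])
    fix p assume p: "p \<in> lip_test U"
    have ip: "(\<lambda>z. \<i> * complex_of_real (p z)) \<in> L2 lebesgue" by (rule L2_cmult[OF lip_test_L2(3)[OF p]])
    have "0 = Re (LINT z|lebesgue. ?f z * cnj (\<i> * complex_of_real (p z)))"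
      using assms(3)[OF p] inner_to_l2[OF of_l2_L2[of x] ip] by simp
    also have "\<dots> = (LINT z|lebesgue. Re (?f z * cnj (\<i> * complex_of_real (p z))))"
      by (rule integral_Re[symmetric]) (rule L2_integrable_mult[OF of_l2_L2 ip])
    finally show "(LINT z|lebesgue. p z * Im (?f z)) = 0" by (simp add: mult.commute)
  qed (auto intro!: bound abs_Im_le_cmod)
  ultimately show ?thesis by eventually_elim (auto simp: complex_eq_iff)
qed

lemma l2_eq_0_iff: "x = 0 \<longleftrightarrow> (AE z in lebesgue. of_l2 x z = 0)"
  using to_l2_eq_iff[of "of_l2 x" "\<lambda>_. 0"] by (simp add: zero_l2_def)

text \<open>The classes to which \<open>ft_isometry\<close> applies. They include the Lipschitz test
  functions, which makes them dense.\<close>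

definition l2_nice :: "'a::euclidean_space l2 set" where
  "l2_nice = {to_l2 f |f. f \<in> L12 \<and> continuous_on UNIV f \<and> (\<exists>M. \<forall>z. cmod (f z) \<le> M)}"

lemma lip_test_l2_nice:
  assumes p: "p \<in> lip_test A"
  shows "to_l2 (\<lambda>z. c * complex_of_real (p z)) \<in> l2_nice"
proof -
  obtain C where C: "\<And>x. \<bar>p x\<bar> \<le> C" using lip_test_bounded[OF p] by blast
  have "(\<lambda>z. c * complex_of_real (p z)) \<in> L12" by (rule L12_cmult[OF lip_test_L12[OF p]])
  moreover have "continuous_on UNIV (\<lambda>z. c * complex_of_real (p z))"
    by (intro continuous_intros continuous_on_of_real lip_test_continuous[OF p])
  moreover have "cmod (c * complex_of_real (p z)) \<le> cmod c * C" for z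
    using mult_left_mono[OF C norm_ge_zero[of c]] by (simp add: norm_mult)
  ultimately show ?thesis unfolding l2_nice_def by blast
qed

lemma subspace_l2_nice: "subspace (l2_nice :: 'a::euclidean_space l2 set)"
  unfolding subspace_def
proof (intro conjI ballI allI)
  show "(0 :: 'a l2) \<in> l2_nice"
    unfolding l2_nice_def zero_l2_def by (auto intro!: exI[of _ "\<lambda>_. 0"] exI[of _ 0] simp: L12_def)
next
  fix x y :: "'a l2" assume "x \<in> l2_nice" "y \<in> l2_nice"
  then obtain f g M N where fg: "x = to_l2 f" "f \<in> L12" "continuous_on UNIV f" "\<And>z. cmod (f z) \<le> M"
    "y = to_l2 g" "g \<in> L12" "continuous_on UNIV g" "\<And>z. cmod (g z) \<le> N"
    unfolding l2_nice_def by blast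
  have "cmod (f z + g z) \<le> M + N" for z using norm_triangle_ineq[of "f z" "g z"] fg(4)[of z] fg(8)[of z] by linarith
  moreover have "x + y = to_l2 (\<lambda>z. f z + g z)" using fg by (simp add: to_l2_add L12_L2)
  ultimately show "x + y \<in> l2_nice"
    using L12_add[OF fg(2,6)] continuous_on_add[OF fg(3,7)] unfolding l2_nice_def by blast
next
  fix c and x :: "'a l2" assume "x \<in> l2_nice"
  then obtain f M where f: "x = to_l2 f" "f \<in> L12" "continuous_on UNIV f" "\<And>z. cmod (f z) \<le> M"
    unfolding l2_nice_def by blast
  have "cmod (complex_of_real c * f z) \<le> \<bar>c\<bar> * M" for z using mult_left_mono[OF f(4), of "\<bar>c\<bar>" z] by (simp add: norm_mult)
  moreover have "c *\<^sub>R x = to_l2 (\<lambda>z. complex_of_real c * f z)" using f by (simp add: to_l2_scaleR L12_L2)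
  moreover have "continuous_on UNIV (\<lambda>z. complex_of_real c * f z)" by (intro continuous_intros f)
  ultimately show "c *\<^sub>R x \<in> l2_nice" using L12_cmult[OF f(2)] unfolding l2_nice_def by blast
qed

lemma closure_l2_nice: "closure (l2_nice :: 'a::euclidean_space l2 set) = UNIV"
proof (rule closure_eq_UNIV_of_orthogonal[OF subspace_l2_nice])
  fix x :: "'a l2" assume x: "\<And>s. s \<in> l2_nice \<Longrightarrow> x \<bullet> s = 0"
  have "AE z in lebesgue. z \<in> UNIV \<longrightarrow> of_l2 x z = 0"
  proof (rule l2_vanishes_of_lip_test[OF open_UNIV])
    fix p :: "'a \<Rightarrow> real" assume p: "p \<in> lip_test UNIV"
    show "x \<bullet> to_l2 (\<lambda>z. complex_of_real (p z)) = 0" using x[OF lip_test_l2_nice[OF p, of 1]] by simp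
    show "x \<bullet> to_l2 (\<lambda>z. \<i> * complex_of_real (p z)) = 0" by (rule x[OF lip_test_l2_nice[OF p]])
  qed
  then show "x = 0" by (simp add: l2_eq_0_iff)
qed

abbreviation fourier_const :: "'a::euclidean_space itself \<Rightarrow> real" where
  "fourier_const _ \<equiv> (2 * pi) ^ DIM('a)"

lemma norm_l2_ft: "(norm (l2_ft (x :: 'a::euclidean_space l2)))\<^sup>2 = fourier_const TYPE('a) * (norm x)\<^sup>2"
proof -
  interpret l2_ft: bounded_linear "l2_ft :: 'a l2 \<Rightarrow> 'a l2" by (rule bounded_linear_l2_ft)
  let ?S = "{x :: 'a l2. (norm (l2_ft x))\<^sup>2 = (2 * pi) ^ DIM('a) * (norm x)\<^sup>2}"
  have "closed ?S"
    by (intro closed_Collect_eq continuous_intros l2_ft.continuous_on)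
  moreover have "l2_nice \<subseteq> ?S"
  proof
    fix x :: "'a l2" assume "x \<in> l2_nice"
    then obtain f M where f: "x = to_l2 f" "f \<in> L12" "continuous_on UNIV f" "\<And>z. cmod (f z) \<le> M"
      unfolding l2_nice_def by blast
    have "ennreal ((norm (to_l2 (ft f)))\<^sup>2) = ennreal ((2 * pi) ^ DIM('a) * (LINT z|lborel. (cmod (f z))\<^sup>2))"
      unfolding norm_to_l2_nn_lborel[OF ft_L2(1)[OF f(2)]] by (rule ft_isometry[OF L12_integrable[OF f(2)] f(3,4)])
    then have "(norm (to_l2 (ft f)))\<^sup>2 = (2 * pi) ^ DIM('a) * (LINT z|lborel. (cmod (f z))\<^sup>2)"
      by (subst (asm) ennreal_inj) auto
    also have "(LINT z|lborel. (cmod (f z))\<^sup>2) = (norm (to_l2 f))\<^sup>2"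
      using L12_measurable[OF f(2)] by (simp add: norm_to_l2_sq[OF L12_L2(2)[OF f(2)]] integral_completion)
    finally show "x \<in> ?S" using f by (simp add: l2_ft_L12)
  qed
  ultimately have "closure l2_nice \<subseteq> ?S" by (rule closure_minimal[rotated])
  then show ?thesis unfolding closure_l2_nice by blast
qed

lemma inner_l2_ft: "l2_ft x \<bullet> l2_ft y = fourier_const TYPE('a) * (x \<bullet> y)" for x y :: "'a::euclidean_space l2"
proof -
  interpret l2_ft: bounded_linear "l2_ft :: 'a l2 \<Rightarrow> 'a l2" by (rule bounded_linear_l2_ft)
  have polar: "u \<bullet> v = ((norm (u + v))\<^sup>2 - (norm u)\<^sup>2 - (norm v)\<^sup>2) / 2" for u v :: "'a l2"
    by (simp add: power2_norm_eq_inner inner_add_left inner_add_right inner_commute)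
  show ?thesis
    unfolding polar l2_ft.add[symmetric] norm_l2_ft by (simp add: algebra_simps diff_divide_distrib)
qed

definition l2_cnj :: "'a::euclidean_space l2 \<Rightarrow> 'a l2" where
  "l2_cnj x = to_l2 (\<lambda>z. cnj (of_l2 x z))"

lemma l2_cnj_to_l2:
  assumes "f \<in> L2 lebesgue"
  shows "l2_cnj (to_l2 f) = to_l2 (\<lambda>z. cnj (f z))"
  unfolding l2_cnj_def
  by (rule to_l2_cong) (use of_to_l2[OF assms(1)] assms in \<open>auto intro: L2_cnj\<close>)

lemma l2_cnj_cnj [simp]: "l2_cnj (l2_cnj x) = x"
proof -
  obtain f where "f \<in> L2 lebesgue" "x = to_l2 f" by (rule l2_cases)
  then show ?thesis by (simp add: l2_cnj_to_l2 L2_cnj)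
qed

lemma bounded_linear_l2_cnj: "bounded_linear (l2_cnj :: 'a::euclidean_space l2 \<Rightarrow> 'a l2)"
proof (rule bounded_linear_intro[where K = 1])
  fix x y :: "'a l2" and r :: real
  obtain f where f: "f \<in> L2 lebesgue" "x = to_l2 f" by (rule l2_cases)
  obtain g where g: "g \<in> L2 lebesgue" "y = to_l2 g" by (rule l2_cases)
  note [simp] = f g l2_cnj_to_l2 L2_cnj to_l2_add to_l2_scaleR L2_add L2_cmult
  show "l2_cnj (x + y) = l2_cnj x + l2_cnj y" "l2_cnj (r *\<^sub>R x) = r *\<^sub>R l2_cnj x" by simp_all
  show "norm (l2_cnj x) \<le> norm x * 1" by (simp add: norm_to_l2 L2_norm_def)
qed

text \<open>The formula \<integral> (ft f) g = \<integral> f (ft g) for classes;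
  \<open>l2_cnj\<close> cancels the conjugation in the inner product. It serves to describe the
  orthogonal complement of the range of \<open>l2_ft\<close>.\<close>

lemma l2_ft_mult_formula:
  fixes x y :: "'a::euclidean_space l2"
  shows "l2_ft x \<bullet> l2_cnj y = x \<bullet> l2_cnj (l2_ft y)"
proof -
  interpret cnj: bounded_linear "l2_cnj :: 'a l2 \<Rightarrow> 'a l2" by (rule bounded_linear_l2_cnj)
  obtain f where f: "\<And>k. f k \<in> L12" "(\<lambda>k. to_l2 (f k)) \<longlonglongrightarrow> x" by (rule l2_L12_sequence[of x]) blast
  obtain g where g: "\<And>k. g k \<in> L12" "(\<lambda>k. to_l2 (g k)) \<longlonglongrightarrow> y" by (rule l2_L12_sequence[of y]) blast
  note L = L12_L2(2)[OF f(1)] L12_L2(2)[OF g(1)] ft_L2(1)[OF f(1), THEN L2_lborel_imp_lebesgue]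
    ft_L2(1)[OF g(1), THEN L2_lborel_imp_lebesgue]
  note [measurable] = L12_measurable[OF f(1)] L12_measurable[OF g(1)]
  have eq: "to_l2 (ft (f k)) \<bullet> l2_cnj (to_l2 (g k)) = to_l2 (f k) \<bullet> l2_cnj (to_l2 (ft (g k)))" for k
  proof -
    have "(LINT \<zeta>|lborel. ft (f k) \<zeta> * g k \<zeta>) = (LINT z|lborel. f k z * ft (g k) z)"
      using ft_mult_formula[OF L12_integrable[OF f(1)] L12_integrable[OF g(1)], of k k] by (simp add: mult.commute)
    then show ?thesis
      by (simp add: l2_cnj_to_l2 L inner_to_l2 L2_cnj integral_completion)
  qed
  have "(\<lambda>k. to_l2 (ft (f k)) \<bullet> l2_cnj (to_l2 (g k))) \<longlonglongrightarrow> l2_ft x \<bullet> l2_cnj y"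
    by (intro tendsto_inner l2_ft_tendsto f cnj.tendsto g)
  moreover have "(\<lambda>k. to_l2 (f k) \<bullet> l2_cnj (to_l2 (ft (g k)))) \<longlonglongrightarrow> x \<bullet> l2_cnj (l2_ft y)"
    by (intro tendsto_inner l2_ft_tendsto f cnj.tendsto g)
  ultimately show ?thesis unfolding eq by (rule LIMSEQ_unique)
qed

lemma l2_ft_eq_0: "l2_ft x = 0 \<Longrightarrow> x = 0"
  using norm_l2_ft[of x] by simp

text \<open>The range is complete because the transform is a multiple of an isometry. If y is
  orthogonal to it, the multiplication formula shows that the transform of the conjugate of y
  vanishes, hence y = 0.\<close>

lemma surj_l2_ft: "surj (l2_ft :: 'a::euclidean_space l2 \<Rightarrow> 'a l2)"
proof -
  interpret l2_ft: bounded_linear "l2_ft :: 'a l2 \<Rightarrow> 'a l2" by (rule bounded_linear_l2_ft)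
  have sub: "subspace (range (l2_ft :: 'a l2 \<Rightarrow> 'a l2))"
    by (rule linear_subspace_image[OF l2_ft.linear subspace_UNIV])
  have "norm (l2_ft x) = sqrt (fourier_const TYPE('a)) * norm x" for x :: "'a l2"
    using norm_l2_ft[of x] by (metis norm_ge_zero real_sqrt_abs real_sqrt_mult abs_of_nonneg)
  then have "complete (range (l2_ft :: 'a l2 \<Rightarrow> 'a l2))"
    by (intro complete_isometric_image[of "sqrt (fourier_const TYPE('a))"] bounded_linear_l2_ft complete_UNIV subspace_UNIV) auto
  then have "closure (range (l2_ft :: 'a l2 \<Rightarrow> 'a l2)) = range l2_ft"
    by (simp add: complete_eq_closed closure_closed)
  moreover have "closure (range (l2_ft :: 'a l2 \<Rightarrow> 'a l2)) = UNIV"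
  proof (rule closure_eq_UNIV_of_orthogonal[OF sub])
    fix y :: "'a l2" assume y: "\<And>s. s \<in> range l2_ft \<Longrightarrow> y \<bullet> s = 0"
    have "x \<bullet> l2_cnj (l2_ft (l2_cnj y)) = 0" for x
      using l2_ft_mult_formula[of x "l2_cnj y"] y[of "l2_ft x"] by (simp add: inner_commute)
    then have "l2_cnj (l2_ft (l2_cnj y)) = 0" using inner_eq_zero_iff by blast
    then have "l2_ft (l2_cnj y) = 0"
      by (metis l2_cnj_cnj bounded_linear_l2_cnj linear_0 bounded_linear.linear)
    then have "l2_cnj y = 0" by (rule l2_ft_eq_0)
    then show "y = 0" by (metis l2_cnj_cnj bounded_linear_l2_cnj linear_0 bounded_linear.linear)
  qed
  ultimately show ?thesis by simp
qed

lemma inj_l2_ft: "inj (l2_ft :: 'a::euclidean_space l2 \<Rightarrow> 'a l2)"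
  using l2_ft_eq_0 linear_injective_0[OF bounded_linear.linear[OF bounded_linear_l2_ft]] by blast

text \<open>\<open>bounded_linear\<close> records linearity over the reals only. The complex scalar
  \<i> is what carries imaginary parts across the transform and gives the complex Parseval identity
  \<open>l2_cinner_ft\<close>.\<close>

lemma l2_ft_mult_const: "l2_ft (l2_mult (\<lambda>_. a) x) = l2_mult (\<lambda>_. a) (l2_ft x)"
  for x :: "'a::euclidean_space l2"
proof -
  interpret m: bounded_linear "l2_mult (\<lambda>_. a) :: 'a l2 \<Rightarrow> 'a l2" by (rule bounded_linear_l2_mult) simp
  obtain f where f: "\<And>k. f k \<in> L12" "(\<lambda>k. to_l2 (f k)) \<longlonglongrightarrow> x" by (rule l2_L12_sequence[of x]) blast
  have "(\<lambda>k. to_l2 (ft (\<lambda>z. a * f k z))) \<longlonglongrightarrow> l2_ft (l2_mult (\<lambda>_. a) x)"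
    by (rule l2_ft_tendsto) (use m.tendsto[OF f(2)] f in \<open>auto simp: l2_mult_to_l2 L12_L2 intro: L12_cmult\<close>)
  moreover have "(\<lambda>k. to_l2 (ft (\<lambda>z. a * f k z))) \<longlonglongrightarrow> l2_mult (\<lambda>_. a) (l2_ft x)"
    using m.tendsto[OF l2_ft_tendsto[OF f]]
    by (simp add: l2_mult_to_l2 ft_cmult ft_L2(1)[OF f(1), THEN L2_lborel_imp_lebesgue])
  ultimately show ?thesis by (rule LIMSEQ_unique)
qed

lemma l2_cinner_ft: "l2_cinner (l2_ft x) (l2_ft y) = complex_of_real (fourier_const TYPE('a)) * l2_cinner x y"
  for x y :: "'a::euclidean_space l2"
  by (simp add: complex_eq_iff Re_l2_cinner Im_l2_cinner inner_l2_ft l2_ft_mult_const[symmetric])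

definition l2_ift :: "'a::euclidean_space l2 \<Rightarrow> 'a l2" where
  "l2_ift = inv l2_ft"

lemma l2_ft_ift [simp]: "l2_ft (l2_ift x) = x"
  unfolding l2_ift_def by (rule surj_f_inv_f[OF surj_l2_ft])

lemma l2_ift_ft [simp]: "l2_ift (l2_ft x) = x"
  unfolding l2_ift_def by (rule inv_f_f[OF inj_l2_ft])

lemma norm_l2_ift: "fourier_const TYPE('a) * (norm (l2_ift x))\<^sup>2 = (norm (x :: 'a::euclidean_space l2))\<^sup>2"
  using norm_l2_ft[of "l2_ift x"] by simp

lemma bounded_linear_l2_ift: "bounded_linear (l2_ift :: 'a::euclidean_space l2 \<Rightarrow> 'a l2)"
proof (rule bounded_linear_intro[where K = 1])
  interpret l2_ft: bounded_linear "l2_ft :: 'a l2 \<Rightarrow> 'a l2" by (rule bounded_linear_l2_ft)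
  fix x y :: "'a l2" and r :: real
  show "l2_ift (x + y) = l2_ift x + l2_ift y" by (rule injD[OF inj_l2_ft]) (simp add: l2_ft.add)
  show "l2_ift (r *\<^sub>R x) = r *\<^sub>R l2_ift x" by (rule injD[OF inj_l2_ft]) (simp add: l2_ft.scaleR)
  have "1 \<le> (2 * pi) ^ DIM('a)" using pi_gt3 by (intro one_le_power) simp
  then have "1 * (norm (l2_ift x))\<^sup>2 \<le> (2 * pi) ^ DIM('a) * (norm (l2_ift x))\<^sup>2" by (intro mult_right_mono) auto
  then have "(norm (l2_ift x))\<^sup>2 \<le> (norm x)\<^sup>2" using norm_l2_ift[of x] by simp
  then show "norm (l2_ift x) \<le> norm x * 1" using power2_le_imp_le by force
qed

section \<open>Anisotropic Sobolev spaces\<close>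

lemma fourier_L1_eq: "fourier_L1 u \<zeta> = (LINT z|lebesgue. cis (- (z \<bullet> \<zeta>)) * u z)"
  for u :: "'n::finite spacetime \<Rightarrow> complex"
proof (cases \<zeta>)
  case (Pair \<rho> \<xi>)
  have "- \<i> * complex_of_real (t * \<rho> + x \<bullet> \<xi>) = \<i> * complex_of_real (- ((t, x) \<bullet> \<zeta>))" for t x
    by (simp add: Pair inner_prod_def algebra_simps)
  then have "exp (- \<i> * complex_of_real (t * \<rho> + x \<bullet> \<xi>)) = cis (- ((t, x) \<bullet> \<zeta>))" for t x
    by (simp only: cis_conv_exp)
  then show ?thesis
    by (simp add: Pair fourier_L1_def case_prod_beta' inner_prod_def)
qed

lemma fourier_L1_borel:
  fixes u :: "'n::finite spacetime \<Rightarrow> complex"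
  assumes [measurable]: "g \<in> borel_measurable borel" and u: "u \<in> borel_measurable lebesgue" "AE z in lebesgue. u z = g z"
  shows "fourier_L1 u = ft g"
proof
  fix \<zeta> :: "'n spacetime"
  have c: "(\<lambda>z. cis (- (z \<bullet> \<zeta>))) \<in> borel_measurable borel" by measurable
  have "fourier_L1 u \<zeta> = (LINT z|lebesgue. cis (- (z \<bullet> \<zeta>)) * g z)"
    unfolding fourier_L1_eq
    by (rule integral_cong_AE)
      (use u in \<open>auto intro!: borel_measurable_times borel_imp_lebesgue[OF c] borel_imp_lebesgue[OF assms(1)]\<close>)
  also have "\<dots> = ft g \<zeta>" unfolding ft_def by (rule integral_completion) measurable
  finally show "fourier_L1 u \<zeta> = ft g \<zeta>" .
qed

lemma L2_norm_diff:
  assumes "f \<in> L2 lebesgue" "g \<in> L2 lebesgue"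
  shows "L2_norm lebesgue (\<lambda>z. f z - g z) = norm (to_l2 f - to_l2 g)"
  using assms by (simp add: to_l2_diff norm_to_l2 L2_diff)

text \<open>The definition through approximating sequences becomes an equation between classes.
  Existence and uniqueness almost everywhere, on which the choice in \<open>fourier\<close> rests,
  are then those of \<open>l2_ft\<close>.\<close>

lemma has_fourier_iff:
  fixes u v :: "'n::finite spacetime \<Rightarrow> complex"
  shows "has_fourier u v \<longleftrightarrow> u \<in> L2 lebesgue \<and> v \<in> L2 lebesgue \<and> to_l2 v = l2_ft (to_l2 u)"
proof
  assume h: "has_fourier u v"
  then have uv: "u \<in> L2 lebesgue" "v \<in> L2 lebesgue" by (auto simp: has_fourier_def)
  obtain f where f: "\<And>k. integrable lebesgue (f k)" "\<And>k. f k \<in> L2 lebesgue" "\<And>k. fourier_L1 (f k) \<in> L2 lebesgue"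
    and lim: "(\<lambda>k. L2_norm lebesgue (\<lambda>z. f k z - u z)) \<longlonglongrightarrow> 0"
      "(\<lambda>k. L2_norm lebesgue (\<lambda>\<zeta>. fourier_L1 (f k) \<zeta> - v \<zeta>)) \<longlonglongrightarrow> 0"
    using h by (auto simp: has_fourier_def)
  have "\<exists>g. g \<in> borel_measurable borel \<and> (AE z in lebesgue. f k z = g z)" for k
    using lebesgue_borel_representative[OF L2_measurable[OF f(2)[of k]]] by metis
  then obtain g where g: "\<And>k. g k \<in> borel_measurable borel" "\<And>k. AE z in lebesgue. f k z = g k z" by metis
  have gL: "g k \<in> L2 lebesgue" for k by (rule L2_cong_AE[OF f(2) borel_imp_lebesgue[OF g(1)] g(2)])
  have fg: "to_l2 (f k) = to_l2 (g k)" for k by (rule to_l2_cong[OF f(2) gL g(2)])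
  have "integrable lebesgue (g k)" for k
    using f(1)[of k] integrable_cong_AE[OF L2_measurable[OF f(2)] borel_imp_lebesgue[OF g(1)] g(2)] by blast
  then have g12: "g k \<in> L12" for k
    using gL[of k] g(1)[of k] integrable_completion[of "g k" lborel] L2_lborel_iff[of "g k"] by (simp add: L12_def)
  have ft: "fourier_L1 (f k) = ft (g k)" for k by (rule fourier_L1_borel[OF g(1) L2_measurable[OF f(2)] g(2)])
  have "(\<lambda>k. to_l2 (g k)) \<longlonglongrightarrow> to_l2 u"
    using lim(1) unfolding L2_norm_diff[OF f(2) uv(1)] fg tendsto_norm_zero_iff LIM_zero_iff .
  then have "(\<lambda>k. to_l2 (ft (g k))) \<longlonglongrightarrow> l2_ft (to_l2 u)" by (rule l2_ft_tendsto[OF g12])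
  moreover have "(\<lambda>k. to_l2 (ft (g k))) \<longlonglongrightarrow> to_l2 v"
  proof -
    have "L2_norm lebesgue (\<lambda>\<zeta>. fourier_L1 (f k) \<zeta> - v \<zeta>) = norm (to_l2 (ft (g k)) - to_l2 v)" for k
      using L2_norm_diff[OF f(3)[of k] uv(2)] unfolding ft .
    then show ?thesis using lim(2) by (simp only: tendsto_norm_zero_iff LIM_zero_iff)
  qed
  ultimately have "to_l2 v = l2_ft (to_l2 u)" using LIMSEQ_unique by blast
  with uv show "u \<in> L2 lebesgue \<and> v \<in> L2 lebesgue \<and> to_l2 v = l2_ft (to_l2 u)" by blast
next
  assume h: "u \<in> L2 lebesgue \<and> v \<in> L2 lebesgue \<and> to_l2 v = l2_ft (to_l2 u)"
  obtain f where f: "\<And>k. f k \<in> L12" "(\<lambda>k. to_l2 (f k)) \<longlonglongrightarrow> to_l2 u" by (rule l2_L12_sequence[of "to_l2 u"]) blast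
  have fm: "f k \<in> borel_measurable borel" for k using L12_measurable[OF f(1)] .
  have ft: "fourier_L1 (f k) = ft (f k)" for k by (rule fourier_L1_borel[OF fm borel_imp_lebesgue[OF fm]]) simp
  have L: "f k \<in> L2 lebesgue" "ft (f k) \<in> L2 lebesgue" for k
    using L12_L2(2)[OF f(1)] ft_L2(1)[OF f(1)] L2_lborel_imp_lebesgue by auto
  show "has_fourier u v"
    unfolding has_fourier_def
  proof (intro conjI exI[of _ f] allI)
    show "integrable lebesgue (f k)" for k
      using L12_integrable[OF f(1)[of k]] fm[of k] integrable_completion[of "f k" lborel] by simp
    show "(\<lambda>k. L2_norm lebesgue (\<lambda>z. f k z - u z)) \<longlonglongrightarrow> 0"
      unfolding L2_norm_diff[OF L(1) conjunct1[OF h]] tendsto_norm_zero_iff LIM_zero_iff by (rule f(2))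
    show "(\<lambda>k. L2_norm lebesgue (\<lambda>\<zeta>. fourier_L1 (f k) \<zeta> - v \<zeta>)) \<longlonglongrightarrow> 0"
      unfolding ft L2_norm_diff[OF L(2) conjunct1[OF conjunct2[OF h]]] tendsto_norm_zero_iff LIM_zero_iff
      using l2_ft_tendsto[OF f] h by simp
  qed (use h L ft in auto)
qed

lemma fourier_L2:
  fixes u :: "'n::finite spacetime \<Rightarrow> complex"
  assumes u: "u \<in> L2 lebesgue"
  shows "fourier u \<in> L2 lebesgue" "to_l2 (fourier u) = l2_ft (to_l2 u)"
proof -
  have "has_fourier u (of_l2 (l2_ft (to_l2 u)))" using u by (simp add: has_fourier_iff)
  then have "has_fourier u (fourier u)" unfolding fourier_def by (rule someI[of "has_fourier u"])
  then show "fourier u \<in> L2 lebesgue" "to_l2 (fourier u) = l2_ft (to_l2 u)" by (simp_all add: has_fourier_iff)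
qed

text \<open>Surjectivity of \<open>l2_ft\<close> provides a function with the prescribed transform,
  so the choice in \<open>fourier_multiplier\<close> succeeds as soon as the product is square
  integrable.\<close>

lemma fourier_multiplier_L2:
  fixes u :: "'n::finite spacetime \<Rightarrow> complex"
  assumes mu: "(\<lambda>\<zeta>. m \<zeta> * fourier u \<zeta>) \<in> L2 lebesgue"
  shows "fourier_multiplier m u \<in> L2 lebesgue"
    and "l2_ft (to_l2 (fourier_multiplier m u)) = to_l2 (\<lambda>\<zeta>. m \<zeta> * fourier u \<zeta>)"
proof -
  let ?P = "\<lambda>v. v \<in> L2 lebesgue \<and> (AE \<zeta> in lebesgue. fourier v \<zeta> = m \<zeta> * fourier u \<zeta>)"
  define v where "v = of_l2 (l2_ift (to_l2 (\<lambda>\<zeta>. m \<zeta> * fourier u \<zeta>)))"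
  have v: "v \<in> L2 lebesgue" by (simp add: v_def)
  have "to_l2 (fourier v) = to_l2 (\<lambda>\<zeta>. m \<zeta> * fourier u \<zeta>)" unfolding fourier_L2(2)[OF v] by (simp add: v_def)
  then have "?P v" using v to_l2_eq_iff[OF fourier_L2(1)[OF v] mu] by blast
  then have P: "?P (fourier_multiplier m u)" unfolding fourier_multiplier_def by (rule someI[of ?P])
  then show 1: "fourier_multiplier m u \<in> L2 lebesgue" by simp
  show "l2_ft (to_l2 (fourier_multiplier m u)) = to_l2 (\<lambda>\<zeta>. m \<zeta> * fourier u \<zeta>)"
    unfolding fourier_L2(2)[OF 1, symmetric] using P by (intro to_l2_cong fourier_L2 mu) auto
qed

section \<open>The heat symbol, its weight, and the Sobolev space in lifted coordinates\<close>

definition heat_symbol :: "'n::finite spacetime \<Rightarrow> complex" where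
  "heat_symbol \<zeta> = \<i> * complex_of_real (fst \<zeta>) + complex_of_real ((norm (snd \<zeta>))\<^sup>2)"

definition Hs_weight :: "real \<Rightarrow> 'n::finite spacetime \<Rightarrow> real" where
  "Hs_weight s \<zeta> = (1 + cmod (heat_symbol \<zeta>)) powr s"

lemma continuous_heat_symbol: "continuous_on A heat_symbol"
  unfolding heat_symbol_def[abs_def] by (intro continuous_intros)

lemma heat_symbol_measurable [measurable]: "heat_symbol \<in> borel_measurable borel"
  by (intro borel_measurable_continuous_onI continuous_heat_symbol)

lemma Hs_weight_measurable [measurable]: "Hs_weight s \<in> borel_measurable borel"
  unfolding Hs_weight_def[abs_def] by measurable

lemma Hs_weight_ge_1: "0 \<le> s \<Longrightarrow> 1 \<le> Hs_weight s \<zeta>"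
  unfolding Hs_weight_def by (rule ge_one_powr_ge_zero) auto

lemma Hs_iff:
  "u \<in> Hs s \<longleftrightarrow> u \<in> L2 lebesgue \<and> integrable lebesgue (\<lambda>\<zeta>. Hs_weight s \<zeta> * (cmod (fourier u \<zeta>))\<^sup>2)"
  unfolding Hs_def Hs_weight_def heat_symbol_def by (simp add: case_prod_beta')

lemma Re_heat_symbol: "Re (heat_symbol \<zeta>) = (norm (snd \<zeta>))\<^sup>2"
  and Im_heat_symbol: "Im (heat_symbol \<zeta>) = fst \<zeta>"
  by (simp_all add: heat_symbol_def)

text \<open>Compares the parabolic with the isotropic size of \<zeta>. By this direction the weight
  grows in every direction of frequency space, as compactness requires; through the converse,
  \<open>heat_symbol_le\<close>, Lipschitz functions enter \<open>Hs s\<close>.\<close>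

lemma norm_le_heat_symbol: "norm \<zeta> \<le> 1 + cmod (heat_symbol \<zeta>)"
proof -
  let ?m = "cmod (heat_symbol \<zeta>)"
  have "(norm (snd \<zeta>))\<^sup>2 \<le> ?m" using complex_Re_le_cmod[of "heat_symbol \<zeta>"] by (simp add: Re_heat_symbol)
  moreover have "\<bar>fst \<zeta>\<bar> \<le> ?m" using abs_Im_le_cmod[of "heat_symbol \<zeta>"] by (simp add: Im_heat_symbol)
  then have "(fst \<zeta>)\<^sup>2 \<le> ?m\<^sup>2" by (metis abs_ge_zero power2_abs power_mono)
  ultimately have "(norm \<zeta>)\<^sup>2 \<le> ?m\<^sup>2 + ?m"
    by (simp add: norm_prod_def real_sqrt_pow2)
  also have "\<dots> \<le> (1 + ?m)\<^sup>2" by (simp add: power2_eq_square algebra_simps)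
  finally show ?thesis by (rule power2_le_imp_le) simp
qed

lemma heat_symbol_le: "cmod (heat_symbol \<zeta>) \<le> 1 + (norm \<zeta>)\<^sup>2"
proof -
  have "cmod (heat_symbol \<zeta>) \<le> \<bar>fst \<zeta>\<bar> + (norm (snd \<zeta>))\<^sup>2"
    using cmod_le[of "heat_symbol \<zeta>"] by (simp add: Re_heat_symbol Im_heat_symbol)
  moreover have "\<bar>fst \<zeta>\<bar> \<le> 1 + (fst \<zeta>)\<^sup>2" using zero_le_power2[of "\<bar>fst \<zeta>\<bar> - 1/2"]
    by (simp add: power2_eq_square algebra_simps)
  moreover have "(norm \<zeta>)\<^sup>2 = (fst \<zeta>)\<^sup>2 + (norm (snd \<zeta>))\<^sup>2" by (simp add: norm_prod_def)
  ultimately show ?thesis by linarith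
qed

text \<open>The principal logarithm commutes with conjugation off the negative real axis, which the
  closed right half plane meets only at 0. Hence powers of the adjoint symbol are conjugates of
  powers of the symbol.\<close>

lemma cnj_powr_of_real:
  assumes "0 \<le> Re z"
  shows "cnj (cnj z powr complex_of_real a) = z powr complex_of_real a"
proof (cases "z = 0")
  case False
  then have "z \<notin> \<real>\<^sub>\<le>\<^sub>0" using assms by (auto simp: complex_nonpos_Reals_iff complex_eq_iff)
  then have "Ln (cnj z) = cnj (Ln z)" by (simp add: cnj_Ln)
  then show ?thesis using False by (simp add: powr_def exp_cnj)
qed simp

lemma frac_heat_eq: "frac_heat a = fourier_multiplier (\<lambda>\<zeta>. heat_symbol \<zeta> powr complex_of_real a)"
  unfolding frac_heat_def heat_symbol_def by (simp add: case_prod_beta')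

lemma frac_heat_adj_eq: "frac_heat_adj a = fourier_multiplier (\<lambda>\<zeta>. cnj (heat_symbol \<zeta>) powr complex_of_real a)"
  unfolding frac_heat_adj_def heat_symbol_def by (simp add: case_prod_beta')

definition Hs_root :: "real \<Rightarrow> 'n::finite spacetime \<Rightarrow> complex" where
  "Hs_root s \<zeta> = complex_of_real (sqrt (Hs_weight s \<zeta>))"

lemma Hs_root_measurable [measurable]: "Hs_root s \<in> borel_measurable borel"
  unfolding Hs_root_def[abs_def] by measurable

lemma Hs_weight_pos [simp]: "0 < Hs_weight s \<zeta>"
  unfolding Hs_weight_def by (metis add_pos_nonneg norm_ge_zero powr_gt_zero zero_less_one less_irrefl)

lemma Hs_weight_nonzero [simp]: "Hs_weight s \<zeta> \<noteq> 0"
  by (rule less_imp_neq[OF Hs_weight_pos, symmetric])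

lemma Hs_root_nonzero [simp]: "Hs_root s \<zeta> \<noteq> 0"
  by (simp add: Hs_root_def)

lemma norm_Hs_root_ge_1: "0 \<le> s \<Longrightarrow> 1 \<le> cmod (Hs_root s \<zeta>)"
  using Hs_weight_ge_1[of s \<zeta>] by (simp add: Hs_root_def)

definition Hs_lift :: "real \<Rightarrow> ('n::finite spacetime \<Rightarrow> complex) \<Rightarrow> 'n spacetime l2" where
  "Hs_lift s u = to_l2 (\<lambda>\<zeta>. Hs_root s \<zeta> * fourier u \<zeta>)"

text \<open>\<open>Hs_lift\<close> identifies \<open>Hs s\<close> isometrically with all of L^2 on
  the frequency side, and \<open>Hs_embed\<close> is the inverse, read as a class in L^2 on
  space-time. It plays the role of the inclusion of the Sobolev space in L^2.\<close>

definition Hs_embed :: "real \<Rightarrow> 'n::finite spacetime l2 \<Rightarrow> 'n spacetime l2" where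
  "Hs_embed s x = l2_ift (l2_mult (\<lambda>\<zeta>. inverse (Hs_root s \<zeta>)) x)"

lemma bounded_multiplier_inverse_root: "0 \<le> s \<Longrightarrow> bounded_multiplier (\<lambda>\<zeta>. inverse (Hs_root s \<zeta>))"
  by (rule bounded_multiplierI[where C = 1])
    (auto intro!: borel_imp_lebesgue simp: norm_inverse norm_Hs_root_ge_1 inverse_le_1_iff)

lemma bounded_linear_Hs_embed: "0 \<le> s \<Longrightarrow> bounded_linear (Hs_embed s)"
  unfolding Hs_embed_def[abs_def]
  by (rule bounded_linear_compose[OF bounded_linear_l2_ift bounded_linear_l2_mult[OF bounded_multiplier_inverse_root]])

lemma Hs_root_fourier_L2:
  assumes "u \<in> Hs s"
  shows "(\<lambda>\<zeta>. Hs_root s \<zeta> * fourier u \<zeta>) \<in> L2 lebesgue"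
  unfolding L2_def
proof (intro CollectI conjI)
  show "(\<lambda>\<zeta>. Hs_root s \<zeta> * fourier u \<zeta>) \<in> borel_measurable lebesgue"
    using assms by (intro borel_measurable_times borel_imp_lebesgue[OF Hs_root_measurable] L2_measurable fourier_L2)
      (auto simp: Hs_iff)
  show "integrable lebesgue (\<lambda>\<zeta>. (cmod (Hs_root s \<zeta> * fourier u \<zeta>))\<^sup>2)"
    using assms by (simp add: Hs_iff norm_mult power_mult_distrib Hs_root_def less_imp_le)
qed

lemma Hs_embed_lift:
  assumes s: "0 \<le> s" and u: "u \<in> Hs s"
  shows "Hs_embed s (Hs_lift s u) = to_l2 u"
proof -
  have uL: "u \<in> L2 lebesgue" using u by (simp add: Hs_iff)
  have "l2_mult (\<lambda>\<zeta>. inverse (Hs_root s \<zeta>)) (Hs_lift s u) = to_l2 (fourier u)"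
    unfolding Hs_lift_def l2_mult_to_l2[OF bounded_multiplier_inverse_root[OF s] Hs_root_fourier_L2[OF u]]
    by (simp add: mult.assoc[symmetric])
  then show ?thesis unfolding Hs_embed_def by (simp add: fourier_L2(2)[OF uL])
qed

lemma Hs_of_embed:
  assumes s: "0 \<le> s" and u: "u \<in> L2 lebesgue" "to_l2 u = Hs_embed s x"
  shows "u \<in> Hs s" "Hs_lift s u = x"
proof -
  have m: "bounded_multiplier (\<lambda>\<zeta>. inverse (Hs_root s \<zeta>))" by (rule bounded_multiplier_inverse_root[OF s])
  obtain f where f: "f \<in> L2 lebesgue" "x = to_l2 f" by (rule l2_cases)
  have "to_l2 (fourier u) = to_l2 (\<lambda>\<zeta>. inverse (Hs_root s \<zeta>) * f \<zeta>)"
    unfolding fourier_L2(2)[OF u(1)] u(2) Hs_embed_def f by (simp add: l2_mult_to_l2[OF m f(1)])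
  then have "AE \<zeta> in lebesgue. fourier u \<zeta> = inverse (Hs_root s \<zeta>) * f \<zeta>"
    using to_l2_eq_iff[OF fourier_L2(1)[OF u(1)] L2_multiplier[OF m f(1)]] by blast
  then have eq: "AE \<zeta> in lebesgue. f \<zeta> = Hs_root s \<zeta> * fourier u \<zeta>"
    by eventually_elim simp
  have L: "(\<lambda>\<zeta>. Hs_root s \<zeta> * fourier u \<zeta>) \<in> L2 lebesgue"
    by (rule L2_cong_AE[OF f(1) _ eq])
      (intro borel_measurable_times borel_imp_lebesgue[OF Hs_root_measurable] L2_measurable fourier_L2 u(1))
  then show "u \<in> Hs s"
    using u(1) L2_integrable[OF L] by (simp add: Hs_iff norm_mult power_mult_distrib Hs_root_def less_imp_le)
  show "Hs_lift s u = x" unfolding Hs_lift_def f by (rule to_l2_cong[OF L f(1)]) (use eq in \<open>auto elim: eventually_mono\<close>)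
qed

lemma Hs_embed_mult_const:
  assumes s: "0 \<le> s"
  shows "Hs_embed s (l2_mult (\<lambda>_. a) x) = l2_mult (\<lambda>_. a) (Hs_embed s x)"
proof (rule injD[OF inj_l2_ft])
  have m: "bounded_multiplier (\<lambda>\<zeta>. inverse (Hs_root s \<zeta>))" by (rule bounded_multiplier_inverse_root[OF s])
  obtain f where f: "f \<in> L2 lebesgue" "x = to_l2 f" by (rule l2_cases)
  show "l2_ft (Hs_embed s (l2_mult (\<lambda>_. a) x)) = l2_ft (l2_mult (\<lambda>_. a) (Hs_embed s x))"
    unfolding l2_ft_mult_const Hs_embed_def l2_ft_ift f(2)
    by (simp add: l2_mult_to_l2 m f(1) L2_cmult L2_multiplier mult.left_commute)
qed

text \<open>The complement of the support is a union of possibly uncountably many open sets on which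
  \<open>u\<close> vanishes; by Lindelof's theorem countably many suffice, so the exceptional null
  sets add up to a null set.\<close>

lemma vanishes_on_closed_supp_iff:
  assumes "closed E"
  shows "supp u \<subseteq> E \<longleftrightarrow> vanishes_on u (- E)"
proof
  assume sub: "supp u \<subseteq> E"
  let ?F = "{U. open U \<and> vanishes_on u U}"
  obtain F' where F': "F' \<subseteq> ?F" "countable F'" "\<Union>F' = \<Union>?F"
    using Lindelof[of ?F] by auto
  have "AE z in lebesgue. \<forall>U\<in>F'. z \<in> U \<longrightarrow> u z = 0"
    using F' by (subst AE_ball_countable) (auto simp: vanishes_on_def)
  moreover have "- E \<subseteq> \<Union>F'" using sub F'(3) by (auto simp: supp_def)
  ultimately show "vanishes_on u (- E)" unfolding vanishes_on_def by (auto elim!: eventually_mono)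
next
  assume "vanishes_on u (- E)"
  then show "supp u \<subseteq> E" using assms by (auto simp: supp_def)
qed

text \<open>The symbol of order s divided by the weight of \<open>Hs s\<close>: in lifted
  coordinates the unbounded operator becomes a multiplier bounded by 1.\<close>

definition heat_form_symbol :: "real \<Rightarrow> 'n::finite spacetime \<Rightarrow> complex" where
  "heat_form_symbol s \<zeta> = heat_symbol \<zeta> powr complex_of_real s / complex_of_real (Hs_weight s \<zeta>)"

lemma heat_symbol_powr_measurable [measurable]:
  "(\<lambda>\<zeta>. heat_symbol \<zeta> powr complex_of_real a) \<in> borel_measurable borel"
proof -
  let ?A = "{\<zeta>. heat_symbol \<zeta> \<noteq> 0}"
  have "open ?A" using continuous_heat_symbol by (intro open_Collect_neq continuous_intros)
  \<comment> \<open>The values lie in the closed right half plane, so off zero they avoid the branch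
    cut; at zero the power is 0.\<close>
  moreover have "heat_symbol \<zeta> \<notin> \<real>\<^sub>\<le>\<^sub>0" if "heat_symbol \<zeta> \<noteq> 0" for \<zeta> :: "'a spacetime"
    using that Re_heat_symbol[of \<zeta>] by (auto simp: complex_nonpos_Reals_iff complex_eq_iff)
  then have "continuous_on ?A (\<lambda>\<zeta>. heat_symbol \<zeta> powr complex_of_real a)"
    by (intro continuous_on_powr_complex continuous_heat_symbol continuous_intros) (auto simp: Re_heat_symbol)
  ultimately have "(\<lambda>\<zeta>. if \<zeta> \<in> ?A then heat_symbol \<zeta> powr complex_of_real a else 0) \<in> borel_measurable borel"
    by (intro borel_measurable_continuous_on_if) auto
  then show ?thesis by (rule measurable_cong[THEN iffD1, rotated]) auto
qed

lemma norm_heat_symbol_powr: "cmod (heat_symbol \<zeta> powr complex_of_real a) = cmod (heat_symbol \<zeta>) powr a"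
proof (cases "heat_symbol \<zeta> = 0")
  case False
  then show ?thesis by (simp add: norm_powr_real_powr' powr_def norm_exp_eq_Re)
qed simp

lemma heat_symbol_powr_le_weight: "0 \<le> s \<Longrightarrow> cmod (heat_symbol \<zeta>) powr s \<le> Hs_weight s \<zeta>"
  unfolding Hs_weight_def by (rule powr_mono2) auto

lemma bounded_multiplier_heat_form_symbol: "0 \<le> s \<Longrightarrow> bounded_multiplier (heat_form_symbol s)"
  unfolding heat_form_symbol_def[abs_def]
  by (rule bounded_multiplierI[where C = 1])
    (auto intro!: borel_imp_lebesgue simp: norm_divide norm_heat_symbol_powr heat_symbol_powr_le_weight less_imp_le)

text \<open>The adjoint symbol is the conjugate of the symbol, and the inner product conjugates its
  second entry; so the two half powers multiply to the full power s. Plancherel accounts for the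
  constant.\<close>

lemma frac_heat_cinner:
  assumes s: "0 \<le> s" and u: "u \<in> Hs s" and w: "w \<in> Hs s"
  shows "complex_of_real (fourier_const TYPE('n::finite spacetime)) * L2_inner lebesgue (frac_heat (s / 2) u) (frac_heat_adj (s / 2) w)
    = l2_cinner (l2_mult (heat_form_symbol s) (Hs_lift s u)) (Hs_lift s (w :: 'n spacetime \<Rightarrow> complex))"
proof -
  let ?m = "\<lambda>\<zeta>. heat_symbol \<zeta> powr complex_of_real (s / 2)"
  let ?n = "\<lambda>\<zeta>. cnj (heat_symbol \<zeta>) powr complex_of_real (s / 2)"
  have nm: "?n \<zeta> = cnj (?m \<zeta>)" for \<zeta> :: "'n spacetime"
  proof -
    have "cnj (?n \<zeta>) = ?m \<zeta>" by (rule cnj_powr_of_real) (simp add: Re_heat_symbol)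
    then show ?thesis by (metis complex_cnj_cnj)
  qed
  have bd: "cmod (?m \<zeta>) \<le> cmod (Hs_root s \<zeta>)" for \<zeta> :: "'n spacetime"
  proof -
    have "(cmod (?m \<zeta>))\<^sup>2 = cmod (heat_symbol \<zeta>) powr s"
      unfolding norm_heat_symbol_powr by (simp add: power2_eq_square flip: powr_add)
    also have "\<dots> \<le> (cmod (Hs_root s \<zeta>))\<^sup>2"
      using heat_symbol_powr_le_weight[OF s] by (simp add: Hs_root_def less_imp_le)
    finally show ?thesis by (rule power2_le_imp_le) simp
  qed
  have prod: "(\<lambda>\<zeta>. k \<zeta> * fourier v \<zeta>) \<in> L2 lebesgue"
    if v: "v \<in> Hs s" and k: "k \<in> borel_measurable borel" "\<And>\<zeta>. cmod (k \<zeta>) \<le> cmod (Hs_root s \<zeta>)" for v k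
  proof (rule L2_bound[OF _ L2_integrable[OF Hs_root_fourier_L2[OF v]]])
    show "(\<lambda>\<zeta>. k \<zeta> * fourier v \<zeta>) \<in> borel_measurable lebesgue"
      using v by (intro borel_measurable_times borel_imp_lebesgue[OF k(1)] L2_measurable fourier_L2) (auto simp: Hs_iff)
    show "AE \<zeta> in lebesgue. (cmod (k \<zeta> * fourier v \<zeta>))\<^sup>2 \<le> (cmod (Hs_root s \<zeta> * fourier v \<zeta>))\<^sup>2"
      unfolding norm_mult using k(2) by (intro AE_I2 power_mono mult_right_mono) auto
  qed
  have mu: "(\<lambda>\<zeta>. ?m \<zeta> * fourier u \<zeta>) \<in> L2 lebesgue" by (rule prod[OF u _ bd]) measurable
  have nw: "(\<lambda>\<zeta>. ?n \<zeta> * fourier w \<zeta>) \<in> L2 lebesgue"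
    unfolding nm by (rule prod[OF w borel_measurable_cnj[OF heat_symbol_powr_measurable]]) (simp only: complex_mod_cnj bd)
  have "complex_of_real (fourier_const TYPE('n spacetime)) * L2_inner lebesgue (frac_heat (s / 2) u) (frac_heat_adj (s / 2) w)
     = l2_cinner (to_l2 (\<lambda>\<zeta>. ?m \<zeta> * fourier u \<zeta>)) (to_l2 (\<lambda>\<zeta>. ?n \<zeta> * fourier w \<zeta>))"
    unfolding frac_heat_eq frac_heat_adj_eq fourier_multiplier_L2(2)[OF mu, symmetric] fourier_multiplier_L2(2)[OF nw, symmetric]
      l2_cinner_ft l2_cinner_to_l2[OF fourier_multiplier_L2(1)[OF mu] fourier_multiplier_L2(1)[OF nw]] ..
  also have "\<dots> = (LINT \<zeta>|lebesgue. (?m \<zeta> * fourier u \<zeta>) * cnj (?n \<zeta> * fourier w \<zeta>))"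
    by (simp only: l2_cinner_to_l2[OF mu nw] L2_inner_def)
  also have "\<dots> = (LINT \<zeta>|lebesgue. (heat_form_symbol s \<zeta> * (Hs_root s \<zeta> * fourier u \<zeta>)) * cnj (Hs_root s \<zeta> * fourier w \<zeta>))"
  proof (rule Bochner_Integration.integral_cong)
    fix \<zeta> :: "'n spacetime"
    have "?m \<zeta> * ?m \<zeta> = heat_symbol \<zeta> powr complex_of_real s"
      by (simp flip: powr_add of_real_add)
    moreover have "heat_symbol \<zeta> powr complex_of_real s = heat_form_symbol s \<zeta> * (Hs_root s \<zeta> * Hs_root s \<zeta>)"
      using Hs_weight_pos[of s \<zeta>] by (simp add: heat_form_symbol_def Hs_root_def less_imp_le flip: of_real_mult)
    ultimately have "?m \<zeta> * ?m \<zeta> = heat_form_symbol s \<zeta> * (Hs_root s \<zeta> * Hs_root s \<zeta>)" by simp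
    moreover have "cnj (Hs_root s \<zeta>) = Hs_root s \<zeta>" by (simp add: Hs_root_def)
    ultimately show "(?m \<zeta> * fourier u \<zeta>) * cnj (?n \<zeta> * fourier w \<zeta>)
        = (heat_form_symbol s \<zeta> * (Hs_root s \<zeta> * fourier u \<zeta>)) * cnj (Hs_root s \<zeta> * fourier w \<zeta>)"
      unfolding nm by (simp add: mult.assoc mult.left_commute)
  qed simp
  also have "\<dots> = l2_cinner (l2_mult (heat_form_symbol s) (Hs_lift s u)) (Hs_lift s w)"
    unfolding Hs_lift_def l2_mult_to_l2[OF bounded_multiplier_heat_form_symbol[OF s] Hs_root_fourier_L2[OF u]]
    by (simp only: l2_cinner_to_l2[OF L2_multiplier[OF bounded_multiplier_heat_form_symbol[OF s] Hs_root_fourier_L2[OF u]]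
        Hs_root_fourier_L2[OF w]] L2_inner_def)
  finally show ?thesis .
qed

section \<open>The weak formulation\<close>

lemma closure_cyl_compact: "bounded A \<Longrightarrow> compact (closure (cyl T A))"
  unfolding cyl_def by (intro compact_closure[THEN iffD2] bounded_Times) auto

lemma open_cyl: "open A \<Longrightarrow> open (cyl T A)"
  unfolding cyl_def by (intro open_Times) auto

lemma closed_kernel_l2_mult:
  assumes "bounded_linear f" "bounded_multiplier b"
  shows "closed {x. l2_mult b (f x) = 0}" "subspace {x. l2_mult b (f x) = 0}"
proof -
  interpret bounded_linear "\<lambda>x. l2_mult b (f x)"
    by (rule bounded_linear_compose[OF bounded_linear_l2_mult[OF assms(2)] assms(1)])
  show "closed {x. l2_mult b (f x) = 0}"
    by (intro closed_Collect_eq continuous_intros continuous_on)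
  show "subspace {x. l2_mult b (f x) = 0}"
    by (auto simp: subspace_def add scaleR zero)
qed

lemma vanishes_on_l2_mult:
  assumes "A \<in> sets lebesgue"
  shows "bounded_multiplier (indicator A)" "u \<in> L2 lebesgue \<Longrightarrow> l2_mult (indicator A) (to_l2 u) = 0 \<longleftrightarrow> vanishes_on u A"
proof -
  show m: "bounded_multiplier (indicator A)"
    using assms by (intro bounded_multiplierI[where C = 1] borel_measurable_indicator) (auto simp: indicator_def)
  assume u: "u \<in> L2 lebesgue"
  have "l2_mult (indicator A) (to_l2 u) = 0 \<longleftrightarrow> (AE z in lebesgue. indicator A z * u z = 0)"
    unfolding l2_mult_to_l2[OF m u] zero_l2_def by (rule to_l2_eq_iff[OF L2_multiplier[OF m u] L2_zero])
  also have "\<dots> \<longleftrightarrow> vanishes_on u A" unfolding vanishes_on_def by (intro arg_cong[where f = "\<lambda>P. eventually P _"]) (auto simp: indicator_def fun_eq_iff)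
  finally show "l2_mult (indicator A) (to_l2 u) = 0 \<longleftrightarrow> vanishes_on u A" .
qed

lemma l2_mult_mult:
  assumes "bounded_multiplier a" "bounded_multiplier b"
  shows "l2_mult a (l2_mult b x) = l2_mult (\<lambda>z. a z * b z) x"
proof -
  obtain f where f: "f \<in> L2 lebesgue" "x = to_l2 f" by (rule l2_cases)
  have "bounded_multiplier (\<lambda>z. a z * b z)"
  proof -
    obtain C D where C: "AE z in lebesgue. cmod (a z) \<le> C" and D: "AE z in lebesgue. cmod (b z) \<le> D"
      using assms by (auto simp: bounded_multiplier_def)
    have "AE z in lebesgue. cmod (a z * b z) \<le> C * D"
      using C D by eventually_elim (auto simp: norm_mult intro!: mult_mono intro: order_trans[OF norm_ge_zero])
    then show ?thesis using assms by (auto simp: bounded_multiplier_def)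
  qed
  then show ?thesis using assms f by (simp add: l2_mult_to_l2 L2_multiplier mult.assoc)
qed

text \<open>Subadditivity of the power: a \<le> a^s on [0, 1], applied to the two parts 1 / (1 + x)
  and x / (1 + x) of 1.\<close>

lemma one_plus_powr_le:
  assumes x: "0 \<le> x" and s: "0 < s" "s \<le> 1"
  shows "(1 + x) powr s \<le> 1 + x powr (s :: real)"
proof -
  have le: "a \<le> a powr s" if "0 \<le> a" "a \<le> 1" for a :: real
    using powr_mono'[of s 1 a] that s by (cases "a = 0") auto
  have "1 = 1 / (1 + x) + x / (1 + x)" using x by (simp add: field_simps)
  also have "\<dots> \<le> (1 / (1 + x)) powr s + (x / (1 + x)) powr s" using x by (intro add_mono le) (auto simp: field_simps)
  also have "\<dots> = (1 + x powr s) / (1 + x) powr s" using x by (simp add: powr_divide add_divide_distrib)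
  finally show ?thesis using x by (simp add: field_simps)
qed

section \<open>The bilinear form of the problem in lifted coordinates\<close>

locale frac_heat_problem =
  fixes s T :: real and \<Omega> :: "(real ^ 'n::finite) set" and Q :: "'n spacetime \<Rightarrow> real"
  assumes s: "0 < s" "s < 1" and T: "0 < T" and \<Omega>: "open \<Omega>" "bounded \<Omega>"
    and Q: "Q \<in> Linf (lebesgue_on (cyl T \<Omega>))"
begin

abbreviation "E \<equiv> closure (cyl T \<Omega>)"

abbreviation J :: "'n spacetime l2 \<Rightarrow> 'n spacetime l2" where "J \<equiv> Hs_embed s"

text \<open>\<open>Q\<close> is arbitrary off the cylinder; the cutoff makes it a bounded multiplier
  on all of space-time.\<close>

definition pot :: "'n spacetime \<Rightarrow> complex" where
  "pot z = indicator (cyl T \<Omega>) z * complex_of_real (Q z)"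

text \<open>The test space \<open>Hs_supp s E\<close> in lifted coordinates, see
  \<open>Hs_supp_iff\<close>. As the kernel of a bounded operator it is visibly a closed
  subspace.\<close>

definition V :: "'n spacetime l2 set" where
  "V = {x. l2_mult (indicator (- E)) (J x) = 0}"

definition cform :: "'n spacetime l2 \<Rightarrow> 'n spacetime l2 \<Rightarrow> complex" where
  "cform x y = l2_cinner (l2_mult (heat_form_symbol s) x) y / complex_of_real (fourier_const TYPE('n spacetime))
    + l2_cinner (l2_mult pot (J x)) (J y)"

definition form :: "'n spacetime l2 \<Rightarrow> 'n spacetime l2 \<Rightarrow> real" where
  "form x y = (l2_mult (heat_form_symbol s) x \<bullet> y) / fourier_const TYPE('n spacetime) + l2_mult pot (J x) \<bullet> J y"

lemma s0: "0 \<le> s" using s by simp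

sublocale J: bounded_linear J by (rule bounded_linear_Hs_embed[OF s0])

lemma cyl_meas: "cyl T \<Omega> \<in> sets lebesgue"
  using open_cyl[OF \<Omega>(1)] by (intro sets_completionI_sets) auto

lemma pot_bound: "\<exists>C\<ge>0. AE z in lebesgue. cmod (pot z) \<le> C"
proof -
  obtain C where "AE z in lebesgue_on (cyl T \<Omega>). \<bar>Q z\<bar> \<le> C" using Q by (auto simp: Linf_def)
  then have "AE z in lebesgue. z \<in> cyl T \<Omega> \<longrightarrow> \<bar>Q z\<bar> \<le> C"
    using cyl_meas by (subst (asm) AE_restrict_space_iff) auto
  then have "AE z in lebesgue. cmod (pot z) \<le> max C 0"
    by eventually_elim (auto simp: pot_def indicator_def)
  then show ?thesis by (intro exI[of _ "max C 0"]) auto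
qed

lemma pot_multiplier: "bounded_multiplier pot"
proof -
  have "Q \<in> borel_measurable (lebesgue_on (cyl T \<Omega>))" using Q by (simp add: Linf_def)
  then have "(\<lambda>z. indicator (cyl T \<Omega>) z *\<^sub>R Q z) \<in> borel_measurable lebesgue"
    using cyl_meas by (subst (asm) borel_measurable_restrict_space_iff) auto
  then have "(\<lambda>z. complex_of_real (indicator (cyl T \<Omega>) z *\<^sub>R Q z)) \<in> borel_measurable lebesgue"
    by (rule measurable_compose[where g = complex_of_real]) (intro borel_measurable_continuous_onI continuous_intros)
  also have "(\<lambda>z. complex_of_real (indicator (cyl T \<Omega>) z *\<^sub>R Q z)) = pot" by (auto simp: pot_def indicator_def)
  finally show ?thesis using pot_bound by (auto simp: bounded_multiplier_def)
qed

lemma compl_E_meas: "- E \<in> sets lebesgue"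
  by (intro sets_completionI_sets) auto

lemma V_closed: "closed V" and V_subspace: "subspace V"
  unfolding V_def using closed_kernel_l2_mult[OF J.bounded_linear_axioms vanishes_on_l2_mult(1)[OF compl_E_meas]] by auto

lemma V_iff: "u \<in> L2 lebesgue \<Longrightarrow> to_l2 u = J x \<Longrightarrow> x \<in> V \<longleftrightarrow> supp u \<subseteq> E"
  unfolding V_def by (simp add: vanishes_on_closed_supp_iff vanishes_on_l2_mult(2)[OF compl_E_meas, symmetric])

lemma Hs_supp_iff: "u \<in> Hs_supp s E \<longleftrightarrow> u \<in> Hs s \<and> Hs_lift s u \<in> V"
  using V_iff[of u "Hs_lift s u"] Hs_embed_lift[OF s0, of u] by (auto simp: Hs_supp_def Hs_iff)

lemma V_I: "x \<in> V \<Longrightarrow> l2_mult (\<lambda>_. a) x \<in> V"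
proof -
  assume x: "x \<in> V"
  have m: "bounded_multiplier (indicator (- E) :: _ \<Rightarrow> complex)" by (rule vanishes_on_l2_mult(1)[OF compl_E_meas])
  interpret a: bounded_linear "l2_mult (\<lambda>_. a) :: 'n spacetime l2 \<Rightarrow> _" by (rule bounded_linear_l2_mult) simp
  have "l2_mult (indicator (- E)) (l2_mult (\<lambda>_. a) (J x)) = l2_mult (\<lambda>_. a) (l2_mult (indicator (- E)) (J x))"
    by (simp add: l2_mult_mult m mult.commute)
  then show ?thesis using x by (simp add: V_def Hs_embed_mult_const[OF s0] a.zero)
qed

lemma bounded_bilinear_form: "bounded_bilinear form"
proof -
  have "bounded_linear (\<lambda>x. l2_mult (heat_form_symbol s) x /\<^sub>R fourier_const TYPE('n spacetime))"
    by (intro bounded_linear_compose[OF bounded_linear_scaleR_right] bounded_linear_l2_mult bounded_multiplier_heat_form_symbol s0)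
  from bounded_bilinear.comp[OF bounded_bilinear_inner this bounded_linear_ident]
  have bb: "bounded_bilinear (\<lambda>x y :: 'n spacetime l2. (l2_mult (heat_form_symbol s) x /\<^sub>R fourier_const TYPE('n spacetime)) \<bullet> y)" .
  have eq: "(a /\<^sub>R r) \<bullet> y = (a \<bullet> y) / r" for a y :: "'n spacetime l2" and r
    by (simp only: inner_scaleR_left divide_inverse mult.commute)
  from bb have 1: "bounded_bilinear (\<lambda>x y :: 'n spacetime l2. (l2_mult (heat_form_symbol s) x \<bullet> y) / fourier_const TYPE('n spacetime))"
    by (simp only: eq)
  have "bounded_linear (\<lambda>x. l2_mult pot (J x))"
    by (rule bounded_linear_compose[OF bounded_linear_l2_mult[OF pot_multiplier] J.bounded_linear_axioms])
  from bounded_bilinear.comp[OF bounded_bilinear_inner this J.bounded_linear_axioms]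
  have 2: "bounded_bilinear (\<lambda>x y. l2_mult pot (J x) \<bullet> J y)" .
  show ?thesis unfolding form_def[abs_def] by (rule bounded_bilinear_add[OF 1 2])
qed

sublocale form: bounded_bilinear form by (rule bounded_bilinear_form)

lemma Re_cform: "Re (cform x y) = form x y"
  by (simp add: cform_def form_def Re_l2_cinner del: of_real_power flip: of_real_power)

lemma Im_cform: "Im (cform x y) = form x (l2_mult (\<lambda>_. \<i>) y)"
  by (simp add: cform_def form_def Im_l2_cinner Hs_embed_mult_const[OF s0] del: of_real_power flip: of_real_power)

lemma B_form_eq:
  assumes u: "u \<in> Hs s" and w: "w \<in> Hs s"
  shows "B_form s T \<Omega> Q u w = cform (Hs_lift s u) (Hs_lift s w)"
proof -
  have uL: "u \<in> L2 lebesgue" and wL: "w \<in> L2 lebesgue" using u w by (auto simp: Hs_iff)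
  have K: "complex_of_real (fourier_const TYPE('n spacetime)) \<noteq> 0" by simp
  have 1: "L2_inner lebesgue (frac_heat (s / 2) u) (frac_heat_adj (s / 2) w)
      = l2_cinner (l2_mult (heat_form_symbol s) (Hs_lift s u)) (Hs_lift s w) / complex_of_real (fourier_const TYPE('n spacetime))"
    unfolding frac_heat_cinner[OF s0 u w, symmetric] using K by (simp del: of_real_power of_real_mult of_real_numeral)
  have "L2_inner (lebesgue_on (cyl T \<Omega>)) (\<lambda>z. complex_of_real (Q z) * u z) w
      = (LINT z|lebesgue. indicator (cyl T \<Omega>) z *\<^sub>R (complex_of_real (Q z) * u z * cnj (w z)))"
    unfolding L2_inner_def using cyl_meas by (intro integral_restrict_space) auto
  also have "\<dots> = (LINT z|lebesgue. (pot z * u z) * cnj (w z))"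
    by (rule Bochner_Integration.integral_cong) (auto simp: pot_def indicator_def)
  also have "\<dots> = l2_cinner (l2_mult pot (to_l2 u)) (to_l2 w)"
    unfolding l2_mult_to_l2[OF pot_multiplier uL] l2_cinner_to_l2[OF L2_multiplier[OF pot_multiplier uL] wL] L2_inner_def ..
  finally show ?thesis
    unfolding B_form_def cform_def 1 Hs_embed_lift[OF s0 u] Hs_embed_lift[OF s0 w] by simp
qed

text \<open>\<open>form\<close> is the real part of the sesquilinear form. Since \<open>V\<close> is
  stable under multiplication by \<i>, a real part that vanishes on all of \<open>V\<close> forces
  the imaginary part to vanish too, and the complex equation is equivalent to a real one.\<close>

lemma solves_iff:
  "solves s T \<Omega> Q u \<longleftrightarrow> u \<in> Hs s \<and> (\<forall>y\<in>V. form (Hs_lift s u) y = 0)"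
proof (intro iffI conjI ballI; (elim conjE)?)
  assume u: "solves s T \<Omega> Q u"
  then show uH: "u \<in> Hs s" by (simp add: solves_def)
  fix y assume y: "y \<in> V"
  define w where "w = of_l2 (J y)"
  have "w \<in> Hs s" "Hs_lift s w = y" using Hs_of_embed[OF s0, of w y] by (auto simp: w_def)
  then have "w \<in> Hs_supp s E" using y by (simp add: Hs_supp_iff)
  then have "B_form s T \<Omega> Q u w = 0" using u by (simp add: solves_def)
  then have "cform (Hs_lift s u) y = 0" using B_form_eq[OF uH \<open>w \<in> Hs s\<close>] \<open>Hs_lift s w = y\<close> by simp
  then show "form (Hs_lift s u) y = 0" by (metis Re_cform zero_complex.sel(1))
next
  assume uH: "u \<in> Hs s" and u: "\<forall>y\<in>V. form (Hs_lift s u) y = 0"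
  show "solves s T \<Omega> Q u"
    unfolding solves_def
  proof (intro conjI ballI uH)
    fix w assume "w \<in> Hs_supp s E"
    then have w: "w \<in> Hs s" "Hs_lift s w \<in> V" by (auto simp: Hs_supp_iff)
    then have "form (Hs_lift s u) (Hs_lift s w) = 0" "form (Hs_lift s u) (l2_mult (\<lambda>_. \<i>) (Hs_lift s w)) = 0"
      using u V_I by auto
    then show "B_form s T \<Omega> Q u w = 0"
      unfolding B_form_eq[OF uH w(1)] by (simp add: complex_eq_iff Re_cform Im_cform)
  qed
qed

lemma K_norm_J: "fourier_const TYPE('n spacetime) * (norm (J x))\<^sup>2 = (norm (l2_mult (\<lambda>\<zeta>. inverse (Hs_root s \<zeta>)) x))\<^sup>2"
  unfolding Hs_embed_def by (rule norm_l2_ift)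

lemma angle: "0 < pi * s / 2" "pi * s / 2 < pi / 2"
  using s by auto

text \<open>The symbol lies in the closed right half plane, so its power has an argument of modulus
  at most pi s / 2 < pi / 2. That |z|^s is at least the weight minus 1 is subadditivity of the
  power.\<close>

lemma Re_heat_form_symbol_ge:
  "cos (pi * s / 2) * (1 - inverse (Hs_weight s \<zeta>)) \<le> Re (heat_form_symbol s \<zeta>)"
proof -
  have cpos: "0 \<le> cos (pi * s / 2)" using angle by (intro cos_ge_zero) linarith+
  let ?z = "heat_symbol \<zeta>"
  have 1: "Hs_weight s \<zeta> - 1 \<le> cmod ?z powr s"
  proof -
    have "(1 + cmod ?z) powr s \<le> 1 powr s + cmod ?z powr s"
      using one_plus_powr_le[of "cmod ?z" s] s by simp
    then show ?thesis by (simp add: Hs_weight_def)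
  qed
  have 2: "cos (pi * s / 2) * (cmod ?z powr s) \<le> Re (?z powr complex_of_real s)"
  proof (cases "?z = 0")
    case False
    have "\<bar>Im (Ln ?z)\<bar> \<le> pi / 2"
      using Re_Ln_pos_le[OF False] Re_heat_symbol[of \<zeta>] by simp
    then have "\<bar>s * Im (Ln ?z)\<bar> \<le> pi * s / 2" using s by (simp add: abs_mult field_simps)
    then have "cos (pi * s / 2) \<le> cos \<bar>s * Im (Ln ?z)\<bar>"
      using angle by (intro cos_monotone_0_pi_le) linarith+
    then have "cos (pi * s / 2) \<le> cos (s * Im (Ln ?z))" by simp
    moreover have "Re (?z powr complex_of_real s) = cmod ?z powr s * cos (s * Im (Ln ?z))"
      using False by (simp add: powr_def Re_exp Ln_of_real' mult.commute)
    ultimately show ?thesis by (simp add: mult.commute mult_left_mono)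
  qed simp
  have "cos (pi * s / 2) * (Hs_weight s \<zeta> - 1) \<le> Re (?z powr complex_of_real s)"
    using mult_left_mono[OF 1 cpos] 2 by linarith
  then have "cos (pi * s / 2) * (Hs_weight s \<zeta> - 1) / Hs_weight s \<zeta> \<le> Re (?z powr complex_of_real s) / Hs_weight s \<zeta>"
    by (intro divide_right_mono) (auto simp: less_imp_le)
  moreover have "cos (pi * s / 2) * (Hs_weight s \<zeta> - 1) / Hs_weight s \<zeta> = cos (pi * s / 2) * (1 - inverse (Hs_weight s \<zeta>))"
    by (simp add: field_simps)
  ultimately show ?thesis by (simp add: heat_form_symbol_def)
qed

text \<open>Garding's inequality. Two defects are measured by \<open>J x\<close>: the weight exceeds
  |z|^s by at most 1, and the potential is a bounded operator on L^2.\<close>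

lemma form_coercive:
  obtains c C where "0 < c" "0 \<le> C" "\<And>x. c * (norm x)\<^sup>2 - C * (norm (J x))\<^sup>2 \<le> form x x"
proof -
  let ?K = "fourier_const TYPE('n spacetime)" and ?c = "cos (pi * s / 2)"
  have K: "0 < ?K" by simp
  have c: "0 < ?c" using angle by (intro cos_gt_zero_pi) linarith+
  obtain D where D: "D \<ge> 0" "AE z in lebesgue. cmod (pot z) \<le> D" using pot_bound by blast
  have est: "(?c / ?K) * (norm x)\<^sup>2 - (?c + D) * (norm (J x))\<^sup>2 \<le> form x x" for x
  proof -
    obtain f where f: "f \<in> L2 lebesgue" "x = to_l2 f" by (rule l2_cases)
    have ms: "bounded_multiplier (heat_form_symbol s :: 'n spacetime \<Rightarrow> complex)"
      by (rule bounded_multiplier_heat_form_symbol[OF s0])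
    have mi: "bounded_multiplier (\<lambda>\<zeta> :: 'n spacetime. inverse (Hs_root s \<zeta>))" by (rule bounded_multiplier_inverse_root[OF s0])
    have i1: "integrable lebesgue (\<lambda>z. (cmod (f z))\<^sup>2)" by (rule L2_integrable[OF f(1)])
    have i2: "integrable lebesgue (\<lambda>z. (cmod (inverse (Hs_root s z) * f z))\<^sup>2)" by (rule L2_integrable[OF L2_multiplier[OF mi f(1)]])
    have i3: "integrable lebesgue (\<lambda>z. (heat_form_symbol s z * f z) * cnj (f z))"
      by (rule L2_integrable_mult[OF L2_multiplier[OF ms f(1)] f(1)])
    have "?c * (norm x)\<^sup>2 - ?c * (?K * (norm (J x))\<^sup>2)
        = (LINT z|lebesgue. ?c * (cmod (f z))\<^sup>2 - ?c * (cmod (inverse (Hs_root s z) * f z))\<^sup>2)"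
      unfolding K_norm_J f(2) l2_mult_to_l2[OF mi f(1)] norm_to_l2_sq[OF f(1)] norm_to_l2_sq[OF L2_multiplier[OF mi f(1)]]
      using i1 i2 by simp
    also have "\<dots> \<le> (LINT z|lebesgue. Re ((heat_form_symbol s z * f z) * cnj (f z)))"
    proof (rule integral_mono)
      fix z :: "'n spacetime"
      have "(cmod (inverse (Hs_root s z)))\<^sup>2 = inverse (Hs_weight s z)"
        by (simp add: norm_inverse Hs_root_def power_inverse less_imp_le)
      then have "?c * (cmod (f z))\<^sup>2 - ?c * (cmod (inverse (Hs_root s z) * f z))\<^sup>2
          = ?c * (1 - inverse (Hs_weight s z)) * (cmod (f z))\<^sup>2"
        by (simp add: norm_mult power_mult_distrib algebra_simps del: norm_inverse)
      also have "\<dots> \<le> Re (heat_form_symbol s z) * (cmod (f z))\<^sup>2"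
        by (intro mult_right_mono Re_heat_form_symbol_ge) simp
      also have "\<dots> = Re (heat_form_symbol s z * complex_of_real ((cmod (f z))\<^sup>2))" by simp
      also have "\<dots> = Re ((heat_form_symbol s z * f z) * cnj (f z))"
        unfolding complex_norm_square by (simp only: mult.assoc)
      finally show "?c * (cmod (f z))\<^sup>2 - ?c * (cmod (inverse (Hs_root s z) * f z))\<^sup>2
          \<le> Re ((heat_form_symbol s z * f z) * cnj (f z))" .
    qed (intro Bochner_Integration.integrable_diff integrable_mult_right i1 i2 integrable_Re i3)+
    also have "\<dots> = l2_mult (heat_form_symbol s) x \<bullet> x"
      unfolding f(2) l2_mult_to_l2[OF ms f(1)] inner_to_l2[OF L2_multiplier[OF ms f(1)] f(1)]
      by (rule integral_Re[OF i3])
    finally have "(?c * (norm x)\<^sup>2 - ?c * (?K * (norm (J x))\<^sup>2)) / ?K \<le> (l2_mult (heat_form_symbol s) x \<bullet> x) / ?K"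
      using K by (intro divide_right_mono) auto
    moreover have "(?c * (norm x)\<^sup>2 - ?c * (?K * (norm (J x))\<^sup>2)) / ?K = (?c / ?K) * (norm x)\<^sup>2 - ?c * (norm (J x))\<^sup>2"
      using K by (simp add: diff_divide_distrib)
    moreover have "- (D * (norm (J x))\<^sup>2) \<le> l2_mult pot (J x) \<bullet> J x"
    proof -
      obtain h where h: "h \<in> L2 lebesgue" "J x = to_l2 h" by (rule l2_cases)
      have "norm (l2_mult pot (J x)) \<le> D * norm (J x)"
        unfolding h(2) l2_mult_to_l2[OF pot_multiplier h(1)]
        by (rule norm_to_l2_mult_le[OF h(1) L2_multiplier[OF pot_multiplier h(1)] _ D(1)])
          (use D(2) in eventually_elim, auto simp: norm_mult intro!: mult_right_mono)
      then have "norm (l2_mult pot (J x)) * norm (J x) \<le> D * norm (J x) * norm (J x)" by (rule mult_right_mono) simp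
      moreover have "\<bar>l2_mult pot (J x) \<bullet> J x\<bar> \<le> norm (l2_mult pot (J x)) * norm (J x)" by (rule Cauchy_Schwarz_ineq2)
      ultimately show ?thesis by (simp add: power2_eq_square)
    qed
    ultimately show ?thesis by (simp add: form_def algebra_simps)
  qed
  show ?thesis by (rule that[OF _ _ est]) (use c K D in auto)
qed

end

text \<open>The representative is Borel, integrable and zero everywhere off \<open>E\<close>, not
  merely almost everywhere, so its transform is a genuine integral with values at single
  frequencies.\<close>

lemma compact_support_representative:
  fixes y :: "'a::euclidean_space l2"
  assumes E: "compact E" and y: "l2_mult (indicator (- E)) y = 0"
  obtains u where "u \<in> L12" "y = to_l2 u" "\<And>z. z \<notin> E \<Longrightarrow> u z = 0"
proof -
  have Em: "E \<in> sets borel" using E by (simp add: borel_compact)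
  have cE: "- E \<in> sets lebesgue" using Em by (intro sets_completionI_sets) auto
  obtain f where f: "f \<in> L2 lborel" "y = to_l2 f" by (rule l2_borel_cases)
  have [measurable]: "f \<in> borel_measurable borel" using L2_measurable[OF f(1)] by simp
  have fL: "f \<in> L2 lebesgue" by (rule L2_lborel_imp_lebesgue[OF f(1)])
  define u where "u z = indicator E z * f z" for z
  have [measurable]: "u \<in> borel_measurable borel"
    unfolding u_def[abs_def] using Em by (intro borel_measurable_times borel_measurable_indicator) auto
  have uL: "u \<in> L2 lborel" unfolding u_def[abs_def]
    using Em by (intro L2_bounded_mult[OF f(1), where C = 1]) (auto simp: indicator_def)
  have "integrable lborel u"
  proof (rule Bochner_Integration.integrable_bound)
    show "integrable lborel (\<lambda>z. indicator E z + (cmod (f z))\<^sup>2)"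
      by (intro Bochner_Integration.integrable_add integrable_indicator_compact[OF E] L2_integrable[OF f(1)])
    have "t \<le> 1 + t\<^sup>2" for t :: real using zero_le_power2[of "t - 1/2"] by (simp add: power2_eq_square algebra_simps)
    then show "AE z in lborel. norm (u z) \<le> norm (indicator E z + (cmod (f z))\<^sup>2)"
      by (intro AE_I2) (auto simp: u_def indicator_def)
  qed measurable
  then have "u \<in> L12" using uL by (simp add: L12_def)
  moreover have "vanishes_on f (- E)" using y vanishes_on_l2_mult(2)[OF cE fL] f(2) by simp
  then have "AE z in lebesgue. f z = u z"
    unfolding vanishes_on_def by eventually_elim (auto simp: u_def indicator_def)
  then have "y = to_l2 u" unfolding f(2) by (intro to_l2_cong fL L2_lborel_imp_lebesgue[OF uL])
  ultimately show ?thesis using that by (auto simp: u_def)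
qed

lemma L1_le_L2_compact:
  fixes u :: "'a::euclidean_space \<Rightarrow> complex"
  assumes E: "compact E" and u: "u \<in> L12" "\<And>z. z \<notin> E \<Longrightarrow> u z = 0"
  shows "(LINT z|lborel. cmod (u z)) \<le> norm (to_l2 u) * norm (to_l2 (indicator E :: 'a \<Rightarrow> complex))"
proof -
  have [measurable]: "u \<in> borel_measurable borel" by (rule L12_measurable[OF u(1)])
  have Em: "E \<in> sets borel" using E by (simp add: borel_compact)
  have im: "(indicator E :: 'a \<Rightarrow> complex) \<in> borel_measurable borel" using Em by (intro borel_measurable_indicator) simp
  have iL: "(indicator E :: 'a \<Rightarrow> complex) \<in> L2 lebesgue"
  proof (rule L2_lborel_imp_lebesgue, rule L2_bound[OF _ integrable_indicator_compact[OF E]])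
    show "AE z in lborel. (cmod (indicator E z))\<^sup>2 \<le> indicator E z" by (auto simp: indicator_def)
  qed (use im in simp)
  have aL: "(\<lambda>z. complex_of_real (cmod (u z))) \<in> L2 lebesgue"
    by (rule L2_bound[OF _ L2_integrable[OF L12_L2(2)[OF u(1)]]]) (auto intro!: borel_imp_lebesgue)
  have "(LINT z|lborel. cmod (u z)) = (LINT z|lebesgue. cmod (u z))" by (rule integral_completion[symmetric]) measurable
  also have "\<dots> = (LINT z|lebesgue. Re (complex_of_real (cmod (u z)) * cnj (indicator E z)))"
    by (rule Bochner_Integration.integral_cong) (use u(2) in \<open>auto simp: indicator_def\<close>)
  also have "\<dots> = Re (LINT z|lebesgue. complex_of_real (cmod (u z)) * cnj (indicator E z))"
    by (rule integral_Re[OF L2_integrable_mult[OF aL iL]])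
  also have "\<dots> = to_l2 (\<lambda>z. complex_of_real (cmod (u z))) \<bullet> to_l2 (indicator E)" by (rule inner_to_l2[OF aL iL, symmetric])
  also have "\<dots> \<le> norm (to_l2 (\<lambda>z. complex_of_real (cmod (u z)))) * norm (to_l2 (indicator E :: 'a \<Rightarrow> complex))"
    by (rule norm_cauchy_schwarz)
  also have "norm (to_l2 (\<lambda>z. complex_of_real (cmod (u z)))) = norm (to_l2 u)"
    using aL L12_L2(2)[OF u(1)] by (simp add: norm_to_l2 L2_norm_def)
  finally show ?thesis .
qed

lemma norm_cis_diff_le: "cmod (cis a - cis b) \<le> \<bar>a - b\<bar>"
proof -
  have "cis a - cis b = cis b * (cis (a - b) - 1)" by (simp add: right_diff_distrib cis_mult)
  then have "cmod (cis a - cis b) = cmod (cis (a - b) - 1)" by (simp add: norm_mult)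
  also have "\<dots> \<le> \<bar>a - b\<bar>" using iexp_approx1[of "a - b" 0] by (simp add: cis_conv_exp)
  finally show ?thesis .
qed

lemma ft_lipschitz:
  fixes u :: "'a::euclidean_space \<Rightarrow> complex"
  assumes u: "u \<in> L12" "\<And>z. R < norm z \<Longrightarrow> u z = 0"
  shows "cmod (ft u \<zeta> - ft u \<eta>) \<le> R * norm (\<zeta> - \<eta>) * (LINT z|lborel. cmod (u z))"
proof -
  have [measurable]: "u \<in> borel_measurable borel" by (rule L12_measurable[OF u(1)])
  have i: "integrable lborel (\<lambda>z. cis (- (z \<bullet> \<zeta>)) * u z)" for \<zeta>
    by (rule integrable_cis_mult[OF L12_integrable[OF u(1)]]) measurable
  have "ft u \<zeta> - ft u \<eta> = (LINT z|lborel. (cis (- (z \<bullet> \<zeta>)) - cis (- (z \<bullet> \<eta>))) * u z)"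
    unfolding ft_def by (simp add: left_diff_distrib Bochner_Integration.integral_diff[OF i i])
  then have "cmod (ft u \<zeta> - ft u \<eta>) \<le> (LINT z|lborel. cmod ((cis (- (z \<bullet> \<zeta>)) - cis (- (z \<bullet> \<eta>))) * u z))"
    by (simp add: integral_norm_bound)
  also have "\<dots> \<le> (LINT z|lborel. R * norm (\<zeta> - \<eta>) * cmod (u z))"
  proof (rule Bochner_Integration.integral_mono')
    show "integrable lborel (\<lambda>z. R * norm (\<zeta> - \<eta>) * cmod (u z))"
      using L12_integrable[OF u(1)] by (intro integrable_mult_right integrable_norm)
    fix z :: 'a
    have "cmod (cis (- (z \<bullet> \<zeta>)) - cis (- (z \<bullet> \<eta>))) \<le> norm z * norm (\<zeta> - \<eta>)"
    proof -
      have "\<bar>- (z \<bullet> \<zeta>) - - (z \<bullet> \<eta>)\<bar> = \<bar>z \<bullet> (\<zeta> - \<eta>)\<bar>" by (simp add: inner_diff_right abs_minus_commute)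
      also have "\<dots> \<le> norm z * norm (\<zeta> - \<eta>)" by (rule Cauchy_Schwarz_ineq2)
      finally show ?thesis using norm_cis_diff_le order_trans by blast
    qed
    also have "norm z * norm (\<zeta> - \<eta>) * cmod (u z) \<le> R * norm (\<zeta> - \<eta>) * cmod (u z)"
      by (cases "R < norm z") (auto simp: u(2) intro!: mult_right_mono)
    finally show "cmod ((cis (- (z \<bullet> \<zeta>)) - cis (- (z \<bullet> \<eta>))) * u z) \<le> R * norm (\<zeta> - \<eta>) * cmod (u z)"
      by (simp add: norm_mult mult_right_mono)
    show "0 \<le> R * norm (\<zeta> - \<eta>) * cmod (u z)"
    proof (cases "R < norm z")
      case False
      then have "0 \<le> R" using norm_ge_zero[of z] by linarith
      then show ?thesis by simp
    qed (simp add: u(2))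
  qed
  finally show ?thesis by simp
qed

text \<open>A quantitative Rellich theorem: the Fourier transform of a compactly supported function is
  Lipschitz, so on a bounded set of frequencies it is controlled by finitely many of its values.\<close>

lemma Hs_embed_compact:
  fixes E :: "'n::finite spacetime set"
  assumes s: "0 < s" and E: "compact E" and \<delta>: "0 < \<delta>"
  obtains I :: "('n spacetime \<times> bool) set" and e :: "'n spacetime \<times> bool \<Rightarrow> 'n spacetime l2"
  where "finite I" "\<And>x. l2_mult (indicator (- E)) (Hs_embed s x) = 0 \<Longrightarrow>
    (norm (Hs_embed s x))\<^sup>2 \<le> \<delta> * (norm x)\<^sup>2 + (\<Sum>i\<in>I. (Hs_embed s x \<bullet> e i)\<^sup>2)"
proof -
  have s0: "0 \<le> s" using s by simp
  define K where "K = fourier_const TYPE('n spacetime)"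
  have K: "0 < K" by (simp add: K_def)
  \<comment> \<open>The factor K converts between the norms on the two sides of the transform; one
    half is given up when the low-frequency error is absorbed into the left-hand side.\<close>
  define \<eta> where "\<eta> = \<delta> * K / 2"
  have \<eta>: "0 < \<eta>" using \<delta> K by (simp add: \<eta>_def)
  obtain RE where RE: "RE > 0" "\<And>z. z \<in> E \<Longrightarrow> norm z \<le> RE"
    using compact_imp_bounded[OF E] by (auto simp: bounded_pos)
  define L where "L = RE * norm (to_l2 (indicator E :: 'n spacetime \<Rightarrow> complex))"
  have L: "0 \<le> L" using RE by (simp add: L_def)
  \<comment> \<open>Beyond this radius the weight is at least 1 / \<eta>, because it dominates
    |\<zeta>|^s.\<close>
  define R where "R = max 1 ((1 / \<eta>) powr (1 / s))"
  define B where "B = cball (0 :: 'n spacetime) R"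
  have highfreq: "inverse (Hs_weight s \<zeta>) \<le> \<eta>" if "\<zeta> \<notin> B" for \<zeta> :: "'n spacetime"
  proof -
    have R1: "R < norm \<zeta>" using that by (simp add: B_def)
    have "1 / \<eta> = ((1 / \<eta>) powr (1 / s)) powr s" using s \<eta> by (simp add: powr_powr)
    also have "\<dots> \<le> (norm \<zeta>) powr s" using R1 s by (intro powr_mono2) (auto simp: R_def)
    also have "\<dots> \<le> Hs_weight s \<zeta>" unfolding Hs_weight_def using s by (intro powr_mono2 norm_le_heat_symbol) auto
    finally have "1 / \<eta> \<le> Hs_weight s \<zeta>" .
    then show ?thesis using \<eta> by (simp add: field_simps inverse_eq_divide)
  qed
  define b where "b = measure lborel B"
  have b: "0 \<le> b" by (simp add: b_def)
  have iB: "integrable lborel (indicator B :: 'n spacetime \<Rightarrow> real)" unfolding B_def by (rule integrable_indicator_compact[OF compact_cball])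
  have imB: "(indicator B :: 'n spacetime \<Rightarrow> real) \<in> borel_measurable lborel"
    unfolding B_def by (intro borel_measurable_indicator) (simp add: borel_closed)
  \<comment> \<open>The mesh is chosen so that the Lipschitz error, integrated over the ball of
    volume b, is at most half of K |u|^2. Adding 1 to b and to L^2 avoids division by zero.\<close>
  define r where "r = sqrt (K / (4 * ((b + 1) * (L\<^sup>2 + 1))))"
  have bL: "0 < (b + 1) * (L\<^sup>2 + 1)" using b by (intro mult_pos_pos) (auto intro: add_nonneg_pos)
  have r: "0 < r" unfolding r_def by (intro real_sqrt_gt_zero divide_pos_pos K mult_pos_pos[of 4] bL) simp
  have r2: "b * (2 * r\<^sup>2 * L\<^sup>2) \<le> K / 2"
  proof -
    have "r\<^sup>2 = K / (4 * ((b + 1) * (L\<^sup>2 + 1)))" using r unfolding r_def by (simp only: real_sqrt_gt_0_iff real_sqrt_pow2 less_imp_le)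
    then have "b * (2 * r\<^sup>2 * L\<^sup>2) = (K / 2) * ((b * L\<^sup>2) / ((b + 1) * (L\<^sup>2 + 1)))" by simp
    also have "\<dots> \<le> (K / 2) * 1"
    proof (intro mult_left_mono)
      have "b * L\<^sup>2 \<le> (b + 1) * (L\<^sup>2 + 1)" using b by (intro mult_mono) auto
      then show "(b * L\<^sup>2) / ((b + 1) * (L\<^sup>2 + 1)) \<le> 1" using bL by simp
    qed (use K in auto)
    finally show ?thesis by simp
  qed
  obtain C where C: "finite C" "B \<subseteq> (\<Union>c\<in>C. ball c r)"
    using compact_cball[of "0 :: 'n spacetime" R] r unfolding compact_eq_totally_bounded B_def by blast
  define g where "g c z = indicator E z * cis (z \<bullet> c)" for c z :: "'n spacetime"
  define M where "M = sqrt (4 * b / K)"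
  \<comment> \<open>Pairing with these functions returns, up to the factor M, the real and the
    imaginary part of \<open>ft u c\<close>; the Boolean selects which. The value M^2 = 4 b / K is
    the factor met at the end of the estimate.\<close>
  define e where "e i = M *\<^sub>R to_l2 (\<lambda>z. (if snd i then \<i> else 1) * g (fst i) z)" for i
  have Em: "E \<in> sets borel" using E by (simp add: borel_compact)
  have gm: "g c \<in> borel_measurable borel" for c
    unfolding g_def[abs_def] using Em by (intro borel_measurable_times borel_measurable_indicator borel_measurable_cis) auto
  have gL: "g c \<in> L2 lebesgue" for c
  proof (rule L2_lborel_imp_lebesgue, rule L2_bound[OF _ integrable_indicator_compact[OF E]])
    show "AE z in lborel. (cmod (g c z))\<^sup>2 \<le> indicator E z" by (auto simp: g_def indicator_def)
  qed (use gm in simp)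
  have main: "(norm (Hs_embed s x))\<^sup>2 \<le> \<delta> * (norm x)\<^sup>2 + (\<Sum>i\<in>C \<times> UNIV. (Hs_embed s x \<bullet> e i)\<^sup>2)"
    if x: "l2_mult (indicator (- E)) (Hs_embed s x) = 0" for x
  proof -
    obtain u where u: "u \<in> L12" "Hs_embed s x = to_l2 u" "\<And>z. z \<notin> E \<Longrightarrow> u z = 0"
      using compact_support_representative[OF E x] by blast
    have [measurable]: "u \<in> borel_measurable borel" by (rule L12_measurable[OF u(1)])
    have uL: "u \<in> L2 lebesgue" by (rule L12_L2(2)[OF u(1)])
    obtain f where f: "f \<in> L2 lborel" "x = to_l2 f" by (rule l2_borel_cases)
    have fL: "f \<in> L2 lebesgue" by (rule L2_lborel_imp_lebesgue[OF f(1)])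
    have mi: "bounded_multiplier (\<lambda>\<zeta> :: 'n spacetime. inverse (Hs_root s \<zeta>))" by (rule bounded_multiplier_inverse_root[OF s0])
    have ftL: "ft u \<in> L2 lebesgue" by (rule L2_lborel_imp_lebesgue[OF ft_L2(1)[OF u(1)]])
    have "to_l2 (ft u) = l2_ft (Hs_embed s x)" unfolding u(2) l2_ft_L12[OF u(1)] ..
    also have "\<dots> = to_l2 (\<lambda>\<zeta>. inverse (Hs_root s \<zeta>) * f \<zeta>)"
      unfolding Hs_embed_def f(2) by (simp add: l2_mult_to_l2[OF mi fL])
    finally have ftf: "AE \<zeta> in lebesgue. ft u \<zeta> = inverse (Hs_root s \<zeta>) * f \<zeta>"
      using to_l2_eq_iff[OF ftL L2_multiplier[OF mi fL]] by blast
    have inner_e: "(\<Sum>i\<in>C \<times> UNIV. (Hs_embed s x \<bullet> e i)\<^sup>2) = (4 * b / K) * (\<Sum>c\<in>C. (cmod (ft u c))\<^sup>2)"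
    proof -
      have gc: "l2_cinner (to_l2 u) (to_l2 (g c)) = ft u c" for c
      proof -
        have "l2_cinner (to_l2 u) (to_l2 (g c)) = (LINT z|lebesgue. u z * cnj (g c z))"
          unfolding l2_cinner_to_l2[OF uL gL] L2_inner_def ..
        also have "\<dots> = (LINT z|lborel. u z * cnj (g c z))" using gm by (intro integral_completion) measurable
        also have "\<dots> = ft u c" unfolding ft_def
          by (rule Bochner_Integration.integral_cong) (use u(3) in \<open>auto simp: g_def indicator_def cis_cnj mult.commute\<close>)
        finally show ?thesis .
      qed
      have "(Hs_embed s x \<bullet> e (c, False))\<^sup>2 + (Hs_embed s x \<bullet> e (c, True))\<^sup>2 = (4 * b / K) * (cmod (ft u c))\<^sup>2" for c
      proof -
        have "to_l2 u \<bullet> to_l2 (g c) = Re (ft u c)" by (simp add: Re_l2_cinner[symmetric] gc)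
        moreover have "to_l2 u \<bullet> to_l2 (\<lambda>z. \<i> * g c z) = Im (ft u c)"
          using Im_l2_cinner[of "to_l2 u" "to_l2 (g c)"] by (simp add: l2_mult_to_l2 gL gc)
        moreover have "M\<^sup>2 = 4 * b / K" using b K by (simp add: M_def)
        ultimately show ?thesis
          unfolding u(2) by (simp add: e_def power_mult_distrib cmod_power2 distrib_left del: times_divide_eq_left)
      qed
      moreover have "(\<Sum>i\<in>C \<times> UNIV. (Hs_embed s x \<bullet> e i)\<^sup>2) = (\<Sum>c\<in>C. \<Sum>t\<in>UNIV. (Hs_embed s x \<bullet> e (c, t))\<^sup>2)"
        by (simp add: sum.cartesian_product)
      ultimately show ?thesis by (simp add: UNIV_bool sum_distrib_left del: times_divide_eq_left)
    qed
    \<comment> \<open>A bound for the squared transform on the whole ball: twice the value at a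
      nearby centre plus twice the squared Lipschitz error.\<close>
    define D where "D = 2 * (\<Sum>c\<in>C. (cmod (ft u c))\<^sup>2) + 2 * r\<^sup>2 * L\<^sup>2 * (norm (to_l2 u))\<^sup>2"
    have D0: "0 \<le> D" by (auto simp: D_def intro!: add_nonneg_nonneg sum_nonneg mult_nonneg_nonneg)
    have low: "(cmod (ft u \<zeta>))\<^sup>2 \<le> D" if \<zeta>: "\<zeta> \<in> B" for \<zeta>
    proof -
      obtain c where c: "c \<in> C" "dist c \<zeta> < r" using C(2) \<zeta> by auto
      have "cmod (ft u \<zeta> - ft u c) \<le> RE * norm (\<zeta> - c) * (LINT z|lborel. cmod (u z))"
        by (rule ft_lipschitz[OF u(1)]) (use RE(2) u(3) in force)
      also have "\<dots> \<le> RE * r * (norm (to_l2 u) * norm (to_l2 (indicator E :: 'n spacetime \<Rightarrow> complex)))"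
        using c(2) RE(1) r by (intro mult_mono L1_le_L2_compact[OF E u(1,3)]) (auto simp: dist_norm norm_minus_commute)
      also have "\<dots> = r * L * norm (to_l2 u)" by (simp add: L_def)
      finally have d: "(cmod (ft u \<zeta> - ft u c))\<^sup>2 \<le> (r * L * norm (to_l2 u))\<^sup>2" by (rule power_mono) simp
      have "cmod (ft u \<zeta>) \<le> cmod (ft u c) + cmod (ft u \<zeta> - ft u c)"
        using norm_triangle_ineq[of "ft u c" "ft u \<zeta> - ft u c"] by simp
      then have "(cmod (ft u \<zeta>))\<^sup>2 \<le> (cmod (ft u c) + cmod (ft u \<zeta> - ft u c))\<^sup>2" by (rule power_mono) simp
      also have "\<dots> \<le> 2 * (cmod (ft u c))\<^sup>2 + 2 * (cmod (ft u \<zeta> - ft u c))\<^sup>2"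
        using zero_le_power2[of "cmod (ft u c) - cmod (ft u \<zeta> - ft u c)"] by (simp add: power2_eq_square algebra_simps)
      also have "(cmod (ft u c))\<^sup>2 \<le> (\<Sum>c\<in>C. (cmod (ft u c))\<^sup>2)" by (rule member_le_sum[OF c(1)]) (use C(1) in auto)
      finally show ?thesis using d by (simp add: D_def power_mult_distrib)
    qed
    have "K * (norm (to_l2 u))\<^sup>2 = (norm (to_l2 (ft u)))\<^sup>2"
      unfolding l2_ft_L12[OF u(1), symmetric] norm_l2_ft K_def ..
    also have "\<dots> = (LINT \<zeta>|lebesgue. (cmod (ft u \<zeta>))\<^sup>2)" by (rule norm_to_l2_sq[OF ftL])
    also have "\<dots> \<le> (LINT \<zeta>|lebesgue. \<eta> * (cmod (f \<zeta>))\<^sup>2 + D * indicator B \<zeta>)"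
    proof (rule integral_mono_AE)
      show "integrable lebesgue (\<lambda>\<zeta>. (cmod (ft u \<zeta>))\<^sup>2)" by (rule L2_integrable[OF ftL])
      have "integrable lebesgue (indicator B :: 'n spacetime \<Rightarrow> real)"
        using iB integrable_completion[OF imB] by simp
      then show "integrable lebesgue (\<lambda>\<zeta>. \<eta> * (cmod (f \<zeta>))\<^sup>2 + D * indicator B \<zeta>)"
        using L2_integrable[OF fL] by (intro Bochner_Integration.integrable_add integrable_mult_right)
      show "AE \<zeta> in lebesgue. (cmod (ft u \<zeta>))\<^sup>2 \<le> \<eta> * (cmod (f \<zeta>))\<^sup>2 + D * indicator B \<zeta>"
        using ftf
      proof eventually_elim
        case (elim \<zeta>)
        show ?case
        proof (cases "\<zeta> \<in> B")
          case True
          then show ?thesis using low[OF True] \<eta> by (simp add: add_increasing)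
        next
          case False
          have "(cmod (inverse (Hs_root s \<zeta>)))\<^sup>2 = inverse (Hs_weight s \<zeta>)"
            by (simp add: norm_inverse Hs_root_def power_inverse less_imp_le)
          then have "(cmod (ft u \<zeta>))\<^sup>2 = inverse (Hs_weight s \<zeta>) * (cmod (f \<zeta>))\<^sup>2"
            unfolding elim by (simp add: norm_mult power_mult_distrib del: norm_inverse)
          then show ?thesis using mult_right_mono[OF highfreq[OF False], of "(cmod (f \<zeta>))\<^sup>2"] False by simp
        qed
      qed
    qed
    also have "\<dots> = \<eta> * (norm x)\<^sup>2 + D * b"
    proof -
      have "(LINT \<zeta>|lebesgue. indicator B \<zeta> :: real) = b"
        using integral_completion[OF imB] by (simp add: b_def)
      moreover have "integrable lebesgue (indicator B :: 'n spacetime \<Rightarrow> real)"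
        using iB integrable_completion[OF imB] by simp
      ultimately show ?thesis
        using L2_integrable[OF fL] by (simp add: f(2) norm_to_l2_sq[OF fL])
    qed
    finally have "K * (norm (to_l2 u))\<^sup>2 \<le> \<eta> * (norm x)\<^sup>2 + D * b" .
    moreover have "D * b \<le> 2 * b * (\<Sum>c\<in>C. (cmod (ft u c))\<^sup>2) + (K / 2) * (norm (to_l2 u))\<^sup>2"
      using mult_right_mono[OF r2, of "(norm (to_l2 u))\<^sup>2"] by (simp add: D_def algebra_simps)
    ultimately have "(K / 2) * (norm (to_l2 u))\<^sup>2 \<le> \<eta> * (norm x)\<^sup>2 + 2 * b * (\<Sum>c\<in>C. (cmod (ft u c))\<^sup>2)" by linarith
    then have "(2 / K) * ((K / 2) * (norm (to_l2 u))\<^sup>2) \<le> (2 / K) * (\<eta> * (norm x)\<^sup>2 + 2 * b * (\<Sum>c\<in>C. (cmod (ft u c))\<^sup>2))"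
      using K by (intro mult_left_mono) auto
    moreover have "(2 / K) * ((K / 2) * (norm (to_l2 u))\<^sup>2) = (norm (to_l2 u))\<^sup>2" using K by simp
    moreover have "(2 / K) * (\<eta> * (norm x)\<^sup>2 + 2 * b * (\<Sum>c\<in>C. (cmod (ft u c))\<^sup>2))
        = \<delta> * (norm x)\<^sup>2 + (4 * b / K) * (\<Sum>c\<in>C. (cmod (ft u c))\<^sup>2)"
      using K by (simp add: \<eta>_def distrib_left)
    ultimately have "(norm (to_l2 u))\<^sup>2 \<le> \<delta> * (norm x)\<^sup>2 + (4 * b / K) * (\<Sum>c\<in>C. (cmod (ft u c))\<^sup>2)" by linarith
    then show ?thesis unfolding inner_e unfolding u(2) .
  qed
  show ?thesis by (rule that[of "C \<times> UNIV" e]) (use C(1) main in auto)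
qed

text \<open>The closure of the cylinder contains the lids at t = -T and t = T, which the uniqueness
  statements leave out; they are null sets.\<close>

lemma AE_fst_neq: "AE z in (lebesgue :: 'n::finite spacetime measure). fst z \<noteq> c"
proof -
  have "negligible {z :: 'n spacetime. z \<bullet> (1, 0) = c}"
    by (rule negligible_standard_hyperplane) (simp add: Basis_prod_def)
  then have "{z :: 'n spacetime. z \<bullet> (1, 0) = c} \<in> null_sets lebesgue" by (simp add: negligible_iff_null_sets)
  from AE_not_in[OF this] show ?thesis by eventually_elim (simp add: inner_prod_def)
qed

section \<open>Solvability of the direct and of the adjoint problem\<close>

context frac_heat_problem
begin

lemma E_subset: "E \<subseteq> {- T..T} \<times> closure \<Omega>"
  unfolding cyl_def closure_Times using T by (simp add: closure_greaterThanLessThan)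

lemma E_compact: "compact E"
  by (rule closure_cyl_compact[OF \<Omega>(2)])

lemma J_eq_0:
  assumes "J x = 0"
  shows "x = 0"
proof -
  have "to_l2 (of_l2 (0 :: 'n spacetime l2)) = J x" "to_l2 (of_l2 (0 :: 'n spacetime l2)) = J 0"
    using assms J.zero by simp_all
  then show ?thesis using Hs_of_embed(2)[OF s0 of_l2_L2] by metis
qed

text \<open>Membership in \<open>V\<close> means support in the closed cylinder, which gives both
  vanishing hypotheses of the eigenvalue condition. Its conclusion leaves the times t \<ge> T, where
  the support condition takes over up to the null lid.\<close>

lemma form_injective:
  assumes ev: "eigenvalue_condition s T \<Omega> Q" and x: "x \<in> V" "\<And>w. w \<in> V \<Longrightarrow> form x w = 0"
  shows "x = 0"
proof -
  define u where "u = of_l2 (J x)"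
  have u: "u \<in> L2 lebesgue" "to_l2 u = J x" by (simp_all add: u_def)
  have uH: "u \<in> Hs s" "Hs_lift s u = x" by (rule Hs_of_embed[OF s0 u])+
  have sol: "solves s T \<Omega> Q u" unfolding solves_iff uH(2) using uH(1) x(2) by blast
  have "vanishes_on u (- E)" using x(1) V_iff[OF u] vanishes_on_closed_supp_iff[of E u] by simp
  then have v: "AE z in lebesgue. z \<notin> E \<longrightarrow> u z = 0" by (simp add: vanishes_on_def)
  have 1: "vanishes_on u (cyl T (- closure \<Omega>))"
    unfolding vanishes_on_def using v by eventually_elim (use E_subset in \<open>auto simp: cyl_def\<close>)
  have 2: "vanishes_on u ({..-T} \<times> UNIV)"
    unfolding vanishes_on_def using v AE_fst_neq[of "- T"] by eventually_elim (use E_subset in fastforce)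
  have "vanishes_on u ({..<T} \<times> UNIV)"
    using ev sol 1 2 unfolding eigenvalue_condition_def by blast
  then have "AE z in lebesgue. z \<in> {..<T} \<times> UNIV \<longrightarrow> u z = 0" unfolding vanishes_on_def .
  with v AE_fst_neq[of T] have "AE z in lebesgue. u z = 0"
  proof eventually_elim
    case (elim z)
    show ?case
    proof (cases "fst z < T")
      case True
      then show ?thesis using elim by (auto simp: mem_Times_iff)
    next
      case False
      then have "z \<notin> E" using elim E_subset by (auto simp: mem_Times_iff)
      then show ?thesis using elim by blast
    qed
  qed
  then have "J x = 0" unfolding u_def l2_eq_0_iff .
  then show ?thesis by (rule J_eq_0)
qed

lemma form_fredholm_estimate:
  obtains c and I :: "('n spacetime \<times> bool) set" and l
  where "0 < c" "finite I" "\<And>i. i \<in> I \<Longrightarrow> bounded_linear (l i)"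
    "\<And>x. x \<in> V \<Longrightarrow> c * (norm x)\<^sup>2 \<le> form x x + (\<Sum>i\<in>I. (l i x)\<^sup>2)"
proof -
  obtain c C where c: "0 < c" "0 \<le> C" "\<And>x. c * (norm x)\<^sup>2 - C * (norm (J x))\<^sup>2 \<le> form x x" using form_coercive by blast
  \<comment> \<open>Makes C \<delta> \<le> c / 2, so that half of the coercivity survives; C + 1
    avoids division by zero.\<close>
  define \<delta> where "\<delta> = c / (2 * (C + 1))"
  have \<delta>: "0 < \<delta>" using c by (simp add: \<delta>_def)
  obtain I :: "('n spacetime \<times> bool) set" and e where I: "finite I"
    "\<And>x. l2_mult (indicator (- E)) (J x) = 0 \<Longrightarrow> (norm (J x))\<^sup>2 \<le> \<delta> * (norm x)\<^sup>2 + (\<Sum>i\<in>I. (J x \<bullet> e i)\<^sup>2)"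
    using Hs_embed_compact[OF s(1) E_compact \<delta>] by blast
  show ?thesis
  proof (rule that[of "c / 2" I "\<lambda>i x. sqrt C * (J x \<bullet> e i)"])
    show "bounded_linear (\<lambda>x. sqrt C * (J x \<bullet> e i))" for i
      by (intro bounded_linear_compose[OF bounded_linear_mult_right]
          bounded_linear_compose[OF bounded_linear_inner_left J.bounded_linear_axioms])
    fix x assume "x \<in> V"
    then have "(norm (J x))\<^sup>2 \<le> \<delta> * (norm x)\<^sup>2 + (\<Sum>i\<in>I. (J x \<bullet> e i)\<^sup>2)" by (intro I) (simp add: V_def)
    then have "C * (norm (J x))\<^sup>2 \<le> C * (\<delta> * (norm x)\<^sup>2 + (\<Sum>i\<in>I. (J x \<bullet> e i)\<^sup>2))" using c(2) by (rule mult_left_mono)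
    moreover have "C * \<delta> \<le> c / 2" using c by (simp add: \<delta>_def field_simps)
    then have "C * \<delta> * (norm x)\<^sup>2 \<le> c / 2 * (norm x)\<^sup>2" by (rule mult_right_mono) simp
    moreover have "(\<Sum>i\<in>I. (sqrt C * (J x \<bullet> e i))\<^sup>2) = C * (\<Sum>i\<in>I. (J x \<bullet> e i)\<^sup>2)"
      using c(2) by (simp add: power_mult_distrib sum_distrib_left)
    ultimately show "c / 2 * (norm x)\<^sup>2 \<le> form x x + (\<Sum>i\<in>I. (sqrt C * (J x \<bullet> e i))\<^sup>2)"
      using c(3)[of x] by (simp add: distrib_left mult.assoc)
  qed (use c I in auto)
qed

lemma form_solvable:
  assumes ev: "eigenvalue_condition s T \<Omega> Q" and f: "bounded_linear f"
  shows "\<exists>v\<in>V. \<forall>w\<in>V. form v w = f w" "\<exists>v\<in>V. \<forall>w\<in>V. form w v = f w"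
proof -
  obtain c and I :: "('n spacetime \<times> bool) set" and l where *: "0 < c" "finite I" "\<And>i. i \<in> I \<Longrightarrow> bounded_linear (l i)"
    "\<And>x. x \<in> V \<Longrightarrow> c * (norm x)\<^sup>2 \<le> form x x + (\<Sum>i\<in>I. (l i x)\<^sup>2)"
    using form_fredholm_estimate by blast
  show "\<exists>v\<in>V. \<forall>w\<in>V. form v w = f w"
    by (rule fredholm_alternative_on[OF V_closed V_subspace bounded_bilinear_form * form_injective[OF ev] f])
  show "\<exists>v\<in>V. \<forall>w\<in>V. form w v = f w"
    by (rule fredholm_alternative_adjoint_on[OF V_closed V_subspace bounded_bilinear_form * form_injective[OF ev] f])
qed

end

section \<open>Lipschitz test functions belong to the Sobolev space\<close>

lemma lborel_integral_shift:
  fixes f :: "'a::euclidean_space \<Rightarrow> complex"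
  assumes "f \<in> borel_measurable borel"
  shows "(LINT z|lborel. f (z + a)) = (LINT z|lborel. f z)"
  using lborel_integral_affine[OF assms, of 1 a] by (simp add: add.commute)

lemma lborel_integrable_shift:
  fixes f :: "'a::euclidean_space \<Rightarrow> complex"
  assumes f: "integrable lborel f"
  shows "integrable lborel (\<lambda>z. f (z + a))"
proof -
  have "integrable (distr lborel borel ((+) a)) f" using f by (simp add: lborel_distr_plus)
  then have "integrable lborel (\<lambda>z. f (a + z))"
    using borel_measurable_integrable[OF f] by (subst (asm) integrable_distr_eq) auto
  then show ?thesis by (simp add: add.commute)
qed

lemma ft_shift:
  fixes f :: "'a::euclidean_space \<Rightarrow> complex"
  assumes [measurable]: "f \<in> borel_measurable borel"
  shows "ft (\<lambda>z. f (z + a)) \<zeta> = cis (a \<bullet> \<zeta>) * ft f \<zeta>"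
proof -
  have "ft f \<zeta> = (LINT z|lborel. cis (- ((z + a) \<bullet> \<zeta>)) * f (z + a))"
    unfolding ft_def by (rule lborel_integral_shift[symmetric]) measurable
  also have "\<dots> = (LINT z|lborel. cis (- (a \<bullet> \<zeta>)) * (cis (- (z \<bullet> \<zeta>)) * f (z + a)))"
    by (rule Bochner_Integration.integral_cong) (simp_all add: inner_add_left cis_mult mult.assoc[symmetric] add.commute)
  also have "\<dots> = cis (- (a \<bullet> \<zeta>)) * ft (\<lambda>z. f (z + a)) \<zeta>" unfolding ft_def by (rule integral_mult_right_zero)
  finally have "cis (a \<bullet> \<zeta>) * ft f \<zeta> = (cis (a \<bullet> \<zeta>) * cis (- (a \<bullet> \<zeta>))) * ft (\<lambda>z. f (z + a)) \<zeta>" by (simp add: mult.assoc)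
  then show ?thesis by (simp add: cis_mult)
qed

lemma lip_test_shift_diff:
  fixes p :: "'a::euclidean_space \<Rightarrow> real"
  assumes "p \<in> lip_test A"
  obtains C where "0 \<le> C" "\<And>a. norm a \<le> 1 \<Longrightarrow>
    (\<integral>\<^sup>+z. ennreal ((cmod (complex_of_real (p (z + a)) - complex_of_real (p z)))\<^sup>2) \<partial>lborel) \<le> ennreal (C * (norm a)\<^sup>2)"
proof -
  obtain L K where L: "L-lipschitz_on UNIV p" and K: "compact K" "\<And>x. x \<notin> K \<Longrightarrow> p x = 0"
    using assms by (auto simp: lip_test_def)
  obtain R where R: "\<And>z. z \<in> K \<Longrightarrow> norm z \<le> R" using compact_imp_bounded[OF K(1)] by (auto simp: bounded_iff)
  \<comment> \<open>The enlarged ball contains the supports of p and of its translates by vectors of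
    length at most 1.\<close>
  define B where "B = cball (0 :: 'a) (R + 1)"
  have B: "emeasure lborel B < \<infinity>" "B \<in> sets borel" unfolding B_def using emeasure_bounded_finite by auto
  show ?thesis
  proof (rule that[of "L\<^sup>2 * measure lborel B"])
    fix a :: 'a assume a: "norm a \<le> 1"
    have pt: "(cmod (complex_of_real (p (z + a)) - complex_of_real (p z)))\<^sup>2 \<le> L\<^sup>2 * (norm a)\<^sup>2 * indicator B z" for z
    proof (cases "z \<in> B")
      case True
      have "cmod (complex_of_real (p (z + a)) - complex_of_real (p z)) = \<bar>p (z + a) - p z\<bar>"
        by (simp flip: of_real_diff)
      also have "\<dots> \<le> L * norm a" using lipschitz_onD[OF L, of "z + a" z] by (simp add: dist_norm)
      finally have "(cmod (complex_of_real (p (z + a)) - complex_of_real (p z)))\<^sup>2 \<le> (L * norm a)\<^sup>2"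
        by (rule power_mono) simp
      then show ?thesis using True by (simp add: power_mult_distrib)
    next
      case False
      then have "R + 1 < norm z" by (simp add: B_def)
      then have "z \<notin> K" "z + a \<notin> K" using R[of z] R[of "z + a"] a norm_diff_ineq[of z a] by auto
      then show ?thesis using K(2) False by simp
    qed
    have "(\<integral>\<^sup>+z. ennreal ((cmod (complex_of_real (p (z + a)) - complex_of_real (p z)))\<^sup>2) \<partial>lborel)
        \<le> (\<integral>\<^sup>+z. ennreal (L\<^sup>2 * (norm a)\<^sup>2) * indicator B z \<partial>lborel)"
      using pt by (intro nn_integral_mono order_trans[OF ennreal_leI[OF pt]]) (auto simp: indicator_def)
    also have "\<dots> = ennreal (L\<^sup>2 * (norm a)\<^sup>2) * emeasure lborel B" using B(2) by (simp add: nn_integral_cmult_indicator)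
    also have "emeasure lborel B = ennreal (measure lborel B)" using B(1) by (simp add: emeasure_eq_ennreal_measure)
    also have "ennreal (L\<^sup>2 * (norm a)\<^sup>2) * ennreal (measure lborel B) = ennreal (L\<^sup>2 * measure lborel B * (norm a)\<^sup>2)"
      by (simp add: ennreal_mult'[symmetric] mult_ac)
    finally show "(\<integral>\<^sup>+z. ennreal ((cmod (complex_of_real (p (z + a)) - complex_of_real (p z)))\<^sup>2) \<partial>lborel)
        \<le> ennreal (L\<^sup>2 * measure lborel B * (norm a)\<^sup>2)" .
  qed simp
qed

lemma cis_diff_quotient: "(\<lambda>k. (cis (t * inverse (real (Suc k))) - 1) * complex_of_real (real (Suc k))) \<longlonglongrightarrow> \<i> * complex_of_real t"
proof -
  have d: "((\<lambda>w. exp (\<i> * complex_of_real t * w)) has_field_derivative \<i> * complex_of_real t) (at 0)"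
    by (auto intro!: derivative_eq_intros)
  then have l: "(\<lambda>w. (exp (\<i> * complex_of_real t * w) - 1) / w) \<midarrow>0\<rightarrow> \<i> * complex_of_real t"
    unfolding has_field_derivative_iff by simp
  have "(\<lambda>k. complex_of_real (inverse (real (Suc k)))) \<longlonglongrightarrow> complex_of_real 0"
    by (intro tendsto_of_real LIMSEQ_inverse_real_of_nat)
  then have "filterlim (\<lambda>k. complex_of_real (inverse (real (Suc k)))) (at 0) sequentially"
    by (intro filterlim_atI always_eventually allI) (simp_all del: of_nat_Suc)
  from filterlim_compose[OF l this]
  have "(\<lambda>k. (exp (\<i> * complex_of_real t * complex_of_real (inverse (real (Suc k)))) - 1)
      / complex_of_real (inverse (real (Suc k)))) \<longlonglongrightarrow> \<i> * complex_of_real t" .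
  then show ?thesis
    by (simp add: cis_conv_exp divide_inverse mult.assoc del: of_nat_Suc)
qed

text \<open>Difference quotients of a compactly supported Lipschitz function are bounded in L^2.
  Their transforms converge pointwise to \<i> (\<zeta> \<bullet> b) times the transform, and Fatou's
  lemma keeps the bound; the function itself is never differentiated.\<close>

lemma lip_test_ft_weight:
  fixes p :: "'a::euclidean_space \<Rightarrow> real"
  assumes p: "p \<in> lip_test A" and b: "b \<in> Basis"
  shows "(\<integral>\<^sup>+\<zeta>. ennreal ((\<zeta> \<bullet> b)\<^sup>2 * (cmod (ft (\<lambda>z. complex_of_real (p z)) \<zeta>))\<^sup>2) \<partial>lborel) < \<infinity>"
proof -
  let ?f = "\<lambda>z. complex_of_real (p z)"
  have f12: "?f \<in> L12" by (rule lip_test_L12[OF p])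
  have [measurable]: "?f \<in> borel_measurable borel" by (rule L12_measurable[OF f12])
  obtain C where C: "0 \<le> C" "\<And>a. norm a \<le> 1 \<Longrightarrow>
    (\<integral>\<^sup>+z. ennreal ((cmod (?f (z + a) - ?f z))\<^sup>2) \<partial>lborel) \<le> ennreal (C * (norm a)\<^sup>2)"
    using lip_test_shift_diff[OF p] by blast
  define N where "N k = real (Suc k)" for k
  define a where "a k = inverse (N k) *\<^sub>R b" for k
  have na: "norm (a k) = inverse (N k)" "0 < N k" for k using b by (simp_all add: a_def N_def)
  let ?q = "\<lambda>k \<zeta>. (N k)\<^sup>2 * (cmod ((cis (a k \<bullet> \<zeta>) - 1) * ft ?f \<zeta>))\<^sup>2"
  have bnd: "(\<integral>\<^sup>+\<zeta>. ennreal (?q k \<zeta>) \<partial>lborel) \<le> 2 * (ennreal ((2 * pi) ^ DIM('a)) * ennreal C)" for k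
  proof -
    have s12: "(\<lambda>z. ?f (z + a k)) \<in> L12"
    proof -
      have "integrable lborel (\<lambda>z. (cmod (?f (z + a k)))\<^sup>2)"
        using lborel_integrable_shift[of "\<lambda>z. complex_of_real ((cmod (?f z))\<^sup>2)" "a k"] L2_integrable[OF L12_L2(1)[OF f12]]
        by (simp only: complex_of_real_integrable_eq)
      then show ?thesis using lborel_integrable_shift[OF L12_integrable[OF f12], of "a k"]
        by (simp add: L12_def L2_def)
    qed
    have ft: "ft (\<lambda>z. ?f (z + a k) - ?f z) \<zeta> = (cis (a k \<bullet> \<zeta>) - 1) * ft ?f \<zeta>" for \<zeta>
      unfolding ft_diff[OF s12 f12] ft_shift[OF L12_measurable[OF f12], of "a k" \<zeta>] by (simp add: left_diff_distrib)
    have "(\<integral>\<^sup>+\<zeta>. ennreal (?q k \<zeta>) \<partial>lborel) = ennreal ((N k)\<^sup>2) * (\<integral>\<^sup>+\<zeta>. ennreal ((cmod (ft (\<lambda>z. ?f (z + a k) - ?f z) \<zeta>))\<^sup>2) \<partial>lborel)"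
      unfolding ft by (simp add: ennreal_mult nn_integral_cmult)
    also have "\<dots> \<le> ennreal ((N k)\<^sup>2) * (2 * (ennreal ((2 * pi) ^ DIM('a)) * (\<integral>\<^sup>+z. ennreal ((cmod (?f (z + a k) - ?f z))\<^sup>2) \<partial>lborel)))"
      by (intro mult_left_mono nn_integral_ft_le[OF L12_integrable[OF L12_diff[OF s12 f12]]]) simp
    also have "\<dots> \<le> ennreal ((N k)\<^sup>2) * (2 * (ennreal ((2 * pi) ^ DIM('a)) * ennreal (C * (norm (a k))\<^sup>2)))"
      using na(1)[of k] by (intro mult_left_mono C) (auto simp: N_def inverse_le_1_iff)
    also have "\<dots> = 2 * (ennreal ((2 * pi) ^ DIM('a)) * (ennreal ((N k)\<^sup>2) * ennreal (C * (norm (a k))\<^sup>2)))" by (simp only: mult_ac)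
    also have "ennreal ((N k)\<^sup>2) * ennreal (C * (norm (a k))\<^sup>2) = ennreal C"
      using na[of k] C(1) by (simp add: ennreal_mult'[symmetric] power_inverse)
    finally show ?thesis .
  qed
  have lim: "(\<lambda>k. ?q k \<zeta>) \<longlonglongrightarrow> (\<zeta> \<bullet> b)\<^sup>2 * (cmod (ft ?f \<zeta>))\<^sup>2" for \<zeta>
  proof -
    have "?q k \<zeta> = (cmod ((cis ((\<zeta> \<bullet> b) * inverse (real (Suc k))) - 1) * complex_of_real (real (Suc k))) * cmod (ft ?f \<zeta>))\<^sup>2" for k
      by (simp add: a_def N_def norm_mult power_mult_distrib inner_commute mult.commute del: of_nat_Suc)
    moreover have "(\<lambda>k. (cmod ((cis ((\<zeta> \<bullet> b) * inverse (real (Suc k))) - 1) * complex_of_real (real (Suc k))) * cmod (ft ?f \<zeta>))\<^sup>2)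
        \<longlonglongrightarrow> (cmod (\<i> * complex_of_real (\<zeta> \<bullet> b)) * cmod (ft ?f \<zeta>))\<^sup>2"
      by (intro tendsto_intros cis_diff_quotient)
    moreover have "(cmod (\<i> * complex_of_real (\<zeta> \<bullet> b)) * cmod (ft ?f \<zeta>))\<^sup>2 = (\<zeta> \<bullet> b)\<^sup>2 * (cmod (ft ?f \<zeta>))\<^sup>2"
      by (simp add: norm_mult power_mult_distrib)
    ultimately show ?thesis by (simp only:)
  qed
  have "(\<integral>\<^sup>+\<zeta>. ennreal ((\<zeta> \<bullet> b)\<^sup>2 * (cmod (ft ?f \<zeta>))\<^sup>2) \<partial>lborel) = (\<integral>\<^sup>+\<zeta>. liminf (\<lambda>k. ennreal (?q k \<zeta>)) \<partial>lborel)"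
    using lim by (intro nn_integral_cong lim_imp_Liminf[symmetric] trivial_limit_sequentially tendsto_ennrealI)
  also have "\<dots> \<le> liminf (\<lambda>k. \<integral>\<^sup>+\<zeta>. ennreal (?q k \<zeta>) \<partial>lborel)"
    by (rule nn_integral_liminf) (simp add: a_def)
  also have "\<dots> \<le> limsup (\<lambda>k. \<integral>\<^sup>+\<zeta>. ennreal (?q k \<zeta>) \<partial>lborel)" by (rule Liminf_le_Limsup) simp
  also have "\<dots> \<le> 2 * (ennreal ((2 * pi) ^ DIM('a)) * ennreal C)"
    by (rule Limsup_bounded) (use bnd in auto)
  also have "\<dots> < \<infinity>" by (simp add: ennreal_mult_less_top)
  finally show ?thesis .
qed

text \<open>For s \<le> 1 the parabolic weight is at most 2 + |\<zeta>|^2, so one isotropic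
  derivative in L^2 suffices.\<close>

lemma lip_test_Hs:
  fixes p :: "'n::finite spacetime \<Rightarrow> real"
  assumes p: "p \<in> lip_test A" and s: "0 \<le> s" "s \<le> 1"
  shows "(\<lambda>z. complex_of_real (p z)) \<in> Hs s"
proof -
  let ?f = "\<lambda>z. complex_of_real (p z)"
  have f12: "?f \<in> L12" by (rule lip_test_L12[OF p])
  have [measurable]: "?f \<in> borel_measurable borel" by (rule L12_measurable[OF f12])
  have fL: "?f \<in> L2 lebesgue" by (rule L12_L2(2)[OF f12])
  have fi: "integrable lborel (\<lambda>\<zeta>. (\<zeta> \<bullet> b)\<^sup>2 * (cmod (ft ?f \<zeta>))\<^sup>2)" if "b \<in> Basis" for b
    using lip_test_ft_weight[OF p that] by (intro integrableI_nonneg) auto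
  have "integrable lborel (\<lambda>\<zeta>. 2 * (cmod (ft ?f \<zeta>))\<^sup>2 + (\<Sum>b\<in>Basis. (\<zeta> \<bullet> b)\<^sup>2 * (cmod (ft ?f \<zeta>))\<^sup>2))"
    by (intro Bochner_Integration.integrable_add integrable_mult_right Bochner_Integration.integrable_sum fi
        L2_integrable[OF ft_L2(1)[OF f12]])
  then have i: "integrable lborel (\<lambda>\<zeta>. Hs_weight s \<zeta> * (cmod (ft ?f \<zeta>))\<^sup>2)"
  proof (rule Bochner_Integration.integrable_bound)
    have "Hs_weight s \<zeta> * (cmod (ft ?f \<zeta>))\<^sup>2
        \<le> 2 * (cmod (ft ?f \<zeta>))\<^sup>2 + (\<Sum>b\<in>Basis. (\<zeta> \<bullet> b)\<^sup>2 * (cmod (ft ?f \<zeta>))\<^sup>2)" for \<zeta>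
    proof -
      have "Hs_weight s \<zeta> \<le> (1 + cmod (heat_symbol \<zeta>)) powr 1"
        unfolding Hs_weight_def using s by (intro powr_mono) auto
      also have "\<dots> \<le> 2 + (norm \<zeta>)\<^sup>2" using heat_symbol_le[of \<zeta>] by simp
      finally have "Hs_weight s \<zeta> \<le> 2 + (\<Sum>b\<in>Basis. (\<zeta> \<bullet> b)\<^sup>2)" unfolding norm_sq_basis[of \<zeta>] .
      then have "Hs_weight s \<zeta> * (cmod (ft ?f \<zeta>))\<^sup>2 \<le> (2 + (\<Sum>b\<in>Basis. (\<zeta> \<bullet> b)\<^sup>2)) * (cmod (ft ?f \<zeta>))\<^sup>2"
        by (rule mult_right_mono) simp
      then show ?thesis by (simp add: distrib_right sum_distrib_right)
    qed
    then show "AE \<zeta> in lborel. norm (Hs_weight s \<zeta> * (cmod (ft ?f \<zeta>))\<^sup>2)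
        \<le> norm (2 * (cmod (ft ?f \<zeta>))\<^sup>2 + (\<Sum>b\<in>Basis. (\<zeta> \<bullet> b)\<^sup>2 * (cmod (ft ?f \<zeta>))\<^sup>2))"
      by (intro AE_I2) (auto intro!: order_trans[OF _ abs_ge_self] simp: abs_mult less_imp_le)
  qed measurable
  have ftm: "(\<lambda>\<zeta>. Hs_weight s \<zeta> * (cmod (ft ?f \<zeta>))\<^sup>2) \<in> borel_measurable borel" by measurable
  have "to_l2 (fourier ?f) = to_l2 (ft ?f)" unfolding fourier_L2(2)[OF fL] l2_ft_L12[OF f12] ..
  then have eq: "AE \<zeta> in lebesgue. fourier ?f \<zeta> = ft ?f \<zeta>"
    using to_l2_eq_iff[OF fourier_L2(1)[OF fL] L2_lborel_imp_lebesgue[OF ft_L2(1)[OF f12]]] by blast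
  have "integrable lebesgue (\<lambda>\<zeta>. Hs_weight s \<zeta> * (cmod (ft ?f \<zeta>))\<^sup>2)"
    by (subst integrable_completion) (use ftm i in simp_all)
  moreover have "(\<lambda>\<zeta>. Hs_weight s \<zeta> * (cmod (fourier ?f \<zeta>))\<^sup>2) \<in> borel_measurable lebesgue"
    by (intro borel_measurable_times borel_measurable_power borel_imp_lebesgue[OF Hs_weight_measurable]
        measurable_compose[OF L2_measurable[OF fourier_L2(1)[OF fL]] borel_measurable_norm])
  ultimately have "integrable lebesgue (\<lambda>\<zeta>. Hs_weight s \<zeta> * (cmod (fourier ?f \<zeta>))\<^sup>2)"
    by (subst integrable_cong_AE[where g = "\<lambda>\<zeta>. Hs_weight s \<zeta> * (cmod (ft ?f \<zeta>))\<^sup>2"])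
      (use eq ftm in \<open>auto intro!: measurable_completion elim!: eventually_mono\<close>)
  then show ?thesis using fL by (simp add: Hs_iff)
qed

section \<open>Fractional powers and the heat semigroup\<close>

lemma has_field_derivative_integral:
  fixes f f' :: "complex \<Rightarrow> 'a \<Rightarrow> complex"
  assumes r: "0 < r"
    and int: "\<And>w. w \<in> ball z r \<Longrightarrow> integrable M (f w)"
    and der: "\<And>w x. w \<in> ball z r \<Longrightarrow> ((\<lambda>w. f w x) has_field_derivative f' w x) (at w)"
    and bnd: "\<And>w x. w \<in> ball z r \<Longrightarrow> cmod (f' w x) \<le> g x"
    and g: "integrable M g" and f': "f' z \<in> borel_measurable M"
  shows "((\<lambda>w. integral\<^sup>L M (f w)) has_field_derivative integral\<^sup>L M (f' z)) (at z)"
  unfolding DERIV_def tendsto_at_iff_sequentially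
proof (intro allI impI)
  fix X :: "nat \<Rightarrow> complex" assume X: "\<forall>i. X i \<in> UNIV - {0}" "X \<longlonglongrightarrow> 0"
  \<comment> \<open>Replaces the finitely many increments outside the disc by r / 2, so that every
    term of the sequence satisfies the bounds.\<close>
  define Y where "Y i = (if cmod (X i) < r then X i else of_real (r / 2))" for i
  have Y: "Y i \<noteq> 0" "cmod (Y i) < r" for i using X(1) r by (auto simp: Y_def)
  have evXY: "eventually (\<lambda>i. Y i = X i) sequentially"
    using tendstoD[OF X(2) r] by eventually_elim (simp add: Y_def)
  have Y0: "Y \<longlonglongrightarrow> 0" using X(2) tendsto_cong[OF evXY] by blast
  have zY: "z + Y i \<in> ball z r" "z \<in> ball z r" for i using Y(2) r by (auto simp: dist_norm)
  let ?q = "\<lambda>i x. (f (z + Y i) x - f z x) / Y i"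
  have "(\<lambda>i. integral\<^sup>L M (?q i)) \<longlonglongrightarrow> integral\<^sup>L M (f' z)"
  proof (rule integral_dominated_convergence)
    show "integrable M g" by fact
    show "f' z \<in> borel_measurable M" by fact
    show "?q i \<in> borel_measurable M" for i
      using borel_measurable_integrable[OF int[OF zY(1)]] borel_measurable_integrable[OF int[OF zY(2)]] by simp
    show "AE x in M. (\<lambda>i. ?q i x) \<longlonglongrightarrow> f' z x"
    proof (rule AE_I2)
      fix x
      have "((\<lambda>h. (f (z + h) x - f z x) / h) \<longlongrightarrow> f' z x) (at 0)" using der[OF zY(2), of x] unfolding DERIV_def .
      then show "(\<lambda>i. ?q i x) \<longlonglongrightarrow> f' z x"
        using Y(1) Y0 unfolding tendsto_at_iff_sequentially by (auto simp: o_def)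
    qed
    show "AE x in M. norm (?q i x) \<le> g x" for i
    proof (rule AE_I2)
      fix x
      have "cmod (f (z + Y i) x - f z x) \<le> g x * cmod (z + Y i - z)"
        by (rule field_differentiable_bound[where S = "ball z r" and f' = "\<lambda>w. f' w x"])
          (use zY bnd der in \<open>auto intro: has_field_derivative_at_within\<close>)
      then show "norm (?q i x) \<le> g x" using Y(1)[of i] by (simp add: norm_divide field_simps)
    qed
  qed
  moreover have e: "integral\<^sup>L M (?q i) = (integral\<^sup>L M (f (z + Y i)) - integral\<^sup>L M (f z)) / Y i" for i
    using int[OF zY(1)] int[OF zY(2)] by simp
  ultimately have "(\<lambda>i. (integral\<^sup>L M (f (z + Y i)) - integral\<^sup>L M (f z)) / Y i) \<longlonglongrightarrow> integral\<^sup>L M (f' z)" unfolding e by blast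
  then show "((\<lambda>h. (integral\<^sup>L M (f (z + h)) - integral\<^sup>L M (f z)) / h) \<circ> X) \<longlonglongrightarrow> integral\<^sup>L M (f' z)"
    by (rule Lim_transform_eventually) (use evXY in \<open>auto simp: o_def elim!: eventually_mono\<close>)
qed

section \<open>Fractional powers as integrals of exponentials\<close>

lemma integrable_lborel_of_absolutely_integrable:
  fixes f :: "real \<Rightarrow> real"
  assumes f: "f absolutely_integrable_on S" "f \<in> borel_measurable borel" "S \<in> sets borel"
  shows "integrable lborel (\<lambda>x. indicator S x * f x)"
proof -
  have m: "(\<lambda>x. indicator S x * f x) \<in> borel_measurable lborel"
    using f by (intro borel_measurable_times borel_measurable_indicator) auto
  show ?thesis using f(1) unfolding set_integrable_def by (subst integrable_completion[OF m, symmetric]) simp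
qed

lemma integrable_powr_exp:
  fixes s a :: real
  assumes "s < 1" "0 < a"
  shows "integrable lborel (\<lambda>t. indicator {0<..} t * (t powr (- s) * exp (- a * t)))"
proof (rule integrable_lborel_of_absolutely_integrable)
  have "(\<lambda>t. complex_of_real t powr (complex_of_real (1 - s) - 1) / complex_of_real (exp (a * t))) absolutely_integrable_on {0<..}"
    by (rule absolutely_integrable_Gamma_integral) (use assms in auto)
  then have "(\<lambda>t. norm (complex_of_real t powr (complex_of_real (1 - s) - 1) / complex_of_real (exp (a * t)))) absolutely_integrable_on {0<..}"
    by (rule absolutely_integrable_norm[unfolded o_def])
  then show "(\<lambda>t. t powr (- s) * exp (- a * t)) absolutely_integrable_on {0<..}"
    by (rule absolutely_integrable_spike[OF _ negligible_empty])
      (auto simp: norm_divide norm_powr_real_powr exp_minus field_simps)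
qed auto

lemma integrable_powr_tail:
  fixes e :: real
  assumes "e < - 1"
  shows "integrable lborel (\<lambda>t. indicator {1..} t * t powr e)"
  by (rule integrable_lborel_of_absolutely_integrable)
    (use has_integral_powr_to_inf[OF assms, of 1] in \<open>auto intro!: nonnegative_absolutely_integrable_1 simp: integrable_on_def\<close>)

text \<open>\<open>min 2 t\<close> bounds |1 - e^(-t z)| for |z| = 1 in the right half plane.
  Integrability at 0 uses s < 1, at infinity 0 < s.\<close>

lemma integrable_min_powr:
  fixes s :: real
  assumes s: "0 < s" "s < 1"
  shows "integrable lborel (\<lambda>t. (indicator {0<..} t * t powr (- 1 - s)) * min 2 t)"
proof (rule Bochner_Integration.integrable_bound)
  show "integrable lborel (\<lambda>t. exp 1 * (indicator {0<..} t * (t powr (- s) * exp (- 1 * t))) + 2 * (indicator {1..} t * t powr (- 1 - s)))"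
    using s by (intro Bochner_Integration.integrable_add integrable_mult_right integrable_powr_exp integrable_powr_tail) auto
  have "(indicator {0<..} t * t powr (- 1 - s)) * min 2 t
      \<le> exp 1 * (indicator {0<..} t * (t powr (- s) * exp (- 1 * t))) + 2 * (indicator {1..} t * t powr (- 1 - s))" for t
  proof (cases "t \<le> 0")
    case False
    then have t: "0 < t" by simp
    show ?thesis
    proof (cases "t < 1")
      case True
      have "t powr (- 1 - s) * t = t powr (- s)" using t powr_mult_base[of t "- 1 - s"] by (simp add: mult.commute)
      also have "\<dots> \<le> exp 1 * (t powr (- s) * exp (- 1 * t))"
      proof -
        have "1 \<le> exp (1 - t)" using True by simp
        then have "t powr (- s) * 1 \<le> t powr (- s) * exp (1 - t)" by (intro mult_left_mono) auto
        then show ?thesis by (simp add: exp_diff exp_minus field_simps)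
      qed
      finally show ?thesis using True t by (simp add: min_def)
    next
      case f: False
      have "t powr (- 1 - s) * min 2 t \<le> t powr (- 1 - s) * 2" by (intro mult_left_mono) auto
      moreover have "0 \<le> exp 1 * (t powr (- s) * exp (- 1 * t))" by simp
      ultimately have "t powr (- 1 - s) * min 2 t \<le> exp 1 * (t powr (- s) * exp (- 1 * t)) + 2 * t powr (- 1 - s)" by linarith
      then show ?thesis using f t by simp
    qed
  qed (auto simp: indicator_def)
  moreover have "0 \<le> (indicator {0<..} t * t powr (- 1 - s)) * min 2 t" for t :: real by (auto simp: indicator_def)
  ultimately have "norm ((indicator {0<..} t * t powr (- 1 - s)) * min 2 t)
     \<le> norm (exp 1 * (indicator {0<..} t * (t powr (- s) * exp (- 1 * t))) + 2 * (indicator {1..} t * t powr (- 1 - s)))" for t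
    unfolding real_norm_def using order_trans[OF _ abs_ge_self] by (metis abs_of_nonneg)
  then show "AE t in lborel. norm ((indicator {0<..} t * t powr (- 1 - s)) * min 2 t)
     \<le> norm (exp 1 * (indicator {0<..} t * (t powr (- s) * exp (- 1 * t))) + 2 * (indicator {1..} t * t powr (- 1 - s)))"
    by (intro AE_I2)
qed measurable

text \<open>Under t |-> l t the measure t^(-1-s) dt scales by a power of l; this is the source of
  the homogeneity of degree s.\<close>

lemma lborel_powr_scaling:
  fixes h :: "real \<Rightarrow> 'b::{banach, second_countable_topology}"
  assumes l: "0 < l"
  shows "(LINT t|lborel. (indicator {0<..} t * t powr (- 1 - s)) *\<^sub>R h (l * t))
      = (l powr s) *\<^sub>R (LINT t|lborel. (indicator {0<..} t * t powr (- 1 - s)) *\<^sub>R h t)"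
    and "integrable lborel (\<lambda>t. (indicator {0<..} t * t powr (- 1 - s)) *\<^sub>R h t) \<Longrightarrow>
      integrable lborel (\<lambda>t. (indicator {0<..} t * t powr (- 1 - s)) *\<^sub>R h (l * t))"
proof -
  let ?F = "\<lambda>t. (indicator {0<..} t * t powr (- 1 - s)) *\<^sub>R h t"
  have F: "?F (0 + l * t) = (l powr (- 1 - s)) *\<^sub>R ((indicator {0<..} t * t powr (- 1 - s)) *\<^sub>R h (l * t))" for t
    using l by (auto simp: indicator_def powr_mult zero_less_mult_iff)
  have "(LINT t|lborel. ?F t) = \<bar>l\<bar> *\<^sub>R (LINT t|lborel. ?F (0 + l * t))"
    using l by (intro lborel_integral_real_affine) auto
  also have "\<dots> = (l * l powr (- 1 - s)) *\<^sub>R (LINT t|lborel. (indicator {0<..} t * t powr (- 1 - s)) *\<^sub>R h (l * t))"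
  proof -
    have "(LINT t|lborel. ?F (0 + l * t)) = (l powr (- 1 - s)) *\<^sub>R (LINT t|lborel. (indicator {0<..} t * t powr (- 1 - s)) *\<^sub>R h (l * t))"
      unfolding F by (rule integral_scaleR_right)
    then show ?thesis using l by simp
  qed
  also have "l * l powr (- 1 - s) = l powr (- s)" using l powr_mult_base[of l "- 1 - s"] by simp
  finally show "(LINT t|lborel. (indicator {0<..} t * t powr (- 1 - s)) *\<^sub>R h (l * t))
      = (l powr s) *\<^sub>R (LINT t|lborel. ?F t)"
    using l by (simp add: powr_minus)
  assume "integrable lborel ?F"
  then have "integrable lborel (\<lambda>t. ?F (0 + l * t))" using l by (subst lborel_integrable_real_affine_iff) auto
  then have "integrable lborel (\<lambda>t. (l powr (1 + s)) *\<^sub>R ?F (0 + l * t))" by (rule integrable_scaleR_right)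
  moreover have "l powr (1 + s) * l powr (- 1 - s) = 1" using l by (simp flip: powr_add)
  ultimately show "integrable lborel (\<lambda>t. (indicator {0<..} t * t powr (- 1 - s)) *\<^sub>R h (l * t))"
    unfolding F by (simp only: scaleR_scaleR mult.assoc[symmetric] mult_1 scaleR_one)
qed

lemma norm_one_minus_exp_le:
  assumes "0 \<le> Re z" "0 \<le> t"
  shows "cmod (1 - exp (- (complex_of_real t * z))) \<le> min 2 (cmod z * t)"
proof -
  let ?w = "- (complex_of_real t * z)"
  have w: "Re ?w \<le> 0" using assms by simp
  have "cmod (exp ?w - exp 0) \<le> 1 * cmod (?w - 0)"
  proof (rule field_differentiable_bound[where S = "{w. Re w \<le> 0}"])
    show "convex {w. Re w \<le> 0}" by (rule convex_halfspace_Re_le)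
  qed (use w in \<open>auto intro: derivative_eq_intros\<close>)
  then have 1: "cmod (1 - exp ?w) \<le> cmod z * t"
    using assms by (simp add: norm_mult norm_minus_commute mult.commute)
  have "cmod (1 - exp ?w) \<le> 1 + cmod (exp ?w)" using norm_triangle_ineq4[of 1 "exp ?w"] by simp
  also have "\<dots> \<le> 2" using w by simp
  finally show ?thesis using 1 by simp
qed

definition powr_weight :: "real \<Rightarrow> real \<Rightarrow> real" where
  "powr_weight s t = indicator {0<..} t * t powr (- 1 - s)"

lemma powr_weight_measurable [measurable]: "powr_weight s \<in> borel_measurable borel"
  unfolding powr_weight_def[abs_def] by measurable

lemma powr_weight_nonneg [simp]: "0 \<le> powr_weight s t"
  by (simp add: powr_weight_def)

definition powr_const :: "real \<Rightarrow> real" where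
  "powr_const s = (LINT t|lborel. powr_weight s t * min 2 t)"

text \<open>The bound by |z|^s is scaling: it reduces the dominating function min 2 (|z| t) to min 2
  t. It makes the integral absolutely convergent when paired with the transforms of two elements of
  \<open>Hs s\<close>.\<close>

lemma powr_integrand_bound:
  fixes z :: complex
  assumes s: "0 < s" "s < 1" and z: "0 \<le> Re z"
  shows "integrable lborel (\<lambda>t. powr_weight s t *\<^sub>R (1 - exp (- (complex_of_real t * z))))"
    and "(LINT t|lborel. cmod (powr_weight s t *\<^sub>R (1 - exp (- (complex_of_real t * z))))) \<le> cmod z powr s * powr_const s"
proof -
  have dom: "integrable lborel (\<lambda>t. powr_weight s t * min 2 (cmod z * t))
    \<and> (LINT t|lborel. powr_weight s t * min 2 (cmod z * t)) = cmod z powr s * powr_const s"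
  proof (cases "z = 0")
    case True
    have z0: "powr_weight s t * min 2 0 = 0" for t by simp
    show ?thesis using True by simp
  next
    case False
    then show ?thesis
      using lborel_powr_scaling[of "cmod z" s "\<lambda>t. min 2 t"] integrable_min_powr[OF s]
      by (simp add: powr_weight_def powr_const_def)
  qed
  have le: "cmod (powr_weight s t *\<^sub>R (1 - exp (- (complex_of_real t * z)))) \<le> powr_weight s t * min 2 (cmod z * t)" for t
  proof (cases "0 < t")
    case True
    then show ?thesis using mult_left_mono[OF norm_one_minus_exp_le[OF z, of t] powr_weight_nonneg[of s t]] by simp
  qed (simp add: powr_weight_def)
  show i: "integrable lborel (\<lambda>t. powr_weight s t *\<^sub>R (1 - exp (- (complex_of_real t * z))))"
    by (rule Bochner_Integration.integrable_bound[OF conjunct1[OF dom]])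
      (use le in \<open>auto intro!: AE_I2 order_trans[OF _ abs_ge_self]\<close>)
  have "(LINT t|lborel. cmod (powr_weight s t *\<^sub>R (1 - exp (- (complex_of_real t * z)))))
      \<le> (LINT t|lborel. powr_weight s t * min 2 (cmod z * t))"
    by (rule integral_mono[OF integrable_norm[OF i] conjunct1[OF dom] le])
  then show "(LINT t|lborel. cmod (powr_weight s t *\<^sub>R (1 - exp (- (complex_of_real t * z))))) \<le> cmod z powr s * powr_const s"
    using dom by simp
qed

text \<open>The subordination integral, a constant multiple of z^s on the open right half plane. The
  difference 1 - e^(-t z) compensates the non-integrable singularity of t^(-1-s) at 0.\<close>

definition powr_int :: "real \<Rightarrow> complex \<Rightarrow> complex" where
  "powr_int s z = (LINT t|lborel. powr_weight s t *\<^sub>R (1 - exp (- (complex_of_real t * z))))"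

lemma powr_int_scale: "0 < l \<Longrightarrow> powr_int s (complex_of_real l * z) = complex_of_real (l powr s) * powr_int s z"
  using lborel_powr_scaling(1)[of l s "\<lambda>t. 1 - exp (- (complex_of_real t * z))"]
  by (simp add: powr_int_def powr_weight_def scaleR_conv_of_real mult_ac)

lemma powr_int_derivative:
  assumes s: "0 < s" "s < 1" and z: "0 < Re z"
  shows "\<exists>D. (powr_int s has_field_derivative D) (at z)"
proof -
  \<comment> \<open>On the disc of this radius around z the real part stays above Re z / 2, which
    supplies a common dominating function.\<close>
  define a where "a = Re z / 2"
  have a: "0 < a" using z by (simp add: a_def)
  let ?f' = "\<lambda>w t. powr_weight s t *\<^sub>R (complex_of_real t * exp (- (complex_of_real t * w)))"
  have re: "a \<le> Re w" if "w \<in> ball z a" for w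
    using that abs_Re_le_cmod[of "z - w"] by (simp add: dist_norm a_def)
  have "((\<lambda>w. LINT t|lborel. powr_weight s t *\<^sub>R (1 - exp (- (complex_of_real t * w)))) has_field_derivative
      (LINT t|lborel. ?f' z t)) (at z)"
  proof (rule has_field_derivative_integral[where g = "\<lambda>t. indicator {0<..} t * (t powr (- s) * exp (- a * t))", OF a])
    show "integrable lborel (\<lambda>t. powr_weight s t *\<^sub>R (1 - exp (- (complex_of_real t * w))))" if "w \<in> ball z a" for w
      by (rule powr_integrand_bound(1)[OF s]) (use re[OF that] a in simp)
    show "((\<lambda>w. powr_weight s t *\<^sub>R (1 - exp (- (complex_of_real t * w)))) has_field_derivative ?f' w t) (at w)" for w t
      unfolding scaleR_conv_of_real by (auto intro!: derivative_eq_intros)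
    show "cmod (?f' w t) \<le> indicator {0<..} t * (t powr (- s) * exp (- a * t))" if "w \<in> ball z a" for w t
    proof (cases "0 < t")
      case True
      have "t powr (- 1 - s) * t = t powr (- s)" using True powr_mult_base[of t "- 1 - s"] by (simp add: mult.commute)
      moreover have "exp (- (t * Re w)) \<le> exp (- a * t)" using re[OF that] True by simp
      ultimately show ?thesis using True
        by (simp add: powr_weight_def norm_mult mult.assoc[symmetric] mult_left_mono)
    qed (simp add: powr_weight_def)
    show "integrable lborel (\<lambda>t. indicator {0<..} t * (t powr (- s) * exp (- a * t)))" by (rule integrable_powr_exp[OF s(2) a])
  qed measurable
  then show ?thesis unfolding powr_int_def[abs_def] by blast
qed

text \<open>Homogeneity turns the derivative into the equation \<open>z G'(z) = s G(z)\<close>, whose solutions on the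
  right half plane are the multiples of the principal power.\<close>

lemma powr_int_eq:
  assumes s: "0 < s" "s < 1" and z: "0 < Re z"
  shows "powr_int s z = powr_int s 1 * z powr complex_of_real s"
proof -
  let ?S = "{z. 0 < Re z}"
  let ?q = "\<lambda>z. powr_int s z * z powr (- complex_of_real s)"
  have der: "(?q has_field_derivative 0) (at w within ?S)" if w: "w \<in> ?S" for w
  proof -
    have w0: "w \<noteq> 0" "w \<notin> \<real>\<^sub>\<le>\<^sub>0" using w by (auto simp: complex_nonpos_Reals_iff)
    obtain D where D: "(powr_int s has_field_derivative D) (at w)" using powr_int_derivative[OF s] w by auto
    have "((\<lambda>l. powr_int s (complex_of_real l * w)) has_vector_derivative (w * D)) (at 1)"
    proof -
      have "((\<lambda>u. powr_int s (u * w)) has_field_derivative D * w) (at (complex_of_real 1))"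
        by (rule DERIV_chain'[where g = "powr_int s"]) (use D in \<open>auto intro!: derivative_eq_intros\<close>)
      from has_vector_derivative_real_field[OF this] show ?thesis by (simp add: mult.commute)
    qed
    moreover have "((\<lambda>l. complex_of_real (l powr s) * powr_int s w) has_vector_derivative (complex_of_real s * powr_int s w)) (at 1)"
    proof -
      have "((\<lambda>l. l powr s) has_real_derivative s) (at 1)" by (auto intro!: derivative_eq_intros)
      then have "((\<lambda>l. complex_of_real (l powr s)) has_vector_derivative complex_of_real s) (at 1)"
        by (rule has_vector_derivative_of_real)
      then show ?thesis by (rule has_vector_derivative_mult_left)
    qed
    then have "((\<lambda>l. powr_int s (complex_of_real l * w)) has_vector_derivative (complex_of_real s * powr_int s w)) (at 1)"
      by (rule has_vector_derivative_transform_within_open[where S = "{0<..}"]) (auto simp: powr_int_scale)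
    ultimately have wD: "w * D = complex_of_real s * powr_int s w" by (rule vector_derivative_unique_at)
    have "(?q has_field_derivative D * w powr (- complex_of_real s)
        + (- complex_of_real s * w powr (- complex_of_real s - 1)) * powr_int s w) (at w)"
      by (rule DERIV_mult'[OF D, THEN DERIV_cong] has_field_derivative_powr)+ (use w0 in \<open>simp_all add: mult_ac\<close>)
    also have "D * w powr (- complex_of_real s) + (- complex_of_real s * w powr (- complex_of_real s - 1)) * powr_int s w = 0"
    proof -
      have "w powr (- complex_of_real s) = w * w powr (- complex_of_real s - 1)"
        using w0 by (simp add: powr_diff)
      then have "D * w powr (- complex_of_real s) + (- complex_of_real s * w powr (- complex_of_real s - 1)) * powr_int s w
          = (w * D - complex_of_real s * powr_int s w) * w powr (- complex_of_real s - 1)" by (simp add: algebra_simps)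
      then show ?thesis using wD by simp
    qed
    finally show ?thesis by (rule has_field_derivative_at_within)
  qed
  have "\<exists>c. \<forall>w\<in>?S. ?q w = c"
    by (rule has_field_derivative_zero_constant[OF convex_halfspace_Re_gt]) (use der in auto)
  then obtain c where c: "\<And>w. w \<in> ?S \<Longrightarrow> ?q w = c" by blast
  have "?q z = ?q 1" using c[of z] c[of 1] z by simp
  moreover have "z powr (- complex_of_real s) * z powr complex_of_real s = 1"
    using z by (simp flip: powr_add) auto
  ultimately show ?thesis by (simp add: mult.assoc) (metis mult.assoc mult.right_neutral)
qed

section \<open>Correlations, the heat kernel, and functions with separated supports\<close>

lemma lborel_integral_reflect:
  fixes h :: "'a::euclidean_space \<Rightarrow> complex"
  assumes [measurable]: "h \<in> borel_measurable borel"
  shows "(LINT w|lborel. h (v - w)) = (LINT z|lborel. h z)"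
proof -
  have "(LINT z|lborel. h z) = (LINT z|distr lborel borel (\<lambda>w. v + (- 1) *\<^sub>R w). h z)"
    using lborel_affine[of "- 1" v] by (simp add: density_1)
  also have "\<dots> = (LINT w|lborel. h (v - w))" by (subst integral_distr) auto
  finally show ?thesis by simp
qed

lemma nn_integral_lborel_reflect:
  fixes h :: "'a::euclidean_space \<Rightarrow> ennreal"
  assumes [measurable]: "h \<in> borel_measurable borel"
  shows "(\<integral>\<^sup>+w. h (v - w) \<partial>lborel) = (\<integral>\<^sup>+z. h z \<partial>lborel)"
proof -
  have "(\<integral>\<^sup>+z. h z \<partial>lborel) = (\<integral>\<^sup>+z. h z \<partial>distr lborel borel (\<lambda>w. v + (- 1) *\<^sub>R w))"
    using lborel_affine[of "- 1" v] by (simp add: density_1)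
  also have "\<dots> = (\<integral>\<^sup>+w. h (v - w) \<partial>lborel)" by (subst nn_integral_distr) auto
  finally show ?thesis by simp
qed

text \<open>Turns an integral over the displacement w = v - z into \<open>f\<close> tested against a
  potential of \<open>\<phi>\<close> at the point z.\<close>

lemma correlation_swap:
  fixes f \<phi> k :: "'a::euclidean_space \<Rightarrow> complex"
  assumes f: "integrable lborel f" and \<phi>: "integrable lborel \<phi>"
    and k [measurable]: "k \<in> borel_measurable borel" and kb: "\<And>w. cmod (k w) \<le> C"
  shows "integrable lborel (\<lambda>w. k w * (LINT v|lborel. f (v - w) * \<phi> v))"
    and "(LINT w|lborel. k w * (LINT v|lborel. f (v - w) * \<phi> v)) = (LINT z|lborel. f z * (LINT v|lborel. k (v - z) * \<phi> v))"
proof -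
  have [measurable]: "f \<in> borel_measurable borel" "\<phi> \<in> borel_measurable borel"
    using borel_measurable_integrable[OF f] borel_measurable_integrable[OF \<phi>] by auto
  let ?H = "\<lambda>v w. \<phi> v * (f (v - w) * k w)"
  have "integrable (lborel \<Otimes>\<^sub>M lborel) (\<lambda>(v, w). \<phi> v * f (v - w))"
  proof (rule integrableI_bounded)
    have "(\<integral>\<^sup>+p. ennreal (norm (case p of (v, w) \<Rightarrow> \<phi> v * f (v - w))) \<partial>(lborel \<Otimes>\<^sub>M lborel))
        = (\<integral>\<^sup>+v. \<integral>\<^sup>+w. ennreal (cmod (\<phi> v)) * ennreal (cmod (f (v - w))) \<partial>lborel \<partial>lborel)"
      by (subst lborel.nn_integral_fst[symmetric]) (auto simp: norm_mult ennreal_mult)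
    also have "\<dots> = (\<integral>\<^sup>+v. ennreal (cmod (\<phi> v)) * (\<integral>\<^sup>+z. ennreal (cmod (f z)) \<partial>lborel) \<partial>lborel)"
      by (simp add: nn_integral_cmult nn_integral_lborel_reflect[of "\<lambda>z. ennreal (cmod (f z))"])
    also have "\<dots> = (\<integral>\<^sup>+v. ennreal (cmod (\<phi> v)) \<partial>lborel) * (\<integral>\<^sup>+z. ennreal (cmod (f z)) \<partial>lborel)"
      by (rule nn_integral_multc) measurable
    also have "\<dots> < \<infinity>" using f \<phi> by (simp add: integrable_iff_bounded ennreal_mult_less_top)
    finally show "(\<integral>\<^sup>+p. ennreal (norm (case p of (v, w) \<Rightarrow> \<phi> v * f (v - w))) \<partial>(lborel \<Otimes>\<^sub>M lborel)) < \<infinity>" .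
  qed measurable
  then have "integrable (lborel \<Otimes>\<^sub>M lborel) (\<lambda>p. of_real C * (case p of (v, w) \<Rightarrow> \<phi> v * f (v - w)))"
    by (rule integrable_mult_right)
  then have H: "integrable (lborel \<Otimes>\<^sub>M lborel) (\<lambda>(v, w). ?H v w)"
  proof (rule Bochner_Integration.integrable_bound)
    have "cmod (?H v w) \<le> cmod (of_real C * (\<phi> v * f (v - w)))" for v w
      using mult_left_mono[OF kb[of w], of "cmod (\<phi> v) * cmod (f (v - w))"] order_trans[OF norm_ge_zero kb[of w]]
      by (simp add: norm_mult mult_ac)
    then show "AE p in lborel \<Otimes>\<^sub>M lborel. norm (case p of (v, w) \<Rightarrow> ?H v w)
        \<le> norm (of_real C * (case p of (v, w) \<Rightarrow> \<phi> v * f (v - w)))"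
      by (intro AE_I2) (auto split: prod.split)
  qed measurable
  have e1: "(LINT v|lborel. ?H v w) = k w * (LINT v|lborel. f (v - w) * \<phi> v)" for w
    by (subst integral_mult_right_zero[symmetric]) (simp add: mult_ac)
  have e2: "(LINT w|lborel. ?H v w) = \<phi> v * (LINT z|lborel. k (v - z) * f z)" for v
  proof -
    have "(LINT w|lborel. f (v - w) * k w) = (LINT w|lborel. (\<lambda>z. k (v - z) * f z) (v - w))" by (simp add: mult.commute)
    also have "\<dots> = (LINT z|lborel. k (v - z) * f z)" by (rule lborel_integral_reflect) measurable
    finally show ?thesis by simp
  qed
  show "integrable lborel (\<lambda>w. k w * (LINT v|lborel. f (v - w) * \<phi> v))"
    using lborel_pair.integrable_snd[OF H] unfolding e1 .
  have "(LINT w|lborel. k w * (LINT v|lborel. f (v - w) * \<phi> v)) = (LINT v|lborel. \<phi> v * (LINT z|lborel. k (v - z) * f z))"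
    using lborel_pair.integral_fst[OF H] lborel_pair.integral_snd[OF H] unfolding e1 e2 by simp
  also have "\<dots> = (LINT z|lborel. f z * (LINT v|lborel. k (v - z) * \<phi> v))"
    by (rule fubini_bounded_kernel(1)[OF lborel.sigma_finite_measure_axioms lborel.sigma_finite_measure_axioms \<phi> f _ kb]) measurable
  finally show "(LINT w|lborel. k w * (LINT v|lborel. f (v - w) * \<phi> v)) = (LINT z|lborel. f z * (LINT v|lborel. k (v - z) * \<phi> v))" .
qed

text \<open>The argument q stands for |y|^2 / 4, and \<beta> collects all powers of \<tau>.
  Extension by zero to \<tau> \<le> 0 makes it one function on the line, continuous when q > 0, so
  that later and earlier times need no separate domains.\<close>

definition exp_kernel :: "real \<Rightarrow> real \<Rightarrow> real \<Rightarrow> real" where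
  "exp_kernel \<beta> \<tau> q = (if 0 < \<tau> then \<tau> powr (- \<beta>) * exp (- q / \<tau>) else 0)"

lemma exp_kernel_measurable [measurable (raw)]:
  assumes [measurable]: "f \<in> borel_measurable M" "g \<in> borel_measurable M"
  shows "(\<lambda>x. exp_kernel \<beta> (f x) (g x)) \<in> borel_measurable M"
  unfolding exp_kernel_def by measurable

lemma exp_kernel_nonneg [simp]: "0 \<le> exp_kernel \<beta> \<tau> q"
  by (simp add: exp_kernel_def)

lemma exp_kernel_bound:
  assumes c: "0 < c" and \<beta>: "0 < \<beta>"
  obtains C where "0 < C" "\<And>\<tau> q. c \<le> q \<Longrightarrow> exp_kernel \<beta> \<tau> q \<le> C"
proof -
  show ?thesis
  \<comment> \<open>The bound is the value at q = c and \<tau> = c / \<beta>, the maximum over q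
    \<ge> c; ln x \<le> x - 1 proves it.\<close>
  proof (rule that[of "exp (- \<beta> - \<beta> * ln (c / \<beta>))"])
    fix \<tau> q :: real assume q: "c \<le> q"
    show "exp_kernel \<beta> \<tau> q \<le> exp (- \<beta> - \<beta> * ln (c / \<beta>))"
    proof (cases "0 < \<tau>")
      case True
      have "ln (c / \<beta> / \<tau>) \<le> c / \<beta> / \<tau> - 1" using c \<beta> True by (intro ln_le_minus_one) auto
      then have "\<beta> * (ln (c / \<beta>) - ln \<tau>) \<le> \<beta> * (c / \<beta> / \<tau> - 1)"
        using c \<beta> True by (intro mult_left_mono) (auto simp: ln_div ln_mult)
      also have "\<dots> = c / \<tau> - \<beta>" using \<beta> by (simp add: right_diff_distrib)
      also have "c / \<tau> \<le> q / \<tau>" using q True by (simp add: divide_right_mono)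
      finally have "- \<beta> * ln \<tau> - q / \<tau> \<le> - \<beta> - \<beta> * ln (c / \<beta>)" by (simp add: algebra_simps)
      moreover have "exp_kernel \<beta> \<tau> q = exp (- \<beta> * ln \<tau> - q / \<tau>)"
        using True by (simp add: exp_kernel_def powr_def exp_add[symmetric])
      ultimately show ?thesis by simp
    qed (simp add: exp_kernel_def)
  qed simp
qed

definition heat_density :: "real \<Rightarrow> real ^ 'n::finite \<Rightarrow> real" where
  "heat_density \<tau> y = exp (- (norm y)\<^sup>2 / (4 * \<tau>)) / sqrt (4 * pi * \<tau>) ^ CARD('n)"

lemma heat_density_measurable [measurable]: "heat_density \<tau> \<in> borel_measurable borel"
  unfolding heat_density_def[abs_def] by measurable

lemma heat_density_integrable:
  assumes "0 < \<tau>"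
  shows "integrable lborel (\<lambda>y :: real ^ 'n::finite. complex_of_real (heat_density \<tau> y))"
proof -
  have "heat_density \<tau> y = inverse (sqrt (4 * pi * \<tau>) ^ CARD('n)) * exp (- (1 / (4 * \<tau>)) * (norm y)\<^sup>2)" for y :: "real ^ 'n"
  proof -
    have "- (norm y)\<^sup>2 / (4 * \<tau>) = - (1 / (4 * \<tau>)) * (norm y)\<^sup>2" by simp
    then show ?thesis by (simp only: heat_density_def) (simp only: divide_inverse_commute)
  qed
  moreover have "integrable lborel (\<lambda>y :: real ^ 'n. inverse (sqrt (4 * pi * \<tau>) ^ CARD('n)) * exp (- (1 / (4 * \<tau>)) * (norm y)\<^sup>2))"
    using assms by (intro integrable_mult_right gauss_integral) simp
  ultimately show ?thesis by (simp only: complex_of_real_integrable_eq)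
qed

text \<open>The semigroup generated by the negative heat operator shifts time by \<tau> and
  convolves with the heat density in space. Its symbol is the transform of the corresponding measure
  on the slice at time \<tau>.\<close>

lemma exp_heat_symbol:
  fixes \<zeta> :: "'n::finite spacetime"
  assumes \<tau>: "0 < \<tau>"
  shows "exp (- (complex_of_real \<tau> * heat_symbol \<zeta>))
    = (LINT y|lborel. cis (- ((\<tau>, y) \<bullet> \<zeta>)) * complex_of_real (heat_density \<tau> y))"
proof -
  let ?A = "sqrt (4 * pi * \<tau>) ^ CARD('n)"
  have A: "?A \<noteq> 0" using \<tau> by simp
  have c: "0 < 1 / (4 * \<tau>)" using \<tau> by simp
  have split: "cis (- ((\<tau>, y) \<bullet> \<zeta>)) * complex_of_real (heat_density \<tau> y)
      = (cis (- \<tau> * fst \<zeta>) / complex_of_real ?A) * (cis (- (y \<bullet> snd \<zeta>)) * complex_of_real (exp (- (1 / (4 * \<tau>)) * (norm y)\<^sup>2)))" for y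
  proof -
    have "cis (- ((\<tau>, y) \<bullet> \<zeta>)) = cis (- \<tau> * fst \<zeta>) * cis (- (y \<bullet> snd \<zeta>))"
      by (simp add: inner_prod_def cis_mult)
    then show ?thesis by (simp add: heat_density_def)
  qed
  have "(LINT y|lborel. cis (- ((\<tau>, y) \<bullet> \<zeta>)) * complex_of_real (heat_density \<tau> y))
      = (cis (- \<tau> * fst \<zeta>) / complex_of_real ?A) * complex_of_real (sqrt (pi / (1 / (4 * \<tau>))) ^ CARD('n) * exp (- (norm (snd \<zeta>))\<^sup>2 / (4 * (1 / (4 * \<tau>)))))"
    unfolding split integral_mult_right_zero gauss_ft(2)[OF c] by simp
  also have "\<dots> = cis (- \<tau> * fst \<zeta>) * complex_of_real (exp (- \<tau> * (norm (snd \<zeta>))\<^sup>2))"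
  proof -
    have "sqrt (pi / (1 / (4 * \<tau>))) = sqrt (4 * pi * \<tau>)" by (simp add: mult_ac)
    moreover have "- (norm (snd \<zeta>))\<^sup>2 / (4 * (1 / (4 * \<tau>))) = - \<tau> * (norm (snd \<zeta>))\<^sup>2" using \<tau> by simp
    ultimately show ?thesis using A by (simp only:) (simp del: of_real_power)
  qed
  also have "\<dots> = exp (- (complex_of_real \<tau> * heat_symbol \<zeta>))"
    unfolding cis_conv_exp exp_of_real[symmetric] exp_add[symmetric] by (simp add: heat_symbol_def algebra_simps)
  finally show ?thesis by simp
qed

text \<open>Parseval's identity for \<open>\<phi>\<close> and the translate of \<open>f\<close> by
  \<open>a\<close>: a character on the frequency side is a displacement in the correlation.\<close>

lemma fourier_correlation:
  fixes f \<phi> :: "'a::euclidean_space \<Rightarrow> complex"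
  assumes f: "f \<in> L12" and \<phi>: "\<phi> \<in> L12"
  shows "(LINT \<zeta>|lborel. cis (- (a \<bullet> \<zeta>)) * (ft f \<zeta> * cnj (ft \<phi> \<zeta>)))
    = complex_of_real (fourier_const TYPE('a)) * (LINT v|lborel. f (v - a) * cnj (\<phi> v))"
proof -
  have fm [measurable]: "f \<in> borel_measurable borel" by (rule L12_measurable[OF f])
  have [measurable]: "\<phi> \<in> borel_measurable borel" by (rule L12_measurable[OF \<phi>])
  have s12: "(\<lambda>z. f (z + - a)) \<in> L12"
  proof -
    have "integrable lborel (\<lambda>z. (cmod (f (z + - a)))\<^sup>2)"
      using lborel_integrable_shift[of "\<lambda>z. complex_of_real ((cmod (f z))\<^sup>2)" "- a"] L2_integrable[OF L12_L2(1)[OF f]]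
      by (simp only: complex_of_real_integrable_eq)
    then show ?thesis using lborel_integrable_shift[OF L12_integrable[OF f], of "- a"] by (simp add: L12_def L2_def)
  qed
  have ft: "ft (\<lambda>z. f (z + - a)) \<zeta> = cis (- (a \<bullet> \<zeta>)) * ft f \<zeta>" for \<zeta>
    using ft_shift[OF fm, of "- a" \<zeta>] by simp
  note L = ft_L2(1)[OF s12, THEN L2_lborel_imp_lebesgue] ft_L2(1)[OF \<phi>, THEN L2_lborel_imp_lebesgue]
  have "(LINT \<zeta>|lborel. cis (- (a \<bullet> \<zeta>)) * (ft f \<zeta> * cnj (ft \<phi> \<zeta>))) = (LINT \<zeta>|lborel. ft (\<lambda>z. f (z + - a)) \<zeta> * cnj (ft \<phi> \<zeta>))"
    unfolding ft by (simp add: mult.assoc)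
  also have "\<dots> = (LINT \<zeta>|lebesgue. ft (\<lambda>z. f (z + - a)) \<zeta> * cnj (ft \<phi> \<zeta>))"
    by (rule integral_completion[symmetric]) measurable
  also have "\<dots> = l2_cinner (l2_ft (to_l2 (\<lambda>z. f (z + - a)))) (l2_ft (to_l2 \<phi>))"
    unfolding l2_ft_L12[OF s12] l2_ft_L12[OF \<phi>] l2_cinner_to_l2[OF L] L2_inner_def ..
  also have "\<dots> = complex_of_real (fourier_const TYPE('a)) * (LINT v|lebesgue. f (v + - a) * cnj (\<phi> v))"
    unfolding l2_cinner_ft l2_cinner_to_l2[OF L12_L2(2)[OF s12] L12_L2(2)[OF \<phi>]] L2_inner_def ..
  also have "(LINT v|lebesgue. f (v + - a) * cnj (\<phi> v)) = (LINT v|lborel. f (v + - a) * cnj (\<phi> v))"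
    by (rule integral_completion) measurable
  finally show ?thesis by simp
qed

lemma AE_snd_nonzero: "AE \<zeta> in (lborel :: 'n::finite spacetime measure). snd \<zeta> \<noteq> 0"
proof -
  obtain b :: "real ^ 'n" where b: "b \<in> Basis" using nonempty_Basis by blast
  have "negligible {z :: 'n spacetime. z \<bullet> (0, b) = 0}"
    by (rule negligible_standard_hyperplane) (use b in \<open>simp add: Basis_prod_def\<close>)
  then have "{z :: 'n spacetime. z \<bullet> (0, b) = 0} \<in> null_sets lebesgue" by (simp add: negligible_iff_null_sets)
  from AE_not_in[OF this] have "AE \<zeta> in (lebesgue :: 'n spacetime measure). snd \<zeta> \<noteq> 0"
    by eventually_elim (auto simp: inner_prod_def)
  then show ?thesis by (simp add: AE_completion_iff)
qed

text \<open>The cutoff |y| \<ge> d removes the singularity at the origin and makes the kernel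
  bounded; it is invisible on pairs of points from supports at distance d.\<close>

definition heat_kernel :: "real \<Rightarrow> real \<Rightarrow> 'n::finite spacetime \<Rightarrow> real" where
  "heat_kernel \<beta> d w = (if d \<le> norm (snd w) then exp_kernel \<beta> (fst w) ((norm (snd w))\<^sup>2 / 4) else 0)"

lemma heat_kernel_measurable [measurable]: "(heat_kernel \<beta> d :: 'n::finite spacetime \<Rightarrow> real) \<in> borel_measurable borel"
proof -
  have [measurable]: "(fst :: 'n spacetime \<Rightarrow> real) \<in> borel_measurable borel" "(snd :: 'n spacetime \<Rightarrow> _) \<in> borel_measurable borel"
    by (auto intro!: borel_measurable_continuous_onI continuous_intros)
  show ?thesis unfolding heat_kernel_def[abs_def] by measurable
qed

text \<open>The origin of the exponent \<beta> = 1 + s + n/2: the subordination weight contributes 1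
  + s, the normalisation of the heat density n/2.\<close>

lemma powr_weight_heat_density:
  assumes "0 < \<tau>"
  shows "powr_weight s \<tau> * heat_density \<tau> (y :: real ^ 'n::finite)
    = inverse (sqrt (4 * pi) ^ CARD('n)) * exp_kernel (1 + s + real CARD('n) / 2) \<tau> ((norm y)\<^sup>2 / 4)"
proof -
  have "sqrt \<tau> ^ CARD('n) = \<tau> powr (real CARD('n) / 2)"
    using assms by (simp add: powr_half_sqrt[symmetric] powr_power)
  then have "sqrt (4 * pi * \<tau>) ^ CARD('n) = sqrt (4 * pi) ^ CARD('n) * \<tau> powr (real CARD('n) / 2)"
    by (simp only: real_sqrt_mult power_mult_distrib)
  moreover have "\<tau> powr (- (1 + s + real CARD('n) / 2)) = \<tau> powr (- 1 - s) * inverse (\<tau> powr (real CARD('n) / 2))"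
    by (simp add: powr_minus[symmetric] powr_add[symmetric])
  moreover have "a * (X / (A * B)) = inverse A * ((a * inverse B) * X)" for a X A B :: real
    by (simp add: divide_inverse mult_ac)
  moreover have "- ((norm y)\<^sup>2 / 4) / \<tau> = - (norm y)\<^sup>2 / (4 * \<tau>)" by simp
  ultimately have "\<tau> powr (- 1 - s) * heat_density \<tau> y
    = inverse (sqrt (4 * pi) ^ CARD('n)) * (\<tau> powr (- (1 + s + real CARD('n) / 2)) * exp (- ((norm y)\<^sup>2 / 4) / \<tau>))"
    unfolding heat_density_def by (simp only:)
  then show ?thesis using assms by (simp only: powr_weight_def exp_kernel_def if_True) simp
qed

text \<open>The power is replaced by the subordination integral of 1 - e^(-t z). The term 1 pairs
  \<open>f\<close> with \<open>\<phi>\<close> and vanishes because the supports are disjoint; the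
  semigroup term is an average of correlations over displacements (t, y) with |y| \<ge> d.\<close>

lemma heat_form_pairing:
  fixes f \<phi> :: "'n::finite spacetime \<Rightarrow> complex"
  assumes s: "0 < s" "s < 1" and d: "0 < d"
    and f: "f \<in> L12" and \<phi>: "\<phi> \<in> L12"
    and sep: "\<And>z v. f z \<noteq> 0 \<Longrightarrow> \<phi> v \<noteq> 0 \<Longrightarrow> d \<le> norm (snd v - snd z)"
    and int: "integrable lborel (\<lambda>\<zeta>. cmod (heat_symbol \<zeta>) powr s * cmod (ft f \<zeta> * cnj (ft \<phi> \<zeta>)))"
    and zero: "(LINT \<zeta>|lborel. heat_symbol \<zeta> powr complex_of_real s * (ft f \<zeta> * cnj (ft \<phi> \<zeta>))) = 0"
  shows "(LINT z|lborel. f z * (LINT v|lborel. complex_of_real (heat_kernel (1 + s + real CARD('n) / 2) d (v - z)) * cnj (\<phi> v))) = 0"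
proof -
  let ?P = "\<lambda>\<zeta>. ft f \<zeta> * cnj (ft \<phi> \<zeta>)" and ?K = "complex_of_real (fourier_const TYPE('n spacetime))"
  let ?\<beta> = "1 + s + real CARD('n) / 2"
  define \<kappa> where "\<kappa> = inverse (sqrt (4 * pi) ^ CARD('n))"
  have fm [measurable]: "f \<in> borel_measurable borel" by (rule L12_measurable[OF f])
  have \<phi>m [measurable]: "\<phi> \<in> borel_measurable borel" by (rule L12_measurable[OF \<phi>])
  have Pi: "integrable lborel ?P" by (rule L2_integrable_mult[OF ft_L2(1)[OF f] ft_L2(1)[OF \<phi>]])
  \<comment> \<open>The correlation of \<open>f\<close> and \<open>\<phi>\<close> at the space-time
    displacement w. It vanishes for |snd w| < d by separation, in particular at w = 0, which
    disposes of the term 1.\<close>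
  define R where "R w = (LINT v|lborel. f (v - w) * cnj (\<phi> v))" for w
  have R0: "R w = 0" if "norm (snd w) < d" for w
  proof -
    have "f (v - w) * cnj (\<phi> v) = 0" for v using sep[of "v - w" v] that by fastforce
    then show ?thesis unfolding R_def by (simp only: Bochner_Integration.integral_zero)
  qed
  have E: "(LINT \<zeta>|lborel. exp (- (complex_of_real \<tau> * heat_symbol \<zeta>)) * ?P \<zeta>)
      = ?K * (LINT y|lborel. complex_of_real (heat_density \<tau> y) * R (\<tau>, y))" if \<tau>: "0 < \<tau>" for \<tau>
  proof -
    have "(LINT \<zeta>|lborel. exp (- (complex_of_real \<tau> * heat_symbol \<zeta>)) * ?P \<zeta>)
        = (LINT \<zeta>|lborel. ?P \<zeta> * (LINT y|lborel. cis (- ((\<tau>, y) \<bullet> \<zeta>)) * complex_of_real (heat_density \<tau> y)))"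
      unfolding exp_heat_symbol[OF \<tau>] by (rule Bochner_Integration.integral_cong[OF refl], rule mult.commute)
    also have "\<dots> = (LINT y|lborel. complex_of_real (heat_density \<tau> y) * (LINT \<zeta>|lborel. cis (- ((\<tau>, y) \<bullet> \<zeta>)) * ?P \<zeta>))"
    proof (rule fubini_bounded_kernel(1)[OF lborel.sigma_finite_measure_axioms lborel.sigma_finite_measure_axioms Pi heat_density_integrable[OF \<tau>], where C = 1])
      have "(\<lambda>p :: 'n spacetime \<times> (real ^ 'n). cis (- ((\<tau>, snd p) \<bullet> fst p))) \<in> borel_measurable borel"
        by (intro borel_measurable_continuous_onI continuous_intros)
      then show "(\<lambda>(\<zeta> :: 'n spacetime, y). cis (- ((\<tau>, y) \<bullet> \<zeta>))) \<in> borel_measurable (lborel \<Otimes>\<^sub>M lborel)"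
        by (simp add: borel_prod case_prod_beta' lborel_prod)
    qed simp
    also have "\<dots> = (LINT y|lborel. complex_of_real (heat_density \<tau> y) * (?K * R (\<tau>, y)))"
      unfolding fourier_correlation[OF f \<phi>] R_def ..
    also have "\<dots> = ?K * (LINT y|lborel. complex_of_real (heat_density \<tau> y) * R (\<tau>, y))"
      unfolding integral_mult_right_zero[symmetric] by (simp add: mult.left_commute)
    finally show ?thesis .
  qed
  have P0: "(LINT \<zeta>|lborel. ?P \<zeta>) = 0"
  proof -
    have "(LINT \<zeta>|lborel. ?P \<zeta>) = ?K * R 0" using fourier_correlation[OF f \<phi>, of 0] by (simp add: R_def)
    then show ?thesis using R0[of 0] d by simp
  qed
  let ?H = "\<lambda>\<zeta> t. (powr_weight s t *\<^sub>R (1 - exp (- (complex_of_real t * heat_symbol \<zeta>)))) * ?P \<zeta>"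
  have re: "0 \<le> Re (heat_symbol \<zeta>)" for \<zeta> :: "'n spacetime" by (simp add: Re_heat_symbol)
  \<comment> \<open>Integrating over t first costs the factor |heat_symbol|^s, which is exactly what
    the assumption \<open>int\<close> allows.\<close>
  have H: "integrable (lborel \<Otimes>\<^sub>M lborel) (\<lambda>(\<zeta>, t). ?H \<zeta> t)"
  proof (rule lborel_pair.Fubini_integrable)
    have ff: "(\<lambda>p :: 'n spacetime \<times> real. h (fst p)) \<in> borel_measurable (lborel \<Otimes>\<^sub>M lborel)"
      if "h \<in> borel_measurable borel" for h :: "'n spacetime \<Rightarrow> complex"
      by (rule measurable_compose[OF measurable_fst]) (use that in simp)
    have sm: "(\<lambda>p :: 'n spacetime \<times> real. powr_weight s (snd p)) \<in> borel_measurable (lborel \<Otimes>\<^sub>M lborel)"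
      by (rule measurable_compose[OF measurable_snd]) simp
    have Pm: "?P \<in> borel_measurable borel" using borel_measurable_integrable[OF Pi] by simp
    note [measurable] = ff[OF heat_symbol_measurable] ff[OF Pm] sm
    have [measurable]: "(\<lambda>p :: 'n spacetime \<times> real. exp (- (complex_of_real (snd p) * heat_symbol (fst p)))) \<in> borel_measurable (lborel \<Otimes>\<^sub>M lborel)"
      by measurable
    show "(\<lambda>(\<zeta> :: 'n spacetime, t). ?H \<zeta> t) \<in> borel_measurable (lborel \<Otimes>\<^sub>M lborel)"
      unfolding case_prod_beta' by measurable
    show "integrable lborel (\<lambda>\<zeta>. LINT t|lborel. norm (case (\<zeta>, t) of (\<zeta>, t) \<Rightarrow> ?H \<zeta> t))"
    proof (rule Bochner_Integration.integrable_bound)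
      show "integrable lborel (\<lambda>\<zeta>. powr_const s * (cmod (heat_symbol \<zeta>) powr s * cmod (?P \<zeta>)))"
        using int by (rule integrable_mult_right)
      have eq: "(LINT t|lborel. norm (case (\<zeta>, t) of (\<zeta>, t) \<Rightarrow> ?H \<zeta> t))
          = (LINT t|lborel. cmod (powr_weight s t *\<^sub>R (1 - exp (- (complex_of_real t * heat_symbol \<zeta>))))) * cmod (?P \<zeta>)" for \<zeta>
        by (simp only: prod.case norm_mult integral_mult_left_zero)
      have "\<bar>LINT t|lborel. norm (case (\<zeta>, t) of (\<zeta>, t) \<Rightarrow> ?H \<zeta> t)\<bar> \<le> powr_const s * (cmod (heat_symbol \<zeta>) powr s * cmod (?P \<zeta>))" for \<zeta>
        using mult_right_mono[OF powr_integrand_bound(2)[OF s re], of "cmod (?P \<zeta>)" \<zeta>]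
        unfolding eq by (subst abs_of_nonneg) (auto simp: mult_ac intro!: mult_nonneg_nonneg Bochner_Integration.integral_nonneg)
      then show "AE \<zeta> in lborel. norm (LINT t|lborel. norm (case (\<zeta>, t) of (\<zeta>, t) \<Rightarrow> ?H \<zeta> t))
          \<le> norm (powr_const s * (cmod (heat_symbol \<zeta>) powr s * cmod (?P \<zeta>)))"
        by (intro AE_I2) (simp only: real_norm_def, rule order_trans[OF _ abs_ge_self])
      show "(\<lambda>\<zeta> :: 'n spacetime. LINT t|lborel. norm (case (\<zeta>, t) of (\<zeta>, t) \<Rightarrow> ?H \<zeta> t)) \<in> borel_measurable lborel"
        unfolding case_prod_beta' by measurable
    qed
    show "AE \<zeta> in lborel. integrable lborel (\<lambda>t. case (\<zeta>, t) of (\<zeta>, t) \<Rightarrow> ?H \<zeta> t)"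
      using powr_integrand_bound(1)[OF s re] by (intro AE_I2) (simp only: prod.case, rule integrable_mult_left)
  qed
  \<comment> \<open>The multiple of z^s integrates to zero by assumption; exchanging the integrals
    over \<zeta> and t expresses the same zero through the semigroup.\<close>
  have "0 = powr_int s 1 * (LINT \<zeta>|lborel. heat_symbol \<zeta> powr complex_of_real s * ?P \<zeta>)" using zero by simp
  also have "\<dots> = (LINT \<zeta>|lborel. LINT t|lborel. ?H \<zeta> t)"
  proof -
    have "(LINT \<zeta>|lborel. LINT t|lborel. ?H \<zeta> t) = (LINT \<zeta>|lborel. powr_int s 1 * (heat_symbol \<zeta> powr complex_of_real s * ?P \<zeta>))"
    proof (rule integral_cong_AE)
      \<comment> \<open>The formula for the power is available where the symbol has positive real
        part, that is for \<xi> \<noteq> 0; the exception is a null set.\<close>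
      show "AE \<zeta> in lborel. (LINT t|lborel. ?H \<zeta> t) = powr_int s 1 * (heat_symbol \<zeta> powr complex_of_real s * ?P \<zeta>)"
        using AE_snd_nonzero
      proof eventually_elim
        case (elim \<zeta>)
        then have "powr_int s (heat_symbol \<zeta>) = powr_int s 1 * heat_symbol \<zeta> powr complex_of_real s"
          by (intro powr_int_eq s) (simp add: Re_heat_symbol)
        moreover have "(LINT t|lborel. ?H \<zeta> t) = powr_int s (heat_symbol \<zeta>) * ?P \<zeta>"
          unfolding powr_int_def by (rule integral_mult_left_zero)
        ultimately show ?case by (simp only: mult.assoc)
      qed
      show "(\<lambda>\<zeta>. LINT t|lborel. ?H \<zeta> t) \<in> borel_measurable lborel"
        using lborel_pair.integrable_fst[OF H] by (rule borel_measurable_integrable)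
    qed measurable
    then show ?thesis by simp
  qed
  also have "\<dots> = (LINT t|lborel. LINT \<zeta>|lborel. ?H \<zeta> t)"
    using lborel_pair.integral_fst[OF H] lborel_pair.integral_snd[OF H] by simp
  also have "\<dots> = (LINT t|lborel. - ?K * (LINT y|lborel. complex_of_real (\<kappa> * heat_kernel ?\<beta> d (t, y)) * R (t, y)))"
  proof (rule Bochner_Integration.integral_cong)
    fix t :: real
    show "(LINT \<zeta>|lborel. ?H \<zeta> t) = - ?K * (LINT y|lborel. complex_of_real (\<kappa> * heat_kernel ?\<beta> d (t, y)) * R (t, y))"
    proof (cases "0 < t")
      case True
      have ei: "integrable lborel (\<lambda>\<zeta>. exp (- (complex_of_real t * heat_symbol \<zeta>)) * ?P \<zeta>)"
      proof (rule Bochner_Integration.integrable_bound[OF Pi])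
        have "cmod (exp (- (complex_of_real t * heat_symbol \<zeta>))) \<le> 1" for \<zeta> :: "'n spacetime"
          using True re[of \<zeta>] by simp
        then show "AE \<zeta> in lborel. norm (exp (- (complex_of_real t * heat_symbol \<zeta>)) * ?P \<zeta>) \<le> norm (?P \<zeta>)"
          by (intro AE_I2) (simp only: norm_mult, rule mult_left_le_one_le, auto)
      qed measurable
      have "(LINT \<zeta>|lborel. ?H \<zeta> t) = (LINT \<zeta>|lborel. complex_of_real (powr_weight s t) * (?P \<zeta> - exp (- (complex_of_real t * heat_symbol \<zeta>)) * ?P \<zeta>))"
        by (rule Bochner_Integration.integral_cong) (simp_all add: scaleR_conv_of_real left_diff_distrib mult.assoc)
      also have "\<dots> = complex_of_real (powr_weight s t) * ((LINT \<zeta>|lborel. ?P \<zeta>) - (LINT \<zeta>|lborel. exp (- (complex_of_real t * heat_symbol \<zeta>)) * ?P \<zeta>))"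
        by (simp only: integral_mult_right_zero Bochner_Integration.integral_diff[OF Pi ei])
      also have "\<dots> = - ?K * (complex_of_real (powr_weight s t) * (LINT y|lborel. complex_of_real (heat_density t y) * R (t, y)))"
        unfolding P0 E[OF True] by simp
      also have "complex_of_real (powr_weight s t) * (LINT y|lborel. complex_of_real (heat_density t y) * R (t, y))
          = (LINT y|lborel. complex_of_real (\<kappa> * heat_kernel ?\<beta> d (t, y)) * R (t, y))"
        unfolding integral_mult_right_zero[symmetric]
      proof (rule Bochner_Integration.integral_cong)
        fix y :: "real ^ 'n"
        show "complex_of_real (powr_weight s t) * (complex_of_real (heat_density t y) * R (t, y))
            = complex_of_real (\<kappa> * heat_kernel ?\<beta> d (t, y)) * R (t, y)"
        proof (cases "d \<le> norm y")
          case dy: True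
          have "powr_weight s t * heat_density t y = \<kappa> * heat_kernel ?\<beta> d (t, y)"
            using powr_weight_heat_density[OF True, of s y] dy by (simp add: heat_kernel_def \<kappa>_def)
          then show ?thesis by (metis mult.assoc of_real_mult)
        qed (use R0[of "(t, y)"] in simp)
      qed simp
      finally show ?thesis .
    next
      case False
      then have "heat_kernel ?\<beta> d (t, y) = 0" for y :: "real ^ 'n" by (simp add: heat_kernel_def exp_kernel_def)
      then show ?thesis using False by (simp add: powr_weight_def)
    qed
  qed simp
  also have "\<dots> = - ?K * (LINT t|lborel. LINT y|lborel. complex_of_real (\<kappa> * heat_kernel ?\<beta> d (t, y)) * R (t, y))"
    by (rule integral_mult_right_zero)
  finally have "?K * (LINT t|lborel. LINT y|lborel. complex_of_real (\<kappa> * heat_kernel ?\<beta> d (t, y)) * R (t, y)) = 0" by simp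
  then have z1: "(LINT t|lborel. LINT y|lborel. complex_of_real (\<kappa> * heat_kernel ?\<beta> d (t, y)) * R (t, y)) = 0" by simp
  obtain C where C: "\<And>\<tau> q. d\<^sup>2 / 4 \<le> q \<Longrightarrow> exp_kernel ?\<beta> \<tau> q \<le> C" "0 < C"
    using exp_kernel_bound[of "d\<^sup>2 / 4" ?\<beta>] d s by (metis add_pos_nonneg add_pos_pos divide_pos_pos of_nat_0_le_iff
        zero_less_numeral zero_less_power divide_nonneg_pos zero_less_one)
  have kb: "cmod (complex_of_real (\<kappa> * heat_kernel ?\<beta> d w)) \<le> \<kappa> * C" for w :: "'n spacetime"
  proof -
    have "0 \<le> \<kappa>" by (simp add: \<kappa>_def)
    moreover have "0 \<le> heat_kernel ?\<beta> d w" by (simp add: heat_kernel_def)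
    moreover have "heat_kernel ?\<beta> d w \<le> C"
      using C d power_mono[of d "norm (snd w)" 2] by (auto simp: heat_kernel_def less_imp_le)
    ultimately show ?thesis unfolding norm_of_real abs_mult by (simp add: mult_left_mono)
  qed
  have cphi: "integrable lborel (\<lambda>v. cnj (\<phi> v))" using L12_integrable[OF \<phi>] by simp
  have km: "(\<lambda>w :: 'n spacetime. complex_of_real (\<kappa> * heat_kernel ?\<beta> d w)) \<in> borel_measurable borel" by measurable
  note cs = correlation_swap[OF L12_integrable[OF f] cphi km kb, folded R_def]
  have "(LINT w|lborel. complex_of_real (\<kappa> * heat_kernel ?\<beta> d w) * R w) = 0"
  proof -
    have "integrable (lborel \<Otimes>\<^sub>M lborel) (\<lambda>(t, y). complex_of_real (\<kappa> * heat_kernel ?\<beta> d (t, y)) * R (t, y))"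
      using cs(1) by (simp add: lborel_prod case_prod_beta')
    from lborel_pair.integral_fst[OF this] show ?thesis using z1 by (simp add: lborel_prod case_prod_beta')
  qed
  then have "(LINT z|lborel. f z * (LINT v|lborel. complex_of_real (\<kappa> * heat_kernel ?\<beta> d (v - z)) * cnj (\<phi> v))) = 0"
    unfolding cs(2) .
  moreover have "(LINT z|lborel. f z * (LINT v|lborel. complex_of_real (\<kappa> * heat_kernel ?\<beta> d (v - z)) * cnj (\<phi> v)))
      = complex_of_real \<kappa> * (LINT z|lborel. f z * (LINT v|lborel. complex_of_real (heat_kernel ?\<beta> d (v - z)) * cnj (\<phi> v)))"
    by (simp only: of_real_mult mult.assoc integral_mult_right_zero mult.left_commute[of _ "complex_of_real \<kappa>"])
  moreover have "complex_of_real \<kappa> \<noteq> 0" by (simp add: \<kappa>_def)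
  ultimately show ?thesis by simp
qed

section \<open>Moments of the heat kernel\<close>

text \<open>An integral that vanishes along a segment has derivative zero, so the differentiated
  kernel pairs to zero as well. The bounds are asked for only on the support of
  \<open>\<psi>\<close>, where the kernels stay away from y = 0.\<close>

lemma kernel_integral_dir_deriv:
  fixes k k' :: "real \<Rightarrow> 'b::euclidean_space \<Rightarrow> real" and \<psi> :: "real \<times> 'b \<Rightarrow> complex"
  assumes \<psi>: "integrable lborel \<psi>" and \<delta>: "0 < \<delta>"
    and k: "(\<lambda>p. k (fst p) (snd p)) \<in> borel_measurable borel" and k': "(\<lambda>p. k' (fst p) (snd p)) \<in> borel_measurable borel"
    and zero: "\<And>r. \<bar>r\<bar> < \<delta> \<Longrightarrow> (LINT v|lborel. complex_of_real (k (fst v - (fst z + r * w1)) (snd v - (snd z + r *\<^sub>R w2))) * \<psi> v) = 0"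
    and bnd: "\<And>r v. \<bar>r\<bar> < \<delta> \<Longrightarrow> \<psi> v \<noteq> 0 \<Longrightarrow> \<bar>k (fst v - (fst z + r * w1)) (snd v - (snd z + r *\<^sub>R w2))\<bar> \<le> C"
      "\<And>r v. \<bar>r\<bar> < \<delta> \<Longrightarrow> \<psi> v \<noteq> 0 \<Longrightarrow> \<bar>k' (fst v - (fst z + r * w1)) (snd v - (snd z + r *\<^sub>R w2))\<bar> \<le> C"
    and der: "\<And>\<tau> y. y \<noteq> 0 \<Longrightarrow> ((\<lambda>h. k (\<tau> - h * w1) (y - h *\<^sub>R w2)) has_real_derivative k' \<tau> y) (at 0)"
    and y0: "\<And>r v. \<bar>r\<bar> < \<delta> \<Longrightarrow> \<psi> v \<noteq> 0 \<Longrightarrow> snd v - (snd z + r *\<^sub>R w2) \<noteq> 0"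
  shows "(LINT v|lborel. complex_of_real (k' (fst v - fst z) (snd v - snd z)) * \<psi> v) = 0"
proof -
  define \<kappa> where "\<kappa> r v = k (fst v - (fst z + r * w1)) (snd v - (snd z + r *\<^sub>R w2))" for r v
  define \<kappa>' where "\<kappa>' r v = k' (fst v - (fst z + r * w1)) (snd v - (snd z + r *\<^sub>R w2))" for r v
  have m: "(\<lambda>v. (fst v - a, snd v - b)) \<in> borel_measurable borel" for a :: real and b :: 'b
    by (intro borel_measurable_continuous_onI continuous_intros)
  have \<kappa>m: "\<kappa> r \<in> borel_measurable borel" and \<kappa>'m: "\<kappa>' r \<in> borel_measurable borel" for r
    using measurable_compose[OF m k] measurable_compose[OF m k'] by (simp_all add: \<kappa>_def[abs_def] \<kappa>'_def[abs_def])
  have \<psi>m: "\<psi> \<in> borel_measurable borel" using borel_measurable_integrable[OF \<psi>] by simp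
  have d: "((\<lambda>r. \<kappa> r v) has_real_derivative \<kappa>' r v) (at r)" if "\<bar>r\<bar> < \<delta>" "\<psi> v \<noteq> 0" for r v
  proof -
    have "((\<lambda>h. k (fst v - (fst z + r * w1) - h * w1) (snd v - (snd z + r *\<^sub>R w2) - h *\<^sub>R w2)) has_real_derivative \<kappa>' r v) (at 0)"
      unfolding \<kappa>'_def by (rule der[OF y0[OF that]])
    then have "((\<lambda>h. \<kappa> (h + r) v) has_real_derivative \<kappa>' r v) (at 0)"
      by (simp add: \<kappa>_def algebra_simps)
    then show ?thesis using DERIV_shift[of "\<lambda>r. \<kappa> r v" "\<kappa>' r v" 0 r] by simp
  qed
  \<comment> \<open>Steps tending to 0 and strictly below \<delta>, whence the double
    \<open>Suc\<close>.\<close>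
  define h where "h i = \<delta> * inverse (real (Suc (Suc i)))" for i :: nat
  have h: "h i \<noteq> 0" "\<bar>h i\<bar> < \<delta>" for i
  proof -
    have "inverse (real (Suc (Suc i))) < 1" by (simp add: inverse_less_1_iff)
    then have "\<delta> * inverse (real (Suc (Suc i))) < \<delta> * 1" using \<delta> by (intro mult_strict_left_mono) auto
    then show "h i \<noteq> 0" "\<bar>h i\<bar> < \<delta>" using \<delta> by (auto simp: h_def abs_mult simp del: of_nat_Suc)
  qed
  have h0: "h \<longlonglongrightarrow> 0"
    unfolding h_def[abs_def] by (rule tendsto_mult_right_zero[OF LIMSEQ_Suc[OF LIMSEQ_inverse_real_of_nat]])
  have int: "integrable lborel (\<lambda>v. complex_of_real (\<kappa> r v) * \<psi> v)" if r: "\<bar>r\<bar> < \<delta>" for r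
  proof (rule Bochner_Integration.integrable_bound)
    show "integrable lborel (\<lambda>v. complex_of_real C * \<psi> v)" using \<psi> by simp
    have "cmod (complex_of_real (\<kappa> r v) * \<psi> v) \<le> cmod (complex_of_real C * \<psi> v)" for v
      using bnd(1)[OF r, of v] by (cases "\<psi> v = 0") (auto simp: norm_mult \<kappa>_def intro!: mult_right_mono)
    then show "AE v in lborel. norm (complex_of_real (\<kappa> r v) * \<psi> v) \<le> norm (complex_of_real C * \<psi> v)" by simp
  qed (use \<kappa>m \<psi>m in simp)
  let ?q = "\<lambda>i v. complex_of_real ((\<kappa> (h i) v - \<kappa> 0 v) / h i) * \<psi> v"
  have "(\<lambda>i. LINT v|lborel. ?q i v) \<longlonglongrightarrow> (LINT v|lborel. complex_of_real (\<kappa>' 0 v) * \<psi> v)"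
  proof (rule integral_dominated_convergence)
    show "integrable lborel (\<lambda>v. C * cmod (\<psi> v))" using \<psi> by simp
    show "AE v in lborel. (\<lambda>i. ?q i v) \<longlonglongrightarrow> complex_of_real (\<kappa>' 0 v) * \<psi> v"
    proof (rule AE_I2)
      fix v
      show "(\<lambda>i. ?q i v) \<longlonglongrightarrow> complex_of_real (\<kappa>' 0 v) * \<psi> v"
      proof (cases "\<psi> v = 0")
        case False
        have "((\<lambda>t. (\<kappa> (0 + t) v - \<kappa> 0 v) / t) \<longlongrightarrow> \<kappa>' 0 v) (at 0)" using d[of 0 v] False \<delta> unfolding DERIV_def by simp
        then have "(\<lambda>i. (\<kappa> (h i) v - \<kappa> 0 v) / h i) \<longlonglongrightarrow> \<kappa>' 0 v"
          using h(1) h0 unfolding tendsto_at_iff_sequentially by (auto simp: o_def)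
        then show ?thesis by (intro tendsto_intros)
      qed simp
    qed
    show "AE v in lborel. norm (?q i v) \<le> C * cmod (\<psi> v)" for i
    proof (rule AE_I2)
      fix v
      show "norm (?q i v) \<le> C * cmod (\<psi> v)"
      proof (cases "\<psi> v = 0")
        case False
        have "norm (\<kappa> (h i) v - \<kappa> 0 v) \<le> C * norm (h i - 0)"
        proof (rule field_differentiable_bound[where S = "ball 0 \<delta>" and f' = "\<lambda>r. \<kappa>' r v"])
          show "((\<lambda>r. \<kappa> r v) has_field_derivative \<kappa>' r v) (at r within ball 0 \<delta>)" if "r \<in> ball 0 \<delta>" for r
            using that False by (intro d[THEN has_field_derivative_at_within]) auto
          show "norm (\<kappa>' r v) \<le> C" if "r \<in> ball 0 \<delta>" for r
            using that bnd(2)[of r v] False by (auto simp: \<kappa>'_def)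
        qed (use h(2)[of i] \<delta> in auto)
        then have "\<bar>(\<kappa> (h i) v - \<kappa> 0 v) / h i\<bar> \<le> C" using h(1)[of i] by (simp add: field_simps)
        then show ?thesis unfolding norm_mult norm_of_real by (intro mult_right_mono) auto
      qed simp
    qed
    show "(\<lambda>v. complex_of_real (\<kappa>' 0 v) * \<psi> v) \<in> borel_measurable lborel" using \<kappa>'m[of 0] \<psi>m by simp
    show "?q i \<in> borel_measurable lborel" for i using \<kappa>m[of 0] \<kappa>m[of "h i"] \<psi>m by simp
  qed
  moreover have "(LINT v|lborel. ?q i v) = 0" for i
  proof -
    have "?q i v = complex_of_real (1 / h i) * (complex_of_real (\<kappa> (h i) v) * \<psi> v - complex_of_real (\<kappa> 0 v) * \<psi> v)" for v
      by (simp add: left_diff_distrib diff_divide_distrib)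
    then have "(LINT v|lborel. ?q i v) = complex_of_real (1 / h i) * ((LINT v|lborel. complex_of_real (\<kappa> (h i) v) * \<psi> v) - (LINT v|lborel. complex_of_real (\<kappa> 0 v) * \<psi> v))"
      using int[OF h(2)[of i]] int[of 0] \<delta> by (simp only: integral_mult_right_zero Bochner_Integration.integral_diff abs_zero)
    also have "\<dots> = 0" using zero[OF h(2)[of i]] zero[of 0] \<delta> by (simp add: \<kappa>_def)
    finally show ?thesis .
  qed
  ultimately have "(\<lambda>i :: nat. 0) \<longlonglongrightarrow> (LINT v|lborel. complex_of_real (\<kappa>' 0 v) * \<psi> v)" by (simp only:)
  then have "(LINT v|lborel. complex_of_real (\<kappa>' 0 v) * \<psi> v) = 0" by (simp only: LIMSEQ_const_iff)
  then show ?thesis by (simp add: \<kappa>'_def)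
qed

lemma exp_kernel_shift_down: "\<tau> * exp_kernel (\<beta> + 1) \<tau> q = exp_kernel \<beta> \<tau> q"
proof (cases "0 < \<tau>")
  case True
  have "\<tau> * \<tau> powr (- (\<beta> + 1)) = \<tau> powr (- \<beta>)" using True powr_mult_base[of \<tau> "- (\<beta> + 1)"] by simp
  then show ?thesis using True by (simp add: exp_kernel_def mult.assoc[symmetric])
qed (simp add: exp_kernel_def)

lemma exp_kernel_deriv_q:
  "((\<lambda>q. exp_kernel \<beta> \<tau> q) has_real_derivative - exp_kernel (\<beta> + 1) \<tau> q) (at q)"
proof (cases "0 < \<tau>")
  case True
  have "\<tau> powr (- (\<beta> + 1)) = \<tau> powr (- \<beta>) / \<tau>" using True by (simp add: powr_diff)
  then show ?thesis using True unfolding exp_kernel_def by (auto intro!: derivative_eq_intros)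
qed (simp add: exp_kernel_def)

text \<open>For q > 0 the factor e^(-q/\<tau>) is flat at \<tau> = 0, so the kernel extended by zero
  is differentiable across it, and differentiation in time produces no boundary term.\<close>

lemma exp_kernel_deriv_time:
  assumes q: "0 < q" and \<beta>: "0 < \<beta>"
  shows "((\<lambda>\<tau>. exp_kernel \<beta> \<tau> q) has_real_derivative (- \<beta> * exp_kernel (\<beta> + 1) \<tau> q + q * exp_kernel (\<beta> + 2) \<tau> q)) (at \<tau>)"
proof -
  consider "\<tau> < 0" | "\<tau> = 0" | "0 < \<tau>" by linarith
  then show ?thesis
  proof cases
    case 1
    have "((\<lambda>\<tau>. 0 :: real) has_real_derivative 0) (at \<tau>)" by simp
    then have "((\<lambda>\<tau>. exp_kernel \<beta> \<tau> q) has_real_derivative 0) (at \<tau>)"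
      by (rule has_field_derivative_transform_within_open[where S = "{..<0}"]) (use 1 in \<open>auto simp: exp_kernel_def\<close>)
    then show ?thesis using 1 by (simp add: exp_kernel_def)
  next
    case 2
    obtain C where C: "\<And>\<tau> q'. q \<le> q' \<Longrightarrow> exp_kernel (\<beta> + 2) \<tau> q' \<le> C" by (rule exp_kernel_bound[of q "\<beta> + 2"]) (use q \<beta> in auto)
    have "(\<lambda>h. (exp_kernel \<beta> (0 + h) q - exp_kernel \<beta> 0 q) / h) \<midarrow>0\<rightarrow> 0"
    proof (rule Lim_null_comparison)
      have "\<bar>(exp_kernel \<beta> (0 + h) q - exp_kernel \<beta> 0 q) / h\<bar> \<le> C * \<bar>h\<bar>" for h
      proof (cases "0 < h")
        case True
        \<comment> \<open>Two shifts of the index extract h^2 and leave the bounded kernel of index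
          \<beta> + 2, so the difference quotient is O(h).\<close>
        have "exp_kernel \<beta> h q = h * (h * exp_kernel (\<beta> + 1 + 1) h q)" by (simp only: exp_kernel_shift_down)
        then have "exp_kernel \<beta> h q / h = h * exp_kernel (\<beta> + 2) h q" using True by (simp add: add.assoc)
        also have "\<dots> \<le> h * C" using True C[of q h] by (intro mult_left_mono) auto
        finally show ?thesis using True by (simp add: exp_kernel_def[of _ 0] mult.commute)
      next
        case False
        have "0 \<le> C" using C[of q 0] exp_kernel_nonneg order_trans by blast
        then show ?thesis using False by (simp add: exp_kernel_def mult_nonneg_nonpos)
      qed
      then show "\<forall>\<^sub>F h in at 0. norm ((exp_kernel \<beta> (0 + h) q - exp_kernel \<beta> 0 q) / h) \<le> C * \<bar>h\<bar>" by simp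
      show "((\<lambda>h. C * \<bar>h\<bar>) \<longlongrightarrow> 0) (at 0)" by (auto intro!: tendsto_eq_intros)
    qed
    then show ?thesis unfolding DERIV_def 2 by (simp add: exp_kernel_def)
  next
    case 3
    have e1: "exp_kernel (\<beta> + 1) \<tau> q = \<tau> powr (- \<beta> - 1) * exp (- q / \<tau>)"
    proof -
      have "- (\<beta> + 1) = - \<beta> - 1" by simp
      then show ?thesis by (simp only: exp_kernel_def 3 if_True)
    qed
    have e2: "exp_kernel (\<beta> + 2) \<tau> q = \<tau> powr (- \<beta>) / \<tau>\<^sup>2 * exp (- q / \<tau>)"
    proof -
      have "- (\<beta> + 2) = - \<beta> - 2" by simp
      moreover have "\<tau> powr (- \<beta> - 2) = \<tau> powr (- \<beta>) / \<tau>\<^sup>2" using 3 powr_diff[of \<tau> "- \<beta>" 2] by (simp add: powr_numeral)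
      ultimately show ?thesis by (simp only: exp_kernel_def 3 if_True)
    qed
    have "((\<lambda>\<tau>. \<tau> powr (- \<beta>) * exp (- q / \<tau>)) has_real_derivative
        (- \<beta> * \<tau> powr (- \<beta> - 1)) * exp (- q / \<tau>) + \<tau> powr (- \<beta>) * (exp (- q / \<tau>) * (q / \<tau>\<^sup>2))) (at \<tau>)"
      using 3 by (auto intro!: derivative_eq_intros simp: power2_eq_square powr_diff field_simps)
    moreover have "(- \<beta> * \<tau> powr (- \<beta> - 1)) * exp (- q / \<tau>) + \<tau> powr (- \<beta>) * (exp (- q / \<tau>) * (q / \<tau>\<^sup>2))
        = - \<beta> * exp_kernel (\<beta> + 1) \<tau> q + q * exp_kernel (\<beta> + 2) \<tau> q"
      unfolding e1 e2 by simp
    ultimately have "((\<lambda>\<tau>. \<tau> powr (- \<beta>) * exp (- q / \<tau>)) has_real_derivative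
        - \<beta> * exp_kernel (\<beta> + 1) \<tau> q + q * exp_kernel (\<beta> + 2) \<tau> q) (at \<tau>)" by simp
    then show ?thesis
      by (rule has_field_derivative_transform_within_open[where S = "{0<..}"]) (use 3 in \<open>auto simp: exp_kernel_def\<close>)
  qed
qed

section \<open>From inverse moments to continuous functions of time\<close>

text \<open>\<open>N\<close> decays exponentially in \<open>c\<close>, so its Laplace transform is analytic; it is continued from \<open>0\<close>
  in steps of fixed length by power series.\<close>

lemma laplace_of_moments:
  fixes N G :: "'a \<Rightarrow> complex" and c :: "'a \<Rightarrow> real"
  assumes c: "\<And>v. 0 \<le> c v" "c \<in> borel_measurable M" and G: "integrable M G" and \<sigma>: "0 < \<sigma>"
    and N: "\<And>v. N v = complex_of_real (exp (- (2 * \<sigma> * c v))) * G v"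
    and mom: "\<And>j. (LINT v|M. complex_of_real (c v ^ j) * N v) = 0"
  shows "(LINT v|M. complex_of_real (c v ^ j * exp (- (real m * \<sigma> * c v))) * N v) = 0"
proof (induction m arbitrary: j)
  case 0
  then show ?case using mom by simp
next
  \<comment> \<open>The step multiplies by e^(-\<sigma> c), expanded into its power series. This
    raises the power of c, which is why all j are carried along.\<close>
  case (Suc m)
  have Gm: "G \<in> borel_measurable M" using borel_measurable_integrable[OF G] .
  have Nm: "N \<in> borel_measurable M"
  proof -
    have "N = (\<lambda>v. complex_of_real (exp (- (2 * \<sigma> * c v))) * G v)" using N by auto
    then show ?thesis using Gm c(2) by simp
  qed
  have nth_le_exp: "x ^ i / fact i \<le> exp x" if "0 \<le> x" for x :: real and i
  proof -
    have "(\<Sum>n\<in>{i}. x ^ n / fact n) \<le> (\<Sum>n. x ^ n / fact n)"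
      using that by (intro sum_le_suminf) (auto simp: summable_exp_generic divide_inverse mult.commute[of _ "inverse _"] summable_exp)
    then show ?thesis by (simp add: exp_def divide_inverse mult.commute)
  qed
  have poly_exp: "c v ^ i * exp (- (\<sigma> * c v)) \<le> fact i / \<sigma> ^ i" for v i
  proof -
    have "(\<sigma> * c v) ^ i / fact i \<le> exp (\<sigma> * c v)" using c(1)[of v] \<sigma> by (intro nth_le_exp) simp
    then have "c v ^ i * \<sigma> ^ i \<le> fact i * exp (\<sigma> * c v)" by (simp add: power_mult_distrib field_simps)
    then show ?thesis using \<sigma> by (simp add: exp_minus field_simps)
  qed
  let ?t = "\<lambda>k v. complex_of_real ((c v ^ (j + k) * exp (- (real m * \<sigma> * c v))) * ((- \<sigma>) ^ k / fact k)) * N v"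
  have psum: "(\<Sum>k<n. ?t k v) = complex_of_real (c v ^ j * exp (- (real m * \<sigma> * c v)) * (\<Sum>k<n. (- (\<sigma> * c v)) ^ k / fact k)) * N v" for n v
  proof -
    have "c v ^ (j + k) * E * ((- \<sigma>) ^ k / fact k) = c v ^ j * E * ((- (\<sigma> * c v)) ^ k / fact k)" for k E
    proof -
      have "(- (\<sigma> * c v)) ^ k = (- \<sigma>) ^ k * c v ^ k" unfolding mult_minus_left[symmetric] by (rule power_mult_distrib)
      then show ?thesis by (simp add: power_add)
    qed
    then show ?thesis by (simp only: of_real_mult of_real_sum sum_distrib_left sum_distrib_right)
  qed
  have absum: "\<bar>\<Sum>k<n. (- (\<sigma> * c v)) ^ k / fact k\<bar> \<le> exp (\<sigma> * c v)" for n v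
  proof -
    have "\<bar>\<Sum>k<n. (- (\<sigma> * c v)) ^ k / fact k\<bar> \<le> (\<Sum>k<n. (\<sigma> * c v) ^ k / fact k)"
      using c(1)[of v] \<sigma> by (intro order_trans[OF sum_abs] sum_mono) (simp add: power_abs abs_mult)
    also have "\<dots> \<le> exp (\<sigma> * c v)"
    proof -
      have "(\<Sum>k<n. (\<sigma> * c v) ^ k / fact k) \<le> (\<Sum>k. (\<sigma> * c v) ^ k / fact k)"
        using c(1)[of v] \<sigma> by (intro sum_le_suminf) (auto simp: divide_inverse mult.commute[of _ "inverse _"] summable_exp)
      then show ?thesis by (simp add: exp_def divide_inverse mult.commute)
    qed
    finally show ?thesis .
  qed
  \<comment> \<open>Of the decay e^(-2 \<sigma> c) in \<open>N\<close>, one factor e^(-\<sigma> c)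
    pays for the partial sums of the series, the other for the power of c.\<close>
  have dom: "cmod (complex_of_real (c v ^ i * exp (- (real m * \<sigma> * c v)) * B) * N v) \<le> (fact i / \<sigma> ^ i) * cmod (G v)"
    if B: "\<bar>B\<bar> \<le> exp (\<sigma> * c v)" for B v i
  proof -
    have em: "exp (- (real m * \<sigma> * c v)) \<le> 1" using c(1)[of v] \<sigma> by simp
    have "cmod (complex_of_real (c v ^ i * exp (- (real m * \<sigma> * c v)) * B) * N v)
        = (c v ^ i * exp (- (real m * \<sigma> * c v)) * \<bar>B\<bar>) * (exp (- (2 * \<sigma> * c v)) * cmod (G v))"
      using c(1)[of v] by (simp add: N norm_mult norm_power abs_mult)
    also have "\<dots> \<le> (c v ^ i * 1 * exp (\<sigma> * c v)) * (exp (- (2 * \<sigma> * c v)) * cmod (G v))"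
      using c(1)[of v] B em by (intro mult_right_mono mult_mono mult_nonneg_nonneg) auto
    also have "\<dots> = (c v ^ i * exp (- (\<sigma> * c v))) * cmod (G v)"
    proof -
      have "exp (\<sigma> * c v) * exp (- (2 * \<sigma> * c v)) = exp (- (\<sigma> * c v))" by (simp flip: exp_add)
      then show ?thesis by (metis mult.assoc mult.right_neutral)
    qed
    also have "\<dots> \<le> (fact i / \<sigma> ^ i) * cmod (G v)" by (intro mult_right_mono poly_exp) auto
    finally show ?thesis .
  qed
  have lim: "(\<lambda>n. LINT v|M. (\<Sum>k<n. ?t k v)) \<longlonglongrightarrow> (LINT v|M. complex_of_real (c v ^ j * exp (- (real (Suc m) * \<sigma> * c v))) * N v)"
  proof (rule integral_dominated_convergence)
    show "integrable M (\<lambda>v. (fact j / \<sigma> ^ j) * cmod (G v))" using G by simp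
    show "AE v in M. (\<lambda>n. \<Sum>k<n. ?t k v) \<longlonglongrightarrow> complex_of_real (c v ^ j * exp (- (real (Suc m) * \<sigma> * c v))) * N v"
    proof (rule AE_I2)
      fix v
      have "(\<lambda>n. \<Sum>k<n. (- (\<sigma> * c v)) ^ k / fact k) \<longlonglongrightarrow> exp (- (\<sigma> * c v))"
        using exp_converges[of "- (\<sigma> * c v)"] by (simp add: sums_def divide_inverse mult.commute)
      then have "(\<lambda>n. \<Sum>k<n. ?t k v) \<longlonglongrightarrow> complex_of_real (c v ^ j * exp (- (real m * \<sigma> * c v)) * exp (- (\<sigma> * c v))) * N v"
        unfolding psum by (intro tendsto_intros)
      moreover have "c v ^ j * exp (- (real m * \<sigma> * c v)) * exp (- (\<sigma> * c v)) = c v ^ j * exp (- (real (Suc m) * \<sigma> * c v))"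
        by (simp add: mult.assoc algebra_simps flip: exp_add)
      ultimately show "(\<lambda>n. \<Sum>k<n. ?t k v) \<longlonglongrightarrow> complex_of_real (c v ^ j * exp (- (real (Suc m) * \<sigma> * c v))) * N v" by simp
    qed
    show "AE v in M. norm (\<Sum>k<n. ?t k v) \<le> (fact j / \<sigma> ^ j) * cmod (G v)" for n
      unfolding psum by (intro AE_I2 dom absum)
    show "(\<lambda>v. \<Sum>k<n. ?t k v) \<in> borel_measurable M" for n using c(2) Nm by simp
    show "(\<lambda>v. complex_of_real (c v ^ j * exp (- (real (Suc m) * \<sigma> * c v))) * N v) \<in> borel_measurable M" using c(2) Nm by simp
  qed
  have ti: "integrable M (\<lambda>v. complex_of_real (c v ^ i * exp (- (real m * \<sigma> * c v))) * N v)" for i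
  proof (rule Bochner_Integration.integrable_bound)
    show "integrable M (\<lambda>v. (fact i / \<sigma> ^ i) * cmod (G v))" using G by simp
    have "cmod (complex_of_real (c v ^ i * exp (- (real m * \<sigma> * c v))) * N v) \<le> (fact i / \<sigma> ^ i) * cmod (G v)" for v
      using dom[of 1 v i] c(1)[of v] \<sigma> by simp
    then show "AE v in M. norm (complex_of_real (c v ^ i * exp (- (real m * \<sigma> * c v))) * N v) \<le> norm ((fact i / \<sigma> ^ i) * cmod (G v))"
      by (intro AE_I2) (simp only: real_norm_def, rule order_trans[OF _ abs_ge_self])
    show "(\<lambda>v. complex_of_real (c v ^ i * exp (- (real m * \<sigma> * c v))) * N v) \<in> borel_measurable M" using c(2) Nm by simp
  qed
  have tk: "?t k v = complex_of_real ((- \<sigma>) ^ k / fact k) * (complex_of_real (c v ^ (j + k) * exp (- (real m * \<sigma> * c v))) * N v)" for k v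
    by simp
  have "(LINT v|M. (\<Sum>k<n. ?t k v)) = 0" for n
  proof -
    have "(LINT v|M. (\<Sum>k<n. ?t k v)) = (\<Sum>k<n. LINT v|M. ?t k v)"
      unfolding tk by (intro Bochner_Integration.integral_sum integrable_mult_right ti)
    also have "\<dots> = 0" unfolding tk integral_mult_right_zero Suc.IH by simp
    finally show ?thesis .
  qed
  then show ?case using lim by (simp add: LIMSEQ_const_iff)
qed

lemma continuous_on_inverse_ln:
  fixes b1 \<sigma> :: real
  assumes "b1 < 1"
  shows "continuous_on {0..b1} (\<lambda>b. - \<sigma> / ln b)"
  unfolding continuous_on_eq_continuous_within
proof
  fix b assume b: "b \<in> {0..b1}"
  show "continuous (at b within {0..b1}) (\<lambda>b. - \<sigma> / ln b)"
  proof (cases "b = 0")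
    case True
    have "filterlim (\<lambda>b :: real. ln b) at_bot (at_right 0)" by (rule ln_at_0)
    then have "((\<lambda>b :: real. - \<sigma> / ln b) \<longlongrightarrow> 0) (at_right 0)"
      by (intro tendsto_divide_0[OF tendsto_const] filterlim_at_bot_imp_at_infinity)
    then have "((\<lambda>b :: real. - \<sigma> / ln b) \<longlongrightarrow> 0) (at 0 within {0..b1})"
    proof (rule tendsto_mono[rotated])
      show "at 0 within {0..b1} \<le> at_right 0" unfolding at_within_def by (intro inf_mono order_refl) auto
    qed
    \<comment> \<open>At b = 0 the expression has the value 0 by the conventions for
      \<open>ln 0\<close> and for division by 0; this is also the limit.\<close>
    then show ?thesis using True by (simp add: continuous_within)
  next
    case False
    then have "0 < b" "ln b \<noteq> 0" using b assms by (auto simp: ln_eq_zero_iff)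
    then show ?thesis by (intro continuous_intros) auto
  qed
qed

text \<open>The variable \<open>\<tau>\<close> is a continuous function of \<open>e\<^sup>-\<^sup>\<sigma>\<^sup>/\<^sup>\<tau>\<close>, so Weierstrass' theorem applies in the latter.\<close>

lemma integral_continuous_of_exp_moments:
  fixes N :: "'a \<Rightarrow> complex" and \<tau> :: "'a \<Rightarrow> real"
  assumes N: "integrable M N" and \<tau>: "\<tau> \<in> borel_measurable M" and supp: "\<And>v. N v \<noteq> 0 \<Longrightarrow> 0 < \<tau> v \<and> \<tau> v \<le> L"
    and \<sigma>: "0 < \<sigma>"
    and mom: "\<And>m :: nat. (LINT v|M. complex_of_real (exp (- (real m * \<sigma> / \<tau> v))) * N v) = 0"
    and \<eta>: "continuous_on UNIV (\<eta> :: real \<Rightarrow> real)"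
  shows "(LINT v|M. complex_of_real (\<eta> (\<tau> v)) * N v) = 0"
proof (cases "0 < L")
  case False
  then have "N v = 0" for v using supp[of v] by linarith
  then show ?thesis by simp
next
  case L: True
  \<comment> \<open>As \<tau> \<le> L on the support, e^(-\<sigma>/\<tau>) stays below b1 < 1, which
    keeps its logarithm away from 0.\<close>
  define b1 where "b1 = exp (- (\<sigma> / L))"
  have b1: "b1 < 1" using L \<sigma> by (simp add: b1_def)
  define g where "g b = \<eta> (- \<sigma> / ln b)" for b
  have gc: "continuous_on {0..b1} g"
    unfolding g_def by (rule continuous_on_compose2[OF \<eta> continuous_on_inverse_ln[OF b1]]) auto
  have Nm: "N \<in> borel_measurable M" using borel_measurable_integrable[OF N] .
  have \<eta>m: "\<eta> \<in> borel_measurable borel" using \<eta> by (rule borel_measurable_continuous_onI)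
  define b where "b v = exp (- (\<sigma> / \<tau> v))" for v
  have bm: "b \<in> borel_measurable M" unfolding b_def[abs_def] using \<tau> by simp
  have b: "b v \<in> {0..b1}" "g (b v) = \<eta> (\<tau> v)" if "N v \<noteq> 0" for v
    using supp[OF that] \<sigma> L by (auto simp: b_def b1_def g_def frac_le)
  have small: "cmod (LINT v|M. complex_of_real (\<eta> (\<tau> v)) * N v) \<le> e * (LINT v|M. cmod (N v))" if e: "0 < e" for e
  proof -
    obtain p where p: "real_polynomial_function p" "\<And>x. x \<in> {0..b1} \<Longrightarrow> \<bar>g x - p x\<bar> < e"
      using Stone_Weierstrass_real_polynomial_function[OF compact_Icc gc e] by blast
    obtain a n where an: "p = (\<lambda>x. \<Sum>i\<le>n. a i * x ^ i)"
      using p(1) real_polynomial_function_iff_sum by blast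
    have pi: "(LINT v|M. complex_of_real (p (b v)) * N v) = 0" "integrable M (\<lambda>v. complex_of_real (p (b v)) * N v)"
    proof -
      have i: "integrable M (\<lambda>v. complex_of_real (b v ^ i) * N v)" for i
      proof (rule Bochner_Integration.integrable_bound[OF N])
        have "cmod (complex_of_real (b v ^ i) * N v) \<le> cmod (N v)" for v
        proof (cases "N v = 0")
          case False
          have "\<bar>b v\<bar> ^ i \<le> 1" using b(1)[OF False] b1 by (intro power_le_one) auto
          then show ?thesis by (simp add: norm_mult norm_power mult_left_le_one_le)
        qed simp
        then show "AE v in M. norm (complex_of_real (b v ^ i) * N v) \<le> norm (N v)" by simp
      qed (use bm Nm in simp)
      have z: "(LINT v|M. complex_of_real (b v ^ i) * N v) = 0" for i
      proof -
        have "b v ^ i = exp (- (real i * \<sigma> / \<tau> v))" for v by (simp add: b_def exp_of_nat_mult[symmetric])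
        then show ?thesis using mom[of i] by simp
      qed
      have eq: "complex_of_real (p (b v)) * N v = (\<Sum>i\<le>n. complex_of_real (a i) * (complex_of_real (b v ^ i) * N v))" for v
        unfolding an by (simp add: sum_distrib_right mult.assoc)
      show "integrable M (\<lambda>v. complex_of_real (p (b v)) * N v)"
        unfolding eq by (intro Bochner_Integration.integrable_sum integrable_mult_right i)
      have "(LINT v|M. complex_of_real (p (b v)) * N v) = (\<Sum>i\<le>n. LINT v|M. complex_of_real (a i) * (complex_of_real (b v ^ i) * N v))"
        unfolding eq by (intro Bochner_Integration.integral_sum integrable_mult_right i)
      also have "\<dots> = 0" unfolding integral_mult_right_zero z by simp
      finally show "(LINT v|M. complex_of_real (p (b v)) * N v) = 0" .
    qed
    have bd: "cmod (complex_of_real (\<eta> (\<tau> v)) * N v - complex_of_real (p (b v)) * N v) \<le> e * cmod (N v)" for v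
    proof (cases "N v = 0")
      case False
      have "cmod (complex_of_real (\<eta> (\<tau> v)) * N v - complex_of_real (p (b v)) * N v) = \<bar>g (b v) - p (b v)\<bar> * cmod (N v)"
        unfolding b(2)[OF False] by (simp add: norm_mult flip: left_diff_distrib of_real_diff)
      also have "\<dots> \<le> e * cmod (N v)" using p(2)[OF b(1)[OF False]] by (intro mult_right_mono) auto
      finally show ?thesis .
    qed simp
    have di: "integrable M (\<lambda>v. complex_of_real (\<eta> (\<tau> v)) * N v - complex_of_real (p (b v)) * N v)"
    proof (rule Bochner_Integration.integrable_bound)
      show "integrable M (\<lambda>v. e * cmod (N v))" using N by simp
      show "AE v in M. norm (complex_of_real (\<eta> (\<tau> v)) * N v - complex_of_real (p (b v)) * N v) \<le> norm (e * cmod (N v))"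
        using bd e by (intro AE_I2) (auto intro: order_trans[OF _ abs_ge_self])
      show "(\<lambda>v. complex_of_real (\<eta> (\<tau> v)) * N v - complex_of_real (p (b v)) * N v) \<in> borel_measurable M"
        using measurable_compose[OF \<tau> \<eta>m] Nm borel_measurable_integrable[OF pi(2)] by simp
    qed
    have \<eta>i: "integrable M (\<lambda>v. complex_of_real (\<eta> (\<tau> v)) * N v)"
      using Bochner_Integration.integrable_add[OF di pi(2)] by simp
    have "(LINT v|M. complex_of_real (\<eta> (\<tau> v)) * N v) = (LINT v|M. complex_of_real (\<eta> (\<tau> v)) * N v - complex_of_real (p (b v)) * N v)"
      using Bochner_Integration.integral_diff[OF \<eta>i pi(2)] pi(1) by simp
    then have "cmod (LINT v|M. complex_of_real (\<eta> (\<tau> v)) * N v) \<le> (LINT v|M. cmod (complex_of_real (\<eta> (\<tau> v)) * N v - complex_of_real (p (b v)) * N v))"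
      using integral_norm_bound by metis
    also have "\<dots> \<le> (LINT v|M. e * cmod (N v))"
      by (rule integral_mono[OF integrable_norm[OF di] _ bd]) (use N in simp)
    finally show ?thesis by simp
  qed
  have "cmod (LINT v|M. complex_of_real (\<eta> (\<tau> v)) * N v) \<le> 0"
  proof (rule field_le_epsilon)
    fix e :: real assume e: "0 < e"
    let ?n = "LINT v|M. cmod (N v)"
    have n: "0 \<le> ?n" by simp
    have aux: "e / (x + 1) * x \<le> e" if "0 \<le> x" for x using e that by (simp add: field_simps)
    have "cmod (LINT v|M. complex_of_real (\<eta> (\<tau> v)) * N v) \<le> e / (?n + 1) * ?n" using e n by (intro small divide_pos_pos add_nonneg_pos) auto
    also have "\<dots> \<le> e" by (rule aux[OF n])
    finally show "cmod (LINT v|M. complex_of_real (\<eta> (\<tau> v)) * N v) \<le> 0 + e" by simp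
  qed
  then show ?thesis by simp
qed

section \<open>Unique continuation\<close>

text \<open>Compact support lets Weierstrass approximation on \<open>K\<close> replace each
  Lipschitz test function by polynomials; vanishing against all Lipschitz functions then gives zero
  almost everywhere.\<close>

lemma AE_zero_of_polynomial_moments:
  fixes N :: "'a::euclidean_space \<Rightarrow> complex"
  assumes N: "integrable lborel N" and K: "compact K" "\<And>v. N v \<noteq> 0 \<Longrightarrow> v \<in> K"
    and mom: "\<And>p. real_polynomial_function p \<Longrightarrow> (LINT v|lborel. complex_of_real (p v) * N v) = 0"
  shows "AE v in lborel. N v = 0"
proof -
  have Nm [measurable]: "N \<in> borel_measurable borel" using borel_measurable_integrable[OF N] by simp
  have pi: "integrable lborel (\<lambda>v. complex_of_real (p v) * N v)" if p: "p \<in> lip_test UNIV" for p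
  proof -
    obtain C where C: "\<And>x. \<bar>p x\<bar> \<le> C" using lip_test_bounded[OF p] by blast
    note [measurable] = lip_test_borel[OF p]
    show ?thesis
    proof (rule Bochner_Integration.integrable_bound)
      show "integrable lborel (\<lambda>v. C * cmod (N v))" using N by simp
      have "norm (complex_of_real (p v) * N v) \<le> C * cmod (N v)" for v
        unfolding norm_mult norm_of_real by (intro mult_right_mono C) simp
      then show "AE v in lborel. norm (complex_of_real (p v) * N v) \<le> norm (C * cmod (N v))"
        by (intro AE_I2) (simp only: real_norm_def, rule order_trans[OF _ abs_ge_self])
    qed measurable
  qed
  have zero: "(LINT v|lborel. complex_of_real (p v) * N v) = 0" if p: "p \<in> lip_test UNIV" for p
  proof -
    let ?I = "LINT v|lborel. complex_of_real (p v) * N v" and ?n = "LINT v|lborel. cmod (N v)"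
    have pc: "continuous_on UNIV p" by (rule lip_test_continuous[OF p])
    note [measurable] = lip_test_borel[OF p]
    have small: "cmod ?I \<le> e * ?n" if e: "0 < e" for e
    proof -
      obtain g where g: "real_polynomial_function g" "\<And>x. x \<in> K \<Longrightarrow> \<bar>p x - g x\<bar> < e"
        using Stone_Weierstrass_real_polynomial_function[OF K(1) continuous_on_subset[OF pc] e] by blast
      have [measurable]: "g \<in> borel_measurable borel"
        using g(1) by (intro borel_measurable_continuous_onI continuous_on_polymonial_function) (simp add: real_polynomial_function_eq)
      have bd: "norm (complex_of_real (p v) * N v - complex_of_real (g v) * N v) \<le> e * cmod (N v)" for v
      proof (cases "N v = 0")
        case False
        have "norm (complex_of_real (p v) * N v - complex_of_real (g v) * N v) = \<bar>p v - g v\<bar> * cmod (N v)"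
          by (simp add: norm_mult flip: left_diff_distrib of_real_diff)
        also have "\<dots> \<le> e * cmod (N v)" using g(2)[OF K(2)[OF False]] by (intro mult_right_mono) auto
        finally show ?thesis .
      qed simp
      have di: "integrable lborel (\<lambda>v. complex_of_real (p v) * N v - complex_of_real (g v) * N v)"
      proof (rule Bochner_Integration.integrable_bound)
        show "integrable lborel (\<lambda>v. e * cmod (N v))" using N by simp
        show "AE v in lborel. norm (complex_of_real (p v) * N v - complex_of_real (g v) * N v) \<le> norm (e * cmod (N v))"
          using bd by (intro AE_I2) (simp only: real_norm_def, rule order_trans[OF _ abs_ge_self])
      qed measurable
      have gi: "integrable lborel (\<lambda>v. complex_of_real (g v) * N v)"
        using Bochner_Integration.integrable_diff[OF pi[OF p] di] by simp
      have "?I = (LINT v|lborel. complex_of_real (p v) * N v - complex_of_real (g v) * N v)"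
        using Bochner_Integration.integral_diff[OF pi[OF p] gi] mom[OF g(1)] by simp
      then have "cmod ?I \<le> (LINT v|lborel. cmod (complex_of_real (p v) * N v - complex_of_real (g v) * N v))"
        using integral_norm_bound by metis
      also have "\<dots> \<le> (LINT v|lborel. e * cmod (N v))"
        by (rule integral_mono[OF integrable_norm[OF di] _ bd]) (use N in simp)
      finally show ?thesis by simp
    qed
    have "cmod ?I \<le> 0"
    proof (rule field_le_epsilon)
      fix e :: real assume e: "0 < e"
      have aux: "e / (x + 1) * x \<le> e" if "0 \<le> x" for x using e that by (simp add: field_simps)
      have "cmod ?I \<le> e / (?n + 1) * ?n" using e by (intro small divide_pos_pos add_nonneg_pos) auto
      also have "\<dots> \<le> e" by (rule aux) simp
      finally show "cmod ?I \<le> 0 + e" by simp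
    qed
    then show ?thesis by simp
  qed
  have AEh: "AE v in lebesgue. h v = 0"
    if h: "integrable lborel h" and hz: "\<And>p. p \<in> lip_test UNIV \<Longrightarrow> (LINT v|lborel. p v * h v) = 0" for h :: "'a \<Rightarrow> real"
  proof -
    have hm [measurable]: "h \<in> borel_measurable borel" using borel_measurable_integrable[OF h] by simp
    have "AE z in lebesgue. z \<in> UNIV \<longrightarrow> h z = 0"
    proof (rule AE_zero_of_lip_test)
      show "h \<in> borel_measurable lebesgue" by (rule borel_imp_lebesgue[OF hm])
      fix K :: "'a set" assume "compact K"
      then have [measurable]: "K \<in> sets borel" by (rule borel_compact)
      have "integrable lborel (\<lambda>z. indicator K z * h z)"
        by (rule Bochner_Integration.integrable_bound[OF h]) (auto simp: indicator_def)
      then show "integrable lebesgue (\<lambda>z. indicator K z * h z)" by (subst integrable_completion) auto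
    next
      fix p :: "'a \<Rightarrow> real" assume p: "p \<in> lip_test UNIV"
      note [measurable] = lip_test_borel[OF p]
      show "(LINT z|lebesgue. p z * h z) = 0" using hz[OF p] by (subst integral_completion) auto
    qed simp
    then show ?thesis by simp
  qed
  have N_Re: "AE v in lebesgue. Re (N v) = 0"
  proof (rule AEh)
    fix p :: "'a \<Rightarrow> real" assume p: "p \<in> lip_test UNIV"
    show "(LINT v|lborel. p v * Re (N v)) = 0" using integral_Re[OF pi[OF p]] zero[OF p] by simp
  qed (use N in simp)
  have N_Im: "AE v in lebesgue. Im (N v) = 0"
  proof (rule AEh)
    fix p :: "'a \<Rightarrow> real" assume p: "p \<in> lip_test UNIV"
    show "(LINT v|lborel. p v * Im (N v)) = 0" using integral_Im[OF pi[OF p]] zero[OF p] by simp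
  qed (use N in simp)
  from N_Re N_Im have "AE v in lebesgue. N v = 0" by eventually_elim (simp add: complex_eq_iff)
  then show ?thesis by (simp add: AE_completion_iff)
qed

section \<open>Potentials of a source at positive distance\<close>

lemma fst_borel [measurable]: "(fst :: 'a::euclidean_space \<times> 'b::euclidean_space \<Rightarrow> 'a) \<in> borel_measurable borel"
  and snd_borel [measurable]: "(snd :: 'a::euclidean_space \<times> 'b::euclidean_space \<Rightarrow> 'b) \<in> borel_measurable borel"
  by (auto intro!: borel_measurable_continuous_onI continuous_intros)

text \<open>Joint continuity, across \<tau> = 0 as well, as long as q0 > 0: there the kernel is
  \<tau> times the kernel of index \<beta> + 1, which is bounded for q \<ge> q0 / 2.\<close>

lemma exp_kernel_tendsto:
  assumes q: "0 < q0" and \<beta>: "0 < \<beta>" and a: "(a \<longlongrightarrow> \<tau>0) F" and b: "(b \<longlongrightarrow> q0) F"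
  shows "((\<lambda>x. exp_kernel \<beta> (a x) (b x)) \<longlongrightarrow> exp_kernel \<beta> \<tau>0 q0) F"
proof -
  consider "\<tau>0 < 0" | "\<tau>0 = 0" | "0 < \<tau>0" by linarith
  then show ?thesis
  proof cases
    case 1
    have "\<forall>\<^sub>F x in F. exp_kernel \<beta> (a x) (b x) = 0"
      using order_tendstoD(2)[OF a 1] by eventually_elim (simp add: exp_kernel_def)
    then show ?thesis using 1 by (simp add: exp_kernel_def tendsto_eventually)
  next
    case 2
    obtain C where C: "\<And>\<tau> q. q0 / 2 \<le> q \<Longrightarrow> exp_kernel (\<beta> + 1) \<tau> q \<le> C"
      by (rule exp_kernel_bound[of "q0 / 2" "\<beta> + 1"]) (use q \<beta> in auto)
    have "((\<lambda>x. exp_kernel \<beta> (a x) (b x)) \<longlongrightarrow> 0) F"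
    proof (rule Lim_null_comparison)
      have "q0 / 2 < q0" using q by simp
      from order_tendstoD(1)[OF b this]
      show "\<forall>\<^sub>F x in F. norm (exp_kernel \<beta> (a x) (b x)) \<le> \<bar>a x\<bar> * C"
      proof eventually_elim
        case (elim x)
        then show ?case using C[of "b x" "a x"] mult_left_mono[OF C[of "b x" "a x"], of "\<bar>a x\<bar>"]
          unfolding exp_kernel_shift_down[of "a x" \<beta> "b x", symmetric] by (simp add: abs_mult)
      qed
      show "((\<lambda>x. \<bar>a x\<bar> * C) \<longlongrightarrow> 0) F" using a 2 by (auto intro!: tendsto_eq_intros)
    qed
    then show ?thesis using 2 by (simp add: exp_kernel_def)
  next
    case 3
    have "\<forall>\<^sub>F x in F. a x powr (- \<beta>) * exp (- b x / a x) = exp_kernel \<beta> (a x) (b x)"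
      using order_tendstoD(1)[OF a 3] by eventually_elim (simp add: exp_kernel_def)
    moreover have "((\<lambda>x. a x powr (- \<beta>) * exp (- b x / a x)) \<longlongrightarrow> \<tau>0 powr (- \<beta>) * exp (- q0 / \<tau>0)) F"
      using 3 a b by (intro tendsto_intros) auto
    ultimately show ?thesis using 3 by (simp add: exp_kernel_def tendsto_cong)
  qed
qed

lemma exp_kernel_moment: "(if 0 < \<tau> then 1 / \<tau> else 0) ^ j * exp_kernel \<beta> \<tau> q = exp_kernel (\<beta> + real j) \<tau> q"
proof (cases "0 < \<tau>")
  case True
  have "\<tau> powr (- (\<beta> + real j)) = (1 / \<tau>) ^ j * \<tau> powr (- \<beta>)"
    using True by (simp add: minus_add_distrib powr_diff powr_realpow power_one_over field_simps)
  then show ?thesis using True by (simp add: exp_kernel_def)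
qed (simp add: exp_kernel_def)

lemma norm_sq_dir_deriv:
  fixes y w :: "'b::euclidean_space"
  shows "((\<lambda>h. (norm (y - h *\<^sub>R w))\<^sup>2 / 4) has_real_derivative - (y \<bullet> w) / 2) (at 0)"
proof -
  have "(norm (y - h *\<^sub>R w))\<^sup>2 / 4 = (y \<bullet> y - 2 * h * (y \<bullet> w) + h * h * (w \<bullet> w)) / 4" for h
    unfolding power2_norm_eq_inner by (simp add: inner_diff_left inner_diff_right inner_commute algebra_simps)
  moreover have "((\<lambda>h. (y \<bullet> y - 2 * h * (y \<bullet> w) + h * h * (w \<bullet> w)) / 4) has_real_derivative - (y \<bullet> w) / 2) (at 0)"
    by (auto intro!: derivative_eq_intros)
  ultimately show ?thesis by simp
qed

lemma exp_kernel_dir_deriv: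
  fixes y w :: "'b::euclidean_space"
  shows "((\<lambda>h. exp_kernel \<beta> \<tau> ((norm (y - h *\<^sub>R w))\<^sup>2 / 4)) has_real_derivative exp_kernel (\<beta> + 1) \<tau> ((norm y)\<^sup>2 / 4) * ((y \<bullet> w) / 2)) (at 0)"
proof -
  have "((\<lambda>h. exp_kernel \<beta> \<tau> ((norm (y - h *\<^sub>R w))\<^sup>2 / 4)) has_real_derivative
      (- exp_kernel (\<beta> + 1) \<tau> ((norm (y - 0 *\<^sub>R w))\<^sup>2 / 4)) * (- (y \<bullet> w) / 2)) (at 0)"
    by (rule DERIV_chain2[OF exp_kernel_deriv_q norm_sq_dir_deriv])
  then show ?thesis by simp
qed

text \<open>In the application \<open>\<psi>\<close> is the conjugate of the adjoint solution and
  \<open>X\<close> the ball off the closure of \<Omega>. It is a locale because the results are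
  applied to weighted sources as well, see \<open>null_weight_snd\<close>.\<close>

locale separated_source =
  fixes \<psi> :: "real \<times> 'b::euclidean_space \<Rightarrow> complex" and X :: "'b set" and d D :: real
  assumes integrable_source: "integrable lborel \<psi>" and open_X: "open X" and pos: "0 < d"
    and separated: "\<And>v x. \<psi> v \<noteq> 0 \<Longrightarrow> x \<in> X \<Longrightarrow> d \<le> norm (snd v - x)"
    and bounded_source: "\<And>v x. \<psi> v \<noteq> 0 \<Longrightarrow> x \<in> X \<Longrightarrow> norm (snd v - x) \<le> D"
    and bounded_time: "\<And>v. \<psi> v \<noteq> 0 \<Longrightarrow> \<bar>fst v\<bar> \<le> D"
begin

definition potential :: "(real \<Rightarrow> 'b \<Rightarrow> real) \<Rightarrow> real \<times> 'b \<Rightarrow> complex" where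
  "potential k z = (LINT v|lborel. complex_of_real (k (fst v - fst z) (snd v - snd z)) * \<psi> v)"

text \<open>Boundedness is asked only for d \<le> |y| \<le> D, the range of spatial differences
  between the support of the source and \<open>X\<close>; the kernels may be singular at y =
  0.\<close>

definition admissible :: "(real \<Rightarrow> 'b \<Rightarrow> real) \<Rightarrow> bool" where
  "admissible k \<longleftrightarrow> (\<lambda>p. k (fst p) (snd p)) \<in> borel_measurable borel
    \<and> (\<exists>C. \<forall>\<tau> y. d \<le> norm y \<longrightarrow> norm y \<le> D \<longrightarrow> \<bar>k \<tau> y\<bar> \<le> C)"

lemma source_measurable [measurable]: "\<psi> \<in> borel_measurable borel"
  using borel_measurable_integrable[OF integrable_source] by simp

lemma integrable_mult_source:
  fixes k :: "real \<times> 'b \<Rightarrow> real"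
  assumes [measurable]: "k \<in> borel_measurable borel" and b: "\<And>v. \<psi> v \<noteq> 0 \<Longrightarrow> \<bar>k v\<bar> \<le> C"
  shows "integrable lborel (\<lambda>v. complex_of_real (k v) * \<psi> v)"
proof (rule Bochner_Integration.integrable_bound)
  show "integrable lborel (\<lambda>v. C * cmod (\<psi> v))" using integrable_source by simp
  have "norm (complex_of_real (k v) * \<psi> v) \<le> C * cmod (\<psi> v)" for v
    using b[of v] by (cases "\<psi> v = 0") (auto simp: norm_mult intro!: mult_right_mono)
  then show "AE v in lborel. norm (complex_of_real (k v) * \<psi> v) \<le> norm (C * cmod (\<psi> v))"
    by (intro AE_I2) (simp only: real_norm_def, rule order_trans[OF _ abs_ge_self])
qed measurable

lemma integrable_potential:
  assumes k: "admissible k" and z: "snd z \<in> X"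
  shows "integrable lborel (\<lambda>v. complex_of_real (k (fst v - fst z) (snd v - snd z)) * \<psi> v)"
proof -
  obtain C where C: "\<And>\<tau> y. d \<le> norm y \<Longrightarrow> norm y \<le> D \<Longrightarrow> \<bar>k \<tau> y\<bar> \<le> C" using k by (auto simp: admissible_def)
  have m: "(\<lambda>p. k (fst p) (snd p)) \<in> borel_measurable borel" using k by (auto simp: admissible_def)
  show ?thesis
  proof (rule integrable_mult_source)
    have "(\<lambda>v. (fst v - fst z, snd v - snd z)) \<in> borel_measurable borel"
      by (intro borel_measurable_continuous_onI continuous_intros)
    from measurable_compose[OF this m]
    show "(\<lambda>v. k (fst v - fst z) (snd v - snd z)) \<in> borel_measurable borel" by simp
    show "\<bar>k (fst v - fst z) (snd v - snd z)\<bar> \<le> C" if "\<psi> v \<noteq> 0" for v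
      by (rule C[OF separated[OF that z] bounded_source[OF that z]])
  qed
qed

lemma admissible_exp_kernel:
  assumes "0 < \<beta>"
  shows "admissible (\<lambda>\<tau> y. exp_kernel \<beta> \<tau> ((norm y)\<^sup>2 / 4))"
proof -
  have "0 < d\<^sup>2 / 4" using pos by simp
  then obtain C where C: "\<And>\<tau> q. d\<^sup>2 / 4 \<le> q \<Longrightarrow> exp_kernel \<beta> \<tau> q \<le> C" by (rule exp_kernel_bound[OF _ assms]) blast
  have "\<bar>exp_kernel \<beta> \<tau> ((norm y)\<^sup>2 / 4)\<bar> \<le> C" if "d \<le> norm y" for \<tau> and y :: 'b
    using C[of "(norm y)\<^sup>2 / 4" \<tau>] power_mono[OF that, of 2] pos by simp
  moreover have "(\<lambda>p :: real \<times> 'b. exp_kernel \<beta> (fst p) ((norm (snd p))\<^sup>2 / 4)) \<in> borel_measurable borel" by measurable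
  ultimately show ?thesis unfolding admissible_def by blast
qed

lemma admissible_mult:
  assumes "admissible k" and "continuous_on UNIV g"
  shows "admissible (\<lambda>\<tau> y. k \<tau> y * g y)"
proof -
  obtain C where C: "\<And>\<tau> y. d \<le> norm y \<Longrightarrow> norm y \<le> D \<Longrightarrow> \<bar>k \<tau> y\<bar> \<le> C" using assms by (auto simp: admissible_def)
  have "compact (g ` cball 0 D)" by (intro compact_continuous_image continuous_on_subset[OF assms(2)]) auto
  then obtain B where B: "\<And>y. norm y \<le> D \<Longrightarrow> \<bar>g y\<bar> \<le> B" using compact_imp_bounded by (fastforce simp: bounded_iff)
  have "\<bar>k \<tau> y * g y\<bar> \<le> C * B" if "d \<le> norm y" "norm y \<le> D" for \<tau> y
    unfolding abs_mult using C[OF that, of \<tau>] B[OF that(2)] by (intro mult_mono) auto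
  moreover have "(\<lambda>p. k (fst p) (snd p) * g (snd p)) \<in> borel_measurable borel"
  proof -
    have [measurable]: "g \<in> borel_measurable borel" by (rule borel_measurable_continuous_onI[OF assms(2)])
    have [measurable]: "(\<lambda>p. k (fst p) (snd p)) \<in> borel_measurable borel" using assms by (auto simp: admissible_def)
    show ?thesis by measurable
  qed
  ultimately show ?thesis unfolding admissible_def by blast
qed

lemma admissible_diff:
  assumes "admissible k" and "admissible k'"
  shows "admissible (\<lambda>\<tau> y. k \<tau> y - k' \<tau> y)"
proof -
  obtain C where C: "\<And>\<tau> y. d \<le> norm y \<Longrightarrow> norm y \<le> D \<Longrightarrow> \<bar>k \<tau> y\<bar> \<le> C" using assms by (auto simp: admissible_def)
  obtain C' where C': "\<And>\<tau> y. d \<le> norm y \<Longrightarrow> norm y \<le> D \<Longrightarrow> \<bar>k' \<tau> y\<bar> \<le> C'" using assms by (auto simp: admissible_def)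
  have "\<bar>k \<tau> y - k' \<tau> y\<bar> \<le> C + C'" if "d \<le> norm y" "norm y \<le> D" for \<tau> y
    using C[OF that, of \<tau>] C'[OF that, of \<tau>] by linarith
  then show ?thesis using assms unfolding admissible_def by (auto intro!: borel_measurable_diff)
qed

text \<open>\<open>U\<close> has to be open only along the direction of differentiation. This admits
  both a space-time box and, for spatial derivatives, a single time slice
  \<open>{t} \<times> X\<close>.\<close>

lemma potential_dir_deriv:
  assumes k: "admissible k" and k': "admissible k'"
    and der: "\<And>\<tau> y. y \<noteq> 0 \<Longrightarrow> ((\<lambda>h. k (\<tau> - h * w1) (y - h *\<^sub>R w2)) has_real_derivative k' \<tau> y) (at 0)"
    and U: "\<And>z. z \<in> U \<Longrightarrow> snd z \<in> X" "\<And>z. z \<in> U \<Longrightarrow> \<exists>\<delta>>0. \<forall>r. \<bar>r\<bar> < \<delta> \<longrightarrow> (fst z + r * w1, snd z + r *\<^sub>R w2) \<in> U"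
    and zero: "\<And>z. z \<in> U \<Longrightarrow> potential k z = 0" and z: "z \<in> U"
  shows "potential k' z = 0"
proof -
  obtain C where C: "\<And>\<tau> y. d \<le> norm y \<Longrightarrow> norm y \<le> D \<Longrightarrow> \<bar>k \<tau> y\<bar> \<le> C" using k by (auto simp: admissible_def)
  obtain C' where C': "\<And>\<tau> y. d \<le> norm y \<Longrightarrow> norm y \<le> D \<Longrightarrow> \<bar>k' \<tau> y\<bar> \<le> C'" using k' by (auto simp: admissible_def)
  obtain \<delta> where \<delta>: "0 < \<delta>" "\<And>r. \<bar>r\<bar> < \<delta> \<Longrightarrow> (fst z + r * w1, snd z + r *\<^sub>R w2) \<in> U" using U(2)[OF z] by blast
  have X: "snd z + r *\<^sub>R w2 \<in> X" if "\<bar>r\<bar> < \<delta>" for r using U(1)[OF \<delta>(2)[OF that]] by simp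
  show ?thesis
    unfolding potential_def
  proof (rule kernel_integral_dir_deriv[OF integrable_source \<delta>(1) _ _ _ _ _ der, where C = "max C C'"])
    show "(LINT v|lborel. complex_of_real (k (fst v - (fst z + r * w1)) (snd v - (snd z + r *\<^sub>R w2))) * \<psi> v) = 0" if "\<bar>r\<bar> < \<delta>" for r
      using zero[OF \<delta>(2)[OF that]] by (simp add: potential_def)
    fix r v assume r: "\<bar>r\<bar> < \<delta>" and v: "\<psi> v \<noteq> 0"
    note b = separated[OF v X[OF r]] bounded_source[OF v X[OF r]]
    show "\<bar>k (fst v - (fst z + r * w1)) (snd v - (snd z + r *\<^sub>R w2))\<bar> \<le> max C C'"
      by (rule order_trans[OF C[OF b]]) simp
    show "\<bar>k' (fst v - (fst z + r * w1)) (snd v - (snd z + r *\<^sub>R w2))\<bar> \<le> max C C'"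
      by (rule order_trans[OF C'[OF b]]) simp
    show "snd v - (snd z + r *\<^sub>R w2) \<noteq> 0" using b(1) pos by auto
  qed (use k k' in \<open>auto simp: admissible_def\<close>)
qed

lemma potential_exp_kernel_dir_deriv:
  assumes \<beta>: "0 < \<beta>"
    and U: "\<And>z. z \<in> U \<Longrightarrow> snd z \<in> X" "\<And>z. z \<in> U \<Longrightarrow> \<exists>\<delta>>0. \<forall>r. \<bar>r\<bar> < \<delta> \<longrightarrow> (fst z, snd z + r *\<^sub>R w) \<in> U"
    and zero: "\<And>z. z \<in> U \<Longrightarrow> potential (\<lambda>\<tau> y. exp_kernel \<beta> \<tau> ((norm y)\<^sup>2 / 4)) z = 0" and z: "z \<in> U"
  shows "potential (\<lambda>\<tau> y. exp_kernel (\<beta> + 1) \<tau> ((norm y)\<^sup>2 / 4) * ((y \<bullet> w) / 2)) z = 0"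
proof (rule potential_dir_deriv[where ?w1.0 = 0 and ?w2.0 = w and U = U])
  show "admissible (\<lambda>\<tau> y. exp_kernel \<beta> \<tau> ((norm y)\<^sup>2 / 4))" by (rule admissible_exp_kernel[OF \<beta>])
  show "admissible (\<lambda>\<tau> y. exp_kernel (\<beta> + 1) \<tau> ((norm y)\<^sup>2 / 4) * ((y \<bullet> w) / 2))"
    using \<beta> by (intro admissible_mult admissible_exp_kernel continuous_intros) auto
qed (use U zero z exp_kernel_dir_deriv in auto)

text \<open>Applying \<open>\<partial>\<^sub>t + \<Delta>\<^sub>x\<close> to the kernel of index \<open>\<beta>\<close> gives a multiple of the kernel of index \<open>\<beta> + 1\<close>.\<close>

lemma potential_exp_kernel_Suc:
  assumes \<beta>: "real DIM('b) / 2 < \<beta>"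
    and zero: "\<And>z. z \<in> {a<..<b} \<times> X \<Longrightarrow> potential (\<lambda>\<tau> y. exp_kernel \<beta> \<tau> ((norm y)\<^sup>2 / 4)) z = 0"
    and z: "z \<in> {a<..<b} \<times> X"
  shows "potential (\<lambda>\<tau> y. exp_kernel (\<beta> + 1) \<tau> ((norm y)\<^sup>2 / 4)) z = 0"
proof -
  let ?U = "{a<..<b} \<times> X"
  have \<beta>0: "0 < \<beta>" using \<beta> by (rule le_less_trans[rotated]) simp
  have U: "\<exists>\<delta>>0. \<forall>r. \<bar>r\<bar> < \<delta> \<longrightarrow> (fst z + r * w1, snd z + r *\<^sub>R w2) \<in> ?U" if "z \<in> ?U" for z w1 w2
  proof -
    have "open ?U" using open_X by (intro open_Times) auto
    moreover have "continuous_on UNIV (\<lambda>r. (fst z + r * w1, snd z + r *\<^sub>R w2))" by (intro continuous_intros)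
    ultimately have "open ((\<lambda>r. (fst z + r * w1, snd z + r *\<^sub>R w2)) -` ?U)" by (simp add: continuous_on_open_vimage)
    moreover have "0 \<in> (\<lambda>r. (fst z + r * w1, snd z + r *\<^sub>R w2)) -` ?U" using that by auto
    ultimately obtain e where "0 < e" "ball 0 e \<subseteq> (\<lambda>r. (fst z + r * w1, snd z + r *\<^sub>R w2)) -` ?U"
      using open_contains_ball by blast
    then show ?thesis by (intro exI[of _ e]) (auto simp: subset_iff)
  qed
  have Ux: "\<exists>\<delta>>0. \<forall>r. \<bar>r\<bar> < \<delta> \<longrightarrow> (fst z, snd z + r *\<^sub>R w) \<in> ?U" if "z \<in> ?U" for z w using U[OF that, of 0 w] by simp
  have UX: "snd z \<in> X" if "z \<in> ?U" for z using that by auto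
  define e where "e j \<tau> y = exp_kernel (\<beta> + j) \<tau> ((norm y)\<^sup>2 / 4)" for j \<tau> and y :: 'b
  have adm: "admissible (e j)" if "0 \<le> j" for j
    unfolding e_def by (rule admissible_exp_kernel) (use that \<beta>0 in simp)
  \<comment> \<open>\<open>k1\<close> is the derivative in the base time t, hence minus the
    derivative in \<tau>; \<open>k3 w\<close> is the second derivative in the direction
    \<open>w\<close>.\<close>
  define k1 where "k1 \<tau> y = e 1 \<tau> y * \<beta> - e 2 \<tau> y * ((norm y)\<^sup>2 / 4)" for \<tau> y
  define k3 where "k3 w \<tau> y = e 2 \<tau> y * ((y \<bullet> w) / 2)\<^sup>2 - e 1 \<tau> y * ((w \<bullet> w) / 2)" for w \<tau> y
  have adm1: "admissible k1" unfolding k1_def[abs_def] by (intro admissible_diff admissible_mult adm continuous_intros) auto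
  have adm3: "admissible (k3 w)" for w unfolding k3_def[abs_def] by (intro admissible_diff admissible_mult adm continuous_intros) auto
  have 1: "potential k1 z = 0"
  proof (rule potential_dir_deriv[where ?w1.0 = 1 and ?w2.0 = 0 and U = ?U, OF admissible_exp_kernel[OF \<beta>0] adm1 _ UX U zero z])
    fix \<tau> :: real and y :: 'b assume "y \<noteq> 0"
    then have q: "0 < (norm y)\<^sup>2 / 4" by simp
    have "((\<lambda>h. \<tau> - h * 1) has_real_derivative - 1) (at 0)" by (auto intro!: derivative_eq_intros)
    moreover have "((\<lambda>\<tau>. exp_kernel \<beta> \<tau> ((norm y)\<^sup>2 / 4)) has_real_derivative - k1 \<tau> y) (at (\<tau> - 0 * 1))"
      using exp_kernel_deriv_time[OF q \<beta>0, of \<tau>] by (simp add: k1_def e_def algebra_simps)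
    ultimately have "((\<lambda>h. exp_kernel \<beta> (\<tau> - h * 1) ((norm y)\<^sup>2 / 4)) has_real_derivative (- k1 \<tau> y) * (- 1)) (at 0)"
      by (rule DERIV_chain2[rotated])
    then show "((\<lambda>h. exp_kernel \<beta> (\<tau> - h * 1) ((norm (y - h *\<^sub>R 0))\<^sup>2 / 4)) has_real_derivative k1 \<tau> y) (at 0)" by simp
  qed
  have 2: "potential (\<lambda>\<tau> y. e 1 \<tau> y * ((y \<bullet> w) / 2)) z = 0" if "z \<in> ?U" for w z
    unfolding e_def by (rule potential_exp_kernel_dir_deriv[OF \<beta>0 UX Ux zero that])
  have 3: "potential (k3 w) z = 0" for w
  proof (rule potential_dir_deriv[where ?w1.0 = 0 and ?w2.0 = w and U = ?U, OF _ adm3 _ UX U 2 z])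
    show "admissible (\<lambda>\<tau> y. e 1 \<tau> y * ((y \<bullet> w) / 2))" by (intro admissible_mult adm continuous_intros) auto
    fix \<tau> :: real and y :: 'b
    have d1: "((\<lambda>h. e 1 \<tau> (y - h *\<^sub>R w)) has_real_derivative e 2 \<tau> y * ((y \<bullet> w) / 2)) (at 0)"
      using exp_kernel_dir_deriv[of "\<beta> + 1" \<tau> y w] by (simp add: e_def add.assoc)
    have d2: "((\<lambda>h. ((y - h *\<^sub>R w) \<bullet> w) / 2) has_real_derivative - (w \<bullet> w) / 2) (at 0)"
      unfolding inner_diff_left inner_scaleR_left by (auto intro!: derivative_eq_intros)
    have "((\<lambda>h. e 1 \<tau> (y - h *\<^sub>R w) * (((y - h *\<^sub>R w) \<bullet> w) / 2)) has_real_derivative k3 w \<tau> y) (at 0)"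
      by (rule DERIV_cong[OF DERIV_mult[OF d1 d2]]) (simp add: k3_def power2_eq_square algebra_simps)
    then show "((\<lambda>h. e 1 (\<tau> - h * 0) (y - h *\<^sub>R w) * (((y - h *\<^sub>R w) \<bullet> w) / 2)) has_real_derivative k3 w \<tau> y) (at 0)" by simp
  qed
  \<comment> \<open>The terms of index \<beta> + 2 cancel because the squared coordinates of y add
    up to |y|^2. The remaining factor is positive by the assumption on \<beta>.\<close>
  have sum: "k1 \<tau> y + (\<Sum>w\<in>Basis. k3 w \<tau> y) = (\<beta> - real DIM('b) / 2) * e 1 \<tau> y" for \<tau> y
  proof -
    have "(\<Sum>w\<in>Basis. ((y \<bullet> w) / 2)\<^sup>2) = (norm y)\<^sup>2 / 4"
      unfolding power2_norm_eq_inner power_divide sum_divide_distrib[symmetric] euclidean_inner[of y y] by (simp add: power2_eq_square)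
    moreover have "(\<Sum>w\<in>(Basis :: 'b set). e 1 \<tau> y * ((w \<bullet> w) / 2)) = real DIM('b) * (e 1 \<tau> y / 2)" by simp
    ultimately show ?thesis
      unfolding k1_def k3_def sum_subtractf sum_distrib_left[symmetric] by (simp add: algebra_simps)
  qed
  have i: "integrable lborel (\<lambda>v. complex_of_real (k (fst v - fst z) (snd v - snd z)) * \<psi> v)" if "admissible k" for k
    by (rule integrable_potential[OF that UX[OF z]])
  have "complex_of_real (\<beta> - real DIM('b) / 2) * potential (e 1) z
      = (LINT v|lborel. complex_of_real (k1 (fst v - fst z) (snd v - snd z)) * \<psi> v
          + (\<Sum>w\<in>Basis. complex_of_real (k3 w (fst v - fst z) (snd v - snd z)) * \<psi> v))"
    unfolding potential_def integral_mult_right_zero[symmetric]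
  proof (rule Bochner_Integration.integral_cong[OF refl])
    fix v :: "real \<times> 'b"
    show "complex_of_real (\<beta> - real DIM('b) / 2) * (complex_of_real (e 1 (fst v - fst z) (snd v - snd z)) * \<psi> v)
      = complex_of_real (k1 (fst v - fst z) (snd v - snd z)) * \<psi> v + (\<Sum>w\<in>Basis. complex_of_real (k3 w (fst v - fst z) (snd v - snd z)) * \<psi> v)"
      unfolding mult.assoc[symmetric] of_real_mult[symmetric] sum[symmetric] by (simp only: of_real_add of_real_sum distrib_right sum_distrib_right)
  qed
  also have "\<dots> = potential k1 z + (\<Sum>w\<in>Basis. potential (k3 w) z)"
    unfolding potential_def by (simp add: Bochner_Integration.integral_add Bochner_Integration.integral_sum Bochner_Integration.integrable_sum i adm1 adm3)
  also have "\<dots> = 0" by (simp add: 1 3)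
  finally have "\<beta> - real DIM('b) / 2 = 0 \<or> potential (e 1) z = 0" by (simp only: mult_eq_0_iff of_real_eq_0_iff)
  then show ?thesis using \<beta> by (simp add: e_def[abs_def])
qed

lemma potential_exp_kernel_shift:
  assumes \<beta>: "real DIM('b) / 2 < \<beta>"
    and zero: "\<And>z. z \<in> {a<..<b} \<times> X \<Longrightarrow> potential (\<lambda>\<tau> y. exp_kernel \<beta> \<tau> ((norm y)\<^sup>2 / 4)) z = 0"
  shows "z \<in> {a<..<b} \<times> X \<Longrightarrow> potential (\<lambda>\<tau> y. exp_kernel (\<beta> + real j) \<tau> ((norm y)\<^sup>2 / 4)) z = 0"
proof (induction j arbitrary: z)
  case (Suc j)
  have "\<beta> + real (Suc j) = (\<beta> + real j) + 1" by simp
  then show ?case using potential_exp_kernel_Suc[of "\<beta> + real j", OF _ Suc.IH Suc.prems] \<beta> by (simp add: add_ac)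
qed (use zero in simp)

end

section \<open>Weights annihilated on a time slice, and vanishing of the source\<close>

context separated_source
begin

abbreviation kernel_at :: "real \<Rightarrow> real \<Rightarrow> 'b \<Rightarrow> real \<times> 'b \<Rightarrow> real" where
  "kernel_at \<beta> t x v \<equiv> exp_kernel \<beta> (fst v - t) ((norm (snd v - x))\<^sup>2 / 4)"

lemma kernel_at_measurable [measurable]: "kernel_at \<beta> t x \<in> borel_measurable borel"
  by measurable

lemma kernel_at_bound:
  assumes "0 < \<beta>"
  obtains C where "0 < C" "\<And>t x v. \<psi> v \<noteq> 0 \<Longrightarrow> x \<in> X \<Longrightarrow> kernel_at \<beta> t x v \<le> C"
proof -
  have "0 < d\<^sup>2 / 4" using pos by simp
  then obtain C where C: "0 < C" "\<And>\<tau> q. d\<^sup>2 / 4 \<le> q \<Longrightarrow> exp_kernel \<beta> \<tau> q \<le> C"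
    by (rule exp_kernel_bound[OF _ assms]) blast
  have "kernel_at \<beta> t x v \<le> C" if "\<psi> v \<noteq> 0" "x \<in> X" for t x v
    using power_mono[OF separated[OF that], of 2] pos by (intro C(2)) simp
  with C(1) show ?thesis by (rule that)
qed

lemma integrable_weighted:
  assumes \<beta>: "0 < \<beta>" and x: "x \<in> X" and h: "continuous_on UNIV h"
  shows "integrable lborel (\<lambda>v. complex_of_real (h v * kernel_at \<beta> t x v) * \<psi> v)"
proof -
  obtain C where C: "0 < C" "\<And>t x v. \<psi> v \<noteq> 0 \<Longrightarrow> x \<in> X \<Longrightarrow> kernel_at \<beta> t x v \<le> C"
    by (rule kernel_at_bound[OF \<beta>]) blast
  let ?K = "{- D..D} \<times> cball x D"
  have "compact (h ` ?K)" by (intro compact_continuous_image continuous_on_subset[OF h] compact_Times) auto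
  then obtain B where B: "\<And>v. v \<in> ?K \<Longrightarrow> \<bar>h v\<bar> \<le> B" using compact_imp_bounded by (fastforce simp: bounded_iff)
  have [measurable]: "h \<in> borel_measurable borel" by (rule borel_measurable_continuous_onI[OF h])
  show ?thesis
  proof (rule integrable_mult_source)
    fix v assume v: "\<psi> v \<noteq> 0"
    have "v \<in> ?K" using bounded_time[OF v] bounded_source[OF v x] by (cases v) (auto simp: dist_norm norm_minus_commute)
    then show "\<bar>h v * kernel_at \<beta> t x v\<bar> \<le> B * C"
      unfolding abs_mult using C(2)[OF v x, of t] B[of v] by (intro mult_mono) auto
  qed measurable
qed

text \<open>For a fixed base point (t, x) the integrals against all powers of 1/\<tau> vanish, hence
  those against e^(-m \<sigma>/\<tau>), hence those against every continuous function of \<tau> =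
  fst v - t.\<close>

lemma time_average_zero:
  assumes \<beta>: "real DIM('b) / 2 < \<beta>"
    and zero: "\<And>z. z \<in> {a<..<b} \<times> X \<Longrightarrow> potential (\<lambda>\<tau> y. exp_kernel \<beta> \<tau> ((norm y)\<^sup>2 / 4)) z = 0"
    and t: "t \<in> {a<..<b}" and x: "x \<in> X" and \<eta>: "continuous_on UNIV (\<eta> :: real \<Rightarrow> real)"
  shows "(LINT v|lborel. complex_of_real (\<eta> (fst v - t)) * (complex_of_real (kernel_at \<beta> t x v) * \<psi> v)) = 0"
proof -
  have \<beta>0: "0 < \<beta>" using \<beta> by (rule le_less_trans[rotated]) simp
  \<comment> \<open>Separation gives q \<ge> d^2/4 in the kernel. Taking 2 \<sigma> = d^2/8 out of q
    leaves at least d^2/8, so \<open>G\<close> is still the source times a bounded factor.\<close>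
  define \<sigma> where "\<sigma> = d\<^sup>2 / 16"
  have \<sigma>: "0 < \<sigma>" using pos by (simp add: \<sigma>_def)
  \<comment> \<open>This is 1/\<tau>, set to 0 for \<tau> \<le> 0, where the kernel
    vanishes.\<close>
  define c where "c v = (if 0 < fst v - t then 1 / (fst v - t) else 0)" for v :: "real \<times> 'b"
  define N where "N v = complex_of_real (kernel_at \<beta> t x v) * \<psi> v" for v
  define G where "G v = complex_of_real (exp_kernel \<beta> (fst v - t) ((norm (snd v - x))\<^sup>2 / 4 - 2 * \<sigma>)) * \<psi> v" for v
  have Ni: "integrable lborel N" using integrable_weighted[OF \<beta>0 x, of "\<lambda>_. 1"] by (simp add: N_def[abs_def])
  have Gi: "integrable lborel G"
  proof -
    have "0 < d\<^sup>2 / 8" using pos by simp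
    then obtain C where C: "\<And>\<tau> q. d\<^sup>2 / 8 \<le> q \<Longrightarrow> exp_kernel \<beta> \<tau> q \<le> C" by (rule exp_kernel_bound[OF _ \<beta>0]) blast
    show ?thesis
      unfolding G_def[abs_def]
    proof (rule integrable_mult_source)
      fix v assume "\<psi> v \<noteq> 0"
      then have "d\<^sup>2 \<le> (norm (snd v - x))\<^sup>2" using separated[OF _ x] pos by (intro power_mono) auto
      then show "\<bar>exp_kernel \<beta> (fst v - t) ((norm (snd v - x))\<^sup>2 / 4 - 2 * \<sigma>)\<bar> \<le> C"
        using C[of "(norm (snd v - x))\<^sup>2 / 4 - 2 * \<sigma>" "fst v - t"] by (simp add: \<sigma>_def)
    qed measurable
  qed
  have cm: "c \<in> borel_measurable lborel" unfolding c_def[abs_def] by measurable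
  have c0: "0 \<le> c v" for v by (simp add: c_def)
  have NG: "N v = complex_of_real (exp (- (2 * \<sigma> * c v))) * G v" for v
  proof (cases "0 < fst v - t")
    case True
    have "exp (- ((norm (snd v - x))\<^sup>2 / 4) / (fst v - t))
        = exp (- (2 * \<sigma> / (fst v - t))) * exp (- ((norm (snd v - x))\<^sup>2 / 4 - 2 * \<sigma>) / (fst v - t))"
      by (simp add: diff_divide_distrib flip: exp_add)
    then show ?thesis using True by (simp add: N_def G_def c_def exp_kernel_def)
  qed (simp add: N_def G_def exp_kernel_def)
  have mom: "(LINT v|lborel. complex_of_real (c v ^ j) * N v) = 0" for j
  proof -
    have "complex_of_real (c v ^ j) * N v = complex_of_real (kernel_at (\<beta> + real j) t x v) * \<psi> v" for v
      unfolding N_def c_def mult.assoc[symmetric] of_real_mult[symmetric] exp_kernel_moment ..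
    then show ?thesis using potential_exp_kernel_shift[OF \<beta> zero, where z = "(t, x)" and j = j] t x by (simp add: potential_def)
  qed
  have "(LINT v|lborel. complex_of_real (exp (- (real m * \<sigma> / (fst v - t)))) * N v) = 0" for m :: nat
  proof -
    have "(LINT v|lborel. complex_of_real (c v ^ 0 * exp (- (real m * \<sigma> * c v))) * N v) = 0"
      by (rule laplace_of_moments[OF c0 cm Gi \<sigma> NG mom])
    moreover have "complex_of_real (c v ^ 0 * exp (- (real m * \<sigma> * c v))) * N v = complex_of_real (exp (- (real m * \<sigma> / (fst v - t)))) * N v" for v
      by (cases "0 < fst v - t") (simp_all add: c_def N_def exp_kernel_def)
    ultimately show ?thesis by (simp only:)
  qed
  from integral_continuous_of_exp_moments[OF Ni _ _ \<sigma> this \<eta>, where L = "D - t"]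
  show ?thesis unfolding N_def
  proof this
    show "(\<lambda>v. fst v - t) \<in> borel_measurable lborel" by measurable
    show "0 < fst v - t \<and> fst v - t \<le> D - t" if "complex_of_real (kernel_at \<beta> t x v) * \<psi> v \<noteq> 0" for v
      using that bounded_time[of v] by (auto simp: exp_kernel_def split: if_splits)
  qed
qed

text \<open>The continuous weights \<open>h\<close> annihilated on the time slice \<open>t\<close>. Translating \<open>x\<close> shows that they
  form a module over the polynomials.\<close>

definition null_weight :: "real \<Rightarrow> real \<Rightarrow> (real \<times> 'b \<Rightarrow> real) \<Rightarrow> bool" where
  "null_weight \<beta> t h \<longleftrightarrow> continuous_on UNIV h \<and> (\<forall>\<eta> x. continuous_on UNIV \<eta> \<longrightarrow> x \<in> X \<longrightarrow>
    (LINT v|lborel. complex_of_real (\<eta> (fst v - t) * h v * kernel_at \<beta> t x v) * \<psi> v) = 0)"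

lemma null_weight_continuous: "null_weight \<beta> t h \<Longrightarrow> continuous_on UNIV h"
  by (simp add: null_weight_def)

lemma null_weight_zero:
  "null_weight \<beta> t h \<Longrightarrow> continuous_on UNIV \<eta> \<Longrightarrow> x \<in> X \<Longrightarrow>
    (LINT v|lborel. complex_of_real (\<eta> (fst v - t) * h v * kernel_at \<beta> t x v) * \<psi> v) = 0"
  by (simp add: null_weight_def)

lemma integrable_null_weight:
  assumes "0 < \<beta>" "x \<in> X" "continuous_on UNIV h" "continuous_on UNIV \<eta>"
  shows "integrable lborel (\<lambda>v. complex_of_real (\<eta> (fst v - t) * h v * kernel_at \<beta> t x v) * \<psi> v)"
  using assms by (intro integrable_weighted continuous_on_mult continuous_on_compose2[OF assms(4)] continuous_intros) auto

lemma null_weight_add: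
  assumes \<beta>: "0 < \<beta>" and h: "null_weight \<beta> t h" and k: "null_weight \<beta> t k"
  shows "null_weight \<beta> t (\<lambda>v. h v + k v)"
  unfolding null_weight_def
proof (intro conjI allI impI)
  note c = null_weight_continuous[OF h] null_weight_continuous[OF k]
  show "continuous_on UNIV (\<lambda>v. h v + k v)" using c by (rule continuous_on_add)
  fix \<eta> :: "real \<Rightarrow> real" and x assume e: "continuous_on UNIV \<eta>" and x: "x \<in> X"
  have "complex_of_real (\<eta> (fst v - t) * (h v + k v) * kernel_at \<beta> t x v) * \<psi> v
      = complex_of_real (\<eta> (fst v - t) * h v * kernel_at \<beta> t x v) * \<psi> v + complex_of_real (\<eta> (fst v - t) * k v * kernel_at \<beta> t x v) * \<psi> v" for v
    by (simp add: algebra_simps)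
  then show "(LINT v|lborel. complex_of_real (\<eta> (fst v - t) * (h v + k v) * kernel_at \<beta> t x v) * \<psi> v) = 0"
    using Bochner_Integration.integral_add[OF integrable_null_weight[OF \<beta> x c(1) e] integrable_null_weight[OF \<beta> x c(2) e]]
      null_weight_zero[OF h e x] null_weight_zero[OF k e x] by (simp only: add_0)
qed

lemma null_weight_cmult:
  assumes h: "null_weight \<beta> t h"
  shows "null_weight \<beta> t (\<lambda>v. r * h v)"
  unfolding null_weight_def
proof (intro conjI allI impI)
  show "continuous_on UNIV (\<lambda>v. r * h v)" using null_weight_continuous[OF h] by (intro continuous_intros)
  fix \<eta> :: "real \<Rightarrow> real" and x assume e: "continuous_on UNIV \<eta>" and x: "x \<in> X"
  \<comment> \<open>The constant is absorbed into the free function of time.\<close>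
  have "continuous_on UNIV (\<lambda>\<tau>. \<eta> \<tau> * r)" using e by (intro continuous_intros)
  from null_weight_zero[OF h this x]
  show "(LINT v|lborel. complex_of_real (\<eta> (fst v - t) * (r * h v) * kernel_at \<beta> t x v) * \<psi> v) = 0"
    by (simp only: mult.assoc)
qed

lemma null_weight_fst:
  assumes h: "null_weight \<beta> t h"
  shows "null_weight \<beta> t (\<lambda>v. fst v * h v)"
  unfolding null_weight_def
proof (intro conjI allI impI)
  show "continuous_on UNIV (\<lambda>v. fst v * h v)" using null_weight_continuous[OF h] by (intro continuous_intros)
  fix \<eta> :: "real \<Rightarrow> real" and x assume e: "continuous_on UNIV \<eta>" and x: "x \<in> X"
  \<comment> \<open>\<open>fst v\<close> equals \<tau> + t and is absorbed into the free function of
    time as well.\<close>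
  have "continuous_on UNIV (\<lambda>\<tau>. \<eta> \<tau> * (\<tau> + t))" using e by (intro continuous_intros)
  from null_weight_zero[OF h this x]
  show "(LINT v|lborel. complex_of_real (\<eta> (fst v - t) * (fst v * h v) * kernel_at \<beta> t x v) * \<psi> v) = 0"
    by (simp only: mult.assoc diff_add_cancel)
qed

text \<open>A derivative in x along \<open>w\<close> brings down (y \<bullet> w) / 2 and raises the
  index to \<beta> + 1; a spare factor \<tau> put next to \<eta> brings the index back to \<beta>.
  Since y = snd v - x, what separates this from the claim is the constant x \<bullet> w.\<close>

lemma null_weight_snd:
  assumes \<beta>: "0 < \<beta>" and h: "null_weight \<beta> t h"
  shows "null_weight \<beta> t (\<lambda>v. (snd v \<bullet> w) * h v)"
  unfolding null_weight_def
proof (intro conjI allI impI)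
  note hc = null_weight_continuous[OF h]
  show "continuous_on UNIV (\<lambda>v. (snd v \<bullet> w) * h v)" using hc by (intro continuous_intros)
  fix \<eta> :: "real \<Rightarrow> real" and x assume e: "continuous_on UNIV \<eta>" and x: "x \<in> X"
  define g where "g v = \<eta> (fst v - t) * (fst v - t) * h v" for v
  have e': "continuous_on UNIV (\<lambda>\<tau>. \<eta> \<tau> * \<tau>)" using e by (intro continuous_intros)
  have gc: "continuous_on UNIV g"
    unfolding g_def[abs_def] using hc by (intro continuous_intros continuous_on_compose2[OF e]) auto
  have [measurable]: "g \<in> borel_measurable borel" by (rule borel_measurable_continuous_onI[OF gc])
  \<comment> \<open>\<open>g\<close> is continuous, hence bounded on the support of
    \<open>\<psi>\<close>, and the product has no larger support; so the weighted source satisfies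
    the assumptions of the same locale.\<close>
  interpret S: separated_source "\<lambda>v. complex_of_real (g v) * \<psi> v" X d D
  proof
    let ?K = "{- D..D} \<times> cball x D"
    have "compact (g ` ?K)" by (intro compact_continuous_image continuous_on_subset[OF gc] compact_Times) auto
    then obtain B where B: "\<And>v. v \<in> ?K \<Longrightarrow> \<bar>g v\<bar> \<le> B" using compact_imp_bounded by (fastforce simp: bounded_iff)
    show "integrable lborel (\<lambda>v. complex_of_real (g v) * \<psi> v)"
    proof (rule integrable_mult_source)
      fix v assume v: "\<psi> v \<noteq> 0"
      have "v \<in> ?K" using bounded_time[OF v] bounded_source[OF v x] by (cases v) (auto simp: dist_norm norm_minus_commute)
      then show "\<bar>g v\<bar> \<le> B" by (rule B)
    qed measurable
  qed (use open_X pos separated bounded_source bounded_time in auto)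
  have "S.potential (\<lambda>\<tau> y. exp_kernel (\<beta> + 1) \<tau> ((norm y)\<^sup>2 / 4) * ((y \<bullet> w) / 2)) (t, x) = 0"
  proof (rule S.potential_exp_kernel_dir_deriv[OF \<beta>, where U = "{t} \<times> X"])
    fix z :: "real \<times> 'b" assume z: "z \<in> {t} \<times> X"
    show "snd z \<in> X" using z by auto
    have "open ((\<lambda>r. snd z + r *\<^sub>R w) -` X)"
      using open_X by (intro open_vimage continuous_intros)
    moreover have "0 \<in> (\<lambda>r. snd z + r *\<^sub>R w) -` X" using z by auto
    ultimately obtain \<delta> where \<delta>: "0 < \<delta>" "ball 0 \<delta> \<subseteq> (\<lambda>r. snd z + r *\<^sub>R w) -` X"
      using open_contains_ball by blast
    have "(fst z, snd z + r *\<^sub>R w) \<in> {t} \<times> X" if "\<bar>r\<bar> < \<delta>" for r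
    proof -
      have "r \<in> ball 0 \<delta>" using that by simp
      then show ?thesis using \<delta>(2) z by auto
    qed
    then show "\<exists>\<delta>>0. \<forall>r. \<bar>r\<bar> < \<delta> \<longrightarrow> (fst z, snd z + r *\<^sub>R w) \<in> {t} \<times> X" using \<delta>(1) by blast
    have eq: "complex_of_real (kernel_at \<beta> (fst z) (snd z) v) * (complex_of_real (g v) * \<psi> v)
        = complex_of_real ((\<eta> (fst v - t) * (fst v - t)) * h v * kernel_at \<beta> t (snd z) v) * \<psi> v" for v
      using z by (auto simp: g_def)
    have zx: "snd z \<in> X" using z by auto
    show "S.potential (\<lambda>\<tau> y. exp_kernel \<beta> \<tau> ((norm y)\<^sup>2 / 4)) z = 0"
      unfolding S.potential_def eq by (rule null_weight_zero[OF h e' zx])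
  qed (use x in auto)
  moreover have "complex_of_real (exp_kernel (\<beta> + 1) (fst v - t) ((norm (snd v - x))\<^sup>2 / 4) * (((snd v - x) \<bullet> w) / 2)) * (complex_of_real (g v) * \<psi> v)
      = complex_of_real (1 / 2) * (complex_of_real (\<eta> (fst v - t) * (((snd v - x) \<bullet> w) * h v) * kernel_at \<beta> t x v) * \<psi> v)" for v
    unfolding exp_kernel_shift_down[of "fst v - t" \<beta>, symmetric] g_def by simp
  ultimately have z1: "(LINT v|lborel. complex_of_real (\<eta> (fst v - t) * (((snd v - x) \<bullet> w) * h v) * kernel_at \<beta> t x v) * \<psi> v) = 0"
    unfolding S.potential_def fst_conv snd_conv by (simp only: integral_mult_right_zero) simp
  have "continuous_on UNIV (\<lambda>\<tau>. \<eta> \<tau> * (x \<bullet> w))" using e by (intro continuous_intros)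
  from null_weight_zero[OF h this x] integrable_null_weight[OF \<beta> x hc this]
  have z2: "(LINT v|lborel. complex_of_real (\<eta> (fst v - t) * ((x \<bullet> w) * h v) * kernel_at \<beta> t x v) * \<psi> v) = 0"
    and i2: "integrable lborel (\<lambda>v. complex_of_real (\<eta> (fst v - t) * ((x \<bullet> w) * h v) * kernel_at \<beta> t x v) * \<psi> v)"
    by (simp_all only: mult.assoc)
  have i1: "integrable lborel (\<lambda>v. complex_of_real (\<eta> (fst v - t) * (((snd v - x) \<bullet> w) * h v) * kernel_at \<beta> t x v) * \<psi> v)"
    using hc by (intro integrable_null_weight[OF \<beta> x _ e] continuous_intros)
  have eq: "complex_of_real (\<eta> (fst v - t) * ((snd v \<bullet> w) * h v) * kernel_at \<beta> t x v) * \<psi> v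
      = complex_of_real (\<eta> (fst v - t) * (((snd v - x) \<bullet> w) * h v) * kernel_at \<beta> t x v) * \<psi> v
        + complex_of_real (\<eta> (fst v - t) * ((x \<bullet> w) * h v) * kernel_at \<beta> t x v) * \<psi> v" for v
    by (simp add: inner_diff_left algebra_simps)
  show "(LINT v|lborel. complex_of_real (\<eta> (fst v - t) * ((snd v \<bullet> w) * h v) * kernel_at \<beta> t x v) * \<psi> v) = 0"
    unfolding eq using Bochner_Integration.integral_add[OF i1 i2] z1 z2 by (simp only: add_0)
qed

text \<open>Induction with \<open>h\<close> generalised, so that the product case applies the
  statement for one factor to the weight produced by the other. A linear polynomial splits into a
  time part and a space part.\<close>

lemma null_weight_polynomial:
  assumes \<beta>: "0 < \<beta>" and p: "real_polynomial_function p"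
  shows "null_weight \<beta> t h \<Longrightarrow> null_weight \<beta> t (\<lambda>v. p v * h v)"
  using p
proof (induction p arbitrary: h rule: real_polynomial_function.induct)
  case (linear f)
  interpret f: bounded_linear f by fact
  have lin: "linear (\<lambda>y. f (0, y))"
  proof
    show "f (0, y1 + y2) = f (0, y1) + f (0, y2)" for y1 y2 using f.add[of "(0, y1)" "(0, y2)"] by simp
    show "f (0, r *\<^sub>R y) = r *\<^sub>R f (0, y)" for r y using f.scaleR[of r "(0, y)"] by simp
  qed
  \<comment> \<open>The Riesz vector of the spatial part of the linear functional.\<close>
  define w where "w = adjoint (\<lambda>y. f (0, y)) 1"
  have f: "f v = f (1, 0) * fst v + snd v \<bullet> w" for v
  proof -
    have "f v = f (fst v *\<^sub>R (1, 0)) + f (0, snd v)" using f.add[of "fst v *\<^sub>R (1, 0)" "(0, snd v)"] by simp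
    also have "f (fst v *\<^sub>R (1, 0)) = fst v * f (1, 0)" using f.scaleR[of "fst v" "(1, 0)"] by simp
    finally show ?thesis using adjoint_works[OF lin, of "snd v" 1] by (simp add: w_def)
  qed
  have eq: "f v * h v = f (1, 0) * (fst v * h v) + (snd v \<bullet> w) * h v" for v
    unfolding f[of v] by (simp add: algebra_simps)
  show ?case
    unfolding eq by (intro null_weight_add[OF \<beta>] null_weight_cmult null_weight_fst null_weight_snd[OF \<beta>] linear)
next
  case (const c)
  then show ?case by (rule null_weight_cmult)
next
  case (add f g)
  then show ?case unfolding distrib_right by (intro null_weight_add[OF \<beta>])
next
  case (mult f g)
  then show ?case unfolding mult.assoc by blast
qed

text \<open>The slice at time t controls the source only where the kernel is positive, at times
  after t. Slices are available for all t in (a, b), and countably many of them decreasing to a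
  reach every time after a.\<close>

theorem source_vanishes:
  assumes \<beta>: "real DIM('b) / 2 < \<beta>" and ab: "a < b" and X: "X \<noteq> {}"
    and zero: "\<And>z. z \<in> {a<..<b} \<times> X \<Longrightarrow> potential (\<lambda>\<tau> y. exp_kernel \<beta> \<tau> ((norm y)\<^sup>2 / 4)) z = 0"
  shows "AE v in lborel. a < fst v \<longrightarrow> \<psi> v = 0"
proof -
  have \<beta>0: "0 < \<beta>" using \<beta> by (rule le_less_trans[rotated]) simp
  obtain x where x: "x \<in> X" using X by blast
  have slice: "AE v in lborel. t < fst v \<longrightarrow> \<psi> v = 0" if t: "t \<in> {a<..<b}" for t
  proof -
    have one: "null_weight \<beta> t (\<lambda>_. 1)"
      unfolding null_weight_def using time_average_zero[OF \<beta> zero t] by (simp add: mult.assoc)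
    have "AE v in lborel. complex_of_real (kernel_at \<beta> t x v) * \<psi> v = 0"
    proof (rule AE_zero_of_polynomial_moments)
      show "integrable lborel (\<lambda>v. complex_of_real (kernel_at \<beta> t x v) * \<psi> v)"
        using integrable_weighted[OF \<beta>0 x, of "\<lambda>_. 1"] by simp
      show "compact ({- D..D} \<times> cball x D)" by (intro compact_Times) auto
      show "v \<in> {- D..D} \<times> cball x D" if "complex_of_real (kernel_at \<beta> t x v) * \<psi> v \<noteq> 0" for v
        using that bounded_time[of v] bounded_source[of v, OF _ x] by (cases v) (auto simp: dist_norm norm_minus_commute)
      fix p :: "real \<times> 'b \<Rightarrow> real" assume p: "real_polynomial_function p"
      have "continuous_on UNIV (\<lambda>_ :: real. 1 :: real)" by simp
      from null_weight_zero[OF null_weight_polynomial[OF \<beta>0 p one] this x]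
      show "(LINT v|lborel. complex_of_real (p v) * (complex_of_real (kernel_at \<beta> t x v) * \<psi> v)) = 0"
        by (simp add: mult.assoc)
    qed
    then show ?thesis by eventually_elim (auto simp: exp_kernel_def)
  qed
  define t where "t k = a + (b - a) * inverse (real (Suc (Suc k)))" for k
  have tI: "t k \<in> {a<..<b}" for k
  proof -
    have "inverse (real (Suc (Suc k))) < 1" by (simp add: inverse_less_1_iff)
    then have "(b - a) * inverse (real (Suc (Suc k))) < (b - a) * 1" using ab by (intro mult_strict_left_mono) auto
    moreover have "0 < (b - a) * inverse (real (Suc (Suc k)))" using ab by simp
    ultimately show ?thesis by (simp add: t_def del: of_nat_Suc)
  qed
  have tl: "t \<longlonglongrightarrow> a"
    unfolding t_def[abs_def]
    using tendsto_add[OF tendsto_const tendsto_mult_right_zero[OF LIMSEQ_Suc[OF LIMSEQ_inverse_real_of_nat]], of a "b - a"] by simp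
  have "AE v in lborel. \<forall>k. t k < fst v \<longrightarrow> \<psi> v = 0"
    unfolding AE_all_countable using slice[OF tI] by blast
  then show ?thesis
  proof eventually_elim
    case (elim v)
    show ?case
    proof
      assume "a < fst v"
      from order_tendstoD(2)[OF tl this] obtain k where "t k < fst v" by (auto simp: eventually_sequentially)
      then show "\<psi> v = 0" using elim by blast
    qed
  qed
qed

text \<open>Testing against Lipschitz functions determines the potential only almost everywhere;
  continuity makes it vanish at every point, as the differentiations require.\<close>

lemma potential_exp_kernel_continuous:
  assumes \<beta>: "0 < \<beta>"
  shows "continuous_on (UNIV \<times> X) (potential (\<lambda>\<tau> y. exp_kernel \<beta> \<tau> ((norm y)\<^sup>2 / 4)))"
proof (rule continuous_on_sequentiallyI)
  fix z :: "nat \<Rightarrow> real \<times> 'b" and l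
  assume z: "\<forall>n. z n \<in> UNIV \<times> X" and l: "l \<in> UNIV \<times> X" and zl: "z \<longlonglongrightarrow> l"
  have zX: "snd (z n) \<in> X" for n using z[rule_format, of n] by (cases "z n") auto
  have lX: "snd l \<in> X" using l by (cases l) auto
  obtain C where C: "0 < C" "\<And>t x v. \<psi> v \<noteq> 0 \<Longrightarrow> x \<in> X \<Longrightarrow> kernel_at \<beta> t x v \<le> C"
    by (rule kernel_at_bound[OF \<beta>]) blast
  show "(\<lambda>n. potential (\<lambda>\<tau> y. exp_kernel \<beta> \<tau> ((norm y)\<^sup>2 / 4)) (z n)) \<longlonglongrightarrow> potential (\<lambda>\<tau> y. exp_kernel \<beta> \<tau> ((norm y)\<^sup>2 / 4)) l"
    unfolding potential_def
  proof (rule integral_dominated_convergence)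
    show "integrable lborel (\<lambda>v. C * cmod (\<psi> v))" using integrable_source by simp
    show "AE v in lborel. (\<lambda>n. complex_of_real (kernel_at \<beta> (fst (z n)) (snd (z n)) v) * \<psi> v)
        \<longlonglongrightarrow> complex_of_real (kernel_at \<beta> (fst l) (snd l) v) * \<psi> v"
    proof (rule AE_I2)
      fix v
      show "(\<lambda>n. complex_of_real (kernel_at \<beta> (fst (z n)) (snd (z n)) v) * \<psi> v)
        \<longlonglongrightarrow> complex_of_real (kernel_at \<beta> (fst l) (snd l) v) * \<psi> v"
      proof (cases "\<psi> v = 0")
        case False
        have "0 < norm (snd v - snd l)" using separated[OF False lX] pos by linarith
        then have "0 < (norm (snd v - snd l))\<^sup>2 / 4" by simp
        then have "(\<lambda>n. kernel_at \<beta> (fst (z n)) (snd (z n)) v) \<longlonglongrightarrow> kernel_at \<beta> (fst l) (snd l) v"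
          using zl by (intro exp_kernel_tendsto[OF _ \<beta>] tendsto_intros) auto
        then show ?thesis by (intro tendsto_intros)
      qed simp
    qed
    have "norm (complex_of_real (kernel_at \<beta> (fst (z n)) (snd (z n)) v) * \<psi> v) \<le> C * cmod (\<psi> v)" for n v
      using C(2)[of v "snd (z n)" "fst (z n)", OF _ zX] by (cases "\<psi> v = 0") (auto simp: norm_mult intro!: mult_right_mono)
    then show "AE v in lborel. norm (complex_of_real (kernel_at \<beta> (fst (z n)) (snd (z n)) v) * \<psi> v) \<le> C * cmod (\<psi> v)" for n
      by (intro AE_I2)
  qed measurable
qed

end

section \<open>Runge approximation\<close>

lemma continuous_zero_of_lip_test_real:
  fixes F :: "'a::euclidean_space \<Rightarrow> real"
  assumes U: "open U" and F: "continuous_on U F"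
    and zero: "\<And>p. p \<in> lip_test U \<Longrightarrow> (LINT z|lborel. p z * F z) = 0" and z: "z \<in> U"
  shows "F z = 0"
proof -
  let ?h = "\<lambda>z. indicator U z * F z"
  have Um: "U \<in> sets borel" using U by simp
  have hm: "?h \<in> borel_measurable borel"
    using borel_measurable_continuous_on_indicator[OF Um F] by simp
  have "AE z in lebesgue. z \<in> U \<longrightarrow> ?h z = 0"
  proof (rule AE_zero_of_lip_test[OF borel_imp_lebesgue[OF hm] U])
    fix K assume K: "compact K" "K \<subseteq> U"
    have Km: "K \<in> sets borel" by (rule borel_compact[OF K(1)])
    have "integrable lborel (\<lambda>z. indicator K z *\<^sub>R F z)"
      using K by (intro borel_integrable_compact continuous_on_subset[OF F])
    moreover have "indicator K z *\<^sub>R F z = indicator K z * ?h z" for z using K(2) by (auto simp: indicator_def)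
    ultimately have "integrable lborel (\<lambda>z. indicator K z * ?h z)" by (simp only:)
    then show "integrable lebesgue (\<lambda>z. indicator K z * ?h z)"
      using hm Km by (subst integrable_completion) auto
  next
    fix p assume p: "p \<in> lip_test U"
    have eq: "p z * ?h z = p z * F z" for z using p by (auto simp: lip_test_def indicator_def)
    have "(\<lambda>z. p z * ?h z) \<in> borel_measurable borel" using hm lip_test_borel[OF p] by simp
    then show "(LINT z|lebesgue. p z * ?h z) = 0" using zero[OF p] by (subst integral_completion) (simp_all add: eq)
  qed
  then have ae: "AE z in lebesgue. z \<notin> {z \<in> U. F z \<noteq> 0}" by eventually_elim auto
  have o: "open {z \<in> U. F z \<noteq> 0}"
  proof -
    have "{z \<in> U. F z \<noteq> 0} = U \<inter> F -` (- {0})" by auto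
    moreover have "open (U \<inter> F -` (- {0}))" by (intro continuous_open_preimage[OF F U] open_Compl closed_singleton)
    ultimately show ?thesis by simp
  qed
  then have "{z \<in> U. F z \<noteq> 0} \<in> sets lebesgue" by (intro sets_completionI_sets) simp
  then have "negligible {z \<in> U. F z \<noteq> 0}"
    using ae by (simp add: negligible_iff_null_sets AE_iff_null_sets)
  then have "{z \<in> U. F z \<noteq> 0} = {}" using open_not_negligible[OF o] by blast
  then show ?thesis using z by blast
qed

text \<open>\<open>F'\<close> is the function produced by the pairing, with the truncated kernel and
  defined everywhere; \<open>F\<close> is the untruncated potential, which is known to be continuous
  on \<open>U\<close>.\<close>

lemma continuous_zero_of_lip_test:
  fixes F F' :: "'a::euclidean_space \<Rightarrow> complex"
  assumes U: "open U" and F: "continuous_on U F" and F': "\<And>z. z \<in> U \<Longrightarrow> F' z = F z"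
    and zero: "\<And>p. p \<in> lip_test U \<Longrightarrow> (LINT z|lborel. complex_of_real (p z) * F' z) = 0" and z: "z \<in> U"
  shows "F z = 0"
proof -
  have pF: "integrable lborel (\<lambda>z. complex_of_real (p z) * F z)" "(LINT z|lborel. complex_of_real (p z) * F z) = 0"
    if p: "p \<in> lip_test U" for p
  proof -
    obtain K where K: "compact K" "K \<subseteq> U" "\<And>z. z \<notin> K \<Longrightarrow> p z = 0" using p by (auto simp: lip_test_def)
    have "integrable lborel (\<lambda>z. indicator K z *\<^sub>R (complex_of_real (p z) * F z))"
      using K lip_test_continuous[OF p]
      by (intro borel_integrable_compact continuous_intros continuous_on_subset[OF F]) (auto intro: continuous_on_subset)
    moreover have "indicator K z *\<^sub>R (complex_of_real (p z) * F z) = complex_of_real (p z) * F z" for z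
      using K(3)[of z] by (auto simp: indicator_def)
    ultimately show "integrable lborel (\<lambda>z. complex_of_real (p z) * F z)" by simp
    have "complex_of_real (p z) * F' z = complex_of_real (p z) * F z" for z
      using K F'[of z] by (cases "z \<in> K") auto
    then show "(LINT z|lborel. complex_of_real (p z) * F z) = 0" using zero[OF p] by (simp only:)
  qed
  have "Re (F z) = 0"
  proof (rule continuous_zero_of_lip_test_real[OF U _ _ z])
    show "continuous_on U (\<lambda>z. Re (F z))" using F by (intro continuous_intros)
    show "(LINT z|lborel. p z * Re (F z)) = 0" if "p \<in> lip_test U" for p
      using integral_Re[OF pF(1)[OF that]] pF(2)[OF that] by simp
  qed
  moreover have "Im (F z) = 0"
  proof (rule continuous_zero_of_lip_test_real[OF U _ _ z])
    show "continuous_on U (\<lambda>z. Im (F z))" using F by (intro continuous_intros)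
    show "(LINT z|lborel. p z * Im (F z)) = 0" if "p \<in> lip_test U" for p
      using integral_Im[OF pF(1)[OF that]] pF(2)[OF that] by simp
  qed
  ultimately show ?thesis by (simp add: complex_eq_iff)
qed

section \<open>From the form to the vanishing of the adjoint solution\<close>

lemma fourier_L12:
  assumes "u \<in> L12"
  shows "AE \<zeta> in lebesgue. fourier u \<zeta> = ft u \<zeta>"
proof -
  have uL: "u \<in> L2 lebesgue" by (rule L12_L2(2)[OF assms])
  have "to_l2 (fourier u) = to_l2 (ft u)" unfolding fourier_L2(2)[OF uL] l2_ft_L12[OF assms] ..
  then show ?thesis
    using to_l2_eq_iff[OF fourier_L2(1)[OF uL] L2_lborel_imp_lebesgue[OF ft_L2(1)[OF assms]]] by simp
qed

lemma Hs_lift_L12: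
  assumes u: "u \<in> Hs s" "u \<in> L12"
  shows "(\<lambda>\<zeta>. Hs_root s \<zeta> * ft u \<zeta>) \<in> L2 lebesgue" "Hs_lift s u = to_l2 (\<lambda>\<zeta>. Hs_root s \<zeta> * ft u \<zeta>)"
proof -
  have ae: "AE \<zeta> in lebesgue. Hs_root s \<zeta> * fourier u \<zeta> = Hs_root s \<zeta> * ft u \<zeta>"
    using fourier_L12[OF u(2)] by eventually_elim simp
  have [measurable]: "u \<in> borel_measurable borel" by (rule L12_measurable[OF u(2)])
  have "(\<lambda>\<zeta>. Hs_root s \<zeta> * ft u \<zeta>) \<in> borel_measurable borel" by measurable
  then show L: "(\<lambda>\<zeta>. Hs_root s \<zeta> * ft u \<zeta>) \<in> L2 lebesgue"
    by (intro L2_cong_AE[OF Hs_root_fourier_L2[OF u(1)] _ ae] borel_imp_lebesgue)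
  show "Hs_lift s u = to_l2 (\<lambda>\<zeta>. Hs_root s \<zeta> * ft u \<zeta>)"
    unfolding Hs_lift_def by (rule to_l2_cong[OF Hs_root_fourier_L2[OF u(1)] L ae])
qed

text \<open>Passes from lifted classes to the pointwise transforms \<open>ft\<close> in an
  absolutely convergent integral with the full power s, the form of the data that
  \<open>heat_form_pairing\<close> takes.\<close>

lemma heat_form_cinner:
  fixes u w :: "'n::finite spacetime \<Rightarrow> complex"
  assumes s: "0 \<le> s" and u: "u \<in> Hs s" "u \<in> L12" and w: "w \<in> Hs s" "w \<in> L12"
  shows "integrable lborel (\<lambda>\<zeta>. cmod (heat_symbol \<zeta>) powr s * cmod (ft u \<zeta> * cnj (ft w \<zeta>)))"
    and "l2_cinner (l2_mult (heat_form_symbol s) (Hs_lift s u)) (Hs_lift s w)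
      = (LINT \<zeta>|lborel. heat_symbol \<zeta> powr complex_of_real s * (ft u \<zeta> * cnj (ft w \<zeta>)))"
proof -
  note U = Hs_lift_L12[OF u] and W = Hs_lift_L12[OF w]
  have [measurable]: "u \<in> borel_measurable borel" "w \<in> borel_measurable borel"
    using L12_measurable u(2) w(2) by auto
  have root: "Hs_root s \<zeta> * a * cnj (Hs_root s \<zeta> * b) = complex_of_real (Hs_weight s \<zeta>) * (a * cnj b)" for \<zeta> :: "'n spacetime" and a b
  proof -
    have "Hs_root s \<zeta> * cnj (Hs_root s \<zeta>) = complex_of_real (Hs_weight s \<zeta>)"
      by (simp add: Hs_root_def less_imp_le flip: of_real_mult)
    moreover have "Hs_root s \<zeta> * a * cnj (Hs_root s \<zeta> * b) = Hs_root s \<zeta> * cnj (Hs_root s \<zeta>) * (a * cnj b)" by simp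
    ultimately show ?thesis by (simp only:)
  qed
  have i: "integrable lborel (\<lambda>\<zeta>. complex_of_real (Hs_weight s \<zeta>) * (ft u \<zeta> * cnj (ft w \<zeta>)))"
    using L2_integrable_mult[OF U(1) W(1)] unfolding root by (subst (asm) integrable_completion) measurable
  show "integrable lborel (\<lambda>\<zeta>. cmod (heat_symbol \<zeta>) powr s * cmod (ft u \<zeta> * cnj (ft w \<zeta>)))"
  proof (rule Bochner_Integration.integrable_bound[OF i])
    have "cmod (heat_symbol \<zeta>) powr s * cmod (ft u \<zeta> * cnj (ft w \<zeta>)) \<le> cmod (complex_of_real (Hs_weight s \<zeta>) * (ft u \<zeta> * cnj (ft w \<zeta>)))" for \<zeta>
      unfolding norm_mult norm_of_real using heat_symbol_powr_le_weight[OF s, of \<zeta>]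
      by (intro mult_right_mono) auto
    then show "AE \<zeta> in lborel. norm (cmod (heat_symbol \<zeta>) powr s * cmod (ft u \<zeta> * cnj (ft w \<zeta>)))
        \<le> norm (complex_of_real (Hs_weight s \<zeta>) * (ft u \<zeta> * cnj (ft w \<zeta>)))" by (intro AE_I2) simp
  qed measurable
  have m: "bounded_multiplier (heat_form_symbol s :: 'n spacetime \<Rightarrow> complex)" by (rule bounded_multiplier_heat_form_symbol[OF s])
  have eq: "heat_form_symbol s \<zeta> * (Hs_root s \<zeta> * ft u \<zeta>) * cnj (Hs_root s \<zeta> * ft w \<zeta>)
      = heat_symbol \<zeta> powr complex_of_real s * (ft u \<zeta> * cnj (ft w \<zeta>))" for \<zeta>
  proof -
    have "Hs_weight s \<zeta> \<noteq> 0" using Hs_weight_ge_1[OF s, of \<zeta>] by linarith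
    then have "heat_form_symbol s \<zeta> * complex_of_real (Hs_weight s \<zeta>) = heat_symbol \<zeta> powr complex_of_real s"
      by (simp add: heat_form_symbol_def)
    then show ?thesis unfolding mult.assoc[of "heat_form_symbol s \<zeta>"] root unfolding mult.assoc[symmetric] by simp
  qed
  have "l2_cinner (l2_mult (heat_form_symbol s) (Hs_lift s u)) (Hs_lift s w)
      = (LINT \<zeta>|lebesgue. heat_form_symbol s \<zeta> * (Hs_root s \<zeta> * ft u \<zeta>) * cnj (Hs_root s \<zeta> * ft w \<zeta>))"
    unfolding U(2) W(2) l2_mult_to_l2[OF m U(1)] l2_cinner_to_l2[OF L2_multiplier[OF m U(1)] W(1)] L2_inner_def ..
  also have "\<dots> = (LINT \<zeta>|lborel. heat_symbol \<zeta> powr complex_of_real s * (ft u \<zeta> * cnj (ft w \<zeta>)))"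
    unfolding eq by (rule integral_completion) measurable
  finally show "l2_cinner (l2_mult (heat_form_symbol s) (Hs_lift s u)) (Hs_lift s w)
      = (LINT \<zeta>|lborel. heat_symbol \<zeta> powr complex_of_real s * (ft u \<zeta> * cnj (ft w \<zeta>)))" .
qed

lemma inner_l2_mult_const: "l2_mult (\<lambda>_. a) x \<bullet> y = Re (a * l2_cinner x y)"
proof -
  obtain f g where f: "f \<in> L2 lebesgue" "x = to_l2 f" and g: "g \<in> L2 lebesgue" "y = to_l2 g" by (metis l2_cases)
  show ?thesis
    unfolding f(2) g(2) l2_mult_to_l2[OF bounded_multiplier_const f(1)] inner_to_l2[OF L2_cmult[OF f(1)] g(1)]
      l2_cinner_to_l2[OF f(1) g(1)] L2_inner_def mult.assoc integral_mult_right_zero ..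
qed

lemma lip_test_zero: "p \<in> lip_test A \<Longrightarrow> z \<notin> A \<Longrightarrow> p z = 0"
  by (auto simp: lip_test_def)

context frac_heat_problem
begin

theorem adjoint_unique_continuation:
  assumes \<Phi>: "\<Phi> \<in> V" and W: "open W" "bounded W" "W \<noteq> {}" and d: "0 < d"
    and sep: "\<And>w y. w \<in> W \<Longrightarrow> y \<in> closure \<Omega> \<Longrightarrow> d \<le> norm (y - w)"
    and zero: "\<And>p a. p \<in> lip_test (cyl T W) \<Longrightarrow> form (l2_mult (\<lambda>_. a) (Hs_lift s (\<lambda>z. complex_of_real (p z)))) \<Phi> = 0"
  shows "\<Phi> = 0"
proof -
  let ?\<beta> = "1 + s + real CARD('n) / 2"
  obtain \<phi> where \<phi>: "\<phi> \<in> L12" "J \<Phi> = to_l2 \<phi>" "\<And>z. z \<notin> E \<Longrightarrow> \<phi> z = 0"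
    using compact_support_representative[OF E_compact, of "J \<Phi>"] \<Phi> by (auto simp: V_def)
  have \<phi>L: "\<phi> \<in> L2 lebesgue" by (rule L12_L2(2)[OF \<phi>(1)])
  have \<phi>H: "\<phi> \<in> Hs s" "Hs_lift s \<phi> = \<Phi>" using Hs_of_embed[OF s0 \<phi>L \<phi>(2)[symmetric]] by auto
  have supp: "\<bar>fst v\<bar> \<le> T" "snd v \<in> closure \<Omega>" if "\<phi> v \<noteq> 0" for v
  proof -
    have "v \<in> {- T..T} \<times> closure \<Omega>" using \<phi>(3)[of v] that E_subset by blast
    then show "\<bar>fst v\<bar> \<le> T" "snd v \<in> closure \<Omega>" by (auto simp: mem_Times_iff abs_le_iff)
  qed
  obtain B where B: "\<And>y. y \<in> closure \<Omega> \<Longrightarrow> norm y \<le> B" using bounded_closure[OF \<Omega>(2)] by (auto simp: bounded_iff)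
  obtain B' where B': "\<And>w. w \<in> W \<Longrightarrow> norm w \<le> B'" using W(2) by (auto simp: bounded_iff)
  \<comment> \<open>The conjugate appears because the pairing is linear in the test function and
    antilinear in \<phi>. One number bounds the times, by T, and the distances between points of
    \<open>W\<close> and of the closure of \<Omega>, by B + B'.\<close>
  interpret S: separated_source "\<lambda>v. cnj (\<phi> v)" W d "max T (B + B')"
  proof
    show "integrable lborel (\<lambda>v. cnj (\<phi> v))" using L12_integrable[OF \<phi>(1)] by simp
    fix v x assume v: "cnj (\<phi> v) \<noteq> 0" and x: "x \<in> W"
    have v': "snd v \<in> closure \<Omega>" using supp(2)[of v] v by simp
    show "d \<le> norm (snd v - x)" by (rule sep[OF x v'])
    show "norm (snd v - x) \<le> max T (B + B')"
      using norm_triangle_ineq4[of "snd v" x] B[OF v'] B'[OF x] by linarith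
  next
    show "\<bar>fst v\<bar> \<le> max T (B + B')" if "cnj (\<phi> v) \<noteq> 0" for v using supp(1)[of v] that by simp
  qed (use W d in auto)
  let ?k = "\<lambda>\<tau> y. exp_kernel ?\<beta> \<tau> ((norm y)\<^sup>2 / 4)"
  have \<beta>0: "0 < ?\<beta>" using s by (intro add_pos_nonneg) auto
  have cU: "open (cyl T W)" by (rule open_cyl[OF W(1)])
  have pair: "(LINT z|lborel. complex_of_real (p z) * (LINT v|lborel. complex_of_real (heat_kernel ?\<beta> d (v - z)) * cnj (\<phi> v))) = 0"
    if p: "p \<in> lip_test (cyl T W)" for p
  proof -
    let ?f = "\<lambda>z. complex_of_real (p z)"
    have f: "?f \<in> Hs s" "?f \<in> L12" using lip_test_Hs[OF p s0] lip_test_L12[OF p] s by auto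
    have fL: "?f \<in> L2 lebesgue" by (rule L12_L2(2)[OF f(2)])
    \<comment> \<open>The test functions live over \<open>W\<close>, off the cylinder, so the
      potential term of the form drops out.\<close>
    have pz: "p z = 0" if "z \<in> cyl T \<Omega>" for z
    proof -
      have "snd z \<notin> W" using that sep[of "snd z" "snd z"] d closure_subset[of \<Omega>] by (auto simp: cyl_def)
      then show ?thesis by (intro lip_test_zero[OF p]) (auto simp: cyl_def)
    qed
    let ?c = "l2_cinner (l2_mult (heat_form_symbol s) (Hs_lift s ?f)) \<Phi>"
    \<comment> \<open>The form is real valued, so a complex factor a is carried along: a = 1 and a =
      \<i> together make the complex pairing vanish.\<close>
    have "Re (a * ?c) = 0" for a
    proof -
      have hm: "bounded_multiplier (heat_form_symbol s :: 'n spacetime \<Rightarrow> complex)" by (rule bounded_multiplier_heat_form_symbol[OF s0])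
      have "l2_mult pot (J (l2_mult (\<lambda>_. a) (Hs_lift s ?f))) = to_l2 (\<lambda>z. pot z * (a * ?f z))"
        unfolding Hs_embed_mult_const[OF s0] Hs_embed_lift[OF s0 f(1)] l2_mult_to_l2[OF bounded_multiplier_const fL]
          l2_mult_to_l2[OF pot_multiplier L2_cmult[OF fL]] ..
      also have "(\<lambda>z. pot z * (a * ?f z)) = (\<lambda>_. 0)" using pz by (auto simp: pot_def indicator_def fun_eq_iff)
      finally have "l2_mult pot (J (l2_mult (\<lambda>_. a) (Hs_lift s ?f))) = 0" by (simp only: zero_l2_def)
      then have "l2_mult (heat_form_symbol s) (l2_mult (\<lambda>_. a) (Hs_lift s ?f)) \<bullet> \<Phi> = 0"
        using zero[OF p, of a] by (simp add: form_def)
      also have "l2_mult (heat_form_symbol s) (l2_mult (\<lambda>_. a) (Hs_lift s ?f)) = l2_mult (\<lambda>_. a) (l2_mult (heat_form_symbol s) (Hs_lift s ?f))"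
        unfolding l2_mult_mult[OF hm bounded_multiplier_const] l2_mult_mult[OF bounded_multiplier_const hm] by (simp only: mult.commute)
      finally show ?thesis unfolding inner_l2_mult_const .
    qed
    from this[of 1] this[of \<i>] have "?c = 0" by (simp add: complex_eq_iff)
    then have z0: "(LINT \<zeta>|lborel. heat_symbol \<zeta> powr complex_of_real s * (ft ?f \<zeta> * cnj (ft \<phi> \<zeta>))) = 0"
      using heat_form_cinner(2)[OF s0 f \<phi>H(1) \<phi>(1)] \<phi>H(2) by simp
    show ?thesis
    proof (rule heat_form_pairing[OF s d f(2) \<phi>(1) _ heat_form_cinner(1)[OF s0 f \<phi>H(1) \<phi>(1)] z0])
      fix z v assume "?f z \<noteq> 0" "\<phi> v \<noteq> 0"
      then have "z \<in> cyl T W" "snd v \<in> closure \<Omega>" using lip_test_zero[OF p, of z] supp(2) by auto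
      then show "d \<le> norm (snd v - snd z)" by (intro sep) (auto simp: cyl_def)
    qed
  qed
  have pot0: "S.potential ?k z = 0" if z: "z \<in> cyl T W" for z
  proof (rule continuous_zero_of_lip_test[OF cU _ _ pair z])
    show "continuous_on (cyl T W) (S.potential ?k)"
      by (rule continuous_on_subset[OF S.potential_exp_kernel_continuous[OF \<beta>0]]) (auto simp: cyl_def)
    fix z :: "'n spacetime" assume "z \<in> cyl T W"
    then have zW: "snd z \<in> W" by (auto simp: cyl_def)
    have "complex_of_real (heat_kernel ?\<beta> d (v - z)) * cnj (\<phi> v) = complex_of_real (?k (fst v - fst z) (snd v - snd z)) * cnj (\<phi> v)" for v
      using sep[OF zW supp(2)[of v]] by (cases "\<phi> v = 0") (auto simp: heat_kernel_def)
    then show "(LINT v|lborel. complex_of_real (heat_kernel ?\<beta> d (v - z)) * cnj (\<phi> v)) = S.potential ?k z"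
      by (simp only: S.potential_def)
  qed
  \<comment> \<open>The support of \<phi> lies in t \<ge> -T, and the remaining slice t = -T is
    null.\<close>
  have "AE v in lborel. - T < fst v \<longrightarrow> cnj (\<phi> v) = 0"
    by (rule S.source_vanishes[where \<beta> = ?\<beta> and b = T]) (use T s W pot0 in \<open>auto simp: cyl_def\<close>)
  then have "AE v in lebesgue. - T < fst v \<longrightarrow> cnj (\<phi> v) = 0" by (rule AE_completion)
  with AE_fst_neq[of "- T"] have "AE v in lebesgue. \<phi> v = 0"
  proof eventually_elim
    case (elim v)
    then show ?case using supp(1)[of v] by (cases "\<phi> v = 0") auto
  qed
  then have "J \<Phi> = 0" unfolding \<phi>(2) zero_l2_def by (intro to_l2_cong \<phi>L) auto
  then show ?thesis by (rule J_eq_0)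
qed

text \<open>\<open>R\<close> consists of the classes that agree on the cylinder with some admissible
  solution and are arbitrary elsewhere. Density of restrictions is thus a statement inside one
  Hilbert space, and a vector orthogonal to \<open>R\<close> automatically vanishes off the
  cylinder.\<close>

theorem runge_approximation:
  assumes ev: "eigenvalue_condition s T \<Omega> Q" and \<Omega>': "open \<Omega>'" "closure \<Omega> \<subseteq> \<Omega>'" and \<epsilon>: "0 < \<epsilon>"
  obtains u where "solves s T \<Omega> Q u" "supp u \<subseteq> closure (cyl T \<Omega>')"
    "norm (l2_mult (indicator (cyl T \<Omega>)) (to_l2 u - G)) < \<epsilon>"
proof -
  let ?E' = "closure (cyl T \<Omega>')" and ?m = "l2_mult (indicator (cyl T \<Omega>)) :: 'n spacetime l2 \<Rightarrow> _"
  let ?V' = "{x. l2_mult (indicator (- ?E')) (J x) = 0}"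
  have E'm: "- ?E' \<in> sets lebesgue" by (intro sets_completionI_sets) auto
  note mE' = vanishes_on_l2_mult(1)[OF E'm]
  have V': "subspace ?V'" by (rule closed_kernel_l2_mult(2)[OF J.bounded_linear_axioms mE'])
  have m: "bounded_multiplier (indicator (cyl T \<Omega>) :: _ \<Rightarrow> complex)" by (rule vanishes_on_l2_mult(1)[OF cyl_meas])
  interpret m: bounded_linear ?m by (rule bounded_linear_l2_mult[OF m])
  have cylE: "cyl T \<Omega> \<subseteq> cyl T \<Omega>'" using \<Omega>'(2) closure_subset[of \<Omega>] by (auto simp: cyl_def)
  have VV': "V \<subseteq> ?V'"
  proof
    fix x assume x: "x \<in> V"
    define u where "u = of_l2 (J x)"
    have u: "u \<in> L2 lebesgue" "to_l2 u = J x" by (simp_all add: u_def)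
    have "supp u \<subseteq> ?E'" using V_iff[OF u] x closure_mono[OF cylE] by blast
    then have "vanishes_on u (- ?E')" by (simp add: vanishes_on_closed_supp_iff)
    then show "x \<in> ?V'" using vanishes_on_l2_mult(2)[OF E'm u(1)] u(2) by simp
  qed
  define S where "S = {x \<in> ?V'. \<forall>y\<in>V. form x y = 0}"
  define R where "R = {y. \<exists>x\<in>S. ?m (y - J x) = 0}"
  have S: "subspace S"
    using V' by (auto simp: S_def subspace_def form.zero_left form.add_left form.scaleR_left)
  have "subspace R"
    unfolding subspace_def
  proof (intro conjI ballI allI)
    show "0 \<in> R" unfolding R_def using subspace_0[OF S] by (auto intro!: bexI[of _ 0] simp: J.zero m.zero)
    fix y1 assume "y1 \<in> R"
    then obtain x1 where x1: "x1 \<in> S" "?m (y1 - J x1) = 0" by (auto simp: R_def)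
    show "c *\<^sub>R y1 \<in> R" for c
      unfolding R_def using x1 subspace_scale[OF S x1(1), of c]
      by (auto intro!: bexI[of _ "c *\<^sub>R x1"] simp: J.scaleR m.scaleR simp flip: scaleR_diff_right)
    fix y2 assume "y2 \<in> R"
    then obtain x2 where x2: "x2 \<in> S" "?m (y2 - J x2) = 0" by (auto simp: R_def)
    have "(y1 + y2) - J (x1 + x2) = (y1 - J x1) + (y2 - J x2)" by (simp add: J.add)
    then have "?m ((y1 + y2) - J (x1 + x2)) = 0" using x1 x2 by (simp only: m.add) simp
    then show "y1 + y2 \<in> R" unfolding R_def using subspace_add[OF S x1(1) x2(1)] by blast
  qed
  then have "closure R = UNIV"
  proof (rule closure_eq_UNIV_of_orthogonal)
    fix h assume orth: "\<And>y. y \<in> R \<Longrightarrow> h \<bullet> y = 0"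
    have orthS: "h \<bullet> J x = 0" if "x \<in> S" for x
      using that by (intro orth) (auto simp: R_def m.zero intro!: bexI[of _ x])
    have orth0: "h \<bullet> y = 0" if "?m y = 0" for y
      using that subspace_0[OF S] by (intro orth) (auto simp: R_def J.zero intro!: bexI[of _ 0])
    have "AE z in lebesgue. z \<in> cyl T \<Omega> \<longrightarrow> of_l2 h z = 0"
    proof (cases "\<Omega> = {}")
      case False
      \<comment> \<open>If \<Omega>' were contained in the closure of \<Omega>, this closure would
        be open and closed, nonempty and bounded, against connectedness of the space. Halving the
        radius of a ball in the gap leaves the distance r / 2.\<close>
      obtain W d where W: "open W" "bounded W" "W \<noteq> {}" "W \<subseteq> \<Omega>'" "0 < d"
        "\<And>w y. w \<in> W \<Longrightarrow> y \<in> closure \<Omega> \<Longrightarrow> d \<le> norm (y - w)"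
      proof -
        have "\<not> \<Omega>' \<subseteq> closure \<Omega>"
        proof
          assume "\<Omega>' \<subseteq> closure \<Omega>"
          then have eq: "\<Omega>' = closure \<Omega>" using \<Omega>'(2) by blast
          then have "closure \<Omega> = {} \<or> closure \<Omega> = UNIV" using clopen[of "closure \<Omega>"] \<Omega>'(1) by simp
          then show False using False bounded_closure[OF \<Omega>(2)] by auto
        qed
        then obtain x0 where "x0 \<in> \<Omega>' - closure \<Omega>" by blast
        moreover have "open (\<Omega>' - closure \<Omega>)" using \<Omega>'(1) by (intro open_Diff) auto
        ultimately obtain r where r: "0 < r" "ball x0 r \<subseteq> \<Omega>' - closure \<Omega>" using open_contains_ball by blast
        show ?thesis
        proof (rule that[of "ball x0 (r / 2)" "r / 2"])
          show "ball x0 (r / 2) \<subseteq> \<Omega>'" using r subset_ball[of "r / 2" r x0] by auto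
          fix w y assume w: "w \<in> ball x0 (r / 2)" and y: "y \<in> closure \<Omega>"
          have "r \<le> dist x0 y" using r(2) y by (meson DiffD2 linorder_not_le mem_ball subsetD)
          also have "\<dots> \<le> dist x0 w + dist w y" by (rule dist_triangle)
          finally show "r / 2 \<le> norm (y - w)" using w by (simp add: dist_norm norm_minus_commute)
        qed (use r in auto)
      qed
      have bl: "bounded_linear (\<lambda>w. J w \<bullet> h)"
        by (rule bounded_linear_compose[OF bounded_linear_inner_left J.bounded_linear_axioms])
      obtain \<Phi> where \<Phi>: "\<Phi> \<in> V" "\<And>w. w \<in> V \<Longrightarrow> form w \<Phi> = J w \<bullet> h"
        using form_solvable(2)[OF ev bl] by blast
      have "\<Phi> = 0"
      proof (rule adjoint_unique_continuation[OF \<Phi>(1) W(1-3,5,6)])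
        fix p a assume p: "p \<in> lip_test (cyl T W)"
        let ?f = "\<lambda>z. complex_of_real (p z)"
        define F where "F = l2_mult (\<lambda>_. a) (Hs_lift s ?f)"
        have fL: "?f \<in> L2 lebesgue" by (rule lip_test_L2(3)[OF p])
        have JF: "J F = to_l2 (\<lambda>z. a * ?f z)"
          unfolding F_def Hs_embed_mult_const[OF s0] using lip_test_Hs[OF p s0] s
          by (simp add: Hs_embed_lift[OF s0] l2_mult_to_l2 fL)
        \<comment> \<open>\<open>v\<close> is a corrector supported in the closed cylinder: F - v
          solves the equation and has \<open>F\<close> as its exterior data.\<close>
        obtain v where v: "v \<in> V" "\<And>w. w \<in> V \<Longrightarrow> form v w = form F w"
          using form_solvable(1)[OF ev form.bounded_linear_right[of F]] by blast
        have "vanishes_on (\<lambda>z. a * ?f z) (- ?E')"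
        proof -
          have "cyl T W \<subseteq> ?E'" using W(4) closure_subset[of "cyl T \<Omega>'"] by (auto simp: cyl_def)
          then have "a * ?f z = 0" if "z \<in> - ?E'" for z using lip_test_zero[OF p, of z] that by auto
          then show ?thesis unfolding vanishes_on_def by (intro AE_I2) blast
        qed
        then have "F \<in> ?V'" using vanishes_on_l2_mult(2)[OF E'm L2_cmult[OF fL]] JF by simp
        then have "F - v \<in> S"
          using subspace_diff[OF V', of F v] VV' v by (auto simp: S_def form.diff_left)
        then have "h \<bullet> J (F - v) = 0" by (rule orthS)
        moreover have "h \<bullet> J F = 0"
        proof (rule orth0)
          have "z \<notin> cyl T W" if "z \<in> cyl T \<Omega>" for z
            using that W(6)[of "snd z" "snd z"] W(5) closure_subset[of \<Omega>] by (auto simp: cyl_def)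
          then have "(\<lambda>z. indicator (cyl T \<Omega>) z * (a * ?f z)) = (\<lambda>_. 0)"
            using lip_test_zero[OF p] by (auto simp: fun_eq_iff indicator_def)
          then show "?m (J F) = 0" unfolding JF l2_mult_to_l2[OF m L2_cmult[OF fL]] by (simp only: zero_l2_def)
        qed
        \<comment> \<open>\<open>F\<close> vanishes on the cylinder, so orthogonality to F - v
          leaves orthogonality to \<open>J v\<close>. By the two problems this number equals form v
          \<Phi> = form F \<Phi>.\<close>
        ultimately have "J v \<bullet> h = 0" by (simp add: J.diff inner_diff_right inner_commute)
        then show "form (l2_mult (\<lambda>_. a) (Hs_lift s ?f)) \<Phi> = 0"
          using \<Phi>(2)[OF v(1)] v(2)[OF \<Phi>(1)] by (simp add: F_def)
      qed
      \<comment> \<open>With \<Phi> = 0 the right-hand side of its problem vanishes on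
        \<open>V\<close>. Lipschitz functions supported in the cylinder belong to \<open>V\<close>
        and detect \<open>h\<close> there.\<close>
      then have orthV: "h \<bullet> J w = 0" if "w \<in> V" for w
        using \<Phi>(2)[OF that] by (simp add: form.zero_right inner_commute)
      show ?thesis
      proof (rule l2_vanishes_of_lip_test[OF open_cyl[OF \<Omega>(1)]])
        fix p assume p: "p \<in> lip_test (cyl T \<Omega>)"
        let ?f = "\<lambda>z. complex_of_real (p z)"
        have fH: "?f \<in> Hs s" using lip_test_Hs[OF p s0] s by simp
        have fL: "?f \<in> L2 lebesgue" by (rule lip_test_L2(3)[OF p])
        have "?f z = 0" if "z \<in> - E" for z
          using lip_test_zero[OF p, of z] that closure_subset[of "cyl T \<Omega>"] by auto
        then have "vanishes_on ?f (- E)" unfolding vanishes_on_def by (intro AE_I2) blast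
        then have "Hs_lift s ?f \<in> V"
          using vanishes_on_l2_mult(2)[OF compl_E_meas fL] by (simp add: V_def Hs_embed_lift[OF s0 fH])
        from orthV[OF V_I[OF this]] have "h \<bullet> to_l2 (\<lambda>z. a * ?f z) = 0" for a
          unfolding Hs_embed_mult_const[OF s0] Hs_embed_lift[OF s0 fH] l2_mult_to_l2[OF bounded_multiplier_const fL] .
        from this[of 1] this[of \<i>] show "h \<bullet> to_l2 ?f = 0" "h \<bullet> to_l2 (\<lambda>z. \<i> * ?f z) = 0" by simp_all
      qed
    qed (simp add: cyl_def)
    then have "vanishes_on (of_l2 h) (cyl T \<Omega>)" by (simp add: vanishes_on_def)
    then have "?m h = 0" using vanishes_on_l2_mult(2)[OF cyl_meas of_l2_L2, of h] by simp
    then show "h = 0" using orth0[of h] by simp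
  qed
  then obtain y where y: "y \<in> R" "dist y G < \<epsilon>" using \<epsilon> closure_approachable[of G R] by auto
  then obtain x where x: "x \<in> S" "?m (y - J x) = 0" by (auto simp: R_def)
  define u where "u = of_l2 (J x)"
  have u: "u \<in> L2 lebesgue" "to_l2 u = J x" by (simp_all add: u_def)
  have uH: "u \<in> Hs s" "Hs_lift s u = x" by (rule Hs_of_embed[OF s0 u])+
  show ?thesis
  proof (rule that)
    show "solves s T \<Omega> Q u" unfolding solves_iff uH(2) using uH(1) x(1) by (auto simp: S_def)
    have "vanishes_on u (- ?E')" using x(1) vanishes_on_l2_mult(2)[OF E'm u(1)] u(2) by (simp add: S_def)
    then show "supp u \<subseteq> ?E'" by (simp add: vanishes_on_closed_supp_iff)
    have "?m (to_l2 u - G) = ?m (y - G)" using x(2) by (simp add: u(2) m.diff)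
    moreover have "norm (?m (y - G)) \<le> 1 * norm (y - G)"
    proof -
      obtain f where f: "f \<in> L2 lebesgue" "y - G = to_l2 f" by (rule l2_cases)
      show ?thesis unfolding f(2) l2_mult_to_l2[OF m f(1)]
        by (rule norm_to_l2_mult_le[OF f(1) L2_multiplier[OF m f(1)]]) (auto simp: indicator_def)
    qed
    ultimately show "norm (?m (to_l2 u - G)) < \<epsilon>" using y(2) by (simp add: dist_norm)
  qed
qed

end

theorem theorem1p2:
  fixes s T \<epsilon> :: real
    and \<Omega> \<Omega>' :: "(real ^ 'n) set"
    and Q :: "real \<times> (real ^ 'n) \<Rightarrow> real"
    and g :: "real \<times> (real ^ 'n) \<Rightarrow> complex"
  assumes "0 < s" and "s < 1" and "0 < T"
    and "open \<Omega>" and "bounded \<Omega>"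
    and "open \<Omega>'" and "compact (closure \<Omega>)" and "closure \<Omega> \<subseteq> \<Omega>'"
    and "Q \<in> Linf (lebesgue_on (cyl T \<Omega>))"
    and "eigenvalue_condition s T \<Omega> Q"
    and "g \<in> L2 (lebesgue_on (cyl T \<Omega>))"
    and "0 < \<epsilon>"
  shows "\<exists>u \<in> Hs s. solves s T \<Omega> Q u
           \<and> supp u \<subseteq> closure (cyl T \<Omega>')
           \<and> L2_norm (lebesgue_on (cyl T \<Omega>)) (\<lambda>z. u z - g z) < \<epsilon>"
proof -
  interpret frac_heat_problem s T \<Omega> Q using assms by unfold_locales auto
  let ?C = "cyl T \<Omega>"
  have C: "?C \<inter> space lebesgue \<in> sets lebesgue" using cyl_meas by simp
  have m: "bounded_multiplier (indicator ?C :: _ \<Rightarrow> complex)" by (rule vanishes_on_l2_mult(1)[OF cyl_meas])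
  \<comment> \<open>\<open>g\<close> is controlled only on the cylinder; extension by zero gives a
    class on all of space-time.\<close>
  define G where "G z = indicator ?C z * g z" for z
  have GL: "G \<in> L2 lebesgue"
  proof -
    have "(\<lambda>z. indicator ?C z *\<^sub>R g z) \<in> borel_measurable lebesgue"
      using assms(11) borel_measurable_restrict_space_iff[OF C, of g] by (simp add: L2_def)
    moreover have "integrable lebesgue (\<lambda>z. indicator ?C z *\<^sub>R (cmod (g z))\<^sup>2)"
      using assms(11) integrable_restrict_space[OF C, of "\<lambda>z. (cmod (g z))\<^sup>2"] by (simp add: L2_def)
    moreover have "indicator ?C z *\<^sub>R g z = G z" "indicator ?C z *\<^sub>R (cmod (g z))\<^sup>2 = (cmod (G z))\<^sup>2" for z
      by (auto simp: G_def indicator_def)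
    ultimately show ?thesis by (simp only: L2_def mem_Collect_eq simp_thms)
  qed
  obtain u where u: "solves s T \<Omega> Q u" "supp u \<subseteq> closure (cyl T \<Omega>')"
    "norm (l2_mult (indicator ?C) (to_l2 u - to_l2 G)) < \<epsilon>"
    using runge_approximation[OF assms(10,6,8,12), of "to_l2 G"] by blast
  have uH: "u \<in> Hs s" using u(1) by (simp add: solves_def)
  then have uL: "u \<in> L2 lebesgue" by (simp add: Hs_iff)
  have dL: "(\<lambda>z. u z - G z) \<in> L2 lebesgue" by (rule L2_diff[OF uL GL])
  have "L2_norm (lebesgue_on ?C) (\<lambda>z. u z - g z) = sqrt (LINT z|lebesgue. indicator ?C z *\<^sub>R (cmod (u z - g z))\<^sup>2)"
    unfolding L2_norm_def by (subst integral_restrict_space[OF C]) simp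
  also have "\<dots> = L2_norm lebesgue (\<lambda>z. indicator ?C z * (u z - G z))"
    unfolding L2_norm_def
    by (intro arg_cong[where f = sqrt] Bochner_Integration.integral_cong) (auto simp: G_def indicator_def)
  also have "\<dots> = norm (l2_mult (indicator ?C) (to_l2 u - to_l2 G))"
    unfolding to_l2_diff[OF uL GL] l2_mult_to_l2[OF m dL] norm_to_l2[OF L2_multiplier[OF m dL]] ..
  finally show ?thesis using u uH by auto
qed

end
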